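(* Let $\boldsymbol\eta\in\mathscr C^{0,\gamma}_g([0,T];\mathbb R^p)$, let $\bar Q\in\mathbb R^{d\times d}$ and let $A,B,Q,R:[0,T]\to\mathbb R^{d\times d}$ be bounded and Borel measurable on $[0,T]$, with $R_t\succ\lambda\,\mathrm{Id}_{d\times d}$ for some $\lambda>0$ and $\bar Q,Q_t\succeq0$, and let $(A^1,(A^1)')\in\mathscr D^{\beta,\beta'}_\eta([0,T];L(\mathbb R^d,\mathbb R^{d\times p}))$ be a deterministic controlled rough path with respect to $\eta$. Then the backward symmetric rough Riccati equation $$p_t= \bar{Q}+\int_t^T \big(p_sA^1_s +(A^1_s)^\top p_s\big) d\boldsymbol{\eta}_s+\int_t^T\Big(p_s A_s + A_s^{\top} p_s - p_sB_s R_s^{-1} B_s^\top p_s + Q_s\Big)ds,\qquad t\in[0,T],$$ has a unique (global) solution with $(p,p')\in\mathscr D^{\gamma,\beta}_\eta([0,T];\mathbb R^{d\times d})$. Moreover, the solution is locally Lipschitz in its data, and in particular in $\boldsymbol\eta$ and $(A^1,(A^1)')$.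
   Context: Fix $T>0$, $d,p\in\mathbb N$, $\gamma\in(\frac13,\frac12)$ and $0<\beta'\le\beta\le\gamma$ with $\gamma+\beta+\beta'>1$. For matrices, $A\succeq B$ ($A\succ B$) means $A-B$ is symmetric and non-negative (positive) definite. Rough paths. Write $\delta\eta_{s,t}=\eta_t-\eta_s$, and $|F|_\gamma=\sup_{s<t}|F_{s,t}|/|t-s|^\gamma$ for two-parameter $F$. A $\gamma$-Hölder rough path is $\boldsymbol\eta=(\eta,\eta^{(2)})$, $\eta:[0,T]\to\mathbb R^p$, $\eta^{(2)}:\{0\le s\le t\le T\}\to\mathbb R^{p\times p}$, with $|\delta\eta|_\gamma,|\eta^{(2)}|_{2\gamma}<\infty$ and $\eta^{(2)}_{s,t}-\eta^{(2)}_{s,u}-\eta^{(2)}_{u,t}=\delta\eta_{s,u}\otimes\delta\eta_{u,t}$. The rough path metric is $\rho_\gamma(\boldsymbol\eta,\bar{\boldsymbol\eta})=|\eta_0-\bar\eta_0|+|\delta\eta-\delta\bar\eta|_\gamma+|\eta^{(2)}-\bar\eta^{(2)}|_{2\gamma}$. $\mathscr C^{0,\gamma}_g([0,T];\mathbb R^p)$ is the $\rho_\gamma$-closure of canonically lifted smooth paths, endowed with $\rho_\gamma$. Controlled rough paths. $\mathscr D^{\beta,\beta'}_\eta([0,T];V)$: pairs $(Z,Z')$, $Z\in C^\beta([0,T];V)$, $Z'\in C^{\beta'}([0,T];L(\mathbb R^p,V))$, with $R^Z_{s,t}=\delta Z_{s,t}-Z'_s\delta\eta_{s,t}$ satisfying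 $|R^Z|_{\beta+\beta'}<\infty$. For $(Z,Z')\in\mathscr D^{\beta,\beta'}_\eta$, $(\bar Z,\bar Z')\in\mathscr D^{\beta,\beta'}_{\bar\eta}$ the distance is $\|(Z,Z');(\bar Z,\bar Z')\|_{\eta,\bar\eta,\beta,\beta'}=|\delta(Z-\bar Z)|_\beta+|\delta(Z'-\bar Z')|_{\beta'}+|Z_0-\bar Z_0|+|Z_0'-\bar Z_0'|+|R^Z-\bar R^{\bar Z}|_{\beta+\beta'}$ with $\bar R^{\bar Z}_{s,t}=\delta\bar Z_{s,t}-\bar Z'_s\delta\bar\eta_{s,t}$. The rough integral is $\int_0^tZ\,d\boldsymbol\eta=\lim_{|\Pi|\to0}\sum_{[u,v]\in\Pi}(Z_u\delta\eta_{u,v}+Z'_u\eta^{(2)}_{u,v})$, $\int_t^T=\int_0^T-\int_0^t$; product integrands carry Gubinelli derivatives by the Leibniz rule. Identify $A^1\in L(\mathbb R^d,\mathbb R^{d\times p})$ with $p$ matrices $A^{1,(1)},\dots,A^{1,(p)}\in\mathbb R^{d\times d}$; then $\int(p_sA^1_s+(A^1_s)^\top p_s)d\boldsymbol\eta_s=\sum_j\int(p_sA^{1,(j)}_s+(A^{1,(j)}_s)^\top p_s)d\boldsymbol\eta^j_s$ and the Gubinelli derivative of the solution is $p'=-(pA^1+(A^1)^\top p)$. *)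

theory Defs
  imports "HOL-Analysis.Analysis"
begin

text \<open>
  Paths on $[0,T]$ are functions on \<^typ>\<open>real\<close> of which only the values on \<open>{0..T}\<close> are ever used;
  two-parameter functions are used only at $0 \le s \le t \le T$.

  A linear map $L \in L(R^p, V)$ is represented by the family of its values on the standard basis,
  i.e. by an element \<open>L\<close> of \<open>'v^'p\<close>, where \<open>L $ j\<close> is the value at the \<open>j\<close>-th basis vector.
  In particular \<open>A1 t $ j\<close> is the matrix $A^{1,(j)}_t$, and an element of $L(R^p, L(R^p, V))$ is
  a family \<open>L\<close> in \<open>('v^'p)^'p\<close>, with \<open>L $ i $ j\<close> the value at the pair \<open>(i, j)\<close> of basis vectors,
  the direction of differentiation coming first.
\<close>

definition lin_app :: "'v::real_vector ^ 'p::finite \<Rightarrow> real ^ 'p \<Rightarrow> 'v" where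
  "lin_app L x = (\<Sum>j\<in>UNIV. (x $ j) *\<^sub>R (L $ j))"

definition bilin_app :: "('v::real_vector ^ 'p::finite) ^ 'p \<Rightarrow> real ^ 'p ^ 'p \<Rightarrow> 'v" where
  "bilin_app L M = (\<Sum>i\<in>UNIV. \<Sum>j\<in>UNIV. (M $ i $ j) *\<^sub>R (L $ i $ j))"

definition incr :: "(real \<Rightarrow> 'v::ab_group_add) \<Rightarrow> real \<Rightarrow> real \<Rightarrow> 'v" where
  "incr x s t = x t - x s"

definition tensor :: "real ^ 'p::finite \<Rightarrow> real ^ 'p \<Rightarrow> real ^ 'p ^ 'p" where
  "tensor x y = (\<chi> i j. (x $ i) * (y $ j))"

text \<open>The seminorms and distances take values in \<^typ>\<open>ennreal\<close>, so that infinite values are genuine.\<close>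

definition holder :: "real \<Rightarrow> real \<Rightarrow> (real \<Rightarrow> real \<Rightarrow> 'v::real_normed_vector) \<Rightarrow> ennreal" where
  "holder T \<alpha> F =
     (SUP (s, t) \<in> {(s, t). 0 \<le> s \<and> s < t \<and> t \<le> T}. ennreal (norm (F s t) / (t - s) powr \<alpha>))"

definition sup_norm :: "real \<Rightarrow> (real \<Rightarrow> 'v::real_normed_vector) \<Rightarrow> ennreal" where
  "sup_norm T f = (SUP t \<in> {0..T}. ennreal (norm (f t)))"


section \<open>Rough paths\<close>

definition rough_path ::
  "real \<Rightarrow> real \<Rightarrow> (real \<Rightarrow> real ^ 'p::finite) \<Rightarrow> (real \<Rightarrow> real \<Rightarrow> real ^ 'p ^ 'p) \<Rightarrow> bool" where
  "rough_path T \<gamma> \<eta> \<eta>2 \<longleftrightarrow>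
     holder T \<gamma> (incr \<eta>) < \<infinity> \<and> holder T (2 * \<gamma>) \<eta>2 < \<infinity> \<and>
     (\<forall>s u t. 0 \<le> s \<and> s \<le> u \<and> u \<le> t \<and> t \<le> T \<longrightarrow>
        \<eta>2 s t - \<eta>2 s u - \<eta>2 u t = tensor (incr \<eta> s u) (incr \<eta> u t))"

definition rough_dist ::
  "real \<Rightarrow> real \<Rightarrow> (real \<Rightarrow> real ^ 'p::finite) \<Rightarrow> (real \<Rightarrow> real \<Rightarrow> real ^ 'p ^ 'p) \<Rightarrow>
   (real \<Rightarrow> real ^ 'p) \<Rightarrow> (real \<Rightarrow> real \<Rightarrow> real ^ 'p ^ 'p) \<Rightarrow> ennreal" where
  "rough_dist T \<gamma> \<eta> \<eta>2 \<zeta> \<zeta>2 =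
     ennreal (norm (\<eta> 0 - \<zeta> 0)) + holder T \<gamma> (\<lambda>s t. incr \<eta> s t - incr \<zeta> s t) +
     holder T (2 * \<gamma>) (\<lambda>s t. \<eta>2 s t - \<zeta>2 s t)"

definition smooth_path :: "real \<Rightarrow> (real \<Rightarrow> 'v::real_normed_vector) \<Rightarrow> bool" where
  "smooth_path T x \<longleftrightarrow>
     (\<exists>D :: nat \<Rightarrow> real \<Rightarrow> 'v. D 0 = x \<and>
        (\<forall>k. \<forall>t\<in>{0..T}. (D k has_vector_derivative D (Suc k) t) (at t within {0..T})))"

definition canonical_lift ::
  "real \<Rightarrow> (real \<Rightarrow> real ^ 'p::finite) \<Rightarrow> real \<Rightarrow> real \<Rightarrow> real ^ 'p ^ 'p" where
  "canonical_lift T x s t =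
     (LINT r:{s..t}|lborel. tensor (incr x s r) (vector_derivative x (at r within {0..T})))"

definition geometric_rough_path ::
  "real \<Rightarrow> real \<Rightarrow> (real \<Rightarrow> real ^ 'p::finite) \<Rightarrow> (real \<Rightarrow> real \<Rightarrow> real ^ 'p ^ 'p) \<Rightarrow> bool" where
  "geometric_rough_path T \<gamma> \<eta> \<eta>2 \<longleftrightarrow>
     rough_path T \<gamma> \<eta> \<eta>2 \<and>
     (\<forall>\<epsilon>>0. \<exists>x. smooth_path T x \<and> rough_dist T \<gamma> x (canonical_lift T x) \<eta> \<eta>2 < ennreal \<epsilon>)"


section \<open>Controlled rough paths and rough integration\<close>

definition remainder ::
  "(real \<Rightarrow> real ^ 'p::finite) \<Rightarrow> (real \<Rightarrow> 'v::real_normed_vector) \<Rightarrow> (real \<Rightarrow> 'v ^ 'p) \<Rightarrow>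
   real \<Rightarrow> real \<Rightarrow> 'v" where
  "remainder \<eta> Z Z' s t = incr Z s t - lin_app (Z' s) (incr \<eta> s t)"

definition controlled ::
  "real \<Rightarrow> real \<Rightarrow> real \<Rightarrow> (real \<Rightarrow> real ^ 'p::finite) \<Rightarrow>
   (real \<Rightarrow> 'v::real_normed_vector) \<Rightarrow> (real \<Rightarrow> 'v ^ 'p) \<Rightarrow> bool" where
  "controlled T \<beta> \<beta>' \<eta> Z Z' \<longleftrightarrow>
     holder T \<beta> (incr Z) < \<infinity> \<and> holder T \<beta>' (incr Z') < \<infinity> \<and>
     holder T (\<beta> + \<beta>') (remainder \<eta> Z Z') < \<infinity>"

definition controlled_dist ::
  "real \<Rightarrow> real \<Rightarrow> real \<Rightarrow> (real \<Rightarrow> real ^ 'p::finite) \<Rightarrow> (real \<Rightarrow> real ^ 'p) \<Rightarrow>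
   (real \<Rightarrow> 'v::real_normed_vector) \<Rightarrow> (real \<Rightarrow> 'v ^ 'p) \<Rightarrow> (real \<Rightarrow> 'v) \<Rightarrow> (real \<Rightarrow> 'v ^ 'p) \<Rightarrow>
   ennreal" where
  "controlled_dist T \<beta> \<beta>' \<eta> \<zeta> Z Z' Y Y' =
     holder T \<beta> (incr (\<lambda>t. Z t - Y t)) + holder T \<beta>' (incr (\<lambda>t. Z' t - Y' t)) +
     ennreal (norm (Z 0 - Y 0)) + ennreal (norm (Z' 0 - Y' 0)) +
     holder T (\<beta> + \<beta>') (\<lambda>s t. remainder \<eta> Z Z' s t - remainder \<zeta> Y Y' s t)"

text \<open>The partition of \<open>[a, b]\<close> with points \<open>\<pi> 0 < \<dots> < \<pi> n\<close> and mesh smaller than \<open>\<delta>\<close>.\<close>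

definition partition_mesh :: "real \<Rightarrow> real \<Rightarrow> real \<Rightarrow> nat \<Rightarrow> (nat \<Rightarrow> real) \<Rightarrow> bool" where
  "partition_mesh a b \<delta> n \<pi> \<longleftrightarrow>
     \<pi> 0 = a \<and> \<pi> n = b \<and> (\<forall>i<n. \<pi> i < \<pi> (Suc i) \<and> \<pi> (Suc i) - \<pi> i < \<delta>)"

definition rough_sum ::
  "(real \<Rightarrow> real ^ 'p::finite) \<Rightarrow> (real \<Rightarrow> real \<Rightarrow> real ^ 'p ^ 'p) \<Rightarrow>
   (real \<Rightarrow> 'v::real_normed_vector ^ 'p) \<Rightarrow> (real \<Rightarrow> ('v ^ 'p) ^ 'p) \<Rightarrow>
   nat \<Rightarrow> (nat \<Rightarrow> real) \<Rightarrow> 'v" where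
  "rough_sum \<eta> \<eta>2 Z Z' n \<pi> =
     (\<Sum>i<n. lin_app (Z (\<pi> i)) (incr \<eta> (\<pi> i) (\<pi> (Suc i)))
           + bilin_app (Z' (\<pi> i)) (\<eta>2 (\<pi> i) (\<pi> (Suc i))))"

definition has_rough_integral ::
  "(real \<Rightarrow> real ^ 'p::finite) \<Rightarrow> (real \<Rightarrow> real \<Rightarrow> real ^ 'p ^ 'p) \<Rightarrow>
   (real \<Rightarrow> 'v::real_normed_vector ^ 'p) \<Rightarrow> (real \<Rightarrow> ('v ^ 'p) ^ 'p) \<Rightarrow>
   real \<Rightarrow> 'v \<Rightarrow> bool" where
  "has_rough_integral \<eta> \<eta>2 Z Z' t I \<longleftrightarrow>
     (\<forall>\<epsilon>>0. \<exists>\<delta>>0. \<forall>n \<pi>. partition_mesh 0 t \<delta> n \<pi> \<longrightarrow> norm (rough_sum \<eta> \<eta>2 Z Z' n \<pi> - I) < \<epsilon>)"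

definition rough_integral ::
  "(real \<Rightarrow> real ^ 'p::finite) \<Rightarrow> (real \<Rightarrow> real \<Rightarrow> real ^ 'p ^ 'p) \<Rightarrow>
   (real \<Rightarrow> 'v::real_normed_vector ^ 'p) \<Rightarrow> (real \<Rightarrow> ('v ^ 'p) ^ 'p) \<Rightarrow> real \<Rightarrow> 'v" where
  "rough_integral \<eta> \<eta>2 Z Z' t = (THE I. has_rough_integral \<eta> \<eta>2 Z Z' t I)"


section \<open>The rough Riccati equation\<close>

definition nonneg_definite :: "real ^ 'n::finite ^ 'n \<Rightarrow> bool" where
  "nonneg_definite M \<longleftrightarrow> transpose M = M \<and> (\<forall>x. 0 \<le> x \<bullet> (M *v x))"

definition positive_definite :: "real ^ 'n::finite ^ 'n \<Rightarrow> bool" where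
  "positive_definite M \<longleftrightarrow> transpose M = M \<and> (\<forall>x. x \<noteq> 0 \<longrightarrow> 0 < x \<bullet> (M *v x))"

record ('d, 'p) riccati_data =
  Qbar :: "real ^ 'd ^ 'd"
  Afun :: "real \<Rightarrow> real ^ 'd ^ 'd"
  Bfun :: "real \<Rightarrow> real ^ 'd ^ 'd"
  Qfun :: "real \<Rightarrow> real ^ 'd ^ 'd"
  Rfun :: "real \<Rightarrow> real ^ 'd ^ 'd"
  eta :: "real \<Rightarrow> real ^ 'p"
  eta2 :: "real \<Rightarrow> real \<Rightarrow> real ^ 'p ^ 'p"
  A1 :: "real \<Rightarrow> (real ^ 'd ^ 'd) ^ 'p"
  A1' :: "real \<Rightarrow> ((real ^ 'd ^ 'd) ^ 'p) ^ 'p"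

definition bounded_measurable :: "real \<Rightarrow> (real \<Rightarrow> real ^ 'd::finite ^ 'd) \<Rightarrow> bool" where
  "bounded_measurable T f \<longleftrightarrow>
     bounded (f ` {0..T}) \<and> f \<in> borel_measurable (restrict_space borel {0..T})"

definition admissible_data ::
  "real \<Rightarrow> real \<Rightarrow> real \<Rightarrow> real \<Rightarrow> real \<Rightarrow> ('d::finite, 'p::finite) riccati_data \<Rightarrow> bool" where
  "admissible_data T \<gamma> \<beta> \<beta>' r D \<longleftrightarrow>
     geometric_rough_path T \<gamma> (eta D) (eta2 D) \<and>
     bounded_measurable T (Afun D) \<and> bounded_measurable T (Bfun D) \<and>
     bounded_measurable T (Qfun D) \<and> bounded_measurable T (Rfun D) \<and>
     (\<forall>t\<in>{0..T}. positive_definite (Rfun D t - r *\<^sub>R mat 1)) \<and>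
     nonneg_definite (Qbar D) \<and> (\<forall>t\<in>{0..T}. nonneg_definite (Qfun D t)) \<and>
     controlled T \<beta> \<beta>' (eta D) (A1 D) (A1' D)"

text \<open>
  The integrand $p A^1 + (A^1)^\top p$ of the rough integral, as a family indexed by the components
  of the driving path, and its Gubinelli derivative according to the Leibniz rule.
\<close>

definition riccati_integrand ::
  "('d::finite, 'p::finite) riccati_data \<Rightarrow> (real \<Rightarrow> real ^ 'd ^ 'd) \<Rightarrow>
   real \<Rightarrow> (real ^ 'd ^ 'd) ^ 'p" where
  "riccati_integrand D p s = (\<chi> j. p s ** (A1 D s $ j) + transpose (A1 D s $ j) ** p s)"

definition riccati_integrand_deriv ::
  "('d::finite, 'p::finite) riccati_data \<Rightarrow> (real \<Rightarrow> real ^ 'd ^ 'd) \<Rightarrow>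
   (real \<Rightarrow> (real ^ 'd ^ 'd) ^ 'p) \<Rightarrow> real \<Rightarrow> ((real ^ 'd ^ 'd) ^ 'p) ^ 'p" where
  "riccati_integrand_deriv D p p' s =
     (\<chi> i j. (p' s $ i) ** (A1 D s $ j) + p s ** (A1' D s $ i $ j)
           + transpose (A1' D s $ i $ j) ** p s + transpose (A1 D s $ j) ** (p' s $ i))"

definition riccati_drift ::
  "('d::finite, 'p::finite) riccati_data \<Rightarrow> (real \<Rightarrow> real ^ 'd ^ 'd) \<Rightarrow> real \<Rightarrow> real ^ 'd ^ 'd" where
  "riccati_drift D p s =
     p s ** Afun D s + transpose (Afun D s) ** p s
     - p s ** Bfun D s ** matrix_inv (Rfun D s) ** transpose (Bfun D s) ** p s + Qfun D s"

text \<open>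
  The Gubinelli derivative is part of the notion of solution and is prescribed by the equation;
  it is not determined by \<open>p\<close> alone when the driving path is not truly rough.
\<close>

definition riccati_solution ::
  "real \<Rightarrow> real \<Rightarrow> real \<Rightarrow> ('d::finite, 'p::finite) riccati_data \<Rightarrow>
   (real \<Rightarrow> real ^ 'd ^ 'd) \<Rightarrow> (real \<Rightarrow> (real ^ 'd ^ 'd) ^ 'p) \<Rightarrow> bool" where
  "riccati_solution T \<gamma> \<beta> D p p' \<longleftrightarrow>
     controlled T \<gamma> \<beta> (eta D) p p' \<and>
     (\<forall>t\<in>{0..T}. p' t = - riccati_integrand D p t) \<and>
     (\<forall>t\<in>{0..T}.
        p t = Qbar D
          + (rough_integral (eta D) (eta2 D) (riccati_integrand D p) (riccati_integrand_deriv D p p') T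
             - rough_integral (eta D) (eta2 D) (riccati_integrand D p) (riccati_integrand_deriv D p p') t)
          + (LINT s:{t..T}|lborel. riccati_drift D p s))"

definition data_dist ::
  "real \<Rightarrow> real \<Rightarrow> real \<Rightarrow> real \<Rightarrow>
   ('d::finite, 'p::finite) riccati_data \<Rightarrow> ('d, 'p) riccati_data \<Rightarrow> ennreal" where
  "data_dist T \<gamma> \<beta> \<beta>' D E =
     ennreal (norm (Qbar D - Qbar E)) +
     sup_norm T (\<lambda>t. Afun D t - Afun E t) + sup_norm T (\<lambda>t. Bfun D t - Bfun E t) +
     sup_norm T (\<lambda>t. Qfun D t - Qfun E t) + sup_norm T (\<lambda>t. Rfun D t - Rfun E t) +
     rough_dist T \<gamma> (eta D) (eta2 D) (eta E) (eta2 E) +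
     controlled_dist T \<beta> \<beta>' (eta D) (eta E) (A1 D) (A1' D) (A1 E) (A1' E)"

text \<open>
  The origin of the data space; it is not admissible and only serves to measure the size of data
  by \<^const>\<open>data_dist\<close>. As usual for rough differential equations, local Lipschitz continuity
  means Lipschitz continuity on sets of admissible data of bounded size with a common lower bound
  \<open>r\<close> on $R$; every admissible datum has a \<^const>\<open>data_dist\<close>-neighbourhood whose admissible data
  are contained in such a set.
\<close>

definition zero_data :: "('d::finite, 'p::finite) riccati_data" where
  "zero_data = \<lparr>Qbar = 0, Afun = (\<lambda>_. 0), Bfun = (\<lambda>_. 0), Qfun = (\<lambda>_. 0), Rfun = (\<lambda>_. 0),
     eta = (\<lambda>_. 0), eta2 = (\<lambda>_ _. 0), A1 = (\<lambda>_. 0), A1' = (\<lambda>_. 0)\<rparr>"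

end

theory Submission
  imports Defs
begin

text \<open>
  Up to errors of order $\theta = \gamma + \beta + \beta' > 1$, a solution satisfies
  $p_s = \mu_{s,t}^\top p_t \mu_{s,t} + \phi_{s,t}(p_t)$, where
  $\mu_{s,t} = 1 + A^1_s \delta\eta_{s,t} + ((A^1)'_s + A^1_s A^1_s) \eta^{(2)}_{s,t}$ is the germ of
  the linear flow driven by $A^1$ and $\phi$ is the integrated quadratic drift with $p$ frozen at $t$;
  passing from the right to the left endpoint uses that $\boldsymbol\eta$ is geometric.
  Conjugating with the exact flow $U$ of $\mu$ removes the rough part: the increments of
  $U_t^\top p_t U_t$ are those of an ordinary integral. This mild form gives uniqueness, and
  stability by Gronwall's lemma, once solutions are bounded.

  The bound comes from the signs. Absorbing the drift $p A + A^\top p - p S p$, where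
  $S = B R^{-1} B^\top$, into the flow (with generator $A - S p / 2$) leaves the source $Q \succeq 0$,
  so $p \succeq 0$; then the term $- p S p$ can only decrease the quadratic form of $p$, so that
  $p$ is bounded above independently of $S$. Hence a solution for a drift truncated at a sufficiently
  high level, which exists globally by sewing, solves the original equation.
\<close>

text \<open>The obstacle is uniformity: the Lipschitz constant may depend on the data only through a
  size M and the lower bound r, while the error constants inside the expansions of a given solution
  are arbitrary. Conjugation with an exact flow disposes of them: errors of order \<theta> > 1
  vanish on refinement and only the source of first order is estimated. This is why many results fix
  a constant first and then quantify over paths with an arbitrary error constant. The upper bound
  never sees the truncation level, so it can itself be taken as that level. Other solutions inherit
  it by uniqueness, which asks only for some bound, and a Hoelder path on a compact interval has
  one. Flows start afresh at each time s with the identity, so the conjugated quantity at s is p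
  itself and flows are never inverted. Stability compares p at s minus the congruence of p at t for
  two data, a quantity of order t - s; the distances of paths, derivatives and remainders are then
  obtained by algebra.\<close>

lemma powr_small_step:
  fixes K \<alpha> \<delta> :: real
  assumes "0 \<le> K" "0 < \<alpha>" "0 < \<delta>"
  obtains h0 where "0 < h0" "\<And>h. 0 \<le> h \<Longrightarrow> h \<le> h0 \<Longrightarrow> K * h powr \<alpha> \<le> \<delta>"
proof -
  let ?h = "(\<delta> / (K + 1)) powr (1 / \<alpha>)"
  have p: "\<delta> / (K + 1) > 0" using assms by simp
  have "K * h powr \<alpha> \<le> \<delta>" if "0 \<le> h" "h \<le> ?h" for h
  proof -
    have "h powr \<alpha> \<le> ?h powr \<alpha>" using that assms by (intro powr_mono2) auto
    also have "\<dots> = \<delta> / (K + 1)" using p assms by (simp add: powr_powr)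
    finally have "K * h powr \<alpha> \<le> K * (\<delta> / (K + 1))" using assms by (intro mult_left_mono)
    also have "\<dots> = (K / (K + 1)) * \<delta>" by simp
    also have "\<dots> \<le> 1 * \<delta>" using assms by (intro mult_right_mono) auto
    finally show ?thesis by simp
  qed
  with p show ?thesis by (intro that[of ?h]) auto
qed

section \<open>Sewing of almost flows\<close>

text \<open>\<open>lip\<close> controls the Lipschitz constant of \<open>m s t\<close> minus the
  identity, so that of \<open>m s t\<close> itself tends to 1 on short intervals, as halving
  arguments require. The factor 1 + norm x in \<open>flow\<close> and \<open>near\<close> admits
  germs of linear growth, such as multiplication by a matrix or congruence, whose defects scale with
  the point.\<close>

locale almost_flow =
  fixes m :: "real \<Rightarrow> real \<Rightarrow> 'a::euclidean_space \<Rightarrow> 'a" and a b K \<gamma> \<theta> :: real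
  assumes K_nonneg: "0 \<le> K" and \<gamma>_pos: "0 < \<gamma>" and \<theta>_gt: "1 < \<theta>"
    and lip: "\<And>s t x y. a \<le> s \<Longrightarrow> s \<le> t \<Longrightarrow> t \<le> b \<Longrightarrow>
      norm (m s t x - m s t y - (x - y)) \<le> K * (t - s) powr \<gamma> * norm (x - y)"
    and flow: "\<And>s u t x. a \<le> s \<Longrightarrow> s \<le> u \<Longrightarrow> u \<le> t \<Longrightarrow> t \<le> b \<Longrightarrow>
      norm (m u t (m s u x) - m s t x) \<le> K * (1 + norm x) * (t - s) powr \<theta>"
    and near: "\<And>s t x. a \<le> s \<Longrightarrow> s \<le> t \<Longrightarrow> t \<le> b \<Longrightarrow>
      norm (m s t x - x) \<le> K * (1 + norm x) * (t - s) powr \<gamma>"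
begin

lemma same: "a \<le> s \<Longrightarrow> s \<le> b \<Longrightarrow> m s s x = x"
  using near[of s s x] by simp

lemma lip_le:
  assumes "a \<le> s" "s \<le> t" "t \<le> b"
  shows "norm (m s t x - m s t y) \<le> (1 + K * (t - s) powr \<gamma>) * norm (x - y)"
proof -
  have "norm (m s t x - m s t y) = norm ((m s t x - m s t y - (x - y)) + (x - y))" by simp
  also have "\<dots> \<le> norm (m s t x - m s t y - (x - y)) + norm (x - y)" by (rule norm_triangle_ineq)
  also have "\<dots> \<le> (1 + K * (t - s) powr \<gamma>) * norm (x - y)"
    using lip[OF assms, of x y] by (simp add: algebra_simps)
  finally show ?thesis .
qed

lemma continuous_germ:
  assumes "a \<le> s" "s \<le> t" "t \<le> b"
  shows "continuous_on UNIV (m s t)"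
proof (rule continuous_onI)
  fix x :: 'a and e :: real assume "e > 0"
  define L where "L = 1 + K * (t - s) powr \<gamma>"
  have L: "L > 0" unfolding L_def using K_nonneg by (simp add: add_pos_nonneg)
  show "\<exists>d>0. \<forall>x'\<in>UNIV. dist x' x < d \<longrightarrow> dist (m s t x') (m s t x) \<le> e"
  proof (intro exI[of _ "e / L"] conjI ballI impI)
    fix x' assume "dist x' x < e / L"
    then have "L * norm (x' - x) \<le> e" using L by (simp add: dist_norm field_simps)
    then show "dist (m s t x') (m s t x) \<le> e"
      using lip_le[OF assms, of x' x] unfolding L_def dist_norm by linarith
  qed (use L \<open>e > 0\<close> in auto)
qed

text \<open>Inserting \<open>m u t (X u)\<close> and \<open>m u t (m s u (X s))\<close> splits the
  defect: the right piece enters as it is, the left piece is transported by the Lipschitz map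
  \<open>m u t\<close>, and the last term is the failure of the germ to compose.\<close>

lemma defect_split:
  assumes "a \<le> s" "s \<le> u" "u \<le> t" "t \<le> b"
  shows "norm (X t - m s t (X s)) \<le> norm (X t - m u t (X u))
    + (1 + K * (t - u) powr \<gamma>) * norm (X u - m s u (X s))
    + K * (1 + norm (X s)) * (t - s) powr \<theta>"
proof -
  have "X t - m s t (X s) = (X t - m u t (X u)) + (m u t (X u) - m u t (m s u (X s)))
      + (m u t (m s u (X s)) - m s t (X s))" by simp
  then have "norm (X t - m s t (X s)) \<le> norm (X t - m u t (X u))
      + norm (m u t (X u) - m u t (m s u (X s))) + norm (m u t (m s u (X s)) - m s t (X s))"
    by (metis norm_triangle_ineq norm_triangle_mono order_refl)
  moreover have "norm (m u t (X u) - m u t (m s u (X s)))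
      \<le> (1 + K * (t - u) powr \<gamma>) * norm (X u - m s u (X s))"
    using assms by (intro lip_le) auto
  ultimately show ?thesis using flow[OF assms, of "X s"] by linarith
qed

text \<open>An Euler polygon on a grid. Values off F are unconstrained, so a polygon extends to a
  larger grid by changing a single value.\<close>

definition euler :: "real set \<Rightarrow> (real \<Rightarrow> 'a) \<Rightarrow> bool" where
  "euler F X \<longleftrightarrow> (\<forall>s\<in>F. \<forall>t\<in>F. s < t \<and> F \<inter> {s<..<t} = {} \<longrightarrow> X t = m s t (X s))"

lemma ex_euler:
  assumes "finite F" "F \<noteq> {}"
  shows "\<exists>X. X (Min F) = x0 \<and> euler F X"
  using assms
proof (induction F rule: finite_linorder_max_induct)
  case (insert c A)
  show ?case
  proof (cases "A = {}")
    case True then show ?thesis by (auto simp: euler_def)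
  next
    case False
    then obtain X where X: "X (Min A) = x0" "euler A X" using insert by auto
    have c: "c \<notin> A" using insert by auto
    have mx: "Max A \<in> A" using False insert by simp
    define Y where "Y = X(c := m (Max A) c (X (Max A)))"
    have "Min (insert c A) = Min A"
      using False insert by (metis Min_in Min_insert less_imp_le min_absorb2)
    moreover have "Min A \<noteq> c" using c False insert by (metis Min_in)
    ultimately have 1: "Y (Min (insert c A)) = x0" by (simp add: Y_def X)
    have "Y t = m s t (Y s)"
      if st: "s \<in> insert c A" "t \<in> insert c A" "s < t" "insert c A \<inter> {s<..<t} = {}" for s t
    proof (cases "t = c")
      case True
      then have "s \<in> A" using st by auto
      have "s = Max A"
      proof (rule ccontr)
        assume "s \<noteq> Max A"
        then have "s < Max A" using \<open>s \<in> A\<close> insert by (simp add: order_less_le)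
        moreover have "Max A < t" using mx insert True by auto
        ultimately show False using st mx by auto
      qed
      then show ?thesis using True c mx by (auto simp: Y_def)
    next
      case False
      then have "t \<in> A" using st by auto
      then have "t < c" using insert by auto
      then have "s \<in> A" using st by auto
      moreover have "A \<inter> {s<..<t} = {}" using st by auto
      ultimately have "X t = m s t (X s)" using X \<open>t \<in> A\<close> \<open>s < t\<close> by (auto simp: euler_def)
      then show ?thesis using c \<open>t \<in> A\<close> \<open>s \<in> A\<close> by (auto simp: Y_def)
    qed
    then have "euler (insert c A) Y" unfolding euler_def by blast
    with 1 show ?thesis by blast
  qed
qed auto

text \<open>A discrete sewing estimate, by induction on the number of grid points strictly between s
  and t. The grid neighbours s' \<le> v < t' of the midpoint v have nothing between them, so the
  defect over [s', t'] is zero, and the two outer pieces have at most half the length. Each halving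
  contributes \<open>2 powr (- \<theta>)\<close>; the left piece is stretched twice by at most 1 +
  \<delta>, hence the condition on \<rho>. The value of c is the fixed point of c = \<rho> c + (2 +
  \<delta>) K.\<close>

lemma euler_defect:
  assumes F: "finite F" "F \<subseteq> {a..b}" and X: "euler F X"
    and S: "\<And>t. t \<in> F \<Longrightarrow> 1 + norm (X t) \<le> S"
    and \<delta>: "\<And>h. 0 \<le> h \<Longrightarrow> h \<le> b - a \<Longrightarrow> K * h powr \<gamma> \<le> \<delta>" and \<delta>0: "0 \<le> \<delta>"
    and \<rho>: "(1 + (1 + \<delta>)^2) * 2 powr (- \<theta>) \<le> \<rho>" "\<rho> < 1"
    and c: "c = (2 + \<delta>) * K / (1 - \<rho>)"
    and st: "s \<in> F" "t \<in> F" "s \<le> t"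
  shows "norm (X t - m s t (X s)) \<le> c * S * (t - s) powr \<theta>"
  using st
proof (induction "card (F \<inter> {s<..<t})" arbitrary: s t rule: less_induct)
  case less
  have S0: "S \<ge> 0" using S[OF less.prems(1)] norm_ge_zero[of "X s"] by linarith
  have c0: "c \<ge> 0" using c \<delta>0 K_nonneg \<rho> by simp
  have ab: "a \<le> s" "t \<le> b" using less F by auto
  show ?case
  proof (cases "s = t")
    case True then show ?thesis using ab same by (simp)
  next
    case False
    then have "s < t" using less by simp
    define v where "v = (s + t) / 2"
    have v: "s \<le> v" "v < t" using \<open>s < t\<close> by (auto simp: v_def)
    define s' where "s' = Max (F \<inter> {s..v})"
    define t' where "t' = Min (F \<inter> {v<..t})"
    have "s' \<in> F \<inter> {s..v}" unfolding s'_def using F v less by (intro Max_in) auto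
    then have s': "s' \<in> F" "s \<le> s'" "s' \<le> v" by auto
    have "t' \<in> F \<inter> {v<..t}" unfolding t'_def using F v less by (intro Min_in) auto
    then have t': "t' \<in> F" "v < t'" "t' \<le> t" by auto
    have s'max: "\<And>w. w \<in> F \<Longrightarrow> s \<le> w \<Longrightarrow> w \<le> v \<Longrightarrow> w \<le> s'" unfolding s'_def using F by auto
    have t'min: "\<And>w. w \<in> F \<Longrightarrow> v < w \<Longrightarrow> w \<le> t \<Longrightarrow> t' \<le> w" unfolding t'_def using F by auto
    have gap: "F \<inter> {s'<..<t'} = {}"
    proof -
      have False if "w \<in> F" "s' < w" "w < t'" for w
        using that s'max[of w] t'min[of w] s' t' by (cases "w \<le> v") auto
      then show ?thesis by auto
    qed
    have Js't': "X t' - m s' t' (X s') = 0"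
      using X s' t' gap by (auto simp: euler_def)
    have half: "(t - s) powr \<theta> * 2 powr (- \<theta>) = ((t - s) / 2) powr \<theta>"
      using \<open>s < t\<close> by (simp add: powr_divide powr_minus divide_simps)
    have L: "norm (X s' - m s s' (X s)) \<le> c * S * ((t - s) / 2) powr \<theta>"
    proof (cases "s' = s")
      case True then show ?thesis using ab same[of s] less.prems(3) c0 S0 by simp
    next
      case False
      have "card (F \<inter> {s<..<s'}) < card (F \<inter> {s<..<t})"
      proof (rule psubset_card_mono)
        have "s' \<in> F \<inter> {s<..<t}" using s' False v by auto
        then show "F \<inter> {s<..<s'} \<subset> F \<inter> {s<..<t}" using s' v by auto
      qed (use F in auto)
      then have "norm (X s' - m s s' (X s)) \<le> c * S * (s' - s) powr \<theta>"
        using less.hyps less.prems s' by blast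
      also have "\<dots> \<le> c * S * ((t - s) / 2) powr \<theta>"
        using s' c0 S0 \<theta>_gt by (intro mult_left_mono powr_mono2) (auto simp: v_def field_simps)
      finally show ?thesis .
    qed
    have R: "norm (X t - m t' t (X t')) \<le> c * S * ((t - s) / 2) powr \<theta>"
    proof (cases "t' = t")
      case True then show ?thesis using ab same[of t] less.prems(3) c0 S0 by simp
    next
      case False
      have "card (F \<inter> {t'<..<t}) < card (F \<inter> {s<..<t})"
      proof (rule psubset_card_mono)
        have "t' \<in> F \<inter> {s<..<t}" using t' False v by auto
        then show "F \<inter> {t'<..<t} \<subset> F \<inter> {s<..<t}" using t' v by auto
      qed (use F in auto)
      then have "norm (X t - m t' t (X t')) \<le> c * S * (t - t') powr \<theta>"
        using less.hyps less.prems t' by blast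
      also have "\<dots> \<le> c * S * ((t - s) / 2) powr \<theta>"
        using t' c0 S0 \<theta>_gt by (intro mult_left_mono powr_mono2) (auto simp: v_def field_simps)
      finally show ?thesis .
    qed
    let ?e = "K * S * (t - s) powr \<theta>"
    have M: "norm (X t' - m s t' (X s)) \<le> (1 + \<delta>) * norm (X s' - m s s' (X s)) + ?e"
    proof -
      have "norm (X t' - m s t' (X s)) \<le> norm (X t' - m s' t' (X s'))
          + (1 + K * (t' - s') powr \<gamma>) * norm (X s' - m s s' (X s))
          + K * (1 + norm (X s)) * (t' - s) powr \<theta>"
        using ab s' t' v by (intro defect_split) auto
      moreover have "(1 + K * (t' - s') powr \<gamma>) * norm (X s' - m s s' (X s))
          \<le> (1 + \<delta>) * norm (X s' - m s s' (X s))"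
        using ab s' t' v by (intro mult_right_mono add_left_mono \<delta>) auto
      moreover have "K * (1 + norm (X s)) * (t' - s) powr \<theta> \<le> ?e"
        using ab s' t' v K_nonneg S[OF less.prems(1)] S0 \<theta>_gt
        by (intro mult_mono powr_mono2 mult_left_mono) auto
      ultimately show ?thesis using Js't' by simp
    qed
    have "norm (X t - m s t (X s)) \<le> norm (X t - m t' t (X t'))
          + (1 + K * (t - t') powr \<gamma>) * norm (X t' - m s t' (X s))
          + K * (1 + norm (X s)) * (t - s) powr \<theta>"
      using ab s' t' v by (intro defect_split) auto
    moreover have "(1 + K * (t - t') powr \<gamma>) * norm (X t' - m s t' (X s))
          \<le> (1 + \<delta>) * norm (X t' - m s t' (X s))"
      using ab s' t' v by (intro mult_right_mono add_left_mono \<delta>) auto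
    moreover have "(1 + \<delta>) * norm (X t' - m s t' (X s))
          \<le> (1 + \<delta>) * ((1 + \<delta>) * (c * S * ((t - s) / 2) powr \<theta>) + ?e)"
    proof (rule mult_left_mono)
      have "(1 + \<delta>) * norm (X s' - m s s' (X s)) \<le> (1 + \<delta>) * (c * S * ((t - s) / 2) powr \<theta>)"
        using L \<delta>0 by (intro mult_left_mono) auto
      then show "norm (X t' - m s t' (X s)) \<le> (1 + \<delta>) * (c * S * ((t - s) / 2) powr \<theta>) + ?e"
        using M by linarith
    qed (use \<delta>0 in simp)
    moreover have "K * (1 + norm (X s)) * (t - s) powr \<theta> \<le> ?e"
        using K_nonneg S[OF less.prems(1)] S0 by (intro mult_mono mult_left_mono) auto
    ultimately have "norm (X t - m s t (X s)) \<le> c * S * ((t - s) / 2) powr \<theta>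
        + (1 + \<delta>) * ((1 + \<delta>) * (c * S * ((t - s) / 2) powr \<theta>) + ?e) + ?e"
      using R by linarith
    also have "\<dots> = ((1 + (1 + \<delta>)^2) * 2 powr (- \<theta>)) * (c * S * (t - s) powr \<theta>) + (2 + \<delta>) * ?e"
      unfolding half[symmetric] by (simp add: algebra_simps power2_eq_square)
    also have "\<dots> \<le> \<rho> * (c * S * (t - s) powr \<theta>) + (2 + \<delta>) * ?e"
      using \<rho> c0 S0 by (intro add_right_mono mult_right_mono) auto
    also have "\<dots> = c * S * (t - s) powr \<theta>"
    proof -
      have "(2 + \<delta>) * K = (1 - \<rho>) * c" using c \<rho> by simp
      then have "(2 + \<delta>) * ?e = (1 - \<rho>) * c * (S * (t - s) powr \<theta>)" by (simp add: mult.assoc[symmetric])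
      then show ?thesis by (simp add: algebra_simps)
    qed
    finally show ?thesis .
  qed
qed

end

text \<open>Euler polygons on finite grids have defects bounded by one constant, and a compactness
  argument replaces convergence along refinements: each pair (s, t) imposes a closed condition on X,
  and finitely many such conditions are met by the polygon on the times involved. The step h0
  depends on K, \<gamma>, \<theta> alone and not on the initial value, which allows
  iteration.\<close>

lemma local_sewing:
  fixes K \<gamma> \<theta> :: real
  assumes "0 \<le> K" "0 < \<gamma>" "1 < \<theta>"
  obtains h0 where "0 < h0"
    "\<And>(m :: real \<Rightarrow> real \<Rightarrow> 'a::euclidean_space \<Rightarrow> 'a) a b x0. almost_flow m a b K \<gamma> \<theta> \<Longrightarrow> a \<le> b \<Longrightarrow> b - a \<le> h0 \<Longrightarrow>
      \<exists>X C. X a = x0 \<and> (\<forall>s t. a \<le> s \<and> s \<le> t \<and> t \<le> b \<longrightarrow> norm (X t - m s t (X s)) \<le> C * (t - s) powr \<theta>)"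
proof -
  have p2: "2 powr \<theta> > (2::real)" using assms powr_less_mono[of 1 \<theta> 2] by simp
  \<comment> \<open>With \<delta> \<le> 1 one has 1 + (1 + \<delta>)^2 \<le> 2 + 3 \<delta>, and 6
    \<delta> \<le> \<open>2 powr \<theta> - 2\<close> keeps this below
    \<open>(2 powr \<theta> + 2) / 2\<close>. Divided by \<open>2 powr \<theta>\<close> this is
    \<rho>, the mean of 1 and \<open>2 * 2 powr (- \<theta>)\<close>, hence less than 1.\<close>
  define \<delta> where "\<delta> = min 1 ((2 powr \<theta> - 2) / 6)"
  have \<delta>: "0 < \<delta>" "\<delta> \<le> 1" "6 * \<delta> \<le> 2 powr \<theta> - 2" using p2 by (auto simp: \<delta>_def min_def)
  define \<rho> where "\<rho> = 1 / 2 + 2 powr (- \<theta>)"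
  have \<rho>1: "\<rho> < 1" unfolding \<rho>_def powr_minus using p2 by (simp add: field_simps)
  have "(1 + (1 + \<delta>)^2) \<le> (2 powr \<theta> + 2) / 2"
  proof -
    have "\<delta> * \<delta> \<le> \<delta>" using \<delta> by (simp add: mult_left_le)
    then have "(1 + (1 + \<delta>)^2) \<le> 2 + 3 * \<delta>" by (simp add: power2_eq_square algebra_simps)
    then show ?thesis using \<delta> by simp
  qed
  then have "(1 + (1 + \<delta>)^2) * 2 powr (- \<theta>) \<le> (2 powr \<theta> + 2) / 2 * 2 powr (- \<theta>)"
    by (intro mult_right_mono) auto
  also have "\<dots> = \<rho>" unfolding \<rho>_def powr_minus by (simp add: field_simps)
  finally have \<rho>: "(1 + (1 + \<delta>)^2) * 2 powr (- \<theta>) \<le> \<rho>" .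
  define c where "c = (2 + \<delta>) * K / (1 - \<rho>)"
  have c0: "c \<ge> 0" using c_def assms \<delta> \<rho>1 by simp
  obtain h1 where h1: "0 < h1" "\<And>h. 0 \<le> h \<Longrightarrow> h \<le> h1 \<Longrightarrow> K * h powr \<gamma> \<le> \<delta>"
    using powr_small_step assms \<delta>(1) by metis
  obtain h2 where h2: "0 < h2" "\<And>h. 0 \<le> h \<Longrightarrow> h \<le> h2 \<Longrightarrow> c * h powr \<theta> \<le> 1 / 2"
    using powr_small_step[of c \<theta> "1/2"] c0 assms by auto
  show ?thesis
  proof (rule that[of "min h1 h2"])
    show "0 < min h1 h2" using h1 h2 by simp
    fix m :: "real \<Rightarrow> real \<Rightarrow> 'a \<Rightarrow> 'a" and a b and x0 :: 'a
    assume "almost_flow m a b K \<gamma> \<theta>" and ab: "a \<le> b" and h0: "b - a \<le> min h1 h2"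
    then interpret almost_flow m a b K \<gamma> \<theta> by simp
    \<comment> \<open>The maximum S of 1 + norm (X t) over the grid satisfies S \<le> 2 (1 + norm
      x0) + S / 2, so S \<le> B.\<close>
    define B where "B = 4 * (1 + norm x0)"
    define P where "P = (\<lambda>(s, t) X. norm (X t - m s t (X s)) \<le> c * B * (t - s) powr \<theta>)"
    have fin: "\<exists>X. X a = x0 \<and> (\<forall>t. norm (X t) \<le> B) \<and> (\<forall>s\<in>F. \<forall>t\<in>F. s \<le> t \<longrightarrow> P (s, t) X)"
      if F: "finite F" "F \<subseteq> {a..b}" "a \<in> F" for F
    proof -
      have "F \<noteq> {}" using F by auto
      moreover have "Min F = a" using F by (intro Min_eqI) auto
      ultimately obtain X where X: "X a = x0" "euler F X" using ex_euler[of F x0] F by auto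
      define S where "S = Max ((\<lambda>t. 1 + norm (X t)) ` F)"
      have S: "1 + norm (X t) \<le> S" if "t \<in> F" for t unfolding S_def using F that by auto
      have J: "norm (X t - m s t (X s)) \<le> c * S * (t - s) powr \<theta>"
        if "s \<in> F" "t \<in> F" "s \<le> t" for s t
        using euler_defect[OF F(1,2) X(2) S _ _ \<rho> \<rho>1 c_def that] h1 h0 \<delta> by auto
      have "1 + norm (X t) \<le> 2 * (1 + norm x0) + S / 2" if "t \<in> F" for t
      proof -
        have S0: "S \<ge> 0" using S[OF that] norm_ge_zero[of "X t"] by linarith
        have t: "a \<le> t" "t \<le> b" using F that by auto
        have "norm (X t) \<le> norm (X t - m a t (X a)) + norm (m a t x0 - x0) + norm x0"
          unfolding X(1) using norm_triangle_ineq[of "X t - m a t x0" "m a t x0"]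
            norm_triangle_ineq[of "m a t x0 - x0" x0] by simp
        moreover have "norm (X t - m a t (X a)) \<le> S / 2"
        proof -
          have "norm (X t - m a t (X a)) \<le> c * S * (t - a) powr \<theta>" using J[of a t] F that t by auto
          also have "\<dots> = S * (c * (t - a) powr \<theta>)" by simp
          also have "\<dots> \<le> S * (1 / 2)" using t h0 S0 by (intro mult_left_mono h2) auto
          finally show ?thesis by simp
        qed
        moreover have "norm (m a t x0 - x0) \<le> 1 + norm x0"
        proof -
          have "norm (m a t x0 - x0) \<le> K * (1 + norm x0) * (t - a) powr \<gamma>" using near t by simp
          also have "\<dots> = (1 + norm x0) * (K * (t - a) powr \<gamma>)" by simp
          also have "\<dots> \<le> (1 + norm x0) * \<delta>" using t h0 by (intro mult_left_mono h1) auto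
          also have "\<dots> \<le> (1 + norm x0) * 1" using \<delta> by (intro mult_left_mono) auto
          finally show ?thesis by simp
        qed
        ultimately show ?thesis by simp
      qed
      moreover have "S \<in> (\<lambda>t. 1 + norm (X t)) ` F" unfolding S_def using F by (intro Max_in) auto
      ultimately have "S \<le> 2 * (1 + norm x0) + S / 2" by auto
      then have SB: "S \<le> B" by (simp add: B_def)
      \<comment> \<open>Off the grid the value is reset to x0, which puts the polygon into the
        product of balls used for compactness.\<close>
      define Y where "Y = (\<lambda>t. if t \<in> F then X t else x0)"
      have "norm (Y t) \<le> B" for t
      proof (cases "t \<in> F")
        case True then show ?thesis using S[OF True] SB by (simp add: Y_def)
      qed (simp add: Y_def B_def)
      moreover have "P (s, t) Y" if "s \<in> F" "t \<in> F" "s \<le> t" for s t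
      proof -
        have "c * S * (t - s) powr \<theta> \<le> c * B * (t - s) powr \<theta>"
          using SB c0 by (intro mult_right_mono mult_left_mono) auto
        then show ?thesis using J[OF that] that by (auto simp: P_def Y_def)
      qed
      ultimately show ?thesis using X F by (intro exI[of _ Y]) (auto simp: Y_def)
    qed
    \<comment> \<open>By Tychonoff's theorem the functions into a closed ball form a compact set for
      pointwise convergence. Each condition involves two values of X, and \<open>m s t\<close> is
      continuous, so the conditions are closed in this topology.\<close>
    let ?C = "PiE UNIV (\<lambda>t::real. cball (0::'a) B)"
    have "compactin (product_topology (\<lambda>_. euclidean) UNIV) ?C"
      unfolding compactin_PiE by simp
    then have comp: "compact ?C" by (simp add: euclidean_product_topology)
    let ?I = "{(s, t). a \<le> s \<and> s \<le> t \<and> t \<le> b}"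
    let ?Q = "\<lambda>i. {X. X a = x0 \<and> P i X}"
    have "?C \<inter> (\<Inter>i\<in>?I. ?Q i) \<noteq> {}"
    proof (rule compact_imp_fip_image[OF comp])
      fix i assume "i \<in> ?I"
      then obtain s t where i: "i = (s, t)" and st: "a \<le> s" "s \<le> t" "t \<le> b" by auto
      have "closed {X::real \<Rightarrow> 'a. X a = x0}"
        by (intro closed_Collect_eq continuous_on_product_coordinates continuous_intros)
      moreover have "closed {X. P i X}" unfolding P_def i prod.case
        by (intro closed_Collect_le continuous_intros continuous_on_product_coordinates
            continuous_on_compose2[OF continuous_germ[OF st]]) auto
      ultimately show "closed (?Q i)" by (simp add: Collect_conj_eq closed_Int)
    next
      fix J assume J: "finite J" "J \<subseteq> ?I"
      \<comment> \<open>The point a is added so that the polygon starts there with value x0.\<close>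
      let ?F = "insert a (fst ` J \<union> snd ` J)"
      have "finite ?F" "?F \<subseteq> {a..b}" "a \<in> ?F" using J ab by auto
      from fin[OF this] obtain X where X: "X a = x0" "\<And>t. norm (X t) \<le> B"
        "\<And>s t. s \<in> ?F \<Longrightarrow> t \<in> ?F \<Longrightarrow> s \<le> t \<Longrightarrow> P (s, t) X" by blast
      have "X \<in> ?Q i" if "i \<in> J" for i
      proof -
        have "fst i \<in> ?F" "snd i \<in> ?F" "fst i \<le> snd i" using that J by auto
        then have "P (fst i, snd i) X" using X(3) by blast
        then show ?thesis using X by simp
      qed
      moreover have "X \<in> ?C" using X by auto
      ultimately show "?C \<inter> (\<Inter>i\<in>J. ?Q i) \<noteq> {}" by blast
    qed
    then obtain X where X: "\<And>i. i \<in> ?I \<Longrightarrow> X \<in> ?Q i" by blast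
    have "X a = x0" using X[of "(a, a)"] ab by auto
    moreover have "norm (X t - m s t (X s)) \<le> c * B * (t - s) powr \<theta>"
      if "a \<le> s \<and> s \<le> t \<and> t \<le> b" for s t
      using X[of "(s, t)"] that by (auto simp: P_def)
    ultimately show "\<exists>X C. X a = x0 \<and> (\<forall>s t. a \<le> s \<and> s \<le> t \<and> t \<le> b \<longrightarrow>
        norm (X t - m s t (X s)) \<le> C * (t - s) powr \<theta>)" by blast
  qed
qed

section \<open>Concatenation of local solutions\<close>

context almost_flow begin

lemma subinterval:
  assumes "a \<le> a'" "b' \<le> b"
  shows "almost_flow m a' b' K \<gamma> \<theta>"
  using assms lip flow near K_nonneg \<gamma>_pos \<theta>_gt by unfold_locales (auto)

lemma bounded_of_defect:
  assumes "\<And>t. a \<le> t \<Longrightarrow> t \<le> c \<Longrightarrow> norm (X t - m a t (X a)) \<le> C * (t - a) powr \<theta>" "c \<le> b"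
  shows "\<exists>B. \<forall>t. a \<le> t \<and> t \<le> c \<longrightarrow> norm (X t) \<le> B"
proof (intro exI allI impI)
  fix t assume t: "a \<le> t \<and> t \<le> c"
  have "norm (X t) \<le> norm (X t - m a t (X a)) + norm (m a t (X a) - X a) + norm (X a)"
    using norm_triangle_ineq[of "X t - m a t (X a)" "m a t (X a)"]
      norm_triangle_ineq[of "m a t (X a) - X a" "X a"] by simp
  also have "\<dots> \<le> \<bar>C\<bar> * (c - a) powr \<theta> + K * (1 + norm (X a)) * (c - a) powr \<gamma> + norm (X a)"
  proof (intro add_mono order_refl)
    have "norm (X t - m a t (X a)) \<le> C * (t - a) powr \<theta>" using assms t by auto
    also have "\<dots> \<le> \<bar>C\<bar> * (c - a) powr \<theta>" using t \<theta>_gt by (intro mult_mono powr_mono2) auto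
    finally show "norm (X t - m a t (X a)) \<le> \<bar>C\<bar> * (c - a) powr \<theta>" .
    have "norm (m a t (X a) - X a) \<le> K * (1 + norm (X a)) * (t - a) powr \<gamma>" using near t assms by auto
    also have "\<dots> \<le> K * (1 + norm (X a)) * (c - a) powr \<gamma>"
      using t \<gamma>_pos K_nonneg by (intro mult_left_mono powr_mono2) auto
    finally show "norm (m a t (X a) - X a) \<le> K * (1 + norm (X a)) * (c - a) powr \<gamma>" .
  qed
  finally show "norm (X t) \<le> \<bar>C\<bar> * (c - a) powr \<theta> + K * (1 + norm (X a)) * (c - a) powr \<gamma> + norm (X a)" .
qed

text \<open>Steps of length h0 are glued until b is reached; h0 is the same at every restart. Across
  a junction c the defect is handled by \<open>defect_split\<close> at c, and D adds up the three
  coefficients occurring there. The final C may depend on the initial value and on the germ, so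
  uniform constants have to be recovered later from the stability of linear flows.\<close>

theorem sewing:
  assumes ab: "a \<le> b"
  shows "\<exists>X C. X a = x0 \<and> (\<forall>s t. a \<le> s \<and> s \<le> t \<and> t \<le> b \<longrightarrow> norm (X t - m s t (X s)) \<le> C * (t - s) powr \<theta>)"
proof -
  obtain h0 where h0: "0 < h0" and loc:
    "\<And>(m :: real \<Rightarrow> real \<Rightarrow> 'a \<Rightarrow> 'a) a b x0. almost_flow m a b K \<gamma> \<theta> \<Longrightarrow> a \<le> b \<Longrightarrow> b - a \<le> h0 \<Longrightarrow>
      \<exists>X C. X a = x0 \<and> (\<forall>s t. a \<le> s \<and> s \<le> t \<and> t \<le> b \<longrightarrow> norm (X t - m s t (X s)) \<le> C * (t - s) powr \<theta>)"
    using local_sewing[OF K_nonneg \<gamma>_pos \<theta>_gt] by blast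
  define sol where "sol c \<longleftrightarrow> (\<exists>X C. X a = x0 \<and> (\<forall>s t. a \<le> s \<and> s \<le> t \<and> t \<le> c \<longrightarrow>
    norm (X t - m s t (X s)) \<le> C * (t - s) powr \<theta>))" for c
  have step: "sol d" if sol: "sol c" and c: "a \<le> c" "c \<le> d" "d \<le> b" "d - c \<le> h0" for c d
  proof -
    obtain X C where X: "X a = x0" "\<And>s t. a \<le> s \<Longrightarrow> s \<le> t \<Longrightarrow> t \<le> c \<Longrightarrow>
        norm (X t - m s t (X s)) \<le> C * (t - s) powr \<theta>"
      using sol unfolding sol_def by blast
    have "almost_flow m c d K \<gamma> \<theta>" using c by (intro subinterval)
    from loc[OF this c(2,4)] obtain Y C' where Y: "Y c = X c" "\<And>s t. c \<le> s \<Longrightarrow> s \<le> t \<Longrightarrow> t \<le> d \<Longrightarrow>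
        norm (Y t - m s t (Y s)) \<le> C' * (t - s) powr \<theta>" by blast
    obtain B where B: "\<And>t. a \<le> t \<Longrightarrow> t \<le> c \<Longrightarrow> norm (X t) \<le> B"
      using bounded_of_defect[of c X C] X(2) c by auto
    have B0: "B \<ge> 0" using B[of a] c norm_ge_zero[of "X a"] by linarith
    define Z where "Z t = (if t \<le> c then X t else Y t)" for t
    define D where "D = \<bar>C'\<bar> + (1 + K * (b - a) powr \<gamma>) * \<bar>C\<bar> + K * (1 + B)"
    have D: "\<bar>C'\<bar> \<le> D" "\<bar>C\<bar> \<le> D"
    proof -
      have n: "0 \<le> (K * (b - a) powr \<gamma>) * \<bar>C\<bar>" "0 \<le> K * (1 + B)" using K_nonneg B0 by auto
      then show "\<bar>C'\<bar> \<le> D" "\<bar>C\<bar> \<le> D" unfolding D_def by (auto simp: algebra_simps)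
    qed
    have "norm (Z t - m s t (Z s)) \<le> D * (t - s) powr \<theta>" if st: "a \<le> s" "s \<le> t" "t \<le> d" for s t
    proof -
      consider "t \<le> c" | "c < s" | "s \<le> c" "c < t" using st by linarith
      then show ?thesis
      proof cases
        case 1
        have "norm (Z t - m s t (Z s)) \<le> C * (t - s) powr \<theta>" using 1 st X by (simp add: Z_def)
        also have "\<dots> \<le> D * (t - s) powr \<theta>" using D by (intro mult_right_mono) auto
        finally show ?thesis .
      next
        case 2
        then have "norm (Z t - m s t (Z s)) \<le> C' * (t - s) powr \<theta>" using 2 st Y by (simp add: Z_def)
        also have "\<dots> \<le> D * (t - s) powr \<theta>" using D by (intro mult_right_mono) auto
        finally show ?thesis .
      next
        case 3
        have "norm (Z t - m s t (Z s)) \<le> norm (Z t - m c t (Z c))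
          + (1 + K * (t - c) powr \<gamma>) * norm (Z c - m s c (Z s))
          + K * (1 + norm (Z s)) * (t - s) powr \<theta>"
          using 3 st c by (intro defect_split) auto
        also have "\<dots> \<le> \<bar>C'\<bar> * (t - s) powr \<theta> + (1 + K * (b - a) powr \<gamma>) * (\<bar>C\<bar> * (t - s) powr \<theta>)
          + K * (1 + B) * (t - s) powr \<theta>"
        proof (intro add_mono mult_mono order_refl)
          have "norm (Z t - m c t (Z c)) \<le> C' * (t - c) powr \<theta>"
            using 3 st Y(1) Y(2)[of c t] by (simp add: Z_def)
          also have "\<dots> \<le> \<bar>C'\<bar> * (t - s) powr \<theta>" using 3 \<theta>_gt by (intro mult_mono powr_mono2) auto
          finally show "norm (Z t - m c t (Z c)) \<le> \<bar>C'\<bar> * (t - s) powr \<theta>" .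
          have "norm (Z c - m s c (Z s)) \<le> C * (c - s) powr \<theta>" using 3 st X by (simp add: Z_def)
          also have "\<dots> \<le> \<bar>C\<bar> * (t - s) powr \<theta>" using 3 \<theta>_gt by (intro mult_mono powr_mono2) auto
          finally show "norm (Z c - m s c (Z s)) \<le> \<bar>C\<bar> * (t - s) powr \<theta>" .
          show "(t - c) powr \<gamma> \<le> (b - a) powr \<gamma>" using 3 st c \<gamma>_pos by (intro powr_mono2) auto
          show "norm (Z s) \<le> B" using B 3 st by (simp add: Z_def)
        qed (use K_nonneg B0 in auto)
        also have "\<dots> = D * (t - s) powr \<theta>" by (simp add: D_def algebra_simps)
        finally show ?thesis .
      qed
    qed
    moreover have "Z a = x0" using X c by (simp add: Z_def)
    ultimately show ?thesis unfolding sol_def by (intro exI[of _ Z] exI[of _ D]) auto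
  qed
  have "sol (min (a + real k * h0) b)" for k
  proof (induction k)
    case 0
    have "norm (x0 - m s t x0) \<le> 0 * (t - s) powr \<theta>" if "a \<le> s \<and> s \<le> t \<and> t \<le> a" for s t
    proof -
      have "s = a" "t = a" using that by auto
      then show ?thesis using same[of a x0] ab by simp
    qed
    then have "sol a" unfolding sol_def by (intro exI[of _ "\<lambda>_. x0"] exI[of _ 0]) auto
    then show ?case using ab by (simp add: min_def)
  next
    case (Suc k)
    then show ?case
      using h0 ab by (elim step) (auto simp: min_def algebra_simps)
  qed
  moreover obtain k :: nat where "real k * h0 \<ge> b - a"
    using h0 by (metis reals_Archimedean3 less_imp_le)
  ultimately have "sol b" by (metis add.commute diff_le_eq min.absorb2)
  then show ?thesis unfolding sol_def .
qed

end

section \<open>Matrices\<close>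

text \<open>The norm of the nested vector type is the Frobenius norm, so it is invariant under
  transposition and submultiplicative. The identity has norm larger than 1 in general, which is why
  later constants have to dominate \<open>norm (mat 1)\<close>.\<close>

lemma norm_matrix_sq:
  fixes A :: "real^'n^'m"
  shows "(norm A)\<^sup>2 = (\<Sum>i\<in>UNIV. \<Sum>j\<in>UNIV. (A $ i $ j)\<^sup>2)"
  by (simp add: norm_vec_def L2_set_def sum_nonneg)

lemma norm_transpose [simp]:
  fixes A :: "real^'n^'m"
  shows "norm (transpose A) = norm A"
proof -
  have "(norm (transpose A))\<^sup>2 = (norm A)\<^sup>2"
    unfolding norm_matrix_sq transpose_def by (simp, rule sum.swap)
  then show ?thesis by simp
qed

lemma norm_matrix_vector_le:
  fixes A :: "real^'n^'m"
  shows "norm (A *v x) \<le> norm A * norm x"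
proof (rule power2_le_imp_le)
  have "(norm (A *v x))\<^sup>2 = (\<Sum>i\<in>UNIV. ((A $ i) \<bullet> x)\<^sup>2)"
    by (simp add: norm_vec_def L2_set_def sum_nonneg matrix_vector_mult_def inner_vec_def)
  also have "\<dots> \<le> (\<Sum>i\<in>UNIV. (norm (A $ i) * norm x)\<^sup>2)"
    by (intro sum_mono abs_le_square_iff[THEN iffD1]) (simp add: Cauchy_Schwarz_ineq2)
  also have "\<dots> = (norm A * norm x)\<^sup>2"
    by (simp add: norm_vec_def[of A] L2_set_def sum_nonneg power_mult_distrib sum_distrib_right)
  finally show "(norm (A *v x))\<^sup>2 \<le> (norm A * norm x)\<^sup>2" .
qed simp

lemma norm_matrix_mult_le:
  fixes A :: "real^'n^'m" and B :: "real^'k^'n"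
  shows "norm (A ** B) \<le> norm A * norm B"
proof (rule power2_le_imp_le)
  have row: "(A ** B) $ i = transpose B *v (A $ i)" for i
    by (simp add: matrix_matrix_mult_def matrix_vector_mult_def transpose_def vec_eq_iff mult.commute)
  have "(norm (A ** B))\<^sup>2 = (\<Sum>i\<in>UNIV. (norm ((A ** B) $ i))\<^sup>2)"
    by (simp add: norm_vec_def[of "A ** B"] L2_set_def sum_nonneg)
  also have "\<dots> \<le> (\<Sum>i\<in>UNIV. (norm B * norm (A $ i))\<^sup>2)"
    unfolding row using norm_matrix_vector_le[of "transpose B"]
    by (intro sum_mono power_mono) auto
  also have "\<dots> = (norm A * norm B)\<^sup>2"
    by (simp add: norm_vec_def[of A] L2_set_def sum_nonneg power_mult_distrib sum_distrib_left mult.commute)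
  finally show "(norm (A ** B))\<^sup>2 \<le> (norm A * norm B)\<^sup>2" .
qed simp

lemma bounded_bilinear_matrix_mult:
  "bounded_bilinear ((**) :: real^'n^'m \<Rightarrow> real^'k^'n \<Rightarrow> real^'k^'m)"
proof
  show "\<exists>K. \<forall>(a :: real^'n^'m) (b :: real^'k^'n). norm (a ** b) \<le> norm a * norm b * K"
    by (intro exI[of _ 1]) (simp add: norm_matrix_mult_le)
qed (simp_all add: matrix_matrix_mult_def vec_eq_iff sum.distrib algebra_simps sum_distrib_left)

interpretation mm: bounded_bilinear "(**) :: real^'n^'m \<Rightarrow> real^'k^'n \<Rightarrow> real^'k^'m"
  by (rule bounded_bilinear_matrix_mult)



lemma transpose_algebra:
  fixes A B :: "real^'n^'m"
  shows "transpose (A + B) = transpose A + transpose B" "transpose (A - B) = transpose A - transpose B"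
    "transpose (- A) = - transpose A" "transpose (0 :: real^'n^'m) = 0"
    "transpose (c *\<^sub>R A) = c *\<^sub>R transpose A"
  by (simp_all add: transpose_def vec_eq_iff)

lemma bounded_linear_transpose: "bounded_linear (transpose :: real^'n^'m \<Rightarrow> real^'m^'n)"
  by (rule bounded_linear_intro[of _ 1]) (simp_all add: transpose_algebra)

lemma transpose_sum: "transpose (\<Sum>i\<in>I. f i :: real^'n^'m) = (\<Sum>i\<in>I. transpose (f i))"
  by (simp add: transpose_def vec_eq_iff)

lemmas mm_simps = mm.add_left mm.add_right mm.diff_left mm.diff_right mm.minus_left mm.minus_right
  mm.zero_left mm.zero_right mm.scaleR_left mm.scaleR_right matrix_mul_assoc
  transpose_algebra(1-4) matrix_transpose_mul
  matrix_mul_lid matrix_mul_rid transpose_mat transpose_transpose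

section \<open>Increments of higher order\<close>

text \<open>Over n + 1 equal parts the increments add up to at most K (b - a)^\<theta> (n + 1)^(1 -
  \<theta>), which tends to 0 because \<theta> > 1. The hypothesis is one-sided, so the lemma also
  propagates inequalities between quadratic forms.\<close>

lemma nonincreasing_of_small_increments:
  fixes \<phi> :: "real \<Rightarrow> real"
  assumes ab: "a \<le> b" and \<theta>: "1 < \<theta>"
    and inc: "\<And>s t. a \<le> s \<Longrightarrow> s \<le> t \<Longrightarrow> t \<le> b \<Longrightarrow> \<phi> t - \<phi> s \<le> K * (t - s) powr \<theta>"
  shows "\<phi> b \<le> \<phi> a"
proof -
  have "\<phi> b - \<phi> a \<le> K * (b - a) powr \<theta> * real (Suc n) powr (1 - \<theta>)" for n
  proof -
    let ?N = "real (Suc n)"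
    define t where "t i = a + (b - a) * (real i / ?N)" for i
    have t0: "t 0 = a" by (simp add: t_def)
    have "?N \<noteq> 0" by simp
    then have tN: "t (Suc n) = b" by (simp only: t_def divide_self mult_1_right) simp
    have tt: "t (Suc i) - t i = (b - a) / ?N" for i
    proof -
      have "t (Suc i) - t i = (b - a) * ((real (Suc i) - real i) / ?N)"
        unfolding t_def diff_divide_distrib by (simp only: right_diff_distrib)
      then show ?thesis by simp
    qed
    have "\<phi> b - \<phi> a = (\<Sum>i<Suc n. \<phi> (t (Suc i)) - \<phi> (t i))"
      using sum_lessThan_telescope[of "\<lambda>i. \<phi> (t i)" "Suc n"] by (simp only: t0 tN)
    also have "\<dots> \<le> (\<Sum>i<Suc n. K * ((b - a) / ?N) powr \<theta>)"
    proof (rule sum_mono)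
      fix i assume "i \<in> {..<Suc n}"
      then have i: "real (Suc i) / ?N \<le> 1" by (simp add: field_simps)
      have "(b - a) * (real (Suc i) / ?N) \<le> (b - a) * 1" using ab i by (intro mult_left_mono) auto
      then have "t (Suc i) \<le> b" by (simp add: t_def)
      moreover have "a \<le> t i" using ab by (simp add: t_def)
      moreover have "t i \<le> t (Suc i)" using tt[of i] ab by (metis diff_ge_0_iff_ge divide_nonneg_nonneg of_nat_0_le_iff)
      ultimately show "\<phi> (t (Suc i)) - \<phi> (t i) \<le> K * ((b - a) / ?N) powr \<theta>"
        using inc[of "t i" "t (Suc i)"] tt[of i] by simp
    qed
    also have "\<dots> = K * (b - a) powr \<theta> * (?N * (1 / ?N powr \<theta>))"
      using ab by (simp add: powr_divide)
    also have "?N * (1 / ?N powr \<theta>) = ?N powr (1 - \<theta>)"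
      by (simp add: powr_diff)
    finally show ?thesis .
  qed
  moreover have "(\<lambda>n. K * (b - a) powr \<theta> * real (Suc n) powr (1 - \<theta>)) \<longlonglongrightarrow> K * (b - a) powr \<theta> * 0"
    using \<theta> by (intro tendsto_intros tendsto_neg_powr filterlim_compose[OF filterlim_real_sequentially filterlim_Suc]) auto
  ultimately have "\<phi> b - \<phi> a \<le> K * (b - a) powr \<theta> * 0"
    by (intro LIMSEQ_le_const) auto
  then show ?thesis by simp
qed

text \<open>The monotonicity lemma is applied to norm (f t - f a) - G t. This is how an estimate up
  to errors of order \<theta> becomes exact: K does not survive in the conclusion.\<close>

lemma increment_le_of_almost:
  fixes f :: "real \<Rightarrow> 'a::real_normed_vector"
  assumes ab: "a \<le> b" and \<theta>: "1 < \<theta>"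
    and inc: "\<And>s t. a \<le> s \<Longrightarrow> s \<le> t \<Longrightarrow> t \<le> b \<Longrightarrow> norm (f t - f s) \<le> G t - G s + K * (t - s) powr \<theta>"
  shows "norm (f b - f a) \<le> G b - G a"
proof -
  have "norm (f b - f a) - G b \<le> norm (f a - f a) - G a"
  proof (rule nonincreasing_of_small_increments[OF ab \<theta>, of "\<lambda>t. norm (f t - f a) - G t" K])
    fix s t assume st: "a \<le> s" "s \<le> t" "t \<le> b"
    have "norm (f t - f a) \<le> norm (f t - f s) + norm (f s - f a)"
      using norm_triangle_ineq[of "f t - f s" "f s - f a"] by simp
    then show "norm (f t - f a) - G t - (norm (f s - f a) - G s) \<le> K * (t - s) powr \<theta>"
      using inc[OF st] by linarith
  qed
  then show ?thesis by simp
qed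

lemma gronwall_backward:
  fixes u :: "real \<Rightarrow> real"
  assumes cont: "continuous_on {0..T} u" and L: "0 \<le> L"
    and le: "\<And>s. 0 \<le> s \<Longrightarrow> s \<le> T \<Longrightarrow> u s \<le> \<alpha> + L * integral {s..T} u"
    and s: "0 \<le> s" "s \<le> T"
  shows "u s \<le> \<alpha> * exp (L * (T - s))"
proof -
  have int: "u integrable_on {c..d}" if "0 \<le> c" "d \<le> T" for c d
    using cont that by (intro integrable_continuous_real continuous_on_subset[OF cont]) auto
  define y where "y t = integral {0..T} u - integral {0..t} u" for t
  have y: "y t = integral {t..T} u" if "0 \<le> t" "t \<le> T" for t
    unfolding y_def using Henstock_Kurzweil_Integration.integral_combine[of 0 t T u] int that by auto
  \<comment> \<open>The integrating factor makes z nondecreasing: its derivative is exp (L t) L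
    (\<alpha> + L y t - u t), which is nonnegative by \<open>le\<close>. Comparing z at s with z at
    T gives the claim.\<close>
  define z where "z t = exp (L * t) * (\<alpha> + L * y t)" for t
  have "\<exists>z'. (z has_real_derivative z') (at t within {0..T}) \<and> 0 \<le> z'" if t: "0 \<le> t" "t \<le> T" for t
  proof -
    have "((\<lambda>t. integral {0..t} u) has_real_derivative u t) (at t within {0..T})"
      using integral_has_real_derivative[OF cont, of t] t by simp
    then have y': "(y has_real_derivative (0 - u t)) (at t within {0..T})"
      unfolding y_def by (intro DERIV_diff DERIV_const)
    have "(z has_real_derivative (L * exp (L * t) * (\<alpha> + L * y t) + exp (L * t) * (L * (0 - u t)))) (at t within {0..T})"
      unfolding z_def by (auto intro!: derivative_eq_intros y')
    moreover have "L * exp (L * t) * (\<alpha> + L * y t) + exp (L * t) * (L * (0 - u t))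
        = exp (L * t) * L * (\<alpha> + L * y t - u t)" by (simp add: algebra_simps)
    moreover have "0 \<le> exp (L * t) * L * (\<alpha> + L * y t - u t)"
      using le[OF t] y[OF t] L by simp
    ultimately show ?thesis by metis
  qed
  then obtain z' where z': "\<And>t. t \<in> {0..T} \<Longrightarrow> (z has_real_derivative z' t) (at t within {0..T}) \<and> 0 \<le> z' t"
    by (metis atLeastAtMost_iff)
  have "z s \<le> z T"
  proof (rule DERIV_nonneg_imp_increasing_open[of s T z])
    fix x assume x: "s < x" "x < T"
    then have "(z has_real_derivative z' x) (at x within {0..T})" using z' s by auto
    moreover have "at x within {0..T} = at x" using x s by (intro at_within_interior) auto
    ultimately show "\<exists>y. (z has_real_derivative y) (at x) \<and> 0 \<le> y" using z'[of x] x s by auto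
  next
    have "continuous_on {0..T} z"
      using DERIV_continuous_on[of "{0..T}" z z'] z' by auto
    then show "continuous_on {s..T} z" by (rule continuous_on_subset) (use s in auto)
  qed (use s in auto)
  also have "z T = exp (L * T) * \<alpha>" unfolding z_def y_def by simp
  finally have "\<alpha> + L * y s \<le> \<alpha> * exp (L * (T - s))"
    unfolding z_def by (simp add: field_simps exp_diff exp_minus exp_add[symmetric] right_diff_distrib)
  then show ?thesis using le[OF s] y[OF s] by simp
qed

section \<open>Linear flows\<close>

text \<open>Halving the interval contracts the constant of a defect that is almost additive.\<close>

lemma defect_absorb:
  fixes j :: "real \<Rightarrow> real \<Rightarrow> 'a::real_normed_vector"
  assumes \<theta>: "0 < \<theta>" and \<delta>0: "0 \<le> \<delta>" and \<rho>: "(2 + \<delta>) * 2 powr (- \<theta>) \<le> \<rho>" "\<rho> < 1" and e: "0 \<le> e"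
    and split: "\<And>s u t. a \<le> s \<Longrightarrow> s \<le> u \<Longrightarrow> u \<le> t \<Longrightarrow> t \<le> b \<Longrightarrow>
      norm (j s t) \<le> norm (j u t) + (1 + \<delta>) * norm (j s u) + e * (t - s) powr \<theta>"
    and B: "\<And>s t. a \<le> s \<Longrightarrow> s \<le> t \<Longrightarrow> t \<le> b \<Longrightarrow> norm (j s t) \<le> B * (t - s) powr \<theta>"
    and st: "a \<le> s" "s \<le> t" "t \<le> b"
  shows "norm (j s t) \<le> e / (1 - \<rho>) * (t - s) powr \<theta>"
proof -
  define q where "q = e / (1 - \<rho>)"
  have q: "q \<ge> 0" "e = (1 - \<rho>) * q" using e \<rho> by (auto simp: q_def)
  have \<rho>0: "\<rho> \<ge> 0" using \<rho> \<delta>0 by (smt (verit) mult_nonneg_nonneg powr_ge_zero)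
  \<comment> \<open>After n halvings the a priori constant B survives only with weight \<rho> ^ n,
    while q is the fixed point of q = \<rho> q + e. Letting n grow removes B altogether, so B has
    only to be finite.\<close>
  have main: "norm (j s t) \<le> (\<rho> ^ n * \<bar>B\<bar> + q) * (t - s) powr \<theta>" if "a \<le> s" "s \<le> t" "t \<le> b" for n s t
    using that
  proof (induction n arbitrary: s t)
    case 0
    have "norm (j s t) \<le> B * (t - s) powr \<theta>" using B 0 by auto
    also have "\<dots> \<le> (\<bar>B\<bar> + q) * (t - s) powr \<theta>" using q by (intro mult_right_mono) auto
    finally show ?case by simp
  next
    case (Suc n)
    define u where "u = (s + t) / 2"
    have u: "s \<le> u" "u \<le> t" "t - u = (t - s) / 2" "u - s = (t - s) / 2"
      using Suc by (auto simp: u_def field_simps)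
    have half: "((t - s) / 2) powr \<theta> = (t - s) powr \<theta> * 2 powr (- \<theta>)"
      using Suc by (simp add: powr_divide powr_minus divide_simps)
    let ?c = "\<rho> ^ n * \<bar>B\<bar> + q" and ?h = "(t - s) powr \<theta>"
    have c0: "?c \<ge> 0" using q \<rho>0 by simp
    have "norm (j u t) \<le> ?c * (?h * 2 powr (- \<theta>))" using Suc.IH[of u t] Suc.prems u half by simp
    moreover have "(1 + \<delta>) * norm (j s u) \<le> (1 + \<delta>) * (?c * (?h * 2 powr (- \<theta>)))"
      using Suc.IH[of s u] Suc.prems u half \<delta>0 by (intro mult_left_mono) auto
    ultimately have "norm (j s t) \<le> ?c * (?h * 2 powr (- \<theta>)) + (1 + \<delta>) * (?c * (?h * 2 powr (- \<theta>))) + e * ?h"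
      using split[of s u t] Suc.prems u by linarith
    also have "\<dots> = ((2 + \<delta>) * 2 powr (- \<theta>)) * (?c * ?h) + e * ?h" by (simp add: algebra_simps)
    also have "\<dots> \<le> \<rho> * (?c * ?h) + e * ?h" using \<rho> c0 by (intro add_right_mono mult_right_mono) auto
    also have "\<dots> = (\<rho> ^ Suc n * \<bar>B\<bar> + q) * ?h" unfolding q(2) by (simp add: algebra_simps)
    finally show ?case .
  qed
  have "(\<lambda>n. (\<rho> ^ n * \<bar>B\<bar> + q) * (t - s) powr \<theta>) \<longlonglongrightarrow> (0 * \<bar>B\<bar> + q) * (t - s) powr \<theta>"
    using \<rho> \<rho>0 by (intro tendsto_intros LIMSEQ_realpow_zero) auto
  then have "norm (j s t) \<le> (0 * \<bar>B\<bar> + q) * (t - s) powr \<theta>"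
    using main[OF st] by (intro LIMSEQ_le_const) auto
  then show ?thesis by (simp add: q_def)
qed

lemma norm_near_id_mult_le:
  fixes \<mu> x :: "real^'d^'d"
  assumes "norm (\<mu> - mat 1) \<le> \<delta>"
  shows "norm (\<mu> ** x) \<le> (1 + \<delta>) * norm x"
proof -
  have "\<mu> ** x = (\<mu> - mat 1) ** x + x" by (simp add: mm_simps)
  then have "norm (\<mu> ** x) \<le> norm (\<mu> - mat 1) * norm x + norm x"
    by (metis norm_triangle_mono norm_matrix_mult_le order_refl)
  also have "\<dots> \<le> \<delta> * norm x + norm x" using assms by (intro add_right_mono mult_right_mono) auto
  finally show ?thesis by (simp add: algebra_simps)
qed

text \<open>The composition errors are required to be \<epsilon>-close as well: closeness of the
  germs themselves is of order \<gamma> only and could not be summed over a partition. The size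
  bounds concern \<mu> alone, so the notion is not symmetric.\<close>

definition close_flows :: "real \<Rightarrow> real \<Rightarrow> real \<Rightarrow> real \<Rightarrow> real \<Rightarrow> real \<Rightarrow>
    (real \<Rightarrow> real \<Rightarrow> real^'d^'d) \<Rightarrow> (real \<Rightarrow> real \<Rightarrow> real^'d^'d) \<Rightarrow> bool" where
  "close_flows K \<gamma> \<theta> \<epsilon> a b \<mu> \<nu> \<longleftrightarrow>
    (\<forall>s t. a \<le> s \<and> s \<le> t \<and> t \<le> b \<longrightarrow>
       norm (\<mu> s t - mat 1) \<le> K * (t - s) powr \<gamma> \<and> norm (\<mu> s t - \<nu> s t) \<le> K * \<epsilon> * (t - s) powr \<gamma>) \<and>
    (\<forall>s u t. a \<le> s \<and> s \<le> u \<and> u \<le> t \<and> t \<le> b \<longrightarrow>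
       norm (\<mu> u t ** \<mu> s u - \<mu> s t) \<le> K * (t - s) powr \<theta> \<and>
       norm ((\<mu> u t ** \<mu> s u - \<mu> s t) - (\<nu> u t ** \<nu> s u - \<nu> s t)) \<le> K * \<epsilon> * (t - s) powr \<theta>)"

lemma close_flows_subinterval:
  "close_flows K \<gamma> \<theta> \<epsilon> a b \<mu> \<nu> \<Longrightarrow> a \<le> a' \<Longrightarrow> b' \<le> b \<Longrightarrow> close_flows K \<gamma> \<theta> \<epsilon> a' b' \<mu> \<nu>"
  unfolding close_flows_def by auto

definition flow_path :: "real \<Rightarrow> real \<Rightarrow> real \<Rightarrow> real \<Rightarrow>
    (real \<Rightarrow> real \<Rightarrow> real^'d^'d) \<Rightarrow> (real \<Rightarrow> real^'d^'d) \<Rightarrow> bool" where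
  "flow_path K \<theta> a b \<mu> X \<longleftrightarrow>
    (\<forall>s t. a \<le> s \<and> s \<le> t \<and> t \<le> b \<longrightarrow> norm (X t - \<mu> s t ** X s) \<le> K * (t - s) powr \<theta>)"

text \<open>The difference of the two defects is almost additive, so \<open>defect_absorb\<close>
  applies. The constant B from the flow property of X is uncontrolled and disappears, leaving a
  bound by the sup distance S and by \<epsilon>.\<close>

lemma close_flows_defect:
  fixes \<mu> \<nu> :: "real \<Rightarrow> real \<Rightarrow> real^'d^'d"
  assumes cl: "close_flows K \<gamma> \<theta> \<epsilon> a b \<mu> \<nu>" and T: "b - a \<le> T" and p: "0 \<le> K" "0 < \<gamma>" "0 \<le> \<epsilon>"
    and Y: "flow_path K \<theta> a b \<nu> Y" "\<And>t. a \<le> t \<Longrightarrow> t \<le> b \<Longrightarrow> norm (Y t) \<le> K"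
    and X: "flow_path B \<theta> a b \<mu> X"
    and S: "\<And>t. a \<le> t \<Longrightarrow> t \<le> b \<Longrightarrow> norm (X t - Y t) \<le> S"
    and \<theta>: "0 < \<theta>" and \<delta>0: "0 \<le> \<delta>" and \<rho>: "(2 + \<delta>) * 2 powr (- \<theta>) \<le> \<rho>" "\<rho> < 1"
    and \<delta>: "\<And>h. 0 \<le> h \<Longrightarrow> h \<le> b - a \<Longrightarrow> K * h powr \<gamma> \<le> \<delta>"
    and st: "a \<le> s" "s \<le> t" "t \<le> b"
  shows "norm ((X t - \<mu> s t ** X s) - (Y t - \<nu> s t ** Y s))
    \<le> (K * S + K\<^sup>2 * (T powr \<gamma> + 1) * \<epsilon>) / (1 - \<rho>) * (t - s) powr \<theta>"
proof (rule defect_absorb[OF \<theta> \<delta>0 \<rho>, of "K * S + K\<^sup>2 * (T powr \<gamma> + 1) * \<epsilon>" a b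
      "\<lambda>s t. (X t - \<mu> s t ** X s) - (Y t - \<nu> s t ** Y s)" "B + K" s t])
  have "0 \<le> S" using S[of a] st norm_ge_zero[of "X a - Y a"] by linarith
  then show "0 \<le> K * S + K\<^sup>2 * (T powr \<gamma> + 1) * \<epsilon>" using p by simp
  fix s u t assume sut: "a \<le> s" "s \<le> u" "u \<le> t" "t \<le> b"
  let ?J = "\<lambda>s t. (X t - \<mu> s t ** X s) - (Y t - \<nu> s t ** Y s)"
  let ?k = "\<mu> u t ** \<mu> s u - \<mu> s t" and ?l = "\<nu> u t ** \<nu> s u - \<nu> s t"
  \<comment> \<open>Beyond the two smaller defects every term has order \<theta> and contains either
    X - Y or one of the \<epsilon>-close differences; the latter act on Y only, whose bounds are
    among the hypotheses.\<close>
  have eq: "?J s t = ?J u t + \<mu> u t ** ?J s u + (\<mu> u t - \<nu> u t) ** (Y u - \<nu> s u ** Y s)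
      + ?k ** (X s - Y s) + (?k - ?l) ** Y s"
    by (simp add: mm_simps algebra_simps)
  have "norm (?J s t) \<le> norm (?J u t) + (1 + \<delta>) * norm (?J s u)
      + (K * \<epsilon> * T powr \<gamma>) * (K * (t - s) powr \<theta>)
      + (K * (t - s) powr \<theta>) * S + (K * \<epsilon> * (t - s) powr \<theta>) * K"
    unfolding eq
  proof (intro norm_triangle_mono order_refl)
    have "norm (\<mu> u t - mat 1) \<le> K * (t - u) powr \<gamma>" using cl sut unfolding close_flows_def by auto
    also have "\<dots> \<le> \<delta>" using sut by (intro \<delta>) auto
    finally have "norm (\<mu> u t - mat 1) \<le> \<delta>" .
    then show "norm (\<mu> u t ** ?J s u) \<le> (1 + \<delta>) * norm (?J s u)" by (rule norm_near_id_mult_le)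
    have "norm (\<mu> u t - \<nu> u t) \<le> K * \<epsilon> * (t - u) powr \<gamma>" using cl sut unfolding close_flows_def by auto
    also have "\<dots> \<le> K * \<epsilon> * T powr \<gamma>" using p sut T by (intro mult_left_mono powr_mono2) auto
    finally have 1: "norm (\<mu> u t - \<nu> u t) \<le> K * \<epsilon> * T powr \<gamma>" .
    have "norm (Y u - \<nu> s u ** Y s) \<le> K * (u - s) powr \<theta>" using Y sut unfolding flow_path_def by auto
    also have "\<dots> \<le> K * (t - s) powr \<theta>" using p sut \<theta> by (intro mult_left_mono powr_mono2) auto
    finally have 2: "norm (Y u - \<nu> s u ** Y s) \<le> K * (t - s) powr \<theta>" .
    show "norm ((\<mu> u t - \<nu> u t) ** (Y u - \<nu> s u ** Y s)) \<le> (K * \<epsilon> * T powr \<gamma>) * (K * (t - s) powr \<theta>)"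
      using p by (intro order.trans[OF norm_matrix_mult_le] mult_mono 1 2) auto
    have 3: "norm ?k \<le> K * (t - s) powr \<theta>" "norm (?k - ?l) \<le> K * \<epsilon> * (t - s) powr \<theta>"
      using cl sut unfolding close_flows_def by auto
    show "norm (?k ** (X s - Y s)) \<le> (K * (t - s) powr \<theta>) * S"
      using p S sut by (intro order.trans[OF norm_matrix_mult_le] mult_mono 3) auto
    show "norm ((?k - ?l) ** Y s) \<le> (K * \<epsilon> * (t - s) powr \<theta>) * K"
      using p Y(2) sut by (intro order.trans[OF norm_matrix_mult_le] mult_mono 3) auto
  qed
  also have "\<dots> = norm (?J u t) + (1 + \<delta>) * norm (?J s u)
      + (K * S + K\<^sup>2 * (T powr \<gamma> + 1) * \<epsilon>) * (t - s) powr \<theta>"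
    by (simp add: algebra_simps power2_eq_square)
  finally show "norm (?J s t) \<le> norm (?J u t) + (1 + \<delta>) * norm (?J s u)
      + (K * S + K\<^sup>2 * (T powr \<gamma> + 1) * \<epsilon>) * (t - s) powr \<theta>" .
next
  fix s t assume "a \<le> s" "s \<le> t" "t \<le> b"
  then have "norm (X t - \<mu> s t ** X s) \<le> B * (t - s) powr \<theta>"
    "norm (Y t - \<nu> s t ** Y s) \<le> K * (t - s) powr \<theta>"
    using X Y unfolding flow_path_def by auto
  then show "norm ((X t - \<mu> s t ** X s) - (Y t - \<nu> s t ** Y s)) \<le> (B + K) * (t - s) powr \<theta>"
    using norm_triangle_ineq4[of "X t - \<mu> s t ** X s" "Y t - \<nu> s t ** Y s"] by (simp add: algebra_simps)
qed (use st in auto)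

text \<open>The constant is independent of B, the error constant of X. On intervals of length h0 the
  defect costs at most half of the sup distance, which is absorbed; this gives a linear recursion
  over about T / h0 intervals. A second pass through \<open>close_flows_defect\<close>, with the sup
  distance now known to be a multiple of \<epsilon>, yields the estimate of the defects.\<close>

theorem linear_flow_stability:
  fixes K T \<gamma> \<theta> :: real
  assumes p: "0 \<le> K" "0 \<le> T" "0 < \<gamma>" "1 < \<theta>"
  obtains C where "0 \<le> C" "\<And>\<epsilon> a b B (\<mu> :: real \<Rightarrow> real \<Rightarrow> real^'d^'d) \<nu> X Y.
    0 \<le> \<epsilon> \<Longrightarrow> a \<le> b \<Longrightarrow> b - a \<le> T \<Longrightarrow> close_flows K \<gamma> \<theta> \<epsilon> a b \<mu> \<nu> \<Longrightarrow>
    flow_path K \<theta> a b \<nu> Y \<Longrightarrow> \<forall>t. a \<le> t \<and> t \<le> b \<longrightarrow> norm (Y t) \<le> K \<Longrightarrow> flow_path B \<theta> a b \<mu> X \<Longrightarrow> X a = Y a \<Longrightarrow>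
    (\<forall>t. a \<le> t \<and> t \<le> b \<longrightarrow> norm (X t - Y t) \<le> C * \<epsilon>) \<and>
    (\<forall>s t. a \<le> s \<and> s \<le> t \<and> t \<le> b \<longrightarrow>
      norm ((X t - \<mu> s t ** X s) - (Y t - \<nu> s t ** Y s)) \<le> C * \<epsilon> * (t - s) powr \<theta>)"
proof -
  have p2: "2 powr \<theta> > (2::real)" using p powr_less_mono[of 1 \<theta> 2] by simp
  define \<delta> where "\<delta> = min 1 ((2 powr \<theta> - 2) / 2)"
  have \<delta>: "0 < \<delta>" "\<delta> \<le> 1" "2 * \<delta> \<le> 2 powr \<theta> - 2" using p2 by (auto simp: \<delta>_def min_def)
  define \<rho> where "\<rho> = 1 / 2 + 2 powr (- \<theta>)"
  have \<rho>1: "\<rho> < 1" unfolding \<rho>_def powr_minus using p2 by (simp add: field_simps)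
  have "(2 + \<delta>) * 2 powr (- \<theta>) \<le> (2 powr \<theta> + 2) / 2 * 2 powr (- \<theta>)"
    using \<delta> by (intro mult_right_mono) auto
  also have "\<dots> = \<rho>" unfolding \<rho>_def powr_minus by (simp add: field_simps)
  finally have \<rho>: "(2 + \<delta>) * 2 powr (- \<theta>) \<le> \<rho>" .
  obtain h1 where h1: "0 < h1" "\<And>h. 0 \<le> h \<Longrightarrow> h \<le> h1 \<Longrightarrow> K * h powr \<gamma> \<le> \<delta>"
    using powr_small_step p \<delta>(1) by metis
  obtain h2 where h2: "0 < h2" "\<And>h. 0 \<le> h \<Longrightarrow> h \<le> h2 \<Longrightarrow> K / (1 - \<rho>) * h powr \<theta> \<le> 1 / 2"
    using powr_small_step[of "K / (1 - \<rho>)" \<theta> "1/2"] p \<rho>1 by auto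
  define h0 where "h0 = min h1 h2"
  have h0: "0 < h0" using h1 h2 by (simp add: h0_def)
  define K1 where "K1 = K\<^sup>2 * (T powr \<gamma> + 1)"
  have K1: "K1 \<ge> 0" using p by (simp add: K1_def)
  define K2 where "K2 = K1 / (1 - \<rho>) * T powr \<theta> + K\<^sup>2 * T powr \<gamma>"
  have K2: "K2 \<ge> 0" using K1 \<rho>1 p by (simp add: K2_def)
  \<comment> \<open>The recursion mirrors the one-step estimate norm (\<Delta> t) \<le> 4 norm
    (\<Delta> c) + 2 K2 \<epsilon> over an interval of length h0.\<close>
  define c where "c = rec_nat 0 (\<lambda>_ x. 4 * x + 2 * K2)"
  have cS: "c 0 = 0" "c (Suc k) = 4 * c k + 2 * K2" for k by (auto simp: c_def)
  have c0: "c k \<ge> 0" for k by (induction k) (auto simp: cS K2)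
  obtain N :: nat where N: "real N * h0 \<ge> T"
    using h0 by (metis reals_Archimedean3 less_imp_le)
  \<comment> \<open>The three summands serve the distance of the paths, the defect over intervals of
    length at most h0, and the defect over longer intervals, where a bound on the norm is divided by
    \<open>h0 powr \<theta>\<close>.\<close>
  define C where "C = c N + (K * c N + K1) / (1 - \<rho>) + (c N + (1 + K * T powr \<gamma>) * c N + K\<^sup>2 * T powr \<gamma>) / h0 powr \<theta>"
  have q1: "(K * c N + K1) / (1 - \<rho>) \<ge> 0" using c0 K1 \<rho>1 p by simp
  have q2: "(c N + (1 + K * T powr \<gamma>) * c N + K\<^sup>2 * T powr \<gamma>) / h0 powr \<theta> \<ge> 0" using c0 p by simp
  have Cge: "c N \<le> C" "(K * c N + K1) / (1 - \<rho>) \<le> C"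
      "(c N + (1 + K * T powr \<gamma>) * c N + K\<^sup>2 * T powr \<gamma>) / h0 powr \<theta> \<le> C"
    unfolding C_def using q1 q2 c0[of N] by linarith+
  have "0 \<le> C" using Cge c0[of N] by linarith
  show ?thesis
  proof (rule that[OF \<open>0 \<le> C\<close>])
    fix \<epsilon> a b B :: real and \<mu> \<nu> :: "real \<Rightarrow> real \<Rightarrow> real^'d^'d" and X Y
    assume \<epsilon>: "0 \<le> \<epsilon>" and ab: "a \<le> b" "b - a \<le> T" and cl: "close_flows K \<gamma> \<theta> \<epsilon> a b \<mu> \<nu>"
      and Y: "flow_path K \<theta> a b \<nu> Y" "\<forall>t. a \<le> t \<and> t \<le> b \<longrightarrow> norm (Y t) \<le> K"
      and X: "flow_path B \<theta> a b \<mu> X" and XY: "X a = Y a"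
    define \<Delta> where "\<Delta> t = X t - Y t" for t
    define J where "J s t = (X t - \<mu> s t ** X s) - (Y t - \<nu> s t ** Y s)" for s t
    have \<mu>\<Delta>: "norm (\<mu> s t ** X s - \<nu> s t ** Y s) \<le> (1 + K * (t - s) powr \<gamma>) * norm (\<Delta> s) + K\<^sup>2 * T powr \<gamma> * \<epsilon>"
      if "a \<le> s" "s \<le> t" "t \<le> b" for s t
    proof -
      have eq: "\<mu> s t ** X s - \<nu> s t ** Y s = \<mu> s t ** \<Delta> s + (\<mu> s t - \<nu> s t) ** Y s"
        by (simp add: \<Delta>_def mm_simps)
      have "norm (\<mu> s t ** X s - \<nu> s t ** Y s) \<le> (1 + K * (t - s) powr \<gamma>) * norm (\<Delta> s) + (K * \<epsilon> * T powr \<gamma>) * K"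
        unfolding eq
      proof (intro norm_triangle_mono norm_near_id_mult_le)
        show "norm (\<mu> s t - mat 1) \<le> K * (t - s) powr \<gamma>" using cl that unfolding close_flows_def by auto
        have "norm (\<mu> s t - \<nu> s t) \<le> K * \<epsilon> * (t - s) powr \<gamma>" using cl that unfolding close_flows_def by auto
        also have "\<dots> \<le> K * \<epsilon> * T powr \<gamma>" using p \<epsilon> that ab by (intro mult_left_mono powr_mono2) auto
        finally show "norm ((\<mu> s t - \<nu> s t) ** Y s) \<le> (K * \<epsilon> * T powr \<gamma>) * K"
          using p \<epsilon> Y(2) that by (intro order.trans[OF norm_matrix_mult_le] mult_mono) auto
      qed
      then show ?thesis by (simp add: power2_eq_square algebra_simps)
    qed
    have step: "norm (\<Delta> t) \<le> 4 * norm (\<Delta> c) + 2 * K2 * \<epsilon>"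
      if cd: "a \<le> c" "c \<le> d" "d \<le> b" "d - c \<le> h0" and t: "c \<le> t" "t \<le> d" for c d t
    proof -
      \<comment> \<open>This bound still involves B; it only makes the supremum S finite, so that S
        / 2 can be absorbed.\<close>
      have bdd: "norm (\<Delta> t) \<le> \<bar>B\<bar> * T powr \<theta> + (1 + K * T powr \<gamma>) * norm (X c) + K" if "c \<le> t" "t \<le> d" for t
      proof -
        have "norm (\<Delta> t) \<le> norm (X t - \<mu> c t ** X c) + norm (\<mu> c t ** X c) + norm (Y t)"
          unfolding \<Delta>_def using norm_triangle_ineq4[of "X t" "Y t"] norm_triangle_ineq[of "X t - \<mu> c t ** X c" "\<mu> c t ** X c"] by simp
        moreover have "norm (X t - \<mu> c t ** X c) \<le> \<bar>B\<bar> * T powr \<theta>"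
        proof -
          have "norm (X t - \<mu> c t ** X c) \<le> B * (t - c) powr \<theta>" using X that cd unfolding flow_path_def by auto
          also have "\<dots> \<le> \<bar>B\<bar> * T powr \<theta>" using that cd p ab by (intro mult_mono powr_mono2) auto
          finally show ?thesis .
        qed
        moreover have "norm (\<mu> c t ** X c) \<le> (1 + K * T powr \<gamma>) * norm (X c)"
        proof (rule norm_near_id_mult_le)
          have "norm (\<mu> c t - mat 1) \<le> K * (t - c) powr \<gamma>" using cl that cd unfolding close_flows_def by auto
          also have "\<dots> \<le> K * T powr \<gamma>" using p that ab cd by (intro mult_left_mono powr_mono2) auto
          finally show "norm (\<mu> c t - mat 1) \<le> K * T powr \<gamma>" .
        qed
        moreover have "norm (Y t) \<le> K" using Y that cd by auto
        ultimately show ?thesis by linarith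
      qed
      define S where "S = (SUP t\<in>{c..d}. norm (\<Delta> t))"
      have S: "norm (\<Delta> t) \<le> S" if "c \<le> t" "t \<le> d" for t
        unfolding S_def using that bdd by (intro cSUP_upper bdd_aboveI2) auto
      have "norm (\<Delta> t) \<le> 2 * norm (\<Delta> c) + K2 * \<epsilon> + S / 2" if t: "c \<le> t" "t \<le> d" for t
      proof -
        have S0: "S \<ge> 0" using S[OF t] norm_ge_zero[of "\<Delta> t"] by linarith
        have "norm (J c t) \<le> (K * S + K\<^sup>2 * (T powr \<gamma> + 1) * \<epsilon>) / (1 - \<rho>) * (t - c) powr \<theta>"
          unfolding J_def
        proof (rule close_flows_defect[of K \<gamma> \<theta> \<epsilon> c d _ _ T _ B _ _ \<delta>])
          show "close_flows K \<gamma> \<theta> \<epsilon> c d \<mu> \<nu>" using cl cd by (auto intro: close_flows_subinterval)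
          show "flow_path K \<theta> c d \<nu> Y" "flow_path B \<theta> c d \<mu> X" using X Y cd unfolding flow_path_def by auto
          fix h assume "0 \<le> h" "h \<le> d - c" then show "K * h powr \<gamma> \<le> \<delta>" using h1 cd h0_def by auto
        qed (use cd ab p \<epsilon> Y S t \<rho> \<rho>1 \<delta> in \<open>auto simp: \<Delta>_def\<close>)
        also have "\<dots> = S * (K / (1 - \<rho>) * (t - c) powr \<theta>) + K1 / (1 - \<rho>) * \<epsilon> * (t - c) powr \<theta>"
          unfolding K1_def by (simp add: algebra_simps add_divide_distrib)
        also have "\<dots> \<le> S * (1 / 2) + K1 / (1 - \<rho>) * \<epsilon> * T powr \<theta>"
          using S0 K1 \<rho>1 \<epsilon> t cd ab p by (intro add_mono mult_left_mono h2 powr_mono2) (auto simp: h0_def)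
        finally have 1: "norm (J c t) \<le> S / 2 + K1 / (1 - \<rho>) * T powr \<theta> * \<epsilon>" by (simp add: mult_ac)
        have "(1 + K * (t - c) powr \<gamma>) * norm (\<Delta> c) \<le> 2 * norm (\<Delta> c)"
          using h1(2)[of "t - c"] \<delta> t cd by (intro mult_right_mono) (auto simp: h0_def)
        then have 2: "norm (\<mu> c t ** X c - \<nu> c t ** Y c) \<le> 2 * norm (\<Delta> c) + K\<^sup>2 * T powr \<gamma> * \<epsilon>"
          using \<mu>\<Delta>[of c t] t cd by linarith
        have "\<Delta> t = J c t + (\<mu> c t ** X c - \<nu> c t ** Y c)" by (simp add: J_def \<Delta>_def)
        then have "norm (\<Delta> t) \<le> norm (J c t) + norm (\<mu> c t ** X c - \<nu> c t ** Y c)" by (metis norm_triangle_ineq)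
        then show ?thesis using 1 2 by (simp add: K2_def algebra_simps)
      qed
      then have "S \<le> 2 * norm (\<Delta> c) + K2 * \<epsilon> + S / 2" unfolding S_def[symmetric]
        using cd by (subst S_def) (intro cSUP_least, auto)
      then show ?thesis using S[OF t] by linarith
    qed
    have ind: "norm (\<Delta> t) \<le> c k * \<epsilon>" if "a \<le> t" "t \<le> b" "t \<le> a + real k * h0" for k t
      using that
    proof (induction k arbitrary: t)
      case 0
      then have "t = a" by simp
      then show ?case by (simp add: \<Delta>_def XY cS)
    next
      case (Suc k)
      define d where "d = min t (a + real k * h0)"
      have d: "a \<le> d" "d \<le> t" "t - d \<le> h0" "d \<le> a + real k * h0"
        using Suc.prems h0 by (auto simp: d_def min_def algebra_simps)
      have "norm (\<Delta> t) \<le> 4 * norm (\<Delta> d) + 2 * K2 * \<epsilon>" using step[of d t t] d Suc.prems by auto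
      also have "\<dots> \<le> 4 * (c k * \<epsilon>) + 2 * K2 * \<epsilon>" using Suc.IH[of d] d Suc.prems by auto
      finally show ?case by (simp add: cS algebra_simps)
    qed
    have \<Delta>: "norm (\<Delta> t) \<le> c N * \<epsilon>" if "a \<le> t" "t \<le> b" for t
      using ind[OF that, of N] that ab N by linarith
    have "norm (\<Delta> t) \<le> C * \<epsilon>" if "a \<le> t" "t \<le> b" for t
      using \<Delta>[OF that] mult_right_mono[OF Cge(1) \<epsilon>] by linarith
    moreover have "norm (J s t) \<le> C * \<epsilon> * (t - s) powr \<theta>" if st: "a \<le> s" "s \<le> t" "t \<le> b" for s t
    proof (cases "t - s \<le> h0")
      case True
      have "norm (J s t) \<le> (K * (c N * \<epsilon>) + K\<^sup>2 * (T powr \<gamma> + 1) * \<epsilon>) / (1 - \<rho>) * (t - s) powr \<theta>"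
        unfolding J_def
      proof (rule close_flows_defect[of K \<gamma> \<theta> \<epsilon> s t _ _ T _ B _ _ \<delta>])
        show "close_flows K \<gamma> \<theta> \<epsilon> s t \<mu> \<nu>" using cl st by (auto intro: close_flows_subinterval)
        show "flow_path K \<theta> s t \<nu> Y" "flow_path B \<theta> s t \<mu> X" using X Y st unfolding flow_path_def by auto
        fix h assume "0 \<le> h" "h \<le> t - s" then show "K * h powr \<gamma> \<le> \<delta>" using h1 True h0_def by auto
      qed (use st ab p \<epsilon> Y \<Delta> \<rho> \<rho>1 \<delta> in \<open>auto simp: \<Delta>_def\<close>)
      also have "\<dots> = (K * c N + K1) / (1 - \<rho>) * (\<epsilon> * (t - s) powr \<theta>)"
        by (simp add: K1_def algebra_simps add_divide_distrib)
      also have "\<dots> \<le> C * (\<epsilon> * (t - s) powr \<theta>)" using Cge \<epsilon> by (intro mult_right_mono) auto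
      finally show ?thesis by (simp add: mult_ac)
    next
      case False
      have "norm (J s t) \<le> norm (\<Delta> t) + norm (\<mu> s t ** X s - \<nu> s t ** Y s)"
        unfolding J_def \<Delta>_def using norm_triangle_ineq4[of "X t - Y t" "\<mu> s t ** X s - \<nu> s t ** Y s"]
        by (simp add: algebra_simps)
      also have "\<dots> \<le> c N * \<epsilon> + ((1 + K * T powr \<gamma>) * (c N * \<epsilon>) + K\<^sup>2 * T powr \<gamma> * \<epsilon>)"
      proof (intro add_mono \<Delta> order.trans[OF \<mu>\<Delta>])
        show "(1 + K * (t - s) powr \<gamma>) * norm (\<Delta> s) \<le> (1 + K * T powr \<gamma>) * (c N * \<epsilon>)"
          using p st ab \<Delta>[of s] \<epsilon> c0 by (intro mult_mono add_mono mult_left_mono powr_mono2) auto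
      qed (use st in auto)
      also have "\<dots> = (c N + (1 + K * T powr \<gamma>) * c N + K\<^sup>2 * T powr \<gamma>) / h0 powr \<theta> * \<epsilon> * h0 powr \<theta>"
        using h0 by (simp add: field_simps)
      also have "\<dots> \<le> C * \<epsilon> * (t - s) powr \<theta>"
        using Cge \<epsilon> False h0 p \<open>0 \<le> C\<close> by (intro mult_mono powr_mono2) auto
      finally show ?thesis .
    qed
    ultimately show "(\<forall>t. a \<le> t \<and> t \<le> b \<longrightarrow> norm (X t - Y t) \<le> C * \<epsilon>) \<and>
      (\<forall>s t. a \<le> s \<and> s \<le> t \<and> t \<le> b \<longrightarrow>
        norm ((X t - \<mu> s t ** X s) - (Y t - \<nu> s t ** Y s)) \<le> C * \<epsilon> * (t - s) powr \<theta>)"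
      by (auto simp: \<Delta>_def J_def)
  qed
qed

section \<open>Comparing two sets of data\<close>

text \<open>The factor h^(\<alpha>' - \<alpha>) is at most 1 + T because the exponents differ by at
  most 1. Lowering an exponent thus costs one factor K, which fits the bookkeeping by powers of
  K.\<close>

lemma powr_le_scale:
  fixes h :: real
  assumes "0 \<le> h" "h \<le> T" "1 + T \<le> K" "\<alpha> \<le> \<alpha>'" "\<alpha>' \<le> \<alpha> + 1"
  shows "h powr \<alpha>' \<le> K * h powr \<alpha>"
proof (cases "h = 0")
  case False
  have "h powr \<alpha>' = h powr (\<alpha>' - \<alpha>) * h powr \<alpha>" by (simp add: powr_add[symmetric])
  also have "h powr (\<alpha>' - \<alpha>) \<le> (1 + T) powr (\<alpha>' - \<alpha>)" using assms by (intro powr_mono2) auto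
  also have "(1 + T) powr (\<alpha>' - \<alpha>) \<le> (1 + T) powr 1" using assms by (intro powr_mono) auto
  also have "\<dots> \<le> K" using assms by simp
  finally show ?thesis by (simp add: mult_right_mono)
qed simp

lemma powr_le_const:
  fixes h :: real
  assumes "0 \<le> h" "h \<le> T" "1 + T \<le> K" "0 \<le> \<alpha>" "\<alpha> \<le> 1"
  shows "h powr \<alpha> \<le> K"
proof -
  have "h powr \<alpha> \<le> (1 + T) powr \<alpha>" using assms by (intro powr_mono2) auto
  also have "\<dots> \<le> (1 + T) powr 1" using assms by (intro powr_mono) auto
  finally show ?thesis using assms by simp
qed

text \<open>Here e stands for the distance of two sets of data, and a pair x, y for one expression
  evaluated on both. Size and Lipschitz estimates of a formula are obtained together by following
  its syntax. K \<ge> 2 lets a sum of two terms be paid for by one factor K.\<close>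

locale two_data =
  fixes K e :: real
  assumes K2: "2 \<le> K" and e0: "0 \<le> e"
begin

text \<open>Constants are only tracked as powers of \<open>K\<close>; with \<open>e = 0\<close> and \<open>x = y\<close> this is a plain size bound.\<close>

definition cl :: "nat \<Rightarrow> real \<Rightarrow> 'a::real_normed_vector \<Rightarrow> 'a \<Rightarrow> bool" where
  "cl n r x y \<longleftrightarrow> norm x \<le> K ^ n * r \<and> norm y \<le> K ^ n * r \<and> norm (x - y) \<le> K ^ n * e * r"

lemma K_pow [simp]: "0 < K ^ n" "0 \<le> K ^ n" using K2 by auto

lemma cl_r: "cl n r x y \<Longrightarrow> 0 \<le> r"
  unfolding cl_def using K_pow(1)[of n] norm_ge_zero[of x]
  by (meson order_trans zero_le_mult_iff not_le)

lemma cl_up: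
  assumes "cl n r x y" "n \<le> m" shows "cl m r x y"
proof -
  have r: "0 \<le> r" using cl_r assms by auto
  have "K ^ n * r \<le> K ^ m * r" "K ^ n * e * r \<le> K ^ m * e * r"
    using r e0 K2 assms(2) by (intro mult_right_mono power_increasing; simp)+
  then show ?thesis using assms unfolding cl_def by linarith
qed

lemma cl_mono:
  assumes "cl n r x y" "r \<le> r'" shows "cl n r' x y"
proof -
  have "K ^ n * r \<le> K ^ n * r'" "K ^ n * e * r \<le> K ^ n * e * r'"
    using e0 assms(2) by (intro mult_left_mono; simp)+
  then show ?thesis using assms unfolding cl_def by linarith
qed

text \<open>The companion of \<open>powr_le_scale\<close>: a change of scale is paid for by one
  power of K.\<close>

lemma cl_scale:
  assumes "cl n r x y" "r \<le> K * r'" shows "cl (Suc n) r' x y"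
  using cl_mono[OF assms] unfolding cl_def by (simp add: mult_ac)

lemma cl_fit:
  assumes "cl n r x y" "r \<le> K * r'" "Suc n \<le> m" shows "cl m r' x y"
  by (rule cl_up[OF cl_scale[OF assms(1,2)] assms(3)])

lemma cl_eq:
  assumes "cl n r x y" "r = r'" "n \<le> m" shows "cl m r' x y"
  using cl_up[OF assms(1,3)] assms(2) by simp

lemma cl_add0:
  assumes "cl n r x y" "cl n r x' y'" shows "cl (Suc n) r (x + x') (y + y')"
proof -
  have r: "0 \<le> r" using cl_r assms by auto
  have "2 * (K ^ n * r) \<le> K ^ Suc n * r" "2 * (K ^ n * e * r) \<le> K ^ Suc n * e * r"
    using K2 mult_right_mono[OF K2, of "K ^ n * r"] mult_right_mono[OF K2, of "K ^ n * e * r"] r e0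
    by (simp_all add: mult_ac)
  moreover have "norm (x + x' - (y + y')) \<le> norm (x - y) + norm (x' - y')"
    using norm_triangle_ineq[of "x - y" "x' - y'"] by (simp add: algebra_simps)
  ultimately show ?thesis using assms norm_triangle_ineq[of x x'] norm_triangle_ineq[of y y']
    unfolding cl_def by linarith
qed

lemma cl_add:
  assumes "cl n r x y" "cl m r x' y'" shows "cl (Suc (max n m)) r (x + x') (y + y')"
  by (intro cl_add0 cl_up[OF assms(1)] cl_up[OF assms(2)]) auto

lemma cl_minus: "cl n r x y \<Longrightarrow> cl n r (- x) (- y)"
  unfolding cl_def by (simp add: norm_minus_commute)

lemma cl_diff:
  assumes "cl n r x y" "cl m r x' y'" shows "cl (Suc (max n m)) r (x - x') (y - y')"
  using cl_add[OF assms(1) cl_minus[OF assms(2)]] by simp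

text \<open>The difference is split as \<open>b (x - y) x' + b y (x' - y')\<close>. The two terms
  cost a factor 2 \<le> K, which is the additional 1 in the exponent.\<close>

lemma cl_bilinear:
  assumes bl: "\<And>x y. norm (b x y) \<le> norm x * norm y"
    and d: "\<And>x y z. b (x - y) z = b x z - b y z" "\<And>x y z. b z (x - y) = b z x - b z y"
    and 1: "cl n r x y" and 2: "cl m r' x' y'"
  shows "cl (Suc (n + m)) (r * r') (b x x') (b y y')"
proof -
  have r: "0 \<le> r" "0 \<le> r'" using cl_r 1 2 by auto
  have K1: "K ^ n * r * (K ^ m * r') \<le> K ^ Suc (n + m) * (r * r')"
    using r K2 mult_right_mono[of 1 K "K ^ n * K ^ m * (r * r')"] by (simp add: power_add mult_ac)
  have n1: "norm (b x x') \<le> K ^ n * r * (K ^ m * r')" "norm (b y y') \<le> K ^ n * r * (K ^ m * r')"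
    using 1 2 r unfolding cl_def by (auto intro!: order.trans[OF bl] mult_mono)
  have "b x x' - b y y' = b (x - y) x' + b y (x' - y')" by (simp add: d)
  then have "norm (b x x' - b y y') \<le> norm (b (x - y) x') + norm (b y (x' - y'))"
    by (metis norm_triangle_ineq)
  also have "\<dots> \<le> K ^ n * e * r * (K ^ m * r') + K ^ n * r * (K ^ m * e * r')"
    using 1 2 r e0 unfolding cl_def by (intro add_mono order.trans[OF bl] mult_mono) auto
  also have "\<dots> = 2 * (K ^ n * K ^ m * e * (r * r'))" by simp
  also have "\<dots> \<le> K * (K ^ n * K ^ m * e * (r * r'))"
    using r e0 K2 by (intro mult_right_mono) auto
  finally have "norm (b x x' - b y y') \<le> K ^ Suc (n + m) * e * (r * r')" by (simp add: power_add mult_ac)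
  then show ?thesis using n1 K1 unfolding cl_def by linarith
qed

lemma cl_mult:
  fixes x y :: "real^'n^'m" and x' y' :: "real^'k^'n"
  shows "cl n r x y \<Longrightarrow> cl m r' x' y' \<Longrightarrow> cl (Suc (n + m)) (r * r') (x ** x') (y ** y')"
  by (rule cl_bilinear) (simp_all add: norm_matrix_mult_le mm_simps)

lemma cl_scaleR:
  shows "cl n r x y \<Longrightarrow> cl m r' x' y' \<Longrightarrow> cl (Suc (n + m)) (r * r') (x *\<^sub>R x') (y *\<^sub>R y')"
  by (rule cl_bilinear) (simp_all add: algebra_simps)

lemma cl_transpose:
  fixes x y :: "real^'n^'m"
  shows "cl n r x y \<Longrightarrow> cl n r (transpose x) (transpose y)"
  unfolding cl_def by (simp add: transpose_algebra[symmetric])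

lemma cl_nth:
  fixes x y :: "'a::real_normed_vector^'n"
  assumes "cl n r x y" shows "cl n r (x $ i) (y $ i)"
  using assms Finite_Cartesian_Product.norm_nth_le[of x i] Finite_Cartesian_Product.norm_nth_le[of y i]
    Finite_Cartesian_Product.norm_nth_le[of "x - y" i]
  unfolding cl_def by auto

lemma cl_sum:
  fixes x y :: "'p::finite \<Rightarrow> 'a::real_normed_vector"
  assumes "\<And>i. cl n r (x i) (y i)" "real CARD('p) \<le> K"
  shows "cl (Suc n) r (\<Sum>i\<in>UNIV. x i) (\<Sum>i\<in>UNIV. y i)"
proof -
  have r: "0 \<le> r" using cl_r[OF assms(1)] .
  have b: "norm (\<Sum>i\<in>UNIV. z i) \<le> K * c" if "\<And>i::'p. norm (z i) \<le> c" "0 \<le> c"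
    for z :: "'p \<Rightarrow> 'a" and c
  proof -
    have "norm (\<Sum>i\<in>UNIV. z i) \<le> of_nat CARD('p) * c" using that by (intro sum_norm_bound) auto
    also have "\<dots> \<le> K * c" using assms(2) that by (intro mult_right_mono) auto
    finally show ?thesis .
  qed
  have "norm (\<Sum>i\<in>UNIV. x i) \<le> K * (K ^ n * r)" "norm (\<Sum>i\<in>UNIV. y i) \<le> K * (K ^ n * r)"
    "norm (\<Sum>i\<in>UNIV. x i - y i) \<le> K * (K ^ n * e * r)"
    using assms(1) r e0 by (auto intro!: b simp: cl_def)
  then show ?thesis unfolding cl_def sum_subtractf by (simp add: mult_ac)
qed

lemma cl_vec:
  fixes x y :: "'a::real_normed_vector^'p"
  assumes "\<And>i. cl n r (x $ i) (y $ i)" "real CARD('p::finite) \<le> K"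
  shows "cl (Suc n) r x y"
proof -
  have r: "0 \<le> r" using cl_r[OF assms(1)] .
  have b: "norm z \<le> K * c" if "\<And>i. norm (z $ i) \<le> c" "0 \<le> c" for z :: "'a^'p" and c
  proof -
    have "norm z \<le> (\<Sum>i\<in>UNIV. norm (z $ i))" by (simp add: norm_vec_def L2_set_le_sum)
    also have "\<dots> \<le> of_nat CARD('p) * c" using that by (intro sum_bounded_above) auto
    also have "\<dots> \<le> K * c" using assms(2) that by (intro mult_right_mono) auto
    finally show ?thesis .
  qed
  have "norm x \<le> K * (K ^ n * r)" "norm y \<le> K * (K ^ n * r)" "norm (x - y) \<le> K * (K ^ n * e * r)"
    using assms(1) r e0 by (auto intro!: b simp: cl_def)
  then show ?thesis unfolding cl_def by (simp add: mult_ac)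
qed

lemma cl_lin_app:
  fixes L L' :: "'a::real_normed_vector^'p" and x x' :: "real^'p"
  assumes "cl n r L L'" "cl m r' x x'" "real CARD('p::finite) \<le> K"
  shows "cl (n + m + 2) (r * r') (lin_app L x) (lin_app L' x')"
proof -
  have "cl (Suc (Suc (m + n))) (r' * r) (lin_app L x) (lin_app L' x')"
    unfolding lin_app_def by (intro cl_sum cl_scaleR cl_nth assms)
  then show ?thesis by (simp add: mult.commute add.commute)
qed

lemma cl_bilin_app:
  fixes L L' :: "('a::real_normed_vector^'p)^'p" and x x' :: "real^'p^'p"
  assumes "cl n r L L'" "cl m r' x x'" "real CARD('p::finite) \<le> K"
  shows "cl (n + m + 3) (r * r') (bilin_app L x) (bilin_app L' x')"
proof -
  have "cl (Suc (Suc (Suc (m + n)))) (r' * r) (bilin_app L x) (bilin_app L' x')"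
    unfolding bilin_app_def by (intro cl_sum cl_scaleR cl_nth assms)
  then show ?thesis by (simp add: mult.commute add.commute numeral_3_eq_3)
qed

end

section \<open>The germ of the linear flow\<close>

definition germ1 :: "(real \<Rightarrow> real^'p) \<Rightarrow> (real \<Rightarrow> (real^'d^'d)^'p) \<Rightarrow> real \<Rightarrow> real \<Rightarrow> real^'d^'d" where
  "germ1 \<eta> A s t = lin_app (A s) (incr \<eta> s t)"

text \<open>The coefficient of the second level in the expansion of the linear equation dU = A
  d\<eta> U. The entry (i, j) of \<eta>2 integrates direction i first and j later, so the later
  factor \<open>A s $ j\<close> stands on the left of \<open>A s $ i\<close>.\<close>

definition second_level :: "(real \<Rightarrow> (real^'d^'d)^'p) \<Rightarrow> (real \<Rightarrow> ((real^'d^'d)^'p)^'p) \<Rightarrow>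
    real \<Rightarrow> ((real^'d^'d)^'p)^'p" where
  "second_level A A' s = (\<chi> i j. A' s $ i $ j + A s $ j ** A s $ i)"

definition germ2 :: "(real \<Rightarrow> real \<Rightarrow> real^'p^'p) \<Rightarrow> (real \<Rightarrow> (real^'d^'d)^'p) \<Rightarrow>
    (real \<Rightarrow> ((real^'d^'d)^'p)^'p) \<Rightarrow> real \<Rightarrow> real \<Rightarrow> real^'d^'d" where
  "germ2 \<eta>2 A A' s t = bilin_app (second_level A A' s) (\<eta>2 s t)"

definition germ where
  "germ \<eta> \<eta>2 A A' s t = mat 1 + (germ1 \<eta> A s t + germ2 \<eta>2 A A' s t)"

lemma lin_app_algebra:
  "lin_app (L + M) x = lin_app L x + lin_app M x" "lin_app (L - M) x = lin_app L x - lin_app M x"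
  "lin_app L (x + y) = lin_app L x + lin_app L y" "lin_app L (x - y) = lin_app L x - lin_app L y"
  "lin_app (- L) x = - lin_app L x"
  by (simp_all add: lin_app_def algebra_simps sum.distrib sum_subtractf sum_negf)

lemma bilin_app_algebra:
  "bilin_app (L + M) x = bilin_app L x + bilin_app M x" "bilin_app (L - M) x = bilin_app L x - bilin_app M x"
  "bilin_app L (x + y) = bilin_app L x + bilin_app L y" "bilin_app L (x - y) = bilin_app L x - bilin_app L y"
  by (simp_all add: bilin_app_def algebra_simps sum.distrib sum_subtractf)

lemma lin_app_mult_lin_app:
  fixes L :: "(real^'n^'m)^'p" and M :: "(real^'k^'n)^'q"
  shows
  "lin_app L x ** lin_app M y = (\<Sum>i\<in>UNIV. \<Sum>j\<in>UNIV. (x $ i * y $ j) *\<^sub>R (L $ i ** M $ j))"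
  unfolding lin_app_def mm.sum_left mm.sum_right
  by (subst sum.swap) (simp add: mm.scaleR_left mm.scaleR_right mult_ac)

lemma bilin_app_tensor: "bilin_app L (tensor x y) = lin_app (lin_app L x) y"
proof -
  have "lin_app (lin_app L x) y = (\<Sum>j\<in>UNIV. \<Sum>i\<in>UNIV. (x $ i * y $ j) *\<^sub>R L $ i $ j)"
    by (simp add: lin_app_def scaleR_sum_right mult_ac)
  also have "\<dots> = bilin_app L (tensor x y)"
    unfolding bilin_app_def tensor_def by (subst sum.swap) simp
  finally show ?thesis by simp
qed

lemma bilin_app_tensor_second_level:
  "bilin_app (second_level A A' s) (tensor x y) =
    lin_app (lin_app (A' s) x) y + lin_app (A s) y ** lin_app (A s) x"
proof -
  have "second_level A A' s = A' s + (\<chi> i j. A s $ j ** A s $ i)"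
    by (simp add: second_level_def vec_eq_iff)
  moreover have "bilin_app (\<chi> i j. A s $ j ** A s $ i) (tensor x y) = lin_app (A s) y ** lin_app (A s) x"
    unfolding lin_app_mult_lin_app bilin_app_def tensor_def by (subst sum.swap) (simp add: mult.commute)
  ultimately show ?thesis by (simp only: bilin_app_algebra bilin_app_tensor[of "A' s"])
qed

text \<open>Chen's relation cancels all terms up to second order. The rest has the orders \<beta> +
  \<beta>' + \<gamma>, \<beta>' + 2 \<gamma>, \<beta> + 2 \<gamma> and at least 3 \<gamma>, and
  \<beta>' \<le> \<beta> \<le> \<gamma> makes each of them at least \<theta> = \<gamma> + \<beta> +
  \<beta>'.\<close>

lemma germ_defect:
  assumes chen: "\<eta>2 s t - \<eta>2 s u - \<eta>2 u t = tensor (incr \<eta> s u) (incr \<eta> u t)"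
  shows "germ \<eta> \<eta>2 A A' u t ** germ \<eta> \<eta>2 A A' s u - germ \<eta> \<eta>2 A A' s t =
    (lin_app (remainder \<eta> A A' s u) (incr \<eta> u t)
      + bilin_app (incr (second_level A A') s u) (\<eta>2 u t))
    + (lin_app (incr A s u) (incr \<eta> u t) ** germ1 \<eta> A s u
      + (germ1 \<eta> A u t ** germ2 \<eta>2 A A' s u
      + germ2 \<eta>2 A A' u t ** (germ1 \<eta> A s u + germ2 \<eta>2 A A' s u)))"
proof -
  have "incr \<eta> s t = incr \<eta> s u + incr \<eta> u t" by (simp add: incr_def)
  moreover have "\<eta>2 s t = \<eta>2 s u + \<eta>2 u t + tensor (incr \<eta> s u) (incr \<eta> u t)"
    using chen by (simp add: algebra_simps)
  ultimately have st: "germ1 \<eta> A s t = germ1 \<eta> A s u + lin_app (A s) (incr \<eta> u t)"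
    "germ2 \<eta>2 A A' s t = germ2 \<eta>2 A A' s u + bilin_app (second_level A A' s) (\<eta>2 u t)
      + (lin_app (lin_app (A' s) (incr \<eta> s u)) (incr \<eta> u t) + lin_app (A s) (incr \<eta> u t) ** germ1 \<eta> A s u)"
    by (simp_all add: germ1_def germ2_def lin_app_algebra bilin_app_algebra bilin_app_tensor_second_level)
  have 1: "lin_app (A u) x = lin_app (incr A s u) x + lin_app (A s) x" for x
    by (simp add: incr_def lin_app_algebra)
  have 2: "germ2 \<eta>2 A A' u t = bilin_app (incr (second_level A A') s u) (\<eta>2 u t) + bilin_app (second_level A A' s) (\<eta>2 u t)"
    by (simp add: germ2_def incr_def bilin_app_algebra)
  have 3: "lin_app (remainder \<eta> A A' s u) x = lin_app (incr A s u) x - lin_app (lin_app (A' s) (incr \<eta> s u)) x" for x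
    by (simp add: remainder_def lin_app_algebra)
  have 4: "germ1 \<eta> A u t = lin_app (incr A s u) (incr \<eta> u t) + lin_app (A s) (incr \<eta> u t)"
    unfolding germ1_def by (rule 1)
  show ?thesis unfolding germ_def st 2 3 4 by (simp add: mm_simps algebra_simps)
qed

definition close_rough_data where
  "close_rough_data K T \<gamma> \<beta> \<beta>' e \<eta> \<eta>2 A A' \<zeta> \<zeta>2 B B' \<longleftrightarrow>
    (\<forall>s t. 0 \<le> s \<and> s \<le> t \<and> t \<le> T \<longrightarrow>
      two_data.cl K e 1 ((t - s) powr \<gamma>) (incr \<eta> s t) (incr \<zeta> s t) \<and>
      two_data.cl K e 1 ((t - s) powr (2 * \<gamma>)) (\<eta>2 s t) (\<zeta>2 s t) \<and>
      two_data.cl K e 1 1 (A s) (B s) \<and> two_data.cl K e 1 1 (A' s) (B' s) \<and>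
      two_data.cl K e 1 ((t - s) powr \<beta>) (incr A s t) (incr B s t) \<and>
      two_data.cl K e 1 ((t - s) powr \<beta>') (incr A' s t) (incr B' s t) \<and>
      two_data.cl K e 1 ((t - s) powr (\<beta> + \<beta>')) (remainder \<eta> A A' s t) (remainder \<zeta> B B' s t)) \<and>
    (\<forall>s u t. 0 \<le> s \<and> s \<le> u \<and> u \<le> t \<and> t \<le> T \<longrightarrow>
      \<eta>2 s t - \<eta>2 s u - \<eta>2 u t = tensor (incr \<eta> s u) (incr \<eta> u t) \<and>
      \<zeta>2 s t - \<zeta>2 s u - \<zeta>2 u t = tensor (incr \<zeta> s u) (incr \<zeta> u t))"

locale two_rough_data = two_data K e
  for K e :: real +
  fixes T \<gamma> \<beta> \<beta>' :: real
    and \<eta> \<zeta> :: "real \<Rightarrow> real^'p::finite" and \<eta>2 \<zeta>2 :: "real \<Rightarrow> real \<Rightarrow> real^'p^'p"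
    and A B :: "real \<Rightarrow> (real^'d::finite^'d)^'p" and A' B' :: "real \<Rightarrow> ((real^'d^'d)^'p)^'p"
  assumes exps: "0 < T" "1 / 3 < \<gamma>" "\<gamma> < 1 / 2" "0 < \<beta>'" "\<beta>' \<le> \<beta>" "\<beta> \<le> \<gamma>" "\<gamma> + \<beta> + \<beta>' > 1"
    and KT: "1 + T \<le> K" and Kp: "real CARD('p) \<le> K"
    and close: "close_rough_data K T \<gamma> \<beta> \<beta>' e \<eta> \<eta>2 A A' \<zeta> \<zeta>2 B B'"
begin

abbreviation "\<theta> \<equiv> \<gamma> + \<beta> + \<beta>'"

lemma base:
  assumes "0 \<le> s" "s \<le> t" "t \<le> T" "t - s \<le> h"
  shows "cl 1 (h powr \<gamma>) (incr \<eta> s t) (incr \<zeta> s t)" "cl 1 (h powr (2 * \<gamma>)) (\<eta>2 s t) (\<zeta>2 s t)"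
    "cl 1 1 (A s) (B s)" "cl 1 1 (A' s) (B' s)"
    "cl 1 (h powr \<beta>) (incr A s t) (incr B s t)" "cl 1 (h powr \<beta>') (incr A' s t) (incr B' s t)"
    "cl 1 (h powr (\<beta> + \<beta>')) (remainder \<eta> A A' s t) (remainder \<zeta> B B' s t)"
proof -
  have m: "(t - s) powr \<alpha> \<le> h powr \<alpha>" if "0 \<le> \<alpha>" for \<alpha> using assms that by (intro powr_mono2) auto
  have c: "cl 1 ((t - s) powr \<gamma>) (incr \<eta> s t) (incr \<zeta> s t)" "cl 1 ((t - s) powr (2 * \<gamma>)) (\<eta>2 s t) (\<zeta>2 s t)"
    "cl 1 1 (A s) (B s)" "cl 1 1 (A' s) (B' s)"
    "cl 1 ((t - s) powr \<beta>) (incr A s t) (incr B s t)" "cl 1 ((t - s) powr \<beta>') (incr A' s t) (incr B' s t)"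
    "cl 1 ((t - s) powr (\<beta> + \<beta>')) (remainder \<eta> A A' s t) (remainder \<zeta> B B' s t)"
    using close assms unfolding close_rough_data_def by auto
  show "cl 1 (h powr \<gamma>) (incr \<eta> s t) (incr \<zeta> s t)" "cl 1 (h powr (2 * \<gamma>)) (\<eta>2 s t) (\<zeta>2 s t)"
    "cl 1 1 (A s) (B s)" "cl 1 1 (A' s) (B' s)"
    "cl 1 (h powr \<beta>) (incr A s t) (incr B s t)" "cl 1 (h powr \<beta>') (incr A' s t) (incr B' s t)"
    "cl 1 (h powr (\<beta> + \<beta>')) (remainder \<eta> A A' s t) (remainder \<zeta> B B' s t)"
    using c exps by (auto intro!: cl_mono[OF _ m] simp del: One_nat_def)
qed

lemma cl_germ1:
  assumes "0 \<le> s" "s \<le> t" "t \<le> T" "t - s \<le> h"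
  shows "cl 4 (h powr \<gamma>) (germ1 \<eta> A s t) (germ1 \<zeta> B s t)"
  unfolding germ1_def by (rule cl_eq[OF cl_lin_app[OF base(3)[OF assms] base(1)[OF assms] Kp]]) simp_all

lemma cl_second_level:
  assumes s: "0 \<le> s" "s \<le> T"
  shows "cl 6 1 (second_level A A' s) (second_level B B' s)"
proof -
  have "s - s \<le> 1" by simp
  note b = base[OF s(1) order_refl s(2) this]
  have m: "cl (Suc (1 + 1)) 1 (A s $ j ** A s $ i) (B s $ j ** B s $ i)" for i j
    using cl_mult[OF cl_nth[OF b(3), of j] cl_nth[OF b(3), of i]] by simp
  have "cl (Suc (Suc (Suc (max 1 (Suc (1 + 1)))))) 1 (second_level A A' s) (second_level B B' s)"
    unfolding second_level_def
    by (rule cl_vec[OF cl_vec[OF _ Kp] Kp], unfold vec_lambda_beta)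
      (rule cl_add[OF cl_nth[OF cl_nth[OF b(4)]] m])
  then show ?thesis by (rule cl_up) simp
qed

text \<open>The increments of A have order \<beta>, those of A' only \<beta>'; the weaker order
  decides.\<close>

lemma cl_incr_second_level:
  assumes "0 \<le> s" "s \<le> t" "t \<le> T" "t - s \<le> h" "h \<le> T"
  shows "cl 9 (h powr \<beta>') (incr (second_level A A') s t) (incr (second_level B B') s t)"
proof -
  note b = base[OF assms(1-4)]
  have At: "cl 1 1 (A t) (B t)" using base(3)[of t t 1] assms by auto
  have h: "0 \<le> h" using assms by simp
  have sc: "h powr \<beta> \<le> K * h powr \<beta>'" using exps h assms KT by (intro powr_le_scale) auto
  have eq: "incr (second_level A A') s t = (\<chi> i j. incr A' s t $ i $ j + (incr A s t $ j ** A t $ i + A s $ j ** incr A s t $ i))"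
    for A :: "real \<Rightarrow> (real^'d^'d)^'p" and A'
    by (simp add: incr_def second_level_def vec_eq_iff mm_simps)
  have "cl (Suc (Suc 1)) (h powr \<beta> * 1) (incr A s t $ j ** A t $ i) (incr B s t $ j ** B t $ i)" for i j
    using cl_mult[OF cl_nth[OF b(5), of j] cl_nth[OF At, of i]] by simp
  moreover have "cl (Suc (Suc 1)) (1 * h powr \<beta>) (A s $ j ** incr A s t $ i) (B s $ j ** incr B s t $ i)" for i j
    using cl_mult[OF cl_nth[OF b(3), of j] cl_nth[OF b(5), of i]] by simp
  ultimately have "cl (Suc (Suc (Suc (Suc 1)))) (h powr \<beta>') (incr A s t $ j ** A t $ i + A s $ j ** incr A s t $ i)
      (incr B s t $ j ** B t $ i + B s $ j ** incr B s t $ i)" for i j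
    by (intro cl_scale[OF _ sc] cl_add0) auto
  then have "cl (Suc (Suc (Suc (max 1 (Suc (Suc (Suc (Suc 1)))))))) (h powr \<beta>')
      (incr (second_level A A') s t) (incr (second_level B B') s t)"
    unfolding eq by (intro cl_vec[OF cl_vec[OF _ Kp] Kp], unfold vec_lambda_beta)
      (rule cl_add[OF cl_nth[OF cl_nth[OF b(6)]]])
  then show ?thesis by (rule cl_up) simp
qed

lemma cl_germ2:
  assumes "0 \<le> s" "s \<le> t" "t \<le> T" "t - s \<le> h"
  shows "cl 10 (h powr (2 * \<gamma>)) (germ2 \<eta>2 A A' s t) (germ2 \<zeta>2 B B' s t)"
  unfolding germ2_def
  by (rule cl_eq[OF cl_bilin_app[OF cl_second_level base(2)[OF assms] Kp]]) (use assms in simp_all)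

lemma cl_germ12:
  assumes "0 \<le> s" "s \<le> t" "t \<le> T" "t - s \<le> h" "h \<le> T"
  shows "cl 12 (h powr \<gamma>) (germ1 \<eta> A s t + germ2 \<eta>2 A A' s t) (germ1 \<zeta> B s t + germ2 \<zeta>2 B B' s t)"
proof -
  have "h powr (2 * \<gamma>) \<le> K * h powr \<gamma>" using exps assms KT by (intro powr_le_scale) auto
  from cl_add[OF cl_germ1[OF assms(1-4)] cl_scale[OF cl_germ2[OF assms(1-4)] this]]
  show ?thesis by (rule cl_eq) simp_all
qed

abbreviation "\<mu> \<equiv> germ \<eta> \<eta>2 A A'"
abbreviation "\<nu> \<equiv> germ \<zeta> \<zeta>2 B B'"

text \<open>Term by term from \<open>germ_defect\<close>. The exponents of K count the operations
  performed; 30 is a rounded bound, and \<open>K ^ 30\<close> is reused as the constant of the germ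
  from here on.\<close>

lemma cl_germ_defect:
  assumes sut: "0 \<le> s" "s \<le> u" "u \<le> t" "t \<le> T"
  shows "cl 30 ((t - s) powr \<theta>) (\<mu> u t ** \<mu> s u - \<mu> s t) (\<nu> u t ** \<nu> s u - \<nu> s t)"
proof -
  define h where "h = t - s"
  have h: "0 \<le> h" "h \<le> T" using sut by (auto simp: h_def)
  have su: "0 \<le> s" "s \<le> u" "u \<le> T" "u - s \<le> h" and ut: "0 \<le> u" "u \<le> t" "t \<le> T" "t - u \<le> h"
    using sut by (auto simp: h_def)
  have sc: "h powr \<alpha> \<le> K * h powr \<theta>" if "\<theta> \<le> \<alpha>" "\<alpha> \<le> \<theta> + 1" for \<alpha>
    using h KT that by (intro powr_le_scale)
  have 1: "cl 5 (h powr \<theta>) (lin_app (remainder \<eta> A A' s u) (incr \<eta> u t)) (lin_app (remainder \<zeta> B B' s u) (incr \<zeta> u t))"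
    by (rule cl_fit[OF cl_lin_app[OF base(7)[OF su] base(1)[OF ut] Kp]])
      (use exps in \<open>simp_all add: powr_add[symmetric] sc\<close>)
  have 2: "cl 14 (h powr \<theta>) (bilin_app (incr (second_level A A') s u) (\<eta>2 u t)) (bilin_app (incr (second_level B B') s u) (\<zeta>2 u t))"
    by (rule cl_fit[OF cl_bilin_app[OF cl_incr_second_level[OF su h(2)] base(2)[OF ut] Kp]])
      (use exps in \<open>simp_all add: powr_add[symmetric] sc\<close>)
  have 3: "cl 10 (h powr \<theta>) (lin_app (incr A s u) (incr \<eta> u t) ** germ1 \<eta> A s u) (lin_app (incr B s u) (incr \<zeta> u t) ** germ1 \<zeta> B s u)"
    by (rule cl_fit[OF cl_mult[OF cl_lin_app[OF base(5)[OF su] base(1)[OF ut] Kp] cl_germ1[OF su]]])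
      (use exps in \<open>simp_all add: powr_add[symmetric] sc\<close>)
  have 4: "cl 16 (h powr \<theta>) (germ1 \<eta> A u t ** germ2 \<eta>2 A A' s u) (germ1 \<zeta> B u t ** germ2 \<zeta>2 B B' s u)"
    by (rule cl_fit[OF cl_mult[OF cl_germ1[OF ut] cl_germ2[OF su]]])
      (use exps in \<open>simp_all add: powr_add[symmetric] sc\<close>)
  have 5: "cl 24 (h powr \<theta>) (germ2 \<eta>2 A A' u t ** (germ1 \<eta> A s u + germ2 \<eta>2 A A' s u))
      (germ2 \<zeta>2 B B' u t ** (germ1 \<zeta> B s u + germ2 \<zeta>2 B B' s u))"
    by (rule cl_fit[OF cl_mult[OF cl_germ2[OF ut] cl_germ12[OF su h(2)]]])
      (use exps in \<open>simp_all add: powr_add[symmetric] sc\<close>)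
  have chen: "\<eta>2 s t - \<eta>2 s u - \<eta>2 u t = tensor (incr \<eta> s u) (incr \<eta> u t)"
    "\<zeta>2 s t - \<zeta>2 s u - \<zeta>2 u t = tensor (incr \<zeta> s u) (incr \<zeta> u t)"
    using close sut unfolding close_rough_data_def by blast+
  show ?thesis
    unfolding germ_defect[of \<eta>2, OF chen(1)] germ_defect[of \<zeta>2, OF chen(2)] h_def[symmetric]
    by (rule cl_up, (rule cl_add 1 2 3 4 5)+) simp
qed

lemma close_flows_germ: "close_flows (K ^ 30) \<gamma> \<theta> e 0 T \<mu> \<nu>"
  unfolding close_flows_def
proof (intro conjI allI impI)
  fix s t assume "0 \<le> s \<and> s \<le> t \<and> t \<le> T"
  then have "cl 12 ((t - s) powr \<gamma>) (germ1 \<eta> A s t + germ2 \<eta>2 A A' s t) (germ1 \<zeta> B s t + germ2 \<zeta>2 B B' s t)"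
    by (intro cl_germ12) auto
  then have "cl 30 ((t - s) powr \<gamma>) (germ1 \<eta> A s t + germ2 \<eta>2 A A' s t) (germ1 \<zeta> B s t + germ2 \<zeta>2 B B' s t)"
    by (rule cl_up) simp
  then show "norm (\<mu> s t - mat 1) \<le> K ^ 30 * (t - s) powr \<gamma>" "norm (\<mu> s t - \<nu> s t) \<le> K ^ 30 * e * (t - s) powr \<gamma>"
    unfolding cl_def germ_def by (simp_all add: algebra_simps)
next
  fix s u t assume "0 \<le> s \<and> s \<le> u \<and> u \<le> t \<and> t \<le> T"
  then show "norm (\<mu> u t ** \<mu> s u - \<mu> s t) \<le> K ^ 30 * (t - s) powr \<theta>"
    "norm ((\<mu> u t ** \<mu> s u - \<mu> s t) - (\<nu> u t ** \<nu> s u - \<nu> s t)) \<le> K ^ 30 * e * (t - s) powr \<theta>"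
    using cl_germ_defect[of s u t] unfolding cl_def by auto
qed

end

section \<open>Conjugation by the linear flow\<close>

lemma almost_flow_mult:
  fixes \<mu> :: "real \<Rightarrow> real \<Rightarrow> real^'d^'d"
  assumes "0 \<le> K" "0 < \<gamma>" "1 < \<theta>"
    and near: "\<And>s t. a \<le> s \<Longrightarrow> s \<le> t \<Longrightarrow> t \<le> b \<Longrightarrow> norm (\<mu> s t - mat 1) \<le> K * (t - s) powr \<gamma>"
    and flow: "\<And>s u t. a \<le> s \<Longrightarrow> s \<le> u \<Longrightarrow> u \<le> t \<Longrightarrow> t \<le> b \<Longrightarrow>
      norm (\<mu> u t ** \<mu> s u - \<mu> s t) \<le> K * (t - s) powr \<theta>"
  shows "almost_flow (\<lambda>s t (X :: real^'d^'d). \<mu> s t ** X) a b K \<gamma> \<theta>"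
proof
  fix s t and x y :: "real^'d^'d" assume st: "a \<le> s" "s \<le> t" "t \<le> b"
  have le: "norm ((\<mu> s t - mat 1) ** z) \<le> K * (t - s) powr \<gamma> * norm z" for z :: "real^'d^'d"
    by (rule order.trans[OF norm_matrix_mult_le mult_right_mono[OF near[OF st]]]) simp
  have "\<mu> s t ** x - \<mu> s t ** y - (x - y) = (\<mu> s t - mat 1) ** (x - y)" by (simp add: mm_simps)
  then show "norm (\<mu> s t ** x - \<mu> s t ** y - (x - y)) \<le> K * (t - s) powr \<gamma> * norm (x - y)"
    using le by simp
  have "\<mu> s t ** x - x = (\<mu> s t - mat 1) ** x" by (simp add: mm_simps)
  then have "norm (\<mu> s t ** x - x) \<le> K * (t - s) powr \<gamma> * norm x" using le by simp
  also have "\<dots> \<le> K * (t - s) powr \<gamma> * (1 + norm x)" using assms by (intro mult_left_mono) auto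
  finally show "norm (\<mu> s t ** x - x) \<le> K * (1 + norm x) * (t - s) powr \<gamma>" by (simp add: mult_ac)
next
  fix s u t and x :: "real^'d^'d" assume sut: "a \<le> s" "s \<le> u" "u \<le> t" "t \<le> b"
  have "\<mu> u t ** (\<mu> s u ** x) - \<mu> s t ** x = (\<mu> u t ** \<mu> s u - \<mu> s t) ** x" by (simp add: mm_simps)
  then have "norm (\<mu> u t ** (\<mu> s u ** x) - \<mu> s t ** x) \<le> K * (t - s) powr \<theta> * norm x"
    using order.trans[OF norm_matrix_mult_le mult_right_mono[OF flow[OF sut] norm_ge_zero]] by metis
  also have "\<dots> \<le> K * (t - s) powr \<theta> * (1 + norm x)" using assms by (intro mult_left_mono) auto
  finally show "norm (\<mu> u t ** (\<mu> s u ** x) - \<mu> s t ** x) \<le> K * (1 + norm x) * (t - s) powr \<theta>"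
    by (simp add: mult_ac)
qed (use assms in auto)

lemma ex_flow_path:
  fixes \<mu> :: "real \<Rightarrow> real \<Rightarrow> real^'d^'d"
  assumes "0 \<le> K" "0 < \<gamma>" "1 < \<theta>" "a \<le> b"
    and "\<And>s t. a \<le> s \<Longrightarrow> s \<le> t \<Longrightarrow> t \<le> b \<Longrightarrow> norm (\<mu> s t - mat 1) \<le> K * (t - s) powr \<gamma>"
    and "\<And>s u t. a \<le> s \<Longrightarrow> s \<le> u \<Longrightarrow> u \<le> t \<Longrightarrow> t \<le> b \<Longrightarrow>
      norm (\<mu> u t ** \<mu> s u - \<mu> s t) \<le> K * (t - s) powr \<theta>"
  obtains U C where "U a = mat 1" "flow_path C \<theta> a b \<mu> U"
  using almost_flow.sewing[OF almost_flow_mult[OF assms(1-3,5,6)] assms(4), of "mat 1"]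
  unfolding flow_path_def by blast

text \<open>Stability against the trivial germ \<open>mat 1\<close> with path \<open>mat 1\<close>
  and \<epsilon> = 1. It turns a flow path with an arbitrary error constant B into one whose bounds
  depend on K, T, \<gamma>, \<theta> and the dimension alone. K' enlarges K so that the constant
  path is bounded by it.\<close>

lemma flow_path_bounded:
  fixes K T \<gamma> \<theta> :: real
  assumes p: "0 \<le> K" "0 \<le> T" "0 < \<gamma>" "1 < \<theta>"
  obtains C where "0 \<le> C" "\<And>a b B (\<mu> :: real \<Rightarrow> real \<Rightarrow> real^'d^'d) U t.
    b - a \<le> T \<Longrightarrow>
    (\<And>s t. a \<le> s \<Longrightarrow> s \<le> t \<Longrightarrow> t \<le> b \<Longrightarrow> norm (\<mu> s t - mat 1) \<le> K * (t - s) powr \<gamma>) \<Longrightarrow>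
    (\<And>s u t. a \<le> s \<Longrightarrow> s \<le> u \<Longrightarrow> u \<le> t \<Longrightarrow> t \<le> b \<Longrightarrow>
      norm (\<mu> u t ** \<mu> s u - \<mu> s t) \<le> K * (t - s) powr \<theta>) \<Longrightarrow>
    flow_path B \<theta> a b \<mu> U \<Longrightarrow> U a = mat 1 \<Longrightarrow> a \<le> t \<Longrightarrow> t \<le> b \<Longrightarrow>
    norm (U t) \<le> C \<and> (\<forall>s. a \<le> s \<and> s \<le> t \<longrightarrow> norm (U t - \<mu> s t ** U s) \<le> C * (t - s) powr \<theta>)"
proof -
  define K' where "K' = K + norm (mat 1 :: real^'d^'d)"
  have K': "0 \<le> K'" "K \<le> K'" using p by (auto simp: K'_def)
  show ?thesis
  proof (rule linear_flow_stability[OF K'(1) p(2-4), where 'd = 'd])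
    fix C assume C: "C \<ge> 0" "\<And>\<epsilon> a b B (\<mu> :: real \<Rightarrow> real \<Rightarrow> real^'d^'d) \<nu> X Y.
    0 \<le> \<epsilon> \<Longrightarrow> a \<le> b \<Longrightarrow> b - a \<le> T \<Longrightarrow> close_flows K' \<gamma> \<theta> \<epsilon> a b \<mu> \<nu> \<Longrightarrow>
    flow_path K' \<theta> a b \<nu> Y \<Longrightarrow> \<forall>t. a \<le> t \<and> t \<le> b \<longrightarrow> norm (Y t) \<le> K' \<Longrightarrow> flow_path B \<theta> a b \<mu> X \<Longrightarrow> X a = Y a \<Longrightarrow>
    (\<forall>t. a \<le> t \<and> t \<le> b \<longrightarrow> norm (X t - Y t) \<le> C * \<epsilon>) \<and>
    (\<forall>s t. a \<le> s \<and> s \<le> t \<and> t \<le> b \<longrightarrow>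
      norm ((X t - \<mu> s t ** X s) - (Y t - \<nu> s t ** Y s)) \<le> C * \<epsilon> * (t - s) powr \<theta>)"
  show ?thesis
  proof (rule that[of "C + norm (mat 1 :: real^'d^'d)"])
    show "0 \<le> C + norm (mat 1 :: real^'d^'d)" using C by auto
    fix a b B t and \<mu> :: "real \<Rightarrow> real \<Rightarrow> real^'d^'d" and U
    assume T: "b - a \<le> T" and near: "\<And>s t. a \<le> s \<Longrightarrow> s \<le> t \<Longrightarrow> t \<le> b \<Longrightarrow> norm (\<mu> s t - mat 1) \<le> K * (t - s) powr \<gamma>"
      and flow: "\<And>s u t. a \<le> s \<Longrightarrow> s \<le> u \<Longrightarrow> u \<le> t \<Longrightarrow> t \<le> b \<Longrightarrow>
        norm (\<mu> u t ** \<mu> s u - \<mu> s t) \<le> K * (t - s) powr \<theta>"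
      and U: "flow_path B \<theta> a b \<mu> U" "U a = mat 1" and t: "a \<le> t" "t \<le> b"
    have "close_flows K' \<gamma> \<theta> 1 a b \<mu> (\<lambda>_ _. mat 1)"
      unfolding close_flows_def
    proof (intro conjI allI impI)
      fix s t assume "a \<le> s \<and> s \<le> t \<and> t \<le> b"
      then have "norm (\<mu> s t - mat 1) \<le> K * (t - s) powr \<gamma>" using near by auto
      also have "\<dots> \<le> K' * (t - s) powr \<gamma>" using K' by (intro mult_right_mono) auto
      finally show "norm (\<mu> s t - mat 1) \<le> K' * (t - s) powr \<gamma>" "norm (\<mu> s t - mat 1) \<le> K' * 1 * (t - s) powr \<gamma>" by auto
    next
      fix s u t assume "a \<le> s \<and> s \<le> u \<and> u \<le> t \<and> t \<le> b"
      then have "norm (\<mu> u t ** \<mu> s u - \<mu> s t) \<le> K * (t - s) powr \<theta>" using flow by auto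
      also have "\<dots> \<le> K' * (t - s) powr \<theta>" using K' by (intro mult_right_mono) auto
      finally show "norm (\<mu> u t ** \<mu> s u - \<mu> s t) \<le> K' * (t - s) powr \<theta>"
        "norm (\<mu> u t ** \<mu> s u - \<mu> s t - (mat 1 ** mat 1 - mat 1)) \<le> K' * 1 * (t - s) powr \<theta>" by (auto simp: mm_simps)
    qed
    from C(2)[OF _ _ T this _ _ U(1), of "\<lambda>_. mat 1"]
    have *: "\<forall>t. a \<le> t \<and> t \<le> b \<longrightarrow> norm (U t - mat 1) \<le> C * 1"
      "\<forall>s t. a \<le> s \<and> s \<le> t \<and> t \<le> b \<longrightarrow> norm (U t - \<mu> s t ** U s) \<le> C * (t - s) powr \<theta>"
      using t U K' p by (auto simp: flow_path_def mm_simps K'_def)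
    have "norm (U t) \<le> C + norm (mat 1 :: real^'d^'d)"
      using *(1) t norm_triangle_ineq[of "U t - mat 1" "mat 1"] by fastforce
    moreover have "norm (U t - \<mu> s t ** U s) \<le> (C + norm (mat 1 :: real^'d^'d)) * (t - s) powr \<theta>" if "a \<le> s" "s \<le> t" for s
    proof -
      have "norm (U t - \<mu> s t ** U s) \<le> C * (t - s) powr \<theta>" using *(2) t that by auto
      also have "\<dots> \<le> (C + norm (mat 1 :: real^'d^'d)) * (t - s) powr \<theta>" by (intro mult_right_mono) auto
      finally show ?thesis .
    qed
    ultimately show "norm (U t) \<le> C + norm (mat 1 :: real^'d^'d) \<and> (\<forall>s. a \<le> s \<and> s \<le> t \<longrightarrow>
      norm (U t - \<mu> s t ** U s) \<le> (C + norm (mat 1 :: real^'d^'d)) * (t - s) powr \<theta>)" by auto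
  qed
  qed
qed

text \<open>If \<open>p\<close> is transported by congruence with \<open>\<mu>\<close> up to a source \<open>w\<close>, then conjugation with the
  exact flow leaves only the source.\<close>

lemma conj_increment:
  fixes \<mu> w :: "real \<Rightarrow> real \<Rightarrow> real^'d^'d"
  assumes \<theta>: "0 < \<theta>" and U: "flow_path C \<theta> a b \<mu> U" "\<And>t. a \<le> t \<Longrightarrow> t \<le> b \<Longrightarrow> norm (U t) \<le> B"
    and P: "\<And>t. a \<le> t \<Longrightarrow> t \<le> b \<Longrightarrow> norm (p t) \<le> P"
    and exp: "\<And>s t. a \<le> s \<Longrightarrow> s \<le> t \<Longrightarrow> t \<le> b \<Longrightarrow>
      norm (p s - (transpose (\<mu> s t) ** p t ** \<mu> s t + w s t)) \<le> D * (t - s) powr \<theta>"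
  obtains C' where "\<And>s t. a \<le> s \<Longrightarrow> s \<le> t \<Longrightarrow> t \<le> b \<Longrightarrow>
    norm (transpose (U t) ** p t ** U t - transpose (U s) ** p s ** U s + transpose (U s) ** w s t ** U s)
      \<le> C' * (t - s) powr \<theta>"
proof -
  \<comment> \<open>A bound for \<open>U t - J\<close>, that is for
    \<open>\<mu> s t ** U s\<close>.\<close>
  define B' where "B' = B + \<bar>C\<bar> * (b - a) powr \<theta>"
  show ?thesis
  proof (rule that[of "\<bar>C\<bar> * P * B + B' * P * \<bar>C\<bar> + B * \<bar>D\<bar> * B"])
    fix s t assume st: "a \<le> s" "s \<le> t" "t \<le> b"
    define h where "h = (t - s) powr \<theta>"
    have h0: "0 \<le> h" by (simp add: h_def)
    define J where "J = U t - \<mu> s t ** U s"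
    define E where "E = p s - (transpose (\<mu> s t) ** p t ** \<mu> s t + w s t)"
    have "norm J \<le> C * h" using U(1) st unfolding flow_path_def J_def h_def by auto
    also have "\<dots> \<le> \<bar>C\<bar> * h" using h0 by (intro mult_right_mono) auto
    finally have J: "norm J \<le> \<bar>C\<bar> * h" .
    have "norm E \<le> D * h" using exp st unfolding E_def h_def by auto
    also have "\<dots> \<le> \<bar>D\<bar> * h" using h0 by (intro mult_right_mono) auto
    finally have E: "norm E \<le> \<bar>D\<bar> * h" .
    have "h \<le> (b - a) powr \<theta>" unfolding h_def using st \<theta> by (intro powr_mono2) auto
    then have "\<bar>C\<bar> * h \<le> \<bar>C\<bar> * (b - a) powr \<theta>" by (intro mult_left_mono) auto
    then have B': "norm (U t - J) \<le> B'"
      using J U(2)[of t] st norm_triangle_ineq4[of "U t" J] unfolding B'_def by auto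
    have Ut: "U t = \<mu> s t ** U s + J" by (simp add: J_def)
    have ps: "p s = transpose (\<mu> s t) ** p t ** \<mu> s t + w s t + E" by (simp add: E_def)
    \<comment> \<open>After inserting both expansions the transported main terms cancel, and each
      remaining term contains the flow error J or the expansion error E.\<close>
    have eq: "transpose (U t) ** p t ** U t - transpose (U s) ** p s ** U s + transpose (U s) ** w s t ** U s
      = transpose J ** p t ** U t + transpose (U t - J) ** p t ** J - transpose (U s) ** E ** U s"
      unfolding Ut ps by (simp add: mm_simps algebra_simps)
    have m3: "norm (X ** Y ** Z) \<le> x * y * z" if "norm X \<le> x" "norm Y \<le> y" "norm Z \<le> z" for X Y Z :: "real^'d^'d" and x y z
    proof -
      have "norm (X ** Y ** Z) \<le> norm X * norm Y * norm Z"
        by (meson norm_matrix_mult_le mult_right_mono norm_ge_zero order_trans)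
      also have "\<dots> \<le> x * y * z" using that by (intro mult_mono mult_nonneg_nonneg) (auto intro: order.trans[OF norm_ge_zero])
      finally show ?thesis .
    qed
    have "norm (transpose (U t) ** p t ** U t - transpose (U s) ** p s ** U s + transpose (U s) ** w s t ** U s)
      \<le> (\<bar>C\<bar> * h) * P * B + B' * P * (\<bar>C\<bar> * h) + B * (\<bar>D\<bar> * h) * B"
      unfolding eq using st J E B' U(2) P
      by (intro order.trans[OF norm_triangle_ineq4] add_mono order.trans[OF norm_triangle_ineq] m3) auto
    then show "norm (transpose (U t) ** p t ** U t - transpose (U s) ** p s ** U s + transpose (U s) ** w s t ** U s)
      \<le> (\<bar>C\<bar> * P * B + B' * P * \<bar>C\<bar> + B * \<bar>D\<bar> * B) * (t - s) powr \<theta>"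
      by (simp add: h_def algebra_simps)
  qed
qed

lemma continuous_on_of_holder:
  fixes f :: "real \<Rightarrow> 'a::real_normed_vector"
  assumes \<gamma>: "0 < \<gamma>" and hol: "\<And>s t. a \<le> s \<Longrightarrow> s \<le> t \<Longrightarrow> t \<le> b \<Longrightarrow> norm (f t - f s) \<le> H * (t - s) powr \<gamma>"
  shows "continuous_on {a..b} f"
proof (rule continuous_onI)
  fix x e :: real assume x: "x \<in> {a..b}" "0 < e"
  obtain h0 where h0: "0 < h0" "\<And>h. 0 \<le> h \<Longrightarrow> h \<le> h0 \<Longrightarrow> \<bar>H\<bar> * h powr \<gamma> \<le> e"
    using powr_small_step[of "\<bar>H\<bar>" \<gamma> e] \<gamma> x by auto
  have "norm (f y - f x) \<le> e" if y: "y \<in> {a..b}" "\<bar>y - x\<bar> < h0" for y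
  proof -
    have "norm (f y - f x) \<le> H * \<bar>y - x\<bar> powr \<gamma>"
      using hol[of x y] hol[of y x] x y by (cases "x \<le> y") (auto simp: norm_minus_commute)
    also have "\<dots> \<le> \<bar>H\<bar> * \<bar>y - x\<bar> powr \<gamma>" by (intro mult_right_mono) auto
    also have "\<dots> \<le> e" using y by (intro h0) auto
    finally show ?thesis .
  qed
  then show "\<exists>d>0. \<forall>y\<in>{a..b}. dist y x < d \<longrightarrow> dist (f y) (f x) \<le> e"
    using h0(1) by (auto simp: dist_norm intro!: exI[of _ h0])
qed

lemma mild_gronwall:
  fixes u :: "real \<Rightarrow> real"
  assumes T: "0 \<le> T" and \<theta>: "1 < \<theta>" "\<theta> \<le> 1 + \<gamma>" and \<gamma>: "0 < \<gamma>" "\<gamma> < 1"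
    and nonneg: "0 \<le> \<alpha>" "0 \<le> c" "0 \<le> \<alpha>'"
    and hol: "\<And>s t. 0 \<le> s \<Longrightarrow> s \<le> t \<Longrightarrow> t \<le> T \<Longrightarrow> \<bar>u t - u s\<bar> \<le> H * (t - s) powr \<gamma>"
    and step: "\<And>s. 0 \<le> s \<Longrightarrow> s \<le> T \<Longrightarrow> \<exists>g C. u s \<le> g s \<and> g T \<le> \<alpha>' \<and>
      (\<forall>r t. s \<le> r \<and> r \<le> t \<and> t \<le> T \<longrightarrow> g r - g t \<le> (\<alpha> + c * u t) * (t - r) + C * (t - r) powr \<theta>)"
    and s: "0 \<le> s" "s \<le> T"
  shows "u s \<le> (\<alpha>' + \<alpha> * T) * exp (c * T)"
proof -
  have cont: "continuous_on {0..T} u" using continuous_on_of_holder[OF \<gamma>(1), of 0 T u H] hol by simp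
  have int: "u integrable_on {c..d}" if "0 \<le> c" "d \<le> T" for c d
    using cont that by (intro integrable_continuous_real continuous_on_subset[OF cont]) auto
  define W where "W t = \<alpha> * t + c * integral {0..t} u" for t
  have W: "W t - W r = \<alpha> * (t - r) + c * integral {r..t} u" if "0 \<le> r" "r \<le> t" "t \<le> T" for r t
  proof -
    have "integral {0..t} u = integral {0..r} u + integral {r..t} u"
      using Henstock_Kurzweil_Integration.integral_combine[of 0 r t u] int that by auto
    then show ?thesis unfolding W_def by (simp add: algebra_simps)
  qed
  have "u s \<le> (\<alpha>' + \<alpha> * T) + c * integral {s..T} u" if s: "0 \<le> s" "s \<le> T" for s
  proof -
    obtain g C where g: "u s \<le> g s" "g T \<le> \<alpha>'" "\<And>r t. s \<le> r \<Longrightarrow> r \<le> t \<Longrightarrow> t \<le> T \<Longrightarrow>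
        g r - g t \<le> (\<alpha> + c * u t) * (t - r) + C * (t - r) powr \<theta>"
      using step[OF s] by blast
    have "- g T - W T \<le> - g s - W s"
    proof (rule nonincreasing_of_small_increments[OF s(2) \<theta>(1), of "\<lambda>t. - g t - W t" "C + c * \<bar>H\<bar> * (1 + T)"])
      fix r t assume rt: "s \<le> r" "r \<le> t" "t \<le> T"
      have "(u t - \<bar>H\<bar> * (t - r) powr \<gamma>) * (t - r) = integral {r..t} (\<lambda>_. u t - \<bar>H\<bar> * (t - r) powr \<gamma>)"
        using rt by simp
      also have "\<dots> \<le> integral {r..t} u"
      proof (rule integral_le)
        fix x assume x: "x \<in> {r..t}"
        have "\<bar>u t - u x\<bar> \<le> H * (t - x) powr \<gamma>" using hol[of x t] x rt s by auto
        also have "\<dots> \<le> \<bar>H\<bar> * (t - r) powr \<gamma>" using x rt \<gamma> by (intro mult_mono powr_mono2) auto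
        finally show "u t - \<bar>H\<bar> * (t - r) powr \<gamma> \<le> u x" by simp
      qed (use int rt s in auto)
      finally have "c * ((u t - \<bar>H\<bar> * (t - r) powr \<gamma>) * (t - r)) \<le> c * integral {r..t} u"
        using nonneg by (intro mult_left_mono)
      moreover have "c * (\<bar>H\<bar> * ((t - r) powr \<gamma> * (t - r))) \<le> c * (\<bar>H\<bar> * ((1 + T) * (t - r) powr \<theta>))"
      proof (intro mult_left_mono)
        have "(t - r) powr \<gamma> * (t - r) = (t - r) powr (1 + \<gamma>)" using rt
          by (cases "r = t") (auto simp: powr_add)
        also have "\<dots> \<le> (1 + T) * (t - r) powr \<theta>" using rt s \<theta> \<gamma> by (intro powr_le_scale) auto
        finally show "(t - r) powr \<gamma> * (t - r) \<le> (1 + T) * (t - r) powr \<theta>" .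
      qed (use nonneg in auto)
      ultimately show "- g t - W t - (- g r - W r) \<le> (C + c * \<bar>H\<bar> * (1 + T)) * (t - r) powr \<theta>"
        using g(3)[OF rt] W[of r t] rt s by (simp add: algebra_simps)
    qed
    moreover have "W T - W s = \<alpha> * T - \<alpha> * s + c * integral {s..T} u"
      using W[of s T] s by (simp add: algebra_simps)
    moreover have "0 \<le> \<alpha> * s" using nonneg s by simp
    ultimately show ?thesis using g(1,2) by linarith
  qed
  then have "u s \<le> (\<alpha>' + \<alpha> * T) * exp (c * (T - s))"
    using s nonneg by (intro gronwall_backward[OF cont]) auto
  also have "\<dots> \<le> (\<alpha>' + \<alpha> * T) * exp (c * T)"
    using s nonneg T by (intro mult_left_mono) (auto simp: algebra_simps)
  finally show ?thesis .
qed

section \<open>Quadratic forms\<close>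

lemma quadratic_congruence:
  fixes U M :: "real^'d^'d"
  shows "x \<bullet> ((transpose U ** M ** U) *v x) = (U *v x) \<bullet> (M *v (U *v x))"
proof -
  have "x \<bullet> (transpose U *v y) = (U *v x) \<bullet> y" for y
    by (metis dot_lmul_matrix inner_commute transpose_matrix_vector)
  moreover have "(transpose U ** M ** U) *v x = transpose U *v (M *v (U *v x))"
    by (simp add: matrix_vector_mul_assoc matrix_mul_assoc)
  ultimately show ?thesis by simp
qed

lemma quadratic_form_le:
  fixes M :: "real^'d^'d"
  shows "\<bar>x \<bullet> (M *v x)\<bar> \<le> norm M * (norm x)\<^sup>2"
proof -
  have "\<bar>x \<bullet> (M *v x)\<bar> \<le> norm x * norm (M *v x)" by (rule Cauchy_Schwarz_ineq2)
  also have "\<dots> \<le> norm x * (norm M * norm x)" by (intro mult_left_mono norm_matrix_vector_le) auto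
  finally show ?thesis by (simp add: power2_eq_square mult_ac)
qed

lemma axis_matrix_axis:
  fixes M :: "real^'d^'d"
  shows "axis i 1 \<bullet> (M *v axis j 1) = M $ i $ j"
  by (simp add: matrix_vector_mult_basis inner_axis' column_def)

lemma trace_eq_sum_quadratic:
  fixes M :: "real^'d^'d"
  shows "trace M = (\<Sum>i\<in>UNIV. axis i 1 \<bullet> (M *v axis i 1))"
  by (simp add: trace_def axis_matrix_axis)

lemma abs_trace_le:
  fixes M :: "real^'d^'d"
  shows "\<bar>trace M\<bar> \<le> real CARD('d) * norm M"
proof -
  have "\<bar>trace M\<bar> \<le> (\<Sum>i\<in>(UNIV :: 'd set). \<bar>axis i 1 \<bullet> (M *v axis i 1)\<bar>)"
    unfolding trace_eq_sum_quadratic by (rule sum_abs)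
  also have "\<dots> \<le> (\<Sum>i\<in>(UNIV :: 'd set). norm M)"
    by (intro sum_mono order.trans[OF quadratic_form_le]) (simp add: norm_axis_1)
  finally show ?thesis by simp
qed

text \<open>Testing the form on sums and differences of two basis vectors bounds an entry by the
  mean of two diagonal entries. On the nonnegative cone the trace is thus a linear substitute for
  the norm, so one-sided information about quadratic forms can be fed into Gronwall's lemma.\<close>

lemma norm_le_trace:
  fixes M :: "real^'d^'d"
  assumes "nonneg_definite M"
  shows "norm M \<le> real CARD('d) * trace M"
proof -
  have sym: "M $ i $ j = M $ j $ i" for i j
    using assms unfolding nonneg_definite_def transpose_def by (metis vec_lambda_beta)
  have ent: "\<bar>M $ i $ j\<bar> \<le> (M $ i $ i + M $ j $ j) / 2" for i j
  proof -
    have "0 \<le> (axis i 1 + axis j 1) \<bullet> (M *v (axis i 1 + axis j 1))"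
      "0 \<le> (axis i 1 - axis j 1) \<bullet> (M *v (axis i 1 - axis j 1))"
      using assms unfolding nonneg_definite_def by blast+
    then show ?thesis using sym[of i j]
      by (simp add: matrix_vector_right_distrib matrix_vector_mult_diff_distrib inner_add_left
          inner_add_right inner_diff_left inner_diff_right axis_matrix_axis)
  qed
  have "norm M \<le> (\<Sum>i\<in>UNIV. \<Sum>j\<in>UNIV. \<bar>M $ i $ j\<bar>)"
    unfolding norm_vec_def[of M]
    by (rule order.trans[OF L2_set_le_sum]) (auto intro!: sum_mono simp: norm_vec_def L2_set_le_sum)
  also have "\<dots> \<le> (\<Sum>i\<in>UNIV. \<Sum>j\<in>UNIV. (M $ i $ i + M $ j $ j) / 2)"
    by (intro sum_mono ent)
  also have "\<dots> = (\<Sum>i\<in>UNIV. \<Sum>j\<in>(UNIV :: 'd set). M $ i $ i / 2) + (\<Sum>i\<in>(UNIV :: 'd set). \<Sum>j\<in>UNIV. M $ j $ j / 2)"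
    by (simp only: add_divide_distrib sum.distrib)
  also have "\<dots> = real CARD('d) * trace M"
    unfolding trace_def by (simp add: sum_distrib_left[symmetric] sum_divide_distrib[symmetric])
  finally show ?thesis .
qed

section \<open>The abstract Riccati equation\<close>

definition congr :: "real^'d^'d \<Rightarrow> real^'d^'d \<Rightarrow> real^'d^'d" where
  "congr U p = transpose U ** p ** U"

lemma congr_diff: "congr U (x - y) = congr U x - congr U y"
  by (simp add: congr_def mm_simps)

lemma transpose_congr: "transpose (congr U x) = congr U (transpose x)"
  by (simp add: congr_def mm_simps)

lemma norm_matrix_mult3_le:
  fixes X Y Z :: "real^'d^'d"
  shows "norm (X ** Y ** Z) \<le> norm X * norm Y * norm Z"
  by (rule order.trans[OF norm_matrix_mult_le mult_right_mono[OF norm_matrix_mult_le norm_ge_zero]])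

lemma norm_congr_le:
  assumes "norm U \<le> B" shows "norm (congr U x) \<le> B\<^sup>2 * norm x"
proof -
  have "norm (congr U x) \<le> norm U * norm x * norm U"
    unfolding congr_def using norm_matrix_mult3_le[of "transpose U" x U] by simp
  also have "\<dots> \<le> B * norm x * B"
    using assms order.trans[OF norm_ge_zero assms] by (intro mult_mono mult_nonneg_nonneg) auto
  finally show ?thesis by (simp add: power2_eq_square mult_ac)
qed

lemma norm_congr_diff_le:
  assumes "norm (U - mat 1) \<le> g" "g \<le> c"
  shows "norm (congr U x - x) \<le> (2 + c) * g * norm x"
proof -
  have g: "0 \<le> g" using assms(1) norm_ge_zero order_trans by blast
  define G where "G = U - mat 1"
  have U: "U = mat 1 + G" by (simp add: G_def)
  have "congr U x - x = transpose G ** x + x ** G + transpose G ** x ** G"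
    unfolding U congr_def by (simp add: mm_simps algebra_simps)
  then have "norm (congr U x - x) \<le> norm G * norm x + norm x * norm G + norm G * norm x * norm G"
    using norm_matrix_mult_le[of "transpose G" x] norm_matrix_mult_le[of x G]
      norm_matrix_mult3_le[of "transpose G" x G]
    by (simp only: norm_transpose) (intro norm_triangle_mono)
  also have "\<dots> = (2 + norm G) * norm G * norm x" by (simp add: algebra_simps)
  also have "\<dots> \<le> (2 + c) * g * norm x"
    using assms g unfolding G_def by (intro mult_right_mono mult_mono) auto
  finally show ?thesis .
qed

text \<open>\<open>a\<close>, \<open>S\<close> and \<open>Q\<close> depend on two times: they stand
  for the coefficients integrated over [s, t], while p is frozen.\<close>

definition drift_germ ::
  "(real \<Rightarrow> real \<Rightarrow> real^'d^'d) \<Rightarrow> (real \<Rightarrow> real \<Rightarrow> real^'d^'d) \<Rightarrow> (real \<Rightarrow> real \<Rightarrow> real^'d^'d) \<Rightarrow>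
   real \<Rightarrow> real \<Rightarrow> real^'d^'d \<Rightarrow> real^'d^'d" where
  "drift_germ a S Q s t p = p ** a s t + transpose (a s t) ** p - p ** S s t ** p + Q s t"

text \<open>The backward equation with linear germ \<open>\<mu>\<close> and source \<open>w\<close>, in the sense of Davie.\<close>

definition expansion ::
  "real \<Rightarrow> real \<Rightarrow> (real \<Rightarrow> real \<Rightarrow> real^'d^'d) \<Rightarrow> (real \<Rightarrow> real \<Rightarrow> real^'d^'d) \<Rightarrow> (real \<Rightarrow> real^'d^'d) \<Rightarrow> bool" where
  "expansion T \<theta> \<mu> w p \<longleftrightarrow>
    (\<exists>C. \<forall>s t. 0 \<le> s \<and> s \<le> t \<and> t \<le> T \<longrightarrow> norm (p s - (congr (\<mu> s t) (p t) + w s t)) \<le> C * (t - s) powr \<theta>)"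

lemma expansion_diff:
  assumes "expansion T \<theta> \<mu> w p" "expansion T \<theta> \<mu> w' q"
  shows "expansion T \<theta> \<mu> (\<lambda>s t. w s t - w' s t) (\<lambda>t. p t - q t)"
proof -
  obtain C D where CD: "\<And>s t. 0 \<le> s \<and> s \<le> t \<and> t \<le> T \<Longrightarrow> norm (p s - (congr (\<mu> s t) (p t) + w s t)) \<le> C * (t - s) powr \<theta>"
     "\<And>s t. 0 \<le> s \<and> s \<le> t \<and> t \<le> T \<Longrightarrow> norm (q s - (congr (\<mu> s t) (q t) + w' s t)) \<le> D * (t - s) powr \<theta>"
    using assms unfolding expansion_def by blast
  have "norm (p s - q s - (congr (\<mu> s t) (p t - q t) + (w s t - w' s t))) \<le> (C + D) * (t - s) powr \<theta>"
    if "0 \<le> s \<and> s \<le> t \<and> t \<le> T" for s t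
  proof -
    have eq: "p s - q s - (congr (\<mu> s t) (p t - q t) + (w s t - w' s t)) =
      (p s - (congr (\<mu> s t) (p t) + w s t)) - (q s - (congr (\<mu> s t) (q t) + w' s t))"
      by (simp add: congr_diff)
    show ?thesis unfolding eq distrib_right
      by (rule order.trans[OF norm_triangle_ineq4 add_mono[OF CD(1)[OF that] CD(2)[OF that]]])
  qed
  then show ?thesis unfolding expansion_def by blast
qed

lemma expansion_transpose:
  assumes "expansion T \<theta> \<mu> w p"
  shows "expansion T \<theta> \<mu> (\<lambda>s t. transpose (w s t)) (\<lambda>t. transpose (p t))"
proof -
  have "transpose (p s) - (congr (\<mu> s t) (transpose (p t)) + transpose (w s t)) =
    transpose (p s - (congr (\<mu> s t) (p t) + w s t))" for s t
    by (simp add: transpose_algebra transpose_congr)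
  then show ?thesis using assms unfolding expansion_def by simp
qed

lemma expansion_conj_increment:
  assumes exp: "expansion T \<theta> \<mu> w p" and s: "0 \<le> s" and \<theta>: "0 < \<theta>"
    and U: "flow_path C \<theta> s T \<mu> U" "\<And>t. s \<le> t \<Longrightarrow> t \<le> T \<Longrightarrow> norm (U t) \<le> B"
    and P: "\<And>t. 0 \<le> t \<Longrightarrow> t \<le> T \<Longrightarrow> norm (p t) \<le> P"
  obtains C' where "\<And>r t. s \<le> r \<Longrightarrow> r \<le> t \<Longrightarrow> t \<le> T \<Longrightarrow>
    norm (congr (U t) (p t) - congr (U r) (p r) + congr (U r) (w r t)) \<le> C' * (t - r) powr \<theta>"
proof -
  obtain D where D: "\<forall>s t. 0 \<le> s \<and> s \<le> t \<and> t \<le> T \<longrightarrow>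
      norm (p s - (congr (\<mu> s t) (p t) + w s t)) \<le> D * (t - s) powr \<theta>"
    using exp unfolding expansion_def by blast
  show ?thesis
  proof (rule conj_increment[OF \<theta> U, of p P w D])
    fix C' assume "\<And>r t. s \<le> r \<Longrightarrow> r \<le> t \<Longrightarrow> t \<le> T \<Longrightarrow>
      norm (transpose (U t) ** p t ** U t - transpose (U r) ** p r ** U r + transpose (U r) ** w r t ** U r) \<le> C' * (t - r) powr \<theta>"
    then show ?thesis by (intro that[of C']) (simp add: congr_def)
  next
    fix r t assume "s \<le> r" "r \<le> t" "t \<le> T"
    then show "norm (p r - (transpose (\<mu> r t) ** p t ** \<mu> r t + w r t)) \<le> D * (t - r) powr \<theta>"
      using D s unfolding congr_def by simp
  qed (use P s in auto)
qed

section \<open>The backward equation with a linear germ and a given source\<close>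

locale linear_germ =
  fixes K T \<gamma> \<theta> :: real and \<mu> :: "real \<Rightarrow> real \<Rightarrow> real^'d::finite^'d"
  assumes exps: "0 < T" "0 < \<gamma>" "\<gamma> < 1" "1 < \<theta>" "\<theta> \<le> 1 + \<gamma>"
    and K: "2 \<le> K" "1 + T \<le> K" "norm (mat 1 :: real^'d^'d) \<le> K"
    and near: "\<And>s t. 0 \<le> s \<Longrightarrow> s \<le> t \<Longrightarrow> t \<le> T \<Longrightarrow> norm (\<mu> s t - mat 1) \<le> K * (t - s) powr \<gamma>"
    and flow: "\<And>s u t. 0 \<le> s \<Longrightarrow> s \<le> u \<Longrightarrow> u \<le> t \<Longrightarrow> t \<le> T \<Longrightarrow>
      norm (\<mu> u t ** \<mu> s u - \<mu> s t) \<le> K * (t - s) powr \<theta>"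
begin

lemma powr_bounds:
  assumes "0 \<le> h" "h \<le> T"
  shows "h powr \<gamma> \<le> K" "h \<le> K * h powr \<gamma>" "h powr \<theta> \<le> K * h" "h powr \<gamma> * h \<le> K * h powr \<theta>"
    "h powr \<theta> \<le> K * h powr \<gamma>"
proof -
  show "h powr \<gamma> \<le> K" using assms exps K by (intro powr_le_const[where T=T]) auto
  show "h \<le> K * h powr \<gamma>" using powr_le_scale[of h T K \<gamma> 1] assms exps K by (auto split: if_splits)
  show "h powr \<theta> \<le> K * h" using powr_le_scale[of h T K 1 \<theta>] assms exps K by auto
  have "h powr \<gamma> * h = h powr (1 + \<gamma>)" using assms by (cases "h = 0") (auto simp: powr_add)
  then show "h powr \<gamma> * h \<le> K * h powr \<theta>" using powr_le_scale[of h T K \<theta> "1 + \<gamma>"] assms exps K by auto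
  show "h powr \<theta> \<le> K * h powr \<gamma>" using powr_le_scale[of h T K \<gamma> \<theta>] assms exps K by auto
qed

lemma norm_congr_germ_diff:
  assumes "0 \<le> s" "s \<le> t" "t \<le> T"
  shows "norm (congr (\<mu> s t) x - x) \<le> (2 + K\<^sup>2) * K * (t - s) powr \<gamma> * norm x"
proof -
  have "K * (t - s) powr \<gamma> \<le> K * K" using powr_bounds(1)[of "t - s"] assms K by (intro mult_left_mono) auto
  from norm_congr_diff_le[OF near[OF assms], OF this] show ?thesis by (simp add: power2_eq_square mult_ac)
qed

lemma norm_germ_le:
  assumes "0 \<le> s" "s \<le> t" "t \<le> T"
  shows "norm (\<mu> s t) \<le> K + K\<^sup>2"
proof -
  have "K * (t - s) powr \<gamma> \<le> K * K" using powr_bounds(1)[of "t - s"] assms K by (intro mult_left_mono) auto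
  then show ?thesis using near[OF assms] norm_triangle_ineq[of "\<mu> s t - mat 1" "mat 1"] K(3)
    unfolding power2_eq_square diff_add_cancel by linarith
qed

text \<open>The expansion holds over intervals of any length, so the single step from t to T already
  bounds p at t. The bound involves the unknown error constant of the expansion and is only of
  qualitative use.\<close>

lemma expansion_bounded:
  assumes exp: "expansion T \<theta> \<mu> w p" and w: "\<And>s t. 0 \<le> s \<Longrightarrow> s \<le> t \<Longrightarrow> t \<le> T \<Longrightarrow> norm (w s t) \<le> W * (t - s)"
  obtains P where "\<And>t. 0 \<le> t \<Longrightarrow> t \<le> T \<Longrightarrow> norm (p t) \<le> P"
proof -
  obtain C where C: "\<And>s t. 0 \<le> s \<Longrightarrow> s \<le> t \<Longrightarrow> t \<le> T \<Longrightarrow>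
      norm (p s - (congr (\<mu> s t) (p t) + w s t)) \<le> C * (t - s) powr \<theta>"
    using exp unfolding expansion_def by blast
  show ?thesis
  proof (rule that)
    fix t assume t: "0 \<le> t" "t \<le> T"
    have "norm (p t) \<le> norm (p t - (congr (\<mu> t T) (p T) + w t T)) + (norm (congr (\<mu> t T) (p T)) + norm (w t T))"
      using norm_triangle_ineq[of "p t - (congr (\<mu> t T) (p T) + w t T)" "congr (\<mu> t T) (p T) + w t T"]
        norm_triangle_ineq[of "congr (\<mu> t T) (p T)" "w t T"] by simp
    also have "\<dots> \<le> \<bar>C\<bar> * T powr \<theta> + ((K + K\<^sup>2)\<^sup>2 * norm (p T) + \<bar>W\<bar> * T)"
    proof (intro add_mono norm_congr_le norm_germ_le)
      have "norm (p t - (congr (\<mu> t T) (p T) + w t T)) \<le> C * (T - t) powr \<theta>" using C t by auto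
      also have "\<dots> \<le> \<bar>C\<bar> * T powr \<theta>" using t exps by (intro mult_mono powr_mono2) auto
      finally show "norm (p t - (congr (\<mu> t T) (p T) + w t T)) \<le> \<bar>C\<bar> * T powr \<theta>" .
      have "norm (w t T) \<le> W * (T - t)" using w t by auto
      also have "\<dots> \<le> \<bar>W\<bar> * T" using t by (intro mult_mono) auto
      finally show "norm (w t T) \<le> \<bar>W\<bar> * T" .
    qed (use t in auto)
    finally show "norm (p t) \<le> \<bar>C\<bar> * T powr \<theta> + ((K + K\<^sup>2)\<^sup>2 * norm (p T) + \<bar>W\<bar> * T)" .
  qed
qed

lemma expansion_holder:
  assumes exp: "expansion T \<theta> \<mu> w p" and w: "\<And>s t. 0 \<le> s \<Longrightarrow> s \<le> t \<Longrightarrow> t \<le> T \<Longrightarrow> norm (w s t) \<le> W * (t - s)"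
    and P: "\<And>t. 0 \<le> t \<Longrightarrow> t \<le> T \<Longrightarrow> norm (p t) \<le> P"
  obtains H where "\<And>s t. 0 \<le> s \<Longrightarrow> s \<le> t \<Longrightarrow> t \<le> T \<Longrightarrow> norm (p t - p s) \<le> H * (t - s) powr \<gamma>"
proof -
  obtain C where C: "\<And>s t. 0 \<le> s \<Longrightarrow> s \<le> t \<Longrightarrow> t \<le> T \<Longrightarrow>
      norm (p s - (congr (\<mu> s t) (p t) + w s t)) \<le> C * (t - s) powr \<theta>"
    using exp unfolding expansion_def by blast
  show ?thesis
  proof (rule that)
    fix s t assume st: "0 \<le> s" "s \<le> t" "t \<le> T"
    define h where "h = t - s"
    have h: "0 \<le> h" "h \<le> T" using st by (auto simp: h_def)
    have "norm (p t - p s) = norm ((p s - (congr (\<mu> s t) (p t) + w s t)) + (congr (\<mu> s t) (p t) - p t) + w s t)"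
      by (simp add: norm_minus_commute)
    also have "\<dots> \<le> \<bar>C\<bar> * (K * h powr \<gamma>) + (2 + K\<^sup>2) * K * h powr \<gamma> * P + \<bar>W\<bar> * (K * h powr \<gamma>)"
    proof (intro norm_triangle_mono)
      have "norm (p s - (congr (\<mu> s t) (p t) + w s t)) \<le> C * h powr \<theta>" using C st by (auto simp: h_def)
      also have "\<dots> \<le> \<bar>C\<bar> * (K * h powr \<gamma>)" using powr_bounds[OF h] by (intro mult_mono) auto
      finally show "norm (p s - (congr (\<mu> s t) (p t) + w s t)) \<le> \<bar>C\<bar> * (K * h powr \<gamma>)" .
      show "norm (congr (\<mu> s t) (p t) - p t) \<le> (2 + K\<^sup>2) * K * h powr \<gamma> * P"
        unfolding h_def using st P K
        by (intro order.trans[OF norm_congr_germ_diff] mult_left_mono) auto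
      have "norm (w s t) \<le> W * h" using w st by (auto simp: h_def)
      also have "\<dots> \<le> \<bar>W\<bar> * (K * h powr \<gamma>)" using powr_bounds[OF h] h by (intro mult_mono) auto
      finally show "norm (w s t) \<le> \<bar>W\<bar> * (K * h powr \<gamma>)" .
    qed
    finally show "norm (p t - p s) \<le> (\<bar>C\<bar> * K + (2 + K\<^sup>2) * K * P + \<bar>W\<bar> * K) * (t - s) powr \<gamma>"
      by (simp add: h_def algebra_simps)
  qed
qed

lemma ex_flow:
  assumes "0 \<le> s" "s \<le> T"
  obtains U C where "U s = mat 1" "flow_path C \<theta> s T \<mu> U"
  by (rule ex_flow_path[of K \<gamma> \<theta> s T \<mu>]) (use K exps near flow assms that in auto)

lemma bounded_flow_paths:
  obtains B where "0 \<le> B" "\<And>s U C t. 0 \<le> s \<Longrightarrow> U s = mat 1 \<Longrightarrow> flow_path C \<theta> s T \<mu> U \<Longrightarrow> s \<le> t \<Longrightarrow> t \<le> T \<Longrightarrow>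
    norm (U t) \<le> B"
proof (rule flow_path_bounded[of K T \<gamma> \<theta>, where 'd = 'd])
  fix C assume "0 \<le> C" and C: "\<And>a b B (\<mu> :: real \<Rightarrow> real \<Rightarrow> real^'d^'d) U t.
    b - a \<le> T \<Longrightarrow>
    (\<And>s t. a \<le> s \<Longrightarrow> s \<le> t \<Longrightarrow> t \<le> b \<Longrightarrow> norm (\<mu> s t - mat 1) \<le> K * (t - s) powr \<gamma>) \<Longrightarrow>
    (\<And>s u t. a \<le> s \<Longrightarrow> s \<le> u \<Longrightarrow> u \<le> t \<Longrightarrow> t \<le> b \<Longrightarrow>
      norm (\<mu> u t ** \<mu> s u - \<mu> s t) \<le> K * (t - s) powr \<theta>) \<Longrightarrow>
    flow_path B \<theta> a b \<mu> U \<Longrightarrow> U a = mat 1 \<Longrightarrow> a \<le> t \<Longrightarrow> t \<le> b \<Longrightarrow>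
    norm (U t) \<le> C \<and> (\<forall>s. a \<le> s \<and> s \<le> t \<longrightarrow> norm (U t - \<mu> s t ** U s) \<le> C * (t - s) powr \<theta>)"
  show thesis
  proof (rule that[OF \<open>0 \<le> C\<close>])
    fix s U D t assume *: "0 \<le> s" "U s = mat 1" "flow_path D \<theta> s T \<mu> U" "s \<le> t" "t \<le> T"
    have "norm (U t) \<le> C \<and> (\<forall>r. s \<le> r \<and> r \<le> t \<longrightarrow> norm (U t - \<mu> r t ** U r) \<le> C * (t - r) powr \<theta>)"
      using * by (intro C[of T s \<mu> D U t] near flow) auto
    then show "norm (U t) \<le> C" by simp
  qed
qed (use K exps in auto)

text \<open>Both expansions share the germ \<mu>, so the difference solves the same linear equation
  with source w - w'. Conjugated with the flow from s, its norm changes only through this source,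
  and Gronwall's lemma with zero terminal value applies. The Lipschitz bound is asked for along the
  two paths only, so a quadratic drift qualifies once both are bounded.\<close>

lemma expansion_unique:
  assumes p: "expansion T \<theta> \<mu> w p" "expansion T \<theta> \<mu> w' q"
    and P: "\<And>t. 0 \<le> t \<Longrightarrow> t \<le> T \<Longrightarrow> norm (p t) \<le> P" "\<And>t. 0 \<le> t \<Longrightarrow> t \<le> T \<Longrightarrow> norm (q t) \<le> P"
    and L: "0 \<le> L" "\<And>s t. 0 \<le> s \<Longrightarrow> s \<le> t \<Longrightarrow> t \<le> T \<Longrightarrow> norm (w s t - w' s t) \<le> L * norm (p t - q t) * (t - s)"
    and T: "p T = q T" and t: "0 \<le> t" "t \<le> T"
  shows "p t = q t"
proof -
  define \<Delta> where "\<Delta> t = p t - q t" for t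
  define v where "v s t = w s t - w' s t" for s t
  have exp: "expansion T \<theta> \<mu> v \<Delta>" unfolding v_def \<Delta>_def using expansion_diff[OF p] .
  have P2: "norm (\<Delta> t) \<le> 2 * P" if "0 \<le> t" "t \<le> T" for t
    unfolding \<Delta>_def using P[OF that] norm_triangle_ineq4[of "p t" "q t"] by linarith
  have v: "norm (v s t) \<le> L * norm (\<Delta> t) * (t - s)" if "0 \<le> s" "s \<le> t" "t \<le> T" for s t
    using L(2) that unfolding v_def \<Delta>_def by auto
  have "norm (v s t) \<le> L * (2 * P) * (t - s)" if "0 \<le> s" "s \<le> t" "t \<le> T" for s t
    using P2[of t] L(1) that by (intro order.trans[OF v[OF that]] mult_right_mono mult_left_mono) auto
  from expansion_holder[OF exp this P2] obtain H where H: "\<And>s t. 0 \<le> s \<Longrightarrow> s \<le> t \<Longrightarrow> t \<le> T \<Longrightarrow>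
      norm (\<Delta> t - \<Delta> s) \<le> H * (t - s) powr \<gamma>" by blast
  obtain B where B: "0 \<le> B" "\<And>s U C t. 0 \<le> s \<Longrightarrow> U s = mat 1 \<Longrightarrow> flow_path C \<theta> s T \<mu> U \<Longrightarrow> s \<le> t \<Longrightarrow> t \<le> T \<Longrightarrow>
    norm (U t) \<le> B" using bounded_flow_paths by blast
  have "norm (\<Delta> t) \<le> (0 + 0 * T) * exp (B\<^sup>2 * L * T)"
  proof (rule mild_gronwall[of T \<theta> \<gamma> 0 "B\<^sup>2 * L" 0 "\<lambda>t. norm (\<Delta> t)" H t])
    fix s t assume st: "0 \<le> s" "s \<le> t" "t \<le> T"
    have "\<bar>norm (\<Delta> t) - norm (\<Delta> s)\<bar> \<le> norm (\<Delta> t - \<Delta> s)" by (rule norm_triangle_ineq3)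
    then show "\<bar>norm (\<Delta> t) - norm (\<Delta> s)\<bar> \<le> H * (t - s) powr \<gamma>" using H[OF st] by linarith
  next
    fix s assume s: "0 \<le> s" "s \<le> T"
    obtain U C where U: "U s = mat 1" "flow_path C \<theta> s T \<mu> U" using ex_flow[OF s] by blast
    have UB: "norm (U t) \<le> B" if "s \<le> t" "t \<le> T" for t using B(2) s U that by blast
    have \<theta>0: "0 < \<theta>" using exps by simp
    obtain C' where C': "\<And>r t. s \<le> r \<Longrightarrow> r \<le> t \<Longrightarrow> t \<le> T \<Longrightarrow>
        norm (congr (U t) (\<Delta> t) - congr (U r) (\<Delta> r) + congr (U r) (v r t)) \<le> C' * (t - r) powr \<theta>"
      using expansion_conj_increment[OF exp s(1) \<theta>0 U(2) UB P2] by blast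
    define g where "g t = norm (congr (U t) (\<Delta> t))" for t
    have "g r - g t \<le> (0 + B\<^sup>2 * L * norm (\<Delta> t)) * (t - r) + C' * (t - r) powr \<theta>" if rt: "s \<le> r" "r \<le> t" "t \<le> T" for r t
    proof -
      have "g r \<le> g t + norm (congr (U r) (v r t)) + norm (congr (U t) (\<Delta> t) - congr (U r) (\<Delta> r) + congr (U r) (v r t))"
        using norm_triangle_ineq4[of "congr (U t) (\<Delta> t) + congr (U r) (v r t)"
            "congr (U t) (\<Delta> t) - congr (U r) (\<Delta> r) + congr (U r) (v r t)"]
          norm_triangle_ineq[of "congr (U t) (\<Delta> t)" "congr (U r) (v r t)"] by (simp add: g_def)
      moreover have "norm (congr (U t) (\<Delta> t) - congr (U r) (\<Delta> r) + congr (U r) (v r t)) \<le> C' * (t - r) powr \<theta>"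
        using C'[OF rt] .
      moreover have "norm (congr (U r) (v r t)) \<le> B\<^sup>2 * (L * norm (\<Delta> t) * (t - r))"
        by (rule order.trans[OF norm_congr_le[OF UB] mult_left_mono[OF v]]) (use rt s in auto)
      ultimately show ?thesis by (simp add: mult_ac)
    qed
    moreover have "norm (\<Delta> s) \<le> g s" unfolding g_def U(1) congr_def by (simp add: mm_simps)
    moreover have "g T \<le> 0" using T by (simp add: g_def \<Delta>_def congr_def)
    ultimately show "\<exists>g C. norm (\<Delta> s) \<le> g s \<and> g T \<le> 0 \<and> (\<forall>r t. s \<le> r \<and> r \<le> t \<and> t \<le> T \<longrightarrow>
        g r - g t \<le> (0 + B\<^sup>2 * L * norm (\<Delta> t)) * (t - r) + C * (t - r) powr \<theta>)" by blast
  qed (use exps L B t in auto)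
  then show ?thesis by (simp add: \<Delta>_def)
qed

text \<open>With symmetric source and terminal value, p and its transpose solve one and the same
  problem, and uniqueness applies with L = 0.\<close>

lemma expansion_symmetric:
  assumes exp: "expansion T \<theta> \<mu> w p" and w: "\<And>s t. 0 \<le> s \<Longrightarrow> s \<le> t \<Longrightarrow> t \<le> T \<Longrightarrow> transpose (w s t) = w s t"
    and P: "\<And>t. 0 \<le> t \<Longrightarrow> t \<le> T \<Longrightarrow> norm (p t) \<le> P" and "transpose (p T) = p T" and t: "0 \<le> t" "t \<le> T"
  shows "transpose (p t) = p t"
  using expansion_unique[OF expansion_transpose[OF exp] exp, of P 0 t] assms by simp

end

lemma (in two_data) cl_selfI: "norm x \<le> K ^ n * r \<Longrightarrow> e = 0 \<Longrightarrow> cl n r x x"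
  unfolding cl_def by simp

lemma (in two_data) cl_selfD: "cl n r x y \<Longrightarrow> norm x \<le> K ^ n * r"
  unfolding cl_def by simp

section \<open>Positivity and existence for the backward equation\<close>

context linear_germ begin

text \<open>The coefficient c may depend on the solution as long as it is additive up to order
  \<theta>: then \<mu> + c is again a linear germ, because products of c with \<mu> - 1 or with
  itself have order at least 1 + \<gamma> \<ge> \<theta>. Conjugated with the flow of \<mu> + c, the
  quadratic form of p is nonincreasing in time, and at T it is nonnegative.\<close>

lemma expansion_nonneg:
  assumes exp: "expansion T \<theta> \<mu> w p"
    and w: "\<And>s t. 0 \<le> s \<Longrightarrow> s \<le> t \<Longrightarrow> t \<le> T \<Longrightarrow> w s t = p t ** c s t + transpose (c s t) ** p t + Q s t"
    and c: "\<And>s t. 0 \<le> s \<Longrightarrow> s \<le> t \<Longrightarrow> t \<le> T \<Longrightarrow> norm (c s t) \<le> L * (t - s)"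
      "\<And>s u t. 0 \<le> s \<Longrightarrow> s \<le> u \<Longrightarrow> u \<le> t \<Longrightarrow> t \<le> T \<Longrightarrow> norm (c s t - c s u - c u t) \<le> L * (t - s) powr \<theta>"
    and Q: "\<And>s t x. 0 \<le> s \<Longrightarrow> s \<le> t \<Longrightarrow> t \<le> T \<Longrightarrow> 0 \<le> x \<bullet> (Q s t *v x)"
    and P: "\<And>t. 0 \<le> t \<Longrightarrow> t \<le> T \<Longrightarrow> norm (p t) \<le> P"
    and pT: "\<And>x. 0 \<le> x \<bullet> (p T *v x)" and s: "0 \<le> s" "s \<le> T"
  shows "0 \<le> x \<bullet> (p s *v x)"
proof -
  have P0: "0 \<le> P" using P[of 0] exps norm_ge_zero[of "p 0"] by linarith
  define N where "N = K + \<bar>L\<bar> + P"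
  have N: "2 \<le> N" "K \<le> N" "L \<le> N" "P \<le> N" "1 + T \<le> N" using K P0 by (auto simp: N_def)
  interpret two_data N 0 by unfold_locales (use N in auto)
  have b\<mu>: "cl 1 (h powr \<gamma>) (\<mu> s t - mat 1) (\<mu> s t - mat 1)" and bc: "cl 1 h (c s t) (c s t)"
    and bp: "cl 1 1 (p t) (p t)"
    if "0 \<le> s" "s \<le> t" "t \<le> T" "t - s \<le> h" for s t h
  proof -
    have "K * (t - s) powr \<gamma> \<le> N * h powr \<gamma>" using that N K exps by (intro mult_mono powr_mono2) auto
    then show "cl 1 (h powr \<gamma>) (\<mu> s t - mat 1) (\<mu> s t - mat 1)" using near[OF that(1-3)] by (intro cl_selfI) auto
    have "L * (t - s) \<le> N * h" using that N K by (intro mult_mono) auto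
    then show "cl 1 h (c s t) (c s t)" using c(1)[OF that(1-3)] by (intro cl_selfI) auto
    show "cl 1 1 (p t) (p t)" using P[of t] that N by (intro cl_selfI) auto
  qed
  have sc: "h \<le> N * h powr \<gamma>" "h powr \<gamma> * h \<le> N * h powr \<theta>" "h * h powr \<gamma> \<le> N * h powr \<theta>"
    if "0 \<le> h" "h \<le> T" for h
    using powr_bounds(2,4)[OF that] N mult_right_mono[of K N "h powr \<gamma>"] mult_right_mono[of K N "h powr \<theta>"]
    by (auto simp: mult_ac)
  define \<mu>' where "\<mu>' s t = \<mu> s t + c s t" for s t
  have near': "cl 3 ((t - s) powr \<gamma>) (\<mu>' s t - mat 1) (\<mu>' s t - mat 1)" if "0 \<le> s" "s \<le> t" "t \<le> T" for s t
  proof -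
    have eq: "\<mu>' s t - mat 1 = (\<mu> s t - mat 1) + c s t" by (simp add: \<mu>'_def)
    have "cl (Suc (max 1 (Suc 1))) ((t - s) powr \<gamma>) (\<mu>' s t - mat 1) (\<mu>' s t - mat 1)"
      unfolding eq
      by (rule cl_add[OF b\<mu>[OF that order_refl] cl_scale[OF bc[OF that order_refl] sc(1)]]) (use that in auto)
    then show ?thesis by (rule cl_up) simp
  qed
  have flow': "cl 10 ((t - s) powr \<theta>) (\<mu>' u t ** \<mu>' s u - \<mu>' s t) (\<mu>' u t ** \<mu>' s u - \<mu>' s t)"
    if sut: "0 \<le> s" "s \<le> u" "u \<le> t" "t \<le> T" for s u t
  proof -
    define h where "h = t - s"
    have h: "0 \<le> h" "h \<le> T" using sut by (auto simp: h_def)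
    have su: "0 \<le> s" "s \<le> u" "u \<le> T" "u - s \<le> h" and ut: "0 \<le> u" "u \<le> t" "t \<le> T" "t - u \<le> h"
      using sut by (auto simp: h_def)
    have eq: "\<mu>' u t ** \<mu>' s u - \<mu>' s t = ((\<mu> u t ** \<mu> s u - \<mu> s t) - (c s t - c s u - c u t))
        + (c u t ** (\<mu> s u - mat 1) + ((\<mu> u t - mat 1) ** c s u + c u t ** c s u))"
      unfolding \<mu>'_def by (simp add: mm_simps algebra_simps)
    have "norm (\<mu> u t ** \<mu> s u - \<mu> s t) \<le> N ^ 1 * h powr \<theta>"
      using flow[OF sut] N mult_right_mono[of K N "h powr \<theta>"] by (auto simp: h_def)
    then have 1: "cl 1 (h powr \<theta>) (\<mu> u t ** \<mu> s u - \<mu> s t) (\<mu> u t ** \<mu> s u - \<mu> s t)" by (intro cl_selfI) auto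
    have "norm (c s t - c s u - c u t) \<le> N ^ 1 * h powr \<theta>"
      using c(2)[OF sut] N mult_right_mono[of L N "h powr \<theta>"] by (auto simp: h_def)
    then have 2: "cl 1 (h powr \<theta>) (c s t - c s u - c u t) (c s t - c s u - c u t)" by (intro cl_selfI) auto
    note 3 = cl_scale[OF cl_mult[OF bc[OF ut] b\<mu>[OF su]] sc(3)[OF h]]
    note 4 = cl_scale[OF cl_mult[OF b\<mu>[OF ut] bc[OF su]] sc(2)[OF h]]
    note 5 = cl_scale[OF cl_mult[OF cl_scale[OF bc[OF ut] sc(1)[OF h]] bc[OF su]] sc(2)[OF h]]
    show ?thesis unfolding eq h_def[symmetric]
      by (rule cl_up[OF cl_add[OF cl_diff[OF 1 2] cl_add[OF 3 cl_add[OF 4 5]]]]) simp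
  qed
  have N10: "N \<le> N ^ 10" using N self_le_power[of N 10] by simp
  interpret l: linear_germ "N ^ 10" T \<gamma> \<theta> \<mu>'
  proof
    fix s t assume "0 \<le> s" "s \<le> t" "t \<le> T"
    then have "cl 10 ((t - s) powr \<gamma>) (\<mu>' s t - mat 1) (\<mu>' s t - mat 1)" by (intro cl_up[OF near']) auto
    then show "norm (\<mu>' s t - mat 1) \<le> N ^ 10 * (t - s) powr \<gamma>" by (rule cl_selfD)
  next
    fix s u t assume "0 \<le> s" "s \<le> u" "u \<le> t" "t \<le> T"
    then show "norm (\<mu>' u t ** \<mu>' s u - \<mu>' s t) \<le> N ^ 10 * (t - s) powr \<theta>" by (auto intro: cl_selfD[OF flow'])
  qed (use exps N K N10 in auto)
  obtain C where C: "\<And>s t. 0 \<le> s \<Longrightarrow> s \<le> t \<Longrightarrow> t \<le> T \<Longrightarrow>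
      norm (p s - (congr (\<mu> s t) (p t) + w s t)) \<le> C * (t - s) powr \<theta>"
    using exp unfolding expansion_def by blast
  have exp': "expansion T \<theta> \<mu>' Q p"
    unfolding expansion_def
  proof (intro exI[of _ "C + N ^ 10"] allI impI, elim conjE)
    fix s t assume st: "0 \<le> s" "s \<le> t" "t \<le> T"
    define h where "h = t - s"
    have h: "0 \<le> h" "h \<le> T" "t - s \<le> h" using st by (auto simp: h_def)
    \<comment> \<open>The terms of \<open>congr (\<mu> s t + c s t) (p t)\<close> that contain c,
      apart from the linear ones already present in w.\<close>
    let ?d = "transpose (c s t) ** p t ** (\<mu> s t - mat 1) + (transpose (\<mu> s t - mat 1) ** p t ** c s t
        + transpose (c s t) ** p t ** c s t)"
    have eq: "p s - (congr (\<mu>' s t) (p t) + Q s t) = (p s - (congr (\<mu> s t) (p t) + w s t)) - ?d"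
      unfolding \<mu>'_def congr_def w[OF st] by (simp add: mm_simps algebra_simps)
    note b = b\<mu>[OF st h(3)] bc[OF st h(3)] bp[OF st h(3)]
    have 1: "cl 6 (h powr \<theta>) (transpose (c s t) ** p t ** (\<mu> s t - mat 1)) (transpose (c s t) ** p t ** (\<mu> s t - mat 1))"
      by (rule cl_fit[OF cl_mult[OF cl_mult[OF cl_transpose[OF b(2)] b(3)] b(1)]]) (use sc h in auto)
    have 2: "cl 6 (h powr \<theta>) (transpose (\<mu> s t - mat 1) ** p t ** c s t) (transpose (\<mu> s t - mat 1) ** p t ** c s t)"
      by (rule cl_fit[OF cl_mult[OF cl_mult[OF cl_transpose[OF b(1)] b(3)] b(2)]]) (use sc h in auto)
    have 3: "cl 7 (h powr \<theta>) (transpose (c s t) ** p t ** c s t) (transpose (c s t) ** p t ** c s t)"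
      by (rule cl_fit[OF cl_mult[OF cl_mult[OF cl_transpose[OF cl_scale[OF b(2) sc(1)[OF h(1,2)]]] b(3)] b(2)]])
        (use sc h in auto)
    have "cl 10 (h powr \<theta>) ?d ?d" by (rule cl_up[OF cl_add[OF 1 cl_add[OF 2 3]]]) simp
    then have "norm ?d \<le> N ^ 10 * h powr \<theta>" by (rule cl_selfD)
    then show "norm (p s - (congr (\<mu>' s t) (p t) + Q s t)) \<le> (C + N ^ 10) * (t - s) powr \<theta>"
      unfolding eq distrib_right h_def[symmetric]
      by (rule order.trans[OF norm_triangle_ineq4 add_mono[OF C[OF st, folded h_def]]])
  qed
  obtain U D where U: "U s = mat 1" "flow_path D \<theta> s T \<mu>' U" using l.ex_flow[OF s] by blast
  obtain B where B: "0 \<le> B" "\<And>s U C t. 0 \<le> s \<Longrightarrow> U s = mat 1 \<Longrightarrow> flow_path C \<theta> s T \<mu>' U \<Longrightarrow> s \<le> t \<Longrightarrow> t \<le> T \<Longrightarrow>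
    norm (U t) \<le> B" using l.bounded_flow_paths by blast
  have UB: "norm (U t) \<le> B" if "s \<le> t" "t \<le> T" for t using B(2)[OF s(1) U that] .
  have \<theta>0: "0 < \<theta>" using exps by simp
  obtain C' where C': "\<And>r t. s \<le> r \<Longrightarrow> r \<le> t \<Longrightarrow> t \<le> T \<Longrightarrow>
      norm (congr (U t) (p t) - congr (U r) (p r) + congr (U r) (Q r t)) \<le> C' * (t - r) powr \<theta>"
    using expansion_conj_increment[OF exp' s(1) \<theta>0 U(2) UB P] by blast
  have "x \<bullet> (congr (U T) (p T) *v x) \<le> x \<bullet> (congr (U s) (p s) *v x)"
  proof (rule nonincreasing_of_small_increments[OF s(2) exps(4), of "\<lambda>t. x \<bullet> (congr (U t) (p t) *v x)" "C' * (norm x)\<^sup>2"])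
    fix r t assume rt: "s \<le> r" "r \<le> t" "t \<le> T"
    let ?E = "congr (U t) (p t) - congr (U r) (p r) + congr (U r) (Q r t)"
    have "x \<bullet> (congr (U t) (p t) *v x) - x \<bullet> (congr (U r) (p r) *v x) + x \<bullet> (congr (U r) (Q r t) *v x) = x \<bullet> (?E *v x)"
      by (simp add: matrix_vector_mult_add_rdistrib matrix_vector_mult_diff_rdistrib inner_add_right inner_diff_right)
    moreover have "x \<bullet> (?E *v x) \<le> norm ?E * (norm x)\<^sup>2" using quadratic_form_le[of x ?E] by linarith
    moreover have "norm ?E * (norm x)\<^sup>2 \<le> (C' * (t - r) powr \<theta>) * (norm x)\<^sup>2"
      using C'[OF rt] by (intro mult_right_mono) auto
    moreover have "0 \<le> x \<bullet> (congr (U r) (Q r t) *v x)"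
      unfolding congr_def quadratic_congruence using Q rt s by auto
    ultimately show "x \<bullet> (congr (U t) (p t) *v x) - x \<bullet> (congr (U r) (p r) *v x) \<le> C' * (norm x)\<^sup>2 * (t - r) powr \<theta>"
      by (simp add: mult_ac)
  qed
  moreover have "0 \<le> x \<bullet> (congr (U T) (p T) *v x)" unfolding congr_def quadratic_congruence by (rule pT)
  ultimately show ?thesis unfolding U(1) congr_def by (simp add: mm_simps)
qed

text \<open>Sewing runs forward from its left endpoint, so time is reversed. An additive source that
  is bounded and Lipschitz turns congruence by \<mu> plus f into an almost flow; a quadratic drift
  does not qualify before it is truncated.\<close>

lemma ex_expansion:
  fixes f :: "real \<Rightarrow> real \<Rightarrow> real^'d^'d \<Rightarrow> real^'d^'d"
  assumes add: "\<And>s u t x. 0 \<le> s \<Longrightarrow> s \<le> u \<Longrightarrow> u \<le> t \<Longrightarrow> t \<le> T \<Longrightarrow> f s t x = f s u x + f u t x"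
    and F: "0 \<le> F" "\<And>s t x. 0 \<le> s \<Longrightarrow> s \<le> t \<Longrightarrow> t \<le> T \<Longrightarrow> norm (f s t x) \<le> F * (t - s)"
      "\<And>s t x y. 0 \<le> s \<Longrightarrow> s \<le> t \<Longrightarrow> t \<le> T \<Longrightarrow> norm (f s t x - f s t y) \<le> F * (t - s) * norm (x - y)"
  obtains p where "p T = q" "expansion T \<theta> \<mu> (\<lambda>s t. f s t (p t)) p"
proof -
  define c where "c = (2 + K\<^sup>2) * K + F * K"
  define M where "M = K + K\<^sup>2"
  define N where "N = c + (K * (M * M + M) + c * F * K + F * c * K)"
  have K0: "0 \<le> K" using K by simp
  have c0: "0 \<le> c" "(2 + K\<^sup>2) * K \<le> c" unfolding c_def using K0 F by auto
  have M0: "0 \<le> M" using K0 by (simp add: M_def)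
  have N0: "c \<le> N" "K * (M * M + M) + c * F * K + F * c * K \<le> N" unfolding N_def using K0 c0 M0 F by auto
  define m where "m s t x = congr (\<mu> s t) x + f s t x" for s t x
  have near_m: "norm (m s t x - x) \<le> c * (1 + norm x) * (t - s) powr \<gamma>" if st: "0 \<le> s" "s \<le> t" "t \<le> T" for s t x
  proof -
    have h: "t - s \<le> K * (t - s) powr \<gamma>" using powr_bounds(2)[of "t - s"] st by auto
    have "norm (m s t x - x) \<le> norm (congr (\<mu> s t) x - x) + norm (f s t x)"
      using norm_triangle_ineq[of "congr (\<mu> s t) x - x" "f s t x"] by (simp add: m_def algebra_simps)
    also have "\<dots> \<le> (2 + K\<^sup>2) * K * (t - s) powr \<gamma> * norm x + F * (K * (t - s) powr \<gamma>)"
      using norm_congr_germ_diff[OF st, of x] F(2)[OF st, of x] mult_left_mono[OF h F(1)] by linarith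
    also have "\<dots> \<le> (2 + K\<^sup>2) * K * (t - s) powr \<gamma> * (1 + norm x) + F * K * (t - s) powr \<gamma> * (1 + norm x)"
      using F(1) K0 by (intro add_mono mult_left_mono) (auto simp: algebra_simps)
    finally show ?thesis by (simp add: c_def algebra_simps)
  qed
  have lip_m: "norm (m s t x - m s t y - (x - y)) \<le> c * (t - s) powr \<gamma> * norm (x - y)" if st: "0 \<le> s" "s \<le> t" "t \<le> T" for s t x y
  proof -
    have h: "t - s \<le> K * (t - s) powr \<gamma>" using powr_bounds(2)[of "t - s"] st by auto
    have "norm (m s t x - m s t y - (x - y)) \<le> norm (congr (\<mu> s t) (x - y) - (x - y)) + norm (f s t x - f s t y)"
      using norm_triangle_ineq[of "congr (\<mu> s t) (x - y) - (x - y)" "f s t x - f s t y"]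
      by (simp add: m_def congr_diff algebra_simps)
    also have "\<dots> \<le> (2 + K\<^sup>2) * K * (t - s) powr \<gamma> * norm (x - y) + F * (K * (t - s) powr \<gamma>) * norm (x - y)"
      using norm_congr_germ_diff[OF st, of "x - y"] F(3)[OF st, of x y]
        mult_right_mono[OF mult_left_mono[OF h F(1)] norm_ge_zero[of "x - y"]] by linarith
    finally show ?thesis by (simp add: c_def algebra_simps)
  qed
  have flow_m: "norm (m s u (m u t x) - m s t x) \<le> N * (1 + norm x) * (t - s) powr \<theta>"
    if sut: "0 \<le> s" "s \<le> u" "u \<le> t" "t \<le> T" for s u t x
  proof -
    define h where "h = t - s"
    have h: "0 \<le> h" "h \<le> T" using sut by (auto simp: h_def)
    have su: "0 \<le> s" "s \<le> u" "u \<le> T" and ut: "0 \<le> u" "u \<le> t" "t \<le> T" and st: "0 \<le> s" "s \<le> t" "t \<le> T" using sut by auto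
    define k where "k = \<mu> u t ** \<mu> s u - \<mu> s t"
    have k: "norm k \<le> K * h powr \<theta>" using flow[OF sut] by (simp add: k_def h_def)
    \<comment> \<open>The composition error consists of the composition error k of \<mu>, seen on
      both sides of x, of the effect of \<mu> on the source over [u, t], and of the change of the
      source over [s, u] when its argument moves from x to \<open>m u t x\<close>.\<close>
    have eq: "m s u (m u t x) - m s t x = (transpose k ** x ** (\<mu> u t ** \<mu> s u) + transpose (\<mu> s t) ** x ** k)
        + (congr (\<mu> s u) (f u t x) - f u t x) + (f s u (m u t x) - f s u x)"
      unfolding m_def add[OF sut, of x] k_def congr_def by (simp add: mm_simps algebra_simps)
    have 1: "norm (transpose k ** x ** (\<mu> u t ** \<mu> s u)) \<le> (K * h powr \<theta>) * (1 + norm x) * (M * M)"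
    proof (rule order.trans[OF norm_matrix_mult3_le], unfold norm_transpose, intro mult_mono k)
      show "norm (\<mu> u t ** \<mu> s u) \<le> M * M"
        using norm_germ_le[OF su] norm_germ_le[OF ut] M0 unfolding M_def[symmetric]
        by (intro order.trans[OF norm_matrix_mult_le] mult_mono) auto
    qed (use K0 in auto)
    have 2: "norm (transpose (\<mu> s t) ** x ** k) \<le> M * (1 + norm x) * (K * h powr \<theta>)"
      by (rule order.trans[OF norm_matrix_mult3_le], unfold norm_transpose, intro mult_mono k)
        (use norm_germ_le[OF st] M0 K0 in \<open>auto simp: M_def\<close>)
    have hh: "(u - s) powr \<gamma> * (t - u) \<le> K * h powr \<theta>" "(u - s) * (t - u) powr \<gamma> \<le> K * h powr \<theta>"
    proof -
      have "(u - s) powr \<gamma> * (t - u) \<le> h powr \<gamma> * h" "(u - s) * (t - u) powr \<gamma> \<le> h * h powr \<gamma>"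
        using sut exps unfolding h_def by (intro mult_mono powr_mono2; simp)+
      then show "(u - s) powr \<gamma> * (t - u) \<le> K * h powr \<theta>" "(u - s) * (t - u) powr \<gamma> \<le> K * h powr \<theta>"
        using powr_bounds(4)[OF h] by (auto simp: mult.commute)
    qed
    have "norm (congr (\<mu> s u) (f u t x) - f u t x) \<le> c * (u - s) powr \<gamma> * (F * (t - u))"
      using F(1) c0 sut K0
      by (intro order.trans[OF norm_congr_germ_diff[OF su]] mult_mono mult_right_mono F(2)) auto
    also have "\<dots> = c * F * ((u - s) powr \<gamma> * (t - u))" by simp
    also have "\<dots> \<le> c * F * (K * h powr \<theta>) * (1 + norm x)"
      using mult_mono[OF mult_left_mono[OF hh(1), of "c * F"], of 1 "1 + norm x"] c0 F(1) K0 by simp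
    finally have 3: "norm (congr (\<mu> s u) (f u t x) - f u t x) \<le> c * F * (K * h powr \<theta>) * (1 + norm x)" .
    have "norm (f s u (m u t x) - f s u x) \<le> F * (u - s) * (c * (1 + norm x) * (t - u) powr \<gamma>)"
      using F(1) sut by (intro order.trans[OF F(3)[OF su]] mult_left_mono near_m[OF ut]) auto
    also have "\<dots> = F * c * (1 + norm x) * ((u - s) * (t - u) powr \<gamma>)" by simp
    also have "\<dots> \<le> F * c * (1 + norm x) * (K * h powr \<theta>)"
      using hh(2) F(1) c0 by (intro mult_left_mono) auto
    finally have 4: "norm (f s u (m u t x) - f s u x) \<le> F * c * (1 + norm x) * (K * h powr \<theta>)" .
    have "norm (m s u (m u t x) - m s t x) \<le> (K * h powr \<theta>) * (1 + norm x) * (M * M) + M * (1 + norm x) * (K * h powr \<theta>)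
        + c * F * (K * h powr \<theta>) * (1 + norm x) + F * c * (1 + norm x) * (K * h powr \<theta>)"
      unfolding eq by (intro norm_triangle_mono 1 2 3 4)
    also have "\<dots> = (K * (M * M + M) + c * F * K + F * c * K) * (1 + norm x) * h powr \<theta>"
      by (simp add: algebra_simps)
    also have "\<dots> \<le> N * (1 + norm x) * h powr \<theta>" using N0 by (intro mult_right_mono) auto
    finally show ?thesis by (simp add: h_def)
  qed
  have le_N: "c * x \<le> N * x" if "0 \<le> x" for x using N0(1) that by (rule mult_right_mono)
  have "almost_flow (\<lambda>s t. m (T - t) (T - s)) 0 T N \<gamma> \<theta>"
  proof
    fix s t x y assume st: "0 \<le> s" "s \<le> t" "t \<le> T"
    have st': "0 \<le> T - t" "T - t \<le> T - s" "T - s \<le> T" using st by auto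
    show "norm (m (T - t) (T - s) x - m (T - t) (T - s) y - (x - y)) \<le> N * (t - s) powr \<gamma> * norm (x - y)"
      using lip_m[OF st', of x y] le_N[of "(t - s) powr \<gamma> * norm (x - y)"] by (simp add: mult.assoc)
    show "norm (m (T - t) (T - s) x - x) \<le> N * (1 + norm x) * (t - s) powr \<gamma>"
      using near_m[OF st', of x] le_N[of "(1 + norm x) * (t - s) powr \<gamma>"] by (simp add: mult.assoc)
  next
    fix s u t x assume "0 \<le> s" "s \<le> u" "u \<le> t" "t \<le> T"
    then show "norm (m (T - t) (T - u) (m (T - u) (T - s) x) - m (T - t) (T - s) x) \<le> N * (1 + norm x) * (t - s) powr \<theta>"
      using flow_m[of "T - t" "T - u" "T - s" x] by simp
  qed (use N0 c0 exps in auto)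
  then obtain X C where X: "X 0 = q" "\<And>s t. 0 \<le> s \<Longrightarrow> s \<le> t \<Longrightarrow> t \<le> T \<Longrightarrow>
      norm (X t - m (T - t) (T - s) (X s)) \<le> C * (t - s) powr \<theta>"
    using almost_flow.sewing[of "\<lambda>s t. m (T - t) (T - s)" 0 T N \<gamma> \<theta> q] exps by auto
  show thesis
  proof (rule that[of "\<lambda>t. X (T - t)"])
    have "norm (X (T - s) - (congr (\<mu> s t) (X (T - t)) + f s t (X (T - t)))) \<le> C * (t - s) powr \<theta>"
      if "0 \<le> s" "s \<le> t" "t \<le> T" for s t
      using X(2)[of "T - t" "T - s"] that by (simp add: m_def)
    then show "expansion T \<theta> \<mu> (\<lambda>s t. f s t (X (T - t))) (\<lambda>t. X (T - t))"
      unfolding expansion_def by blast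
  qed (simp add: X)
qed

end

lemma nonneg_definite_sandwich:
  fixes S p :: "real^'d^'d"
  assumes "nonneg_definite S" "transpose p = p"
  shows "0 \<le> x \<bullet> ((p ** S ** p) *v x)"
  using quadratic_congruence[of x p S] assms unfolding nonneg_definite_def by simp

text \<open>The bound only sees the inequality satisfied by the quadratic form of the source, hence it is
  insensitive to the quadratic term and to its truncation.\<close>

lemma expansion_upper_bound:
  fixes K T \<gamma> \<theta> :: real
  obtains P0 where "1 \<le> P0" "\<And>(\<mu> :: real \<Rightarrow> real \<Rightarrow> real^'d^'d) w p W s.
    linear_germ K T \<gamma> \<theta> \<mu> \<Longrightarrow> expansion T \<theta> \<mu> w p \<Longrightarrow>
    (\<And>t. 0 \<le> t \<Longrightarrow> t \<le> T \<Longrightarrow> nonneg_definite (p t)) \<Longrightarrow>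
    (\<And>s t. 0 \<le> s \<Longrightarrow> s \<le> t \<Longrightarrow> t \<le> T \<Longrightarrow> norm (w s t) \<le> W * (t - s)) \<Longrightarrow>
    (\<And>s t x. 0 \<le> s \<Longrightarrow> s \<le> t \<Longrightarrow> t \<le> T \<Longrightarrow>
      x \<bullet> (w s t *v x) \<le> K * (2 * norm (p t) + 1) * (t - s) * (norm x)\<^sup>2) \<Longrightarrow>
    norm (p T) \<le> K \<Longrightarrow> 0 \<le> s \<Longrightarrow> s \<le> T \<Longrightarrow> norm (p s) \<le> P0"
proof (cases "2 \<le> K \<and> 0 < T \<and> 0 < \<gamma> \<and> 1 < \<theta>")
  case True
  then have p: "0 \<le> K" "0 \<le> T" "0 < \<gamma>" "1 < \<theta>" by auto
  show thesis
  proof (rule flow_path_bounded[OF p, where 'd = 'd])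
    fix B assume B0: "0 \<le> B" and B: "\<And>a b C (\<mu> :: real \<Rightarrow> real \<Rightarrow> real^'d^'d) U t.
      b - a \<le> T \<Longrightarrow>
      (\<And>s t. a \<le> s \<Longrightarrow> s \<le> t \<Longrightarrow> t \<le> b \<Longrightarrow> norm (\<mu> s t - mat 1) \<le> K * (t - s) powr \<gamma>) \<Longrightarrow>
      (\<And>s u t. a \<le> s \<Longrightarrow> s \<le> u \<Longrightarrow> u \<le> t \<Longrightarrow> t \<le> b \<Longrightarrow>
        norm (\<mu> u t ** \<mu> s u - \<mu> s t) \<le> K * (t - s) powr \<theta>) \<Longrightarrow>
      flow_path C \<theta> a b \<mu> U \<Longrightarrow> U a = mat 1 \<Longrightarrow> a \<le> t \<Longrightarrow> t \<le> b \<Longrightarrow>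
      norm (U t) \<le> B \<and> (\<forall>s. a \<le> s \<and> s \<le> t \<longrightarrow> norm (U t - \<mu> s t ** U s) \<le> B * (t - s) powr \<theta>)"
    \<comment> \<open>Passing from norm to trace costs one factor d, and passing back by
      \<open>norm_le_trace\<close> another. \<alpha>, c and \<alpha>' are the constant rate, the
      linear rate and the terminal value for \<open>mild_gronwall\<close>; the summand 1 makes P0
      usable as a truncation level.\<close>
    define d where "d = real CARD('d)"
    define \<alpha> where "\<alpha> = d * (K * B\<^sup>2)"
    define c where "c = d * (2 * d * K * B\<^sup>2)"
    define \<alpha>' where "\<alpha>' = d * (B\<^sup>2 * K)"
    define P0 where "P0 = d * ((\<alpha>' + \<alpha> * T) * exp (c * T)) + 1"
    have d0: "0 \<le> d" by (simp add: d_def)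
    have nn: "0 \<le> \<alpha>" "0 \<le> c" "0 \<le> \<alpha>'" unfolding \<alpha>_def c_def \<alpha>'_def using p d0 by auto
    show thesis
    proof (rule that[of P0])
      show "1 \<le> P0" unfolding P0_def using nn p d0 by simp
      fix \<mu> :: "real \<Rightarrow> real \<Rightarrow> real^'d^'d" and w p W s
      assume "linear_germ K T \<gamma> \<theta> \<mu>" and exp: "expansion T \<theta> \<mu> w p"
        and psd: "\<And>t. 0 \<le> t \<Longrightarrow> t \<le> T \<Longrightarrow> nonneg_definite (p t)"
        and W: "\<And>s t. 0 \<le> s \<Longrightarrow> s \<le> t \<Longrightarrow> t \<le> T \<Longrightarrow> norm (w s t) \<le> W * (t - s)"
        and w: "\<And>s t x. 0 \<le> s \<Longrightarrow> s \<le> t \<Longrightarrow> t \<le> T \<Longrightarrow>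
          x \<bullet> (w s t *v x) \<le> K * (2 * norm (p t) + 1) * (t - s) * (norm x)\<^sup>2"
        and pT: "norm (p T) \<le> K" and s: "0 \<le> s" "s \<le> T"
      then interpret linear_germ K T \<gamma> \<theta> \<mu> by simp
      obtain P where P: "\<And>t. 0 \<le> t \<Longrightarrow> t \<le> T \<Longrightarrow> norm (p t) \<le> P"
        using expansion_bounded[OF exp W] by blast
      obtain H where H: "\<And>s t. 0 \<le> s \<Longrightarrow> s \<le> t \<Longrightarrow> t \<le> T \<Longrightarrow> norm (p t - p s) \<le> H * (t - s) powr \<gamma>"
        using expansion_holder[OF exp W P] by blast
      \<comment> \<open>The trace is linear, so the upper bound on the quadratic form of the source,
        summed over the images of the basis vectors, bounds its growth. The norm bound W, which may
        depend on the truncation level, does not enter the rate.\<close>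
      have "trace (p s) \<le> (\<alpha>' + \<alpha> * T) * Transcendental.exp (c * T)"
      proof (rule mild_gronwall[of T \<theta> \<gamma> \<alpha> c \<alpha>' "\<lambda>t. trace (p t)" "d * H" s])
        fix s t assume st: "0 \<le> s" "s \<le> t" "t \<le> T"
        have "\<bar>trace (p t) - trace (p s)\<bar> = \<bar>trace (p t - p s)\<bar>" by (simp add: trace_sub)
        also have "\<dots> \<le> d * norm (p t - p s)" unfolding d_def by (rule abs_trace_le)
        also have "\<dots> \<le> d * (H * (t - s) powr \<gamma>)" using H[OF st] d0 by (intro mult_left_mono)
        finally show "\<bar>trace (p t) - trace (p s)\<bar> \<le> d * H * (t - s) powr \<gamma>" by simp
      next
        fix s assume s: "0 \<le> s" "s \<le> T"
        obtain U C where U: "U s = mat 1" "flow_path C \<theta> s T \<mu> U" using ex_flow[OF s] by blast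
        have UB: "norm (U t) \<le> B" if "s \<le> t" "t \<le> T" for t
          using B[of T s \<mu> C U t] near flow U s that by auto
        have \<theta>0: "0 < \<theta>" using exps by simp
        obtain C' where C': "\<And>r t. s \<le> r \<Longrightarrow> r \<le> t \<Longrightarrow> t \<le> T \<Longrightarrow>
            norm (congr (U t) (p t) - congr (U r) (p r) + congr (U r) (w r t)) \<le> C' * (t - r) powr \<theta>"
          using expansion_conj_increment[OF exp s(1) \<theta>0 U(2) UB P] by blast
        define g where "g t = trace (congr (U t) (p t))" for t
        have "g r - g t \<le> (\<alpha> + c * trace (p t)) * (t - r) + d * C' * (t - r) powr \<theta>"
          if rt: "s \<le> r" "r \<le> t" "t \<le> T" for r t
        proof -
          let ?E = "congr (U t) (p t) - congr (U r) (p r) + congr (U r) (w r t)"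
          have "g r - g t = trace (congr (U r) (w r t)) - trace ?E"
            by (simp add: g_def trace_add trace_sub)
          moreover have "- trace ?E \<le> d * (C' * (t - r) powr \<theta>)"
            using abs_trace_le[of ?E] mult_left_mono[OF C'[OF rt] d0] unfolding d_def by linarith
          moreover have "trace (congr (U r) (w r t)) \<le> (\<alpha> + c * trace (p t)) * (t - r)"
          proof -
            have "trace (congr (U r) (w r t)) = (\<Sum>i\<in>UNIV. (U r *v axis i 1) \<bullet> (w r t *v (U r *v axis i 1)))"
              unfolding trace_eq_sum_quadratic congr_def quadratic_congruence ..
            also have "\<dots> \<le> (\<Sum>i\<in>(UNIV :: 'd set). K * (2 * norm (p t) + 1) * (t - r) * B\<^sup>2)"
            proof (rule sum_mono)
              fix i :: 'd
              have "norm (U r *v axis i 1) \<le> norm (U r) * norm (axis i (1::real) :: real^'d)"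
                by (rule norm_matrix_vector_le)
              then have "norm (U r *v axis i 1) \<le> B" using UB[of r] rt by (simp add: norm_axis_1)
              then have "(norm (U r *v axis i 1))\<^sup>2 \<le> B\<^sup>2" by (intro power_mono) auto
              then show "(U r *v axis i 1) \<bullet> (w r t *v (U r *v axis i 1)) \<le> K * (2 * norm (p t) + 1) * (t - r) * B\<^sup>2"
                using rt s p(1) by (intro order.trans[OF w] mult_left_mono) auto
            qed
            also have "\<dots> = d * (K * (2 * norm (p t) + 1) * (t - r) * B\<^sup>2)" by (simp add: d_def)
            also have "\<dots> \<le> d * (K * (2 * (d * trace (p t)) + 1) * (t - r) * B\<^sup>2)"
              using norm_le_trace[OF psd[of t]] rt s p(1) d0 unfolding d_def
              by (intro mult_left_mono mult_right_mono add_right_mono) auto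
            also have "\<dots> = (\<alpha> + c * trace (p t)) * (t - r)" by (simp add: \<alpha>_def c_def algebra_simps)
            finally show ?thesis .
          qed
          ultimately show ?thesis by simp
        qed
        moreover have "trace (p s) \<le> g s" unfolding g_def U(1) congr_def by (simp add: mm_simps)
        moreover have "g T \<le> \<alpha>'"
        proof -
          have "g T \<le> d * norm (congr (U T) (p T))" unfolding g_def d_def using abs_trace_le by (metis abs_le_D1)
          also have "\<dots> \<le> d * (B\<^sup>2 * K)"
            using UB[of T] s pT d0 by (intro mult_left_mono order.trans[OF norm_congr_le[of _ B]]) auto
          finally show ?thesis by (simp add: \<alpha>'_def)
        qed
        ultimately show "\<exists>g C. trace (p s) \<le> g s \<and> g T \<le> \<alpha>' \<and> (\<forall>r t. s \<le> r \<and> r \<le> t \<and> t \<le> T \<longrightarrow>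
            g r - g t \<le> (\<alpha> + c * trace (p t)) * (t - r) + C * (t - r) powr \<theta>)" by blast
      qed (use exps nn s in auto)
      then have "d * trace (p s) \<le> d * ((\<alpha>' + \<alpha> * T) * Transcendental.exp (c * T))" using d0 by (intro mult_left_mono)
      then show "norm (p s) \<le> P0" using norm_le_trace[OF psd[OF s]] unfolding P0_def d_def by linarith
    qed
  qed
next
  \<comment> \<open>For such parameters no \<open>linear_germ\<close> exists, so any value of P0
    will do.\<close>
  case False
  show thesis
    by (rule that[of 1]) (use False in \<open>auto simp: linear_germ_def\<close>)
qed

subsection \<open>Truncation\<close>

text \<open>\<open>trunc P\<close> is the radial projection onto the ball of radius P, written as
  multiplication by a number in [0, 1]. The scalar form lets the truncated drift be read as linear
  in p with bounded coefficients plus the source Q, as the positivity argument requires.\<close>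

definition trunc_factor :: "real \<Rightarrow> 'a::real_normed_vector \<Rightarrow> real" where
  "trunc_factor P x = P / max P (norm x)"

definition trunc :: "real \<Rightarrow> 'a::real_normed_vector \<Rightarrow> 'a" where
  "trunc P x = trunc_factor P x *\<^sub>R x"

lemma trunc_factor_bounds:
  assumes "1 \<le> P"
  shows "0 \<le> trunc_factor P x" "trunc_factor P x \<le> 1" "norm x \<le> P \<Longrightarrow> trunc_factor P x = 1"
    "norm (trunc P x) \<le> P"
proof -
  have m: "0 < max P (norm x)" using assms by simp
  show "0 \<le> trunc_factor P x" "trunc_factor P x \<le> 1" "norm x \<le> P \<Longrightarrow> trunc_factor P x = 1"
    using assms m by (auto simp: trunc_factor_def divide_simps max_def)
  have "norm (trunc P x) = P * norm x / max P (norm x)" using assms by (simp add: trunc_def trunc_factor_def)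
  also have "\<dots> \<le> P" using assms m by (simp add: divide_simps mult_left_mono)
  finally show "norm (trunc P x) \<le> P" .
qed

text \<open>The weight \<open>max 1 (norm y)\<close> serves two purposes: norm y is what the
  Lipschitz bound for \<open>trunc\<close> needs, and 1 shows that the factor is Hoelder along a
  Hoelder path.\<close>

lemma trunc_factor_lipschitz:
  assumes "1 \<le> P"
  shows "\<bar>trunc_factor P x - trunc_factor P y\<bar> * max 1 (norm y) \<le> norm (x - y)"
proof -
  let ?a = "max P (norm x)" and ?b = "max P (norm y)"
  have ab: "P \<le> ?a" "0 < ?a" "0 < ?b" "max 1 (norm y) \<le> ?b" using assms by auto
  have "trunc_factor P x - trunc_factor P y = P * (?b - ?a) / (?a * ?b)"
    unfolding trunc_factor_def using ab by (simp add: field_simps)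
  then have "\<bar>trunc_factor P x - trunc_factor P y\<bar> = P * \<bar>?b - ?a\<bar> / (?a * ?b)"
    using assms ab by (simp add: abs_mult)
  then have "\<bar>trunc_factor P x - trunc_factor P y\<bar> * max 1 (norm y) = \<bar>?b - ?a\<bar> * (P / ?a) * (max 1 (norm y) / ?b)" by simp
  also have "\<dots> \<le> \<bar>?b - ?a\<bar> * 1 * 1"
    using ab assms by (intro mult_mono) (auto simp: divide_le_eq_1)
  also have "\<dots> \<le> \<bar>norm y - norm x\<bar>" by (simp add: max_def)
  also have "\<dots> \<le> norm (x - y)" by (metis norm_minus_commute norm_triangle_ineq3)
  finally show ?thesis .
qed

lemma trunc_lipschitz:
  assumes "1 \<le> P"
  shows "norm (trunc P x - trunc P y) \<le> 2 * norm (x - y)"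
proof -
  have "trunc P x - trunc P y = trunc_factor P x *\<^sub>R (x - y) + (trunc_factor P x - trunc_factor P y) *\<^sub>R y"
    by (simp add: trunc_def algebra_simps)
  then have "norm (trunc P x - trunc P y) \<le> \<bar>trunc_factor P x\<bar> * norm (x - y) + \<bar>trunc_factor P x - trunc_factor P y\<bar> * norm y"
    by (metis norm_scaleR norm_triangle_ineq)
  also have "\<dots> \<le> 1 * norm (x - y) + norm (x - y)"
  proof (intro add_mono mult_right_mono)
    show "\<bar>trunc_factor P x\<bar> \<le> 1" using trunc_factor_bounds[OF assms, of x] by simp
    have "\<bar>trunc_factor P x - trunc_factor P y\<bar> * norm y \<le> \<bar>trunc_factor P x - trunc_factor P y\<bar> * max 1 (norm y)"
      by (intro mult_left_mono) auto
    then show "\<bar>trunc_factor P x - trunc_factor P y\<bar> * norm y \<le> norm (x - y)"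
      using trunc_factor_lipschitz[OF assms, of x y] by linarith
  qed auto
  finally show ?thesis by simp
qed

text \<open>Symmetrization is built into the truncated equation, so that its source is symmetric
  before the solution is known to be.\<close>

definition sym_part :: "real^'d^'d \<Rightarrow> real^'d^'d" where
  "sym_part x = (1 / 2) *\<^sub>R (x + transpose x)"

lemma sym_part_of_symmetric: "transpose x = x \<Longrightarrow> sym_part x = x"
  by (simp add: sym_part_def scaleR_2[symmetric])

lemma transpose_sym_part: "transpose (sym_part x) = sym_part x"
  by (simp add: sym_part_def transpose_algebra add.commute)

lemma norm_sym_part_diff: "norm (sym_part x - sym_part y) \<le> norm (x - y)"
proof -
  have "sym_part x - sym_part y = (1 / 2) *\<^sub>R ((x - y) + transpose (x - y))"
    by (simp add: sym_part_def transpose_algebra scaleR_diff_right[symmetric] algebra_simps)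
  then have "norm (sym_part x - sym_part y) \<le> 1 / 2 * (norm (x - y) + norm (transpose (x - y)))"
    using norm_triangle_ineq[of "x - y" "transpose (x - y)"] by simp
  then show ?thesis by simp
qed

subsection \<open>Existence of a bounded symmetric solution\<close>

locale riccati_germ = linear_germ K T \<gamma> \<theta> \<mu>
  for K T \<gamma> \<theta> and \<mu> :: "real \<Rightarrow> real \<Rightarrow> real^'d::finite^'d" +
  fixes a S Q :: "real \<Rightarrow> real \<Rightarrow> real^'d^'d" and q :: "real^'d^'d"
  assumes additive: "\<And>s u t. 0 \<le> s \<Longrightarrow> s \<le> u \<Longrightarrow> u \<le> t \<Longrightarrow> t \<le> T \<Longrightarrow>
      a s t = a s u + a u t \<and> S s t = S s u + S u t \<and> Q s t = Q s u + Q u t"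
    and drift_le: "\<And>s t. 0 \<le> s \<Longrightarrow> s \<le> t \<Longrightarrow> t \<le> T \<Longrightarrow>
      norm (a s t) \<le> K * (t - s) \<and> norm (S s t) \<le> K * (t - s) \<and> norm (Q s t) \<le> K * (t - s)"
    and psd: "\<And>s t. 0 \<le> s \<Longrightarrow> s \<le> t \<Longrightarrow> t \<le> T \<Longrightarrow> nonneg_definite (S s t) \<and> nonneg_definite (Q s t)"
    and q: "nonneg_definite q" "norm q \<le> K"
begin

abbreviation "\<phi> \<equiv> drift_germ a S Q"

lemma drift_germ_add:
  "0 \<le> s \<Longrightarrow> s \<le> u \<Longrightarrow> u \<le> t \<Longrightarrow> t \<le> T \<Longrightarrow> \<phi> s t x = \<phi> s u x + \<phi> u t x"
  using additive[of s u t] by (simp add: drift_germ_def mm_simps algebra_simps)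

lemma norm_drift_germ_le:
  assumes st: "0 \<le> s" "s \<le> t" "t \<le> T" and x: "norm x \<le> P"
  shows "norm (\<phi> s t x) \<le> K * (2 * P + P\<^sup>2 + 1) * (t - s)"
proof -
  let ?h = "K * (t - s)"
  have d: "norm (a s t) \<le> ?h" "norm (S s t) \<le> ?h" "norm (Q s t) \<le> ?h" using drift_le[OF st] by auto
  have P0: "0 \<le> P" using x norm_ge_zero order_trans by blast
  have "norm (\<phi> s t x) \<le> P * ?h + ?h * P + P * ?h * P + ?h"
    unfolding drift_germ_def
  proof (intro order.trans[OF norm_triangle_ineq] order.trans[OF norm_triangle_ineq4] add_mono d)
    show "norm (x ** a s t) \<le> P * ?h"
      using d x P0 by (intro order.trans[OF norm_matrix_mult_le] mult_mono) auto
    show "norm (transpose (a s t) ** x) \<le> ?h * P"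
      using d x P0 st K by (intro order.trans[OF norm_matrix_mult_le] mult_mono) auto
    show "norm (x ** S s t ** x) \<le> P * ?h * P"
      using d x P0 st K by (intro order.trans[OF norm_matrix_mult3_le] mult_mono) auto
  qed
  then show ?thesis by (simp add: algebra_simps power2_eq_square)
qed

lemma norm_drift_germ_diff_le:
  assumes st: "0 \<le> s" "s \<le> t" "t \<le> T" and x: "norm x \<le> P" "norm y \<le> P"
  shows "norm (\<phi> s t x - \<phi> s t y) \<le> K * (2 + 2 * P) * (t - s) * norm (x - y)"
proof -
  let ?h = "K * (t - s)" and ?d = "norm (x - y)"
  have d: "norm (a s t) \<le> ?h" "norm (S s t) \<le> ?h" using drift_le[OF st] by auto
  have P0: "0 \<le> P" using x norm_ge_zero order_trans by blast
  have eq: "\<phi> s t x - \<phi> s t y = (x - y) ** a s t + transpose (a s t) ** (x - y)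
      - ((x - y) ** S s t ** x + y ** S s t ** (x - y))"
    by (simp add: drift_germ_def mm_simps algebra_simps)
  have "norm (\<phi> s t x - \<phi> s t y) \<le> ?d * ?h + ?h * ?d + (?d * ?h * P + P * ?h * ?d)"
    unfolding eq
  proof (intro order.trans[OF norm_triangle_ineq] order.trans[OF norm_triangle_ineq4] add_mono)
    show "norm ((x - y) ** a s t) \<le> ?d * ?h"
      using d by (intro order.trans[OF norm_matrix_mult_le] mult_mono) auto
    show "norm (transpose (a s t) ** (x - y)) \<le> ?h * ?d"
      using d st K by (intro order.trans[OF norm_matrix_mult_le] mult_mono) auto
    show "norm ((x - y) ** S s t ** x) \<le> ?d * ?h * P"
      using d x st K by (intro order.trans[OF norm_matrix_mult3_le] mult_mono) auto
    show "norm (y ** S s t ** (x - y)) \<le> P * ?h * ?d"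
      using d x P0 st K by (intro order.trans[OF norm_matrix_mult3_le] mult_mono) auto
  qed
  then show ?thesis by (simp add: algebra_simps)
qed

lemma transpose_drift_germ:
  assumes "0 \<le> s" "s \<le> t" "t \<le> T" "transpose x = x"
  shows "transpose (\<phi> s t x) = \<phi> s t x"
  using psd[OF assms(1-3)] assms(4)
  by (simp add: drift_germ_def nonneg_definite_def mm_simps add.commute)

text \<open>The drift is evaluated at the truncation of the symmetric part. This makes the source
  bounded, Lipschitz and symmetric, so a solution exists and is symmetric, and the symmetrization
  then disappears from the equation. As \<open>trunc P (p t)\<close> is a multiple of
  \<open>p t\<close>, the source takes the form required by \<open>expansion_nonneg\<close>.\<close>

lemma ex_truncated:
  assumes P: "1 \<le> P"
  obtains p where "p T = q" "expansion T \<theta> \<mu> (\<lambda>s t. \<phi> s t (trunc P (p t))) p"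
    "\<And>t. 0 \<le> t \<Longrightarrow> t \<le> T \<Longrightarrow> nonneg_definite (p t)"
proof -
  define y where "y x = trunc P (sym_part x)" for x :: "real^'d^'d"
  have y: "norm (y x) \<le> P" "norm (y x - y x') \<le> 2 * norm (x - x')" "transpose (y x) = y x" for x x'
  proof -
    show "norm (y x) \<le> P" unfolding y_def using trunc_factor_bounds[OF P] by blast
    show "norm (y x - y x') \<le> 2 * norm (x - x')"
      unfolding y_def using trunc_lipschitz[OF P, of "sym_part x" "sym_part x'"] norm_sym_part_diff[of x x'] by linarith
    show "transpose (y x) = y x" by (simp add: y_def trunc_def transpose_algebra transpose_sym_part)
  qed
  define F where "F = K * (2 * P + P\<^sup>2 + 1) + K * (2 + 2 * P) * 2"
  have F0: "K * (2 * P + P\<^sup>2 + 1) \<le> F" "K * (2 + 2 * P) * 2 \<le> F" "0 \<le> F" using K P by (auto simp: F_def)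
  have f1: "norm (\<phi> s t (y x)) \<le> F * (t - s)" if "0 \<le> s" "s \<le> t" "t \<le> T" for s t x
    using norm_drift_germ_le[OF that y(1)[of x]] mult_right_mono[OF F0(1), of "t - s"] that by linarith
  have f2: "norm (\<phi> s t (y x) - \<phi> s t (y x')) \<le> F * (t - s) * norm (x - x')"
    if "0 \<le> s" "s \<le> t" "t \<le> T" for s t x x'
  proof -
    have "norm (\<phi> s t (y x) - \<phi> s t (y x')) \<le> K * (2 + 2 * P) * (t - s) * norm (y x - y x')"
      by (rule norm_drift_germ_diff_le[OF that y(1) y(1)])
    also have "\<dots> \<le> K * (2 + 2 * P) * (t - s) * (2 * norm (x - x'))"
      using y(2)[of x x'] K P that by (intro mult_left_mono) auto
    also have "\<dots> = K * (2 + 2 * P) * 2 * ((t - s) * norm (x - x'))" by simp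
    also have "\<dots> \<le> F * ((t - s) * norm (x - x'))" using F0 that by (intro mult_right_mono) auto
    finally show ?thesis by (simp add: mult.assoc)
  qed
  obtain p where p: "p T = q" "expansion T \<theta> \<mu> (\<lambda>s t. \<phi> s t (y (p t))) p"
    using ex_expansion[of "\<lambda>s t x. \<phi> s t (y x)" F q] drift_germ_add F0(3) f1 f2 by blast
  obtain B where B: "\<And>t. 0 \<le> t \<Longrightarrow> t \<le> T \<Longrightarrow> norm (p t) \<le> B"
    using expansion_bounded[OF p(2) f1] by blast
  obtain H where H: "\<And>s t. 0 \<le> s \<Longrightarrow> s \<le> t \<Longrightarrow> t \<le> T \<Longrightarrow> norm (p t - p s) \<le> H * (t - s) powr \<gamma>"
    using expansion_holder[OF p(2) f1 B] by blast
  have H0: "0 \<le> H" using H[of 0 T] exps by (smt (verit) norm_ge_zero powr_gt_zero zero_le_mult_iff)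
  have sym: "transpose (p t) = p t" if t: "0 \<le> t" "t \<le> T" for t
    using expansion_symmetric[OF p(2) _ B _ t] transpose_drift_germ y(3) q p(1) unfolding nonneg_definite_def by auto
  define \<kappa> where "\<kappa> t = trunc_factor P (p t)" for t
  define z where "z t = trunc P (p t)" for t
  have z: "y (p t) = z t" if "0 \<le> t" "t \<le> T" for t
    using sym[OF that] by (simp add: y_def z_def sym_part_of_symmetric)
  have zk: "z t = \<kappa> t *\<^sub>R p t" for t by (simp add: z_def \<kappa>_def trunc_def)
  have z_le: "norm (z t) \<le> P" for t unfolding z_def using trunc_factor_bounds[OF P] by blast
  have \<kappa>: "0 \<le> \<kappa> t" "\<kappa> t \<le> 1" for t unfolding \<kappa>_def using trunc_factor_bounds[OF P] by blast+
  have \<kappa>_lip: "\<bar>\<kappa> t - \<kappa> s\<bar> \<le> H * (t - s) powr \<gamma>" if "0 \<le> s" "s \<le> t" "t \<le> T" for s t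
  proof -
    have "\<bar>\<kappa> t - \<kappa> s\<bar> * 1 \<le> \<bar>\<kappa> t - \<kappa> s\<bar> * max 1 (norm (p s))" by (intro mult_left_mono) auto
    also have "\<dots> \<le> norm (p t - p s)" unfolding \<kappa>_def by (rule trunc_factor_lipschitz[OF P])
    also have "\<dots> \<le> H * (t - s) powr \<gamma>" by (rule H[OF that])
    finally show ?thesis by simp
  qed
  have z_lip: "norm (z t - z s) \<le> 2 * (H * (t - s) powr \<gamma>)" if "0 \<le> s" "s \<le> t" "t \<le> T" for s t
    using trunc_lipschitz[OF P, of "p t" "p s"] H[OF that] unfolding z_def by linarith
  have exp: "expansion T \<theta> \<mu> (\<lambda>s t. \<phi> s t (z t)) p"
    using p(2) z unfolding expansion_def by (auto intro!: exI)
  \<comment> \<open>Since z = \<kappa> p, the quadratic term z S z equals \<kappa> p S z and also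
    \<kappa> z S p; half of it is put on each side of p. As \<kappa> and z are frozen at t, c is
    additive up to their increments over [u, t] times integrals over [s, u], which has order 1 +
    \<gamma>.\<close>
  define c where "c s t = \<kappa> t *\<^sub>R a s t - (\<kappa> t / 2) *\<^sub>R (S s t ** z t)" for s t
  define L where "L = K + K * P + (H * K * K + (H * K * K * P + 2 * H * K * K))"
  have L: "K + K * P \<le> L" "H * K * K + (H * K * K * P + 2 * H * K * K) \<le> L"
    unfolding L_def using K P H0 by auto
  have nonneg: "0 \<le> x \<bullet> (p t *v x)" if t: "0 \<le> t" "t \<le> T" for x t
  proof (rule expansion_nonneg[OF exp, of c Q L B])
    fix s t assume st: "0 \<le> s" "s \<le> t" "t \<le> T"
    have "transpose (S s t) = S s t" "transpose (p t) = p t" using psd[OF st] sym st unfolding nonneg_definite_def by auto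
    then show "\<phi> s t (z t) = p t ** c s t + transpose (c s t) ** p t + Q s t"
      unfolding drift_germ_def c_def zk
      by (simp add: mm_simps transpose_algebra(5) algebra_simps scaleR_2[symmetric])
    have "norm (c s t) \<le> 1 * (K * (t - s)) + (1 / 2) * (K * (t - s) * P)"
      unfolding c_def
    proof (intro order.trans[OF norm_triangle_ineq4] add_mono; unfold norm_scaleR; intro mult_mono)
      show "norm (S s t ** z t) \<le> K * (t - s) * P"
        using drift_le[OF st] z_le[of t] st K by (intro order.trans[OF norm_matrix_mult_le] mult_mono) auto
    qed (use \<kappa>[of t] drift_le[OF st] in auto)
    also have "\<dots> \<le> (K + K * P) * (t - s)"
    proof -
      have "0 \<le> K * (t - s) * P" using K P st by simp
      moreover have "(K + K * P) * (t - s) = K * (t - s) + K * (t - s) * P" by (simp add: algebra_simps)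
      ultimately show ?thesis by linarith
    qed
    also have "\<dots> \<le> L * (t - s)" using L st by (intro mult_right_mono) auto
    finally show "norm (c s t) \<le> L * (t - s)" .
  next
    fix s u t assume sut: "0 \<le> s" "s \<le> u" "u \<le> t" "t \<le> T"
    define h where "h = t - s"
    have h: "0 \<le> h" "h \<le> T" using sut by (auto simp: h_def)
    have st: "0 \<le> s" "s \<le> t" "t \<le> T" and su: "0 \<le> s" "s \<le> u" "u \<le> T" and ut: "0 \<le> u" "u \<le> t" "t \<le> T" using sut by auto
    have hm: "(t - u) powr \<gamma> \<le> h powr \<gamma>" using sut exps by (intro powr_mono2) (auto simp: h_def)
    have d\<kappa>: "\<bar>\<kappa> t - \<kappa> u\<bar> \<le> H * h powr \<gamma>" using \<kappa>_lip[OF ut] mult_left_mono[OF hm H0] by linarith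
    have dz: "norm (z t - z u) \<le> 2 * (H * h powr \<gamma>)" using z_lip[OF ut] mult_left_mono[OF hm H0] by linarith
    have Kh: "K * (u - s) \<le> K * h" using sut K by (auto simp: h_def)
    have aS: "norm (a s u) \<le> K * h" "norm (S s u) \<le> K * h" using drift_le[OF su] Kh by auto
    have eq: "c s t - c s u - c u t = (\<kappa> t - \<kappa> u) *\<^sub>R a s u
        - (((\<kappa> t - \<kappa> u) / 2) *\<^sub>R (S s u ** z t) + (\<kappa> u / 2) *\<^sub>R (S s u ** (z t - z u)))"
      using additive[OF sut] unfolding c_def
      by (simp add: mm_simps algebra_simps diff_divide_distrib)
    have "norm (c s t - c s u - c u t) \<le> (H * h powr \<gamma>) * (K * h)
        + ((H * h powr \<gamma>) * (K * h * P) + 1 * (K * h * (2 * (H * h powr \<gamma>))))"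
      unfolding eq
    proof (intro order.trans[OF norm_triangle_ineq4] order.trans[OF norm_triangle_ineq] add_mono; unfold norm_scaleR; intro mult_mono)
      show "norm (S s u ** z t) \<le> K * h * P" "norm (S s u ** (z t - z u)) \<le> K * h * (2 * (H * h powr \<gamma>))"
        using aS z_le[of t] dz K h by (auto intro!: order.trans[OF norm_matrix_mult_le] mult_mono)
      show "\<bar>(\<kappa> t - \<kappa> u) / 2\<bar> \<le> H * h powr \<gamma>" using d\<kappa> by simp
      show "\<bar>\<kappa> u / 2\<bar> \<le> 1" using \<kappa>[of u] by simp
    qed (use d\<kappa> aS H0 K P h in auto)
    also have "\<dots> = (H * K + H * K * P + 2 * H * K) * (h powr \<gamma> * h)" by (simp add: algebra_simps)
    also have "\<dots> \<le> (H * K + H * K * P + 2 * H * K) * (K * h powr \<theta>)"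
      using powr_bounds(4)[OF h] H0 K P by (intro mult_left_mono) auto
    also have "\<dots> = (H * K * K + (H * K * K * P + 2 * H * K * K)) * h powr \<theta>" by (simp add: algebra_simps)
    also have "\<dots> \<le> L * h powr \<theta>" using L by (intro mult_right_mono) auto
    finally show "norm (c s t - c s u - c u t) \<le> L * (t - s) powr \<theta>" by (simp add: h_def)
  next
    show "0 \<le> x \<bullet> (p T *v x)" for x using q p(1) unfolding nonneg_definite_def by auto
    show "0 \<le> x \<bullet> (Q s t *v x)" if "0 \<le> s" "s \<le> t" "t \<le> T" for s t x using psd[OF that] unfolding nonneg_definite_def by auto
  qed (use B t in auto)
  show thesis
    by (rule that[OF p(1) exp[unfolded z_def]]) (use sym nonneg in \<open>auto simp: nonneg_definite_def\<close>)
qed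

text \<open>With y the truncation of p, the term - y S y can only lower the form, and the norm of y
  is at most that of p, so the level P does not appear in the bound. Otherwise the level could not
  be chosen from the resulting estimate of p.\<close>

lemma quadratic_truncated_drift:
  assumes P: "1 \<le> P" and st: "0 \<le> s" "s \<le> t" "t \<le> T" and p: "transpose p = p"
  shows "x \<bullet> (\<phi> s t (trunc P p) *v x) \<le> K * (2 * norm p + 1) * (t - s) * (norm x)\<^sup>2"
proof -
  let ?y = "trunc P p"
  have n: "norm ?y \<le> norm p"
    unfolding trunc_def using trunc_factor_bounds(1,2)[OF P, of p] by (simp add: mult_left_le_one_le)
  have ysym: "transpose ?y = ?y" by (simp add: trunc_def transpose_algebra p)
  let ?l = "?y ** a s t + transpose (a s t) ** ?y + Q s t"
  have "\<phi> s t ?y = ?l - ?y ** S s t ** ?y" by (simp add: drift_germ_def)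
  then have "x \<bullet> (\<phi> s t ?y *v x) = x \<bullet> (?l *v x) - x \<bullet> ((?y ** S s t ** ?y) *v x)"
    by (simp add: matrix_vector_mult_diff_rdistrib inner_diff_right)
  also have "\<dots> \<le> x \<bullet> (?l *v x)"
    using nonneg_definite_sandwich[OF _ ysym, of "S s t" x] psd[OF st] by simp
  also have "\<dots> \<le> norm ?l * (norm x)\<^sup>2" using quadratic_form_le[of x ?l] by linarith
  also have "\<dots> \<le> (K * (2 * norm p + 1) * (t - s)) * (norm x)\<^sup>2"
  proof (rule mult_right_mono)
    have "norm ?l \<le> norm p * (K * (t - s)) + (K * (t - s)) * norm p + K * (t - s)"
      using drift_le[OF st] n st K
      by (intro norm_triangle_mono) (auto intro!: order.trans[OF norm_matrix_mult_le] mult_mono)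
    then show "norm ?l \<le> K * (2 * norm p + 1) * (t - s)" by (simp add: algebra_simps)
  qed simp
  finally show ?thesis .
qed

end

text \<open>The number P from \<open>expansion_upper_bound\<close> is available before any equation
  is fixed, so it is taken as the truncation level. The truncated solution then never leaves the
  ball on which the truncation is the identity.\<close>

theorem riccati_germ_existence:
  fixes K T \<gamma> \<theta> :: real
  obtains P0 where "1 \<le> P0" "\<And>(\<mu> :: real \<Rightarrow> real \<Rightarrow> real^'d^'d) a S Q q. riccati_germ K T \<gamma> \<theta> \<mu> a S Q q \<Longrightarrow>
    \<exists>p. p T = q \<and> expansion T \<theta> \<mu> (\<lambda>s t. drift_germ a S Q s t (p t)) p \<and>
      (\<forall>t. 0 \<le> t \<and> t \<le> T \<longrightarrow> norm (p t) \<le> P0)"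
proof (rule expansion_upper_bound[of K T \<gamma> \<theta>, where 'd = 'd])
  fix P assume P: "1 \<le> P" and bound: "\<And>(\<mu> :: real \<Rightarrow> real \<Rightarrow> real^'d^'d) w p W s.
    linear_germ K T \<gamma> \<theta> \<mu> \<Longrightarrow> expansion T \<theta> \<mu> w p \<Longrightarrow>
    (\<And>t. 0 \<le> t \<Longrightarrow> t \<le> T \<Longrightarrow> nonneg_definite (p t)) \<Longrightarrow>
    (\<And>s t. 0 \<le> s \<Longrightarrow> s \<le> t \<Longrightarrow> t \<le> T \<Longrightarrow> norm (w s t) \<le> W * (t - s)) \<Longrightarrow>
    (\<And>s t x. 0 \<le> s \<Longrightarrow> s \<le> t \<Longrightarrow> t \<le> T \<Longrightarrow>
      x \<bullet> (w s t *v x) \<le> K * (2 * norm (p t) + 1) * (t - s) * (norm x)\<^sup>2) \<Longrightarrow>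
    norm (p T) \<le> K \<Longrightarrow> 0 \<le> s \<Longrightarrow> s \<le> T \<Longrightarrow> norm (p s) \<le> P"
  show thesis
  proof (rule that[OF P])
    fix \<mu> :: "real \<Rightarrow> real \<Rightarrow> real^'d^'d" and a S Q q
    assume "riccati_germ K T \<gamma> \<theta> \<mu> a S Q q"
    then interpret riccati_germ K T \<gamma> \<theta> \<mu> a S Q q .
    obtain p where p: "p T = q" "expansion T \<theta> \<mu> (\<lambda>s t. \<phi> s t (trunc P (p t))) p"
      "\<And>t. 0 \<le> t \<Longrightarrow> t \<le> T \<Longrightarrow> nonneg_definite (p t)" using ex_truncated[OF P] by blast
    have le: "norm (p t) \<le> P" if t: "0 \<le> t" "t \<le> T" for t
    proof (rule bound[OF linear_germ_axioms p(2,3) _ _ _ t])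
      show "norm (\<phi> s t (trunc P (p t))) \<le> K * (2 * P + P\<^sup>2 + 1) * (t - s)" if "0 \<le> s" "s \<le> t" "t \<le> T" for s t
        by (rule norm_drift_germ_le[OF that trunc_factor_bounds(4)[OF P]])
      show "x \<bullet> (\<phi> s t (trunc P (p t)) *v x) \<le> K * (2 * norm (p t) + 1) * (t - s) * (norm x)\<^sup>2"
        if "0 \<le> s" "s \<le> t" "t \<le> T" for s t x
        using p(3)[of t] that by (intro quadratic_truncated_drift[OF P]) (auto simp: nonneg_definite_def)
    qed (use p(1) q in auto)
    have "trunc P (p t) = p t" if "0 \<le> t" "t \<le> T" for t
      using trunc_factor_bounds(3)[OF P le[OF that]] by (simp add: trunc_def)
    then have "expansion T \<theta> \<mu> (\<lambda>s t. \<phi> s t (p t)) p"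
      using p(2) unfolding expansion_def by (auto intro!: exI)
    then show "\<exists>p. p T = q \<and> expansion T \<theta> \<mu> (\<lambda>s t. \<phi> s t (p t)) p \<and>
        (\<forall>t. 0 \<le> t \<and> t \<le> T \<longrightarrow> norm (p t) \<le> P)" using p(1) le by blast
  qed
qed

section \<open>Stability of the Riccati equation\<close>

lemma close_flows_mono:
  assumes "close_flows K \<gamma> \<theta> \<epsilon> a b \<mu> \<nu>" "K \<le> K'" "0 \<le> \<epsilon>"
  shows "close_flows K' \<gamma> \<theta> \<epsilon> a b \<mu> \<nu>"
proof -
  have "K * x \<le> K' * x" "K * \<epsilon> * x \<le> K' * \<epsilon> * x" if "0 \<le> x" for x
    using assms that by (intro mult_right_mono; simp)+
  note le = this(1)[OF powr_ge_zero] this(2)[OF powr_ge_zero]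
  show ?thesis
    unfolding close_flows_def
    by (intro conjI allI impI; elim conjE; rule order_trans[OF _ le(1)] order_trans[OF _ le(2)])
      (use assms(1) in \<open>auto simp: close_flows_def\<close>)
qed

lemma congr_diff_congr:
  "congr U w - congr V w' = congr U (w - w') + (transpose (U - V) ** w' ** U + transpose V ** w' ** (U - V))"
  by (simp add: congr_def mm_simps)

text \<open>The error constants of the two expansions are unrelated to \<epsilon>, so subtracting
  the expansions gives nothing. Each solution is conjugated with its own exact flow from s; errors
  of order \<theta> then vanish on refinement and only the difference of the sources remains.
  Besides p - p' the conclusion controls \<open>p s - congr (\<mu> s t) (p t)\<close>, of order t -
  s, from which the distance of the Gubinelli remainders is recovered later.\<close>

theorem riccati_germ_stability:
  fixes K T \<gamma> \<theta> :: real
  assumes K: "2 \<le> K" and T: "0 < T" "1 + T \<le> K" and exps: "0 < \<gamma>" "\<gamma> < 1" "1 < \<theta>" "\<theta> \<le> 1 + \<gamma>"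
  obtains C where "0 \<le> C" "\<And>\<epsilon> (\<mu> :: real \<Rightarrow> real \<Rightarrow> real^'d^'d) a S Q q \<nu> a' S' Q' q' p p' s t.
    0 \<le> \<epsilon> \<Longrightarrow> riccati_germ K T \<gamma> \<theta> \<mu> a S Q q \<Longrightarrow> riccati_germ K T \<gamma> \<theta> \<nu> a' S' Q' q' \<Longrightarrow>
    close_flows K \<gamma> \<theta> \<epsilon> 0 T \<mu> \<nu> \<Longrightarrow>
    (\<And>s t. 0 \<le> s \<Longrightarrow> s \<le> t \<Longrightarrow> t \<le> T \<Longrightarrow> norm (a s t - a' s t) \<le> K * \<epsilon> * (t - s) \<and>
      norm (S s t - S' s t) \<le> K * \<epsilon> * (t - s) \<and> norm (Q s t - Q' s t) \<le> K * \<epsilon> * (t - s)) \<Longrightarrow>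
    norm (q - q') \<le> K * \<epsilon> \<Longrightarrow>
    expansion T \<theta> \<mu> (\<lambda>s t. drift_germ a S Q s t (p t)) p \<Longrightarrow>
    expansion T \<theta> \<nu> (\<lambda>s t. drift_germ a' S' Q' s t (p' t)) p' \<Longrightarrow> p T = q \<Longrightarrow> p' T = q' \<Longrightarrow>
    (\<And>t. 0 \<le> t \<Longrightarrow> t \<le> T \<Longrightarrow> norm (p t) \<le> K \<and> norm (p' t) \<le> K) \<Longrightarrow>
    0 \<le> s \<Longrightarrow> s \<le> t \<Longrightarrow> t \<le> T \<Longrightarrow>
    norm (p t - p' t) \<le> C * \<epsilon> \<and> norm (p s - congr (\<mu> s t) (p t)) \<le> C * (t - s) \<and>
    norm (p' s - congr (\<nu> s t) (p' t)) \<le> C * (t - s) \<and>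
    norm ((p s - congr (\<mu> s t) (p t)) - (p' s - congr (\<nu> s t) (p' t))) \<le> C * \<epsilon> * (t - s)"
proof (rule flow_path_bounded[of K T \<gamma> \<theta>, where 'd = 'd])
  fix B assume B0: "0 \<le> B" and B: "\<And>a b C (\<mu> :: real \<Rightarrow> real \<Rightarrow> real^'d^'d) U t.
      b - a \<le> T \<Longrightarrow>
      (\<And>s t. a \<le> s \<Longrightarrow> s \<le> t \<Longrightarrow> t \<le> b \<Longrightarrow> norm (\<mu> s t - mat 1) \<le> K * (t - s) powr \<gamma>) \<Longrightarrow>
      (\<And>s u t. a \<le> s \<Longrightarrow> s \<le> u \<Longrightarrow> u \<le> t \<Longrightarrow> t \<le> b \<Longrightarrow>
        norm (\<mu> u t ** \<mu> s u - \<mu> s t) \<le> K * (t - s) powr \<theta>) \<Longrightarrow>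
      flow_path C \<theta> a b \<mu> U \<Longrightarrow> U a = mat 1 \<Longrightarrow> a \<le> t \<Longrightarrow> t \<le> b \<Longrightarrow>
      norm (U t) \<le> B \<and> (\<forall>s. a \<le> s \<and> s \<le> t \<longrightarrow> norm (U t - \<mu> s t ** U s) \<le> B * (t - s) powr \<theta>)"
  define K1 where "K1 = K + B"
  have K1: "0 \<le> K1" "K \<le> K1" "B \<le> K1" using K B0 by (auto simp: K1_def)
  show thesis
  proof (rule linear_flow_stability[of K1 T \<gamma> \<theta>, where 'd = 'd])
    fix C1 assume C1: "0 \<le> C1" "\<And>\<epsilon> a b B (\<mu> :: real \<Rightarrow> real \<Rightarrow> real^'d^'d) \<nu> X Y.
      0 \<le> \<epsilon> \<Longrightarrow> a \<le> b \<Longrightarrow> b - a \<le> T \<Longrightarrow> close_flows K1 \<gamma> \<theta> \<epsilon> a b \<mu> \<nu> \<Longrightarrow>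
      flow_path K1 \<theta> a b \<nu> Y \<Longrightarrow> \<forall>t. a \<le> t \<and> t \<le> b \<longrightarrow> norm (Y t) \<le> K1 \<Longrightarrow> flow_path B \<theta> a b \<mu> X \<Longrightarrow> X a = Y a \<Longrightarrow>
      (\<forall>t. a \<le> t \<and> t \<le> b \<longrightarrow> norm (X t - Y t) \<le> C1 * \<epsilon>) \<and>
      (\<forall>s t. a \<le> s \<and> s \<le> t \<and> t \<le> b \<longrightarrow>
        norm ((X t - \<mu> s t ** X s) - (Y t - \<nu> s t ** Y s)) \<le> C1 * \<epsilon> * (t - s) powr \<theta>)"
    \<comment> \<open>F bounds the drift germ on the ball of radius K and L gives its Lipschitz
      constant there. C2 bounds the difference of the conjugated sources, C3 that of the terminal
      values, C4 is the resulting Gronwall constant, and C5 is the rate once the bound C4 \<epsilon>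
      has been inserted.\<close>
    define F where "F = K * (2 * K + K\<^sup>2 + 1)"
    define L where "L = K * (2 + 2 * K)"
    define C2 where "C2 = B\<^sup>2 * (L + F) + 2 * B * C1 * F"
    define C3 where "C3 = B\<^sup>2 * K + 2 * B * C1 * K"
    define C4 where "C4 = (C3 + C2 * T) * exp (C2 * T)"
    define C5 where "C5 = C2 * (1 + C4)"
    define N where "N = K + B + C1 + C4 + C5 + B\<^sup>2 * F + K * K"
    have F0: "0 \<le> F" "0 \<le> L" using K by (auto simp: F_def L_def)
    have C20: "0 \<le> C2" "0 \<le> C3" using F0 B0 C1 K by (auto simp: C2_def C3_def)
    have C40: "0 \<le> C4" "0 \<le> C5" using C20 T by (auto simp: C4_def C5_def)
    have N: "K \<le> N" "B \<le> N" "C1 \<le> N" "C4 \<le> N" "C5 \<le> N" "B\<^sup>2 * F \<le> N" "2 \<le> N" "1 + T \<le> N" "K * K \<le> N" "K + K * K \<le> N"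
    proof -
      have "0 \<le> B\<^sup>2 * F" "0 \<le> K * K" using F0 K by auto
      then show "K \<le> N" "B \<le> N" "C1 \<le> N" "C4 \<le> N" "C5 \<le> N" "B\<^sup>2 * F \<le> N" "2 \<le> N" "1 + T \<le> N" "K * K \<le> N" "K + K * K \<le> N"
        unfolding N_def using K T B0 C1(1) C40 by linarith+
    qed
    show thesis
    proof (rule that[of "N ^ 15"])
      show "0 \<le> N ^ 15" using N by simp
      fix \<epsilon> and \<mu> \<nu> :: "real \<Rightarrow> real \<Rightarrow> real^'d^'d" and a S Q q a' S' Q' q' p p' s t
      assume \<epsilon>: "0 \<le> \<epsilon>" and r: "riccati_germ K T \<gamma> \<theta> \<mu> a S Q q" and r': "riccati_germ K T \<gamma> \<theta> \<nu> a' S' Q' q'"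
        and cf: "close_flows K \<gamma> \<theta> \<epsilon> 0 T \<mu> \<nu>"
        and cd: "\<And>s t. 0 \<le> s \<Longrightarrow> s \<le> t \<Longrightarrow> t \<le> T \<Longrightarrow> norm (a s t - a' s t) \<le> K * \<epsilon> * (t - s) \<and>
          norm (S s t - S' s t) \<le> K * \<epsilon> * (t - s) \<and> norm (Q s t - Q' s t) \<le> K * \<epsilon> * (t - s)"
        and qq: "norm (q - q') \<le> K * \<epsilon>"
        and exp: "expansion T \<theta> \<mu> (\<lambda>s t. drift_germ a S Q s t (p t)) p"
        and exp': "expansion T \<theta> \<nu> (\<lambda>s t. drift_germ a' S' Q' s t (p' t)) p'"
        and pT: "p T = q" "p' T = q'"
        and P: "\<And>t. 0 \<le> t \<Longrightarrow> t \<le> T \<Longrightarrow> norm (p t) \<le> K \<and> norm (p' t) \<le> K"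
      interpret A: riccati_germ K T \<gamma> \<theta> \<mu> a S Q q by (rule r)
      interpret A': riccati_germ K T \<gamma> \<theta> \<nu> a' S' Q' q' by (rule r')
      interpret two_data N \<epsilon> by unfold_locales (use N \<epsilon> in auto)
      have P1: "norm (p t) \<le> K" and P1': "norm (p' t) \<le> K" if "0 \<le> t" "t \<le> T" for t using P[OF that] by auto
      define \<Delta> where "\<Delta> t = p t - p' t" for t
      define w where "w s t = A.\<phi> s t (p t)" for s t
      define w' where "w' s t = A'.\<phi> s t (p' t)" for s t
      have exp: "expansion T \<theta> \<mu> w p" and exp': "expansion T \<theta> \<nu> w' p'"
        using exp exp' unfolding w_def w'_def by auto
      have w: "norm (w s t) \<le> F * (t - s)" "norm (w' s t) \<le> F * (t - s)" if "0 \<le> s" "s \<le> t" "t \<le> T" for s t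
        unfolding w_def w'_def F_def
        using A.norm_drift_germ_le[OF that P1[of t]] A'.norm_drift_germ_le[OF that P1'[of t]] that by auto
      have ww: "norm (w s t - w' s t) \<le> (L * norm (\<Delta> t) + F * \<epsilon>) * (t - s)" if st: "0 \<le> s" "s \<le> t" "t \<le> T" for s t
      proof -
        have t: "0 \<le> t" "t \<le> T" using st by auto
        have eq: "w s t - w' s t = (A.\<phi> s t (p t) - A.\<phi> s t (p' t))
          + drift_germ (\<lambda>s t. a s t - a' s t) (\<lambda>s t. S s t - S' s t) (\<lambda>s t. Q s t - Q' s t) s t (p' t)"
          unfolding w_def w'_def by (simp add: drift_germ_def mm_simps algebra_simps)
        let ?h = "K * \<epsilon> * (t - s)"
        have h0: "0 \<le> ?h" using K \<epsilon> st by simp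
        have "norm (drift_germ (\<lambda>s t. a s t - a' s t) (\<lambda>s t. S s t - S' s t) (\<lambda>s t. Q s t - Q' s t) s t (p' t))
          \<le> K * ?h + ?h * K + K * ?h * K + ?h"
          unfolding drift_germ_def
        proof (rule order.trans[OF norm_triangle_ineq add_mono], rule order.trans[OF norm_triangle_ineq4 add_mono],
            rule order.trans[OF norm_triangle_ineq add_mono])
          show "norm (p' t ** (a s t - a' s t)) \<le> K * ?h"
            using cd[OF st] P1'[OF t] K h0 by (intro order.trans[OF norm_matrix_mult_le] mult_mono) auto
          show "norm (transpose (a s t - a' s t) ** p' t) \<le> ?h * K"
            using cd[OF st] P1'[OF t] K h0 by (intro order.trans[OF norm_matrix_mult_le] mult_mono) auto
          show "norm (p' t ** (S s t - S' s t) ** p' t) \<le> K * ?h * K"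
            using cd[OF st] P1'[OF t] K h0 \<epsilon> st by (intro order.trans[OF norm_matrix_mult3_le] mult_mono mult_nonneg_nonneg) auto
        qed (use cd[OF st] in auto)
        also have "\<dots> = F * \<epsilon> * (t - s)" by (simp add: F_def algebra_simps power2_eq_square)
        finally have "norm (drift_germ (\<lambda>s t. a s t - a' s t) (\<lambda>s t. S s t - S' s t) (\<lambda>s t. Q s t - Q' s t) s t (p' t)) \<le> F * \<epsilon> * (t - s)" .
        moreover have "norm (A.\<phi> s t (p t) - A.\<phi> s t (p' t)) \<le> L * (t - s) * norm (\<Delta> t)"
          unfolding L_def \<Delta>_def by (rule A.norm_drift_germ_diff_le[OF st P1[OF t] P1'[OF t]])
        ultimately show ?thesis unfolding eq
          by (intro order.trans[OF norm_triangle_ineq]) (simp add: algebra_simps)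
      qed
      obtain H where H: "\<And>s t. 0 \<le> s \<Longrightarrow> s \<le> t \<Longrightarrow> t \<le> T \<Longrightarrow> norm (p t - p s) \<le> H * (t - s) powr \<gamma>"
        using A.expansion_holder[OF exp w(1) P1] by blast
      obtain H' where H': "\<And>s t. 0 \<le> s \<Longrightarrow> s \<le> t \<Longrightarrow> t \<le> T \<Longrightarrow> norm (p' t - p' s) \<le> H' * (t - s) powr \<gamma>"
        using A'.expansion_holder[OF exp' w(2) P1'] by blast
      have \<theta>0: "0 < \<theta>" using exps by simp
      have flows: "\<exists>U V. U s = mat 1 \<and> V s = mat 1 \<and>
          (\<forall>t. s \<le> t \<and> t \<le> T \<longrightarrow> norm (U t) \<le> B \<and> norm (V t) \<le> B \<and> norm (U t - V t) \<le> C1 * \<epsilon> \<and>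
            norm (U t - \<mu> s t) \<le> B * (t - s) powr \<theta> \<and> norm (V t - \<nu> s t) \<le> B * (t - s) powr \<theta> \<and>
            norm ((U t - \<mu> s t) - (V t - \<nu> s t)) \<le> C1 * \<epsilon> * (t - s) powr \<theta>) \<and>
          (\<exists>C. \<forall>r t. s \<le> r \<and> r \<le> t \<and> t \<le> T \<longrightarrow>
             norm (congr (U t) (p t) - congr (U r) (p r) + congr (U r) (w r t)) \<le> C * (t - r) powr \<theta> \<and>
             norm (congr (V t) (p' t) - congr (V r) (p' r) + congr (V r) (w' r t)) \<le> C * (t - r) powr \<theta>)"
        if s: "0 \<le> s" "s \<le> T" for s
      proof -
        obtain U c where U: "U s = mat 1" "flow_path c \<theta> s T \<mu> U" using A.ex_flow[OF s] by blast
        obtain V c' where V: "V s = mat 1" "flow_path c' \<theta> s T \<nu> V" using A'.ex_flow[OF s] by blast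
        have UB: "norm (U t) \<le> B \<and> (\<forall>r. s \<le> r \<and> r \<le> t \<longrightarrow> norm (U t - \<mu> r t ** U r) \<le> B * (t - r) powr \<theta>)"
          if "s \<le> t" "t \<le> T" for t
          using s that by (intro B[OF _ A.near A.flow U(2,1)]) auto
        have VB: "norm (V t) \<le> B \<and> (\<forall>r. s \<le> r \<and> r \<le> t \<longrightarrow> norm (V t - \<nu> r t ** V r) \<le> B * (t - r) powr \<theta>)"
          if "s \<le> t" "t \<le> T" for t
          using s that by (intro B[OF _ A'.near A'.flow V(2,1)]) auto
        have "flow_path K1 \<theta> s T \<nu> V" unfolding flow_path_def
        proof (intro allI impI)
          fix r t assume "s \<le> r \<and> r \<le> t \<and> t \<le> T"
          then have "norm (V t - \<nu> r t ** V r) \<le> B * (t - r) powr \<theta>" using VB[of t] by auto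
          also have "\<dots> \<le> K1 * (t - r) powr \<theta>" using K1 by (intro mult_right_mono) auto
          finally show "norm (V t - \<nu> r t ** V r) \<le> K1 * (t - r) powr \<theta>" .
        qed
        moreover have "close_flows K1 \<gamma> \<theta> \<epsilon> s T \<mu> \<nu>"
          using close_flows_mono[OF cf K1(2) \<epsilon>] close_flows_subinterval s by blast
        moreover have "\<forall>t. s \<le> t \<and> t \<le> T \<longrightarrow> norm (V t) \<le> K1" using VB K1 by fastforce
        ultimately have UV: "(\<forall>t. s \<le> t \<and> t \<le> T \<longrightarrow> norm (U t - V t) \<le> C1 * \<epsilon>) \<and>
          (\<forall>r t. s \<le> r \<and> r \<le> t \<and> t \<le> T \<longrightarrow>
            norm ((U t - \<mu> r t ** U r) - (V t - \<nu> r t ** V r)) \<le> C1 * \<epsilon> * (t - r) powr \<theta>)"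
          using s U V \<epsilon> by (intro C1(2)) auto
        obtain D where D: "\<And>r t. s \<le> r \<Longrightarrow> r \<le> t \<Longrightarrow> t \<le> T \<Longrightarrow>
             norm (congr (U t) (p t) - congr (U r) (p r) + congr (U r) (w r t)) \<le> D * (t - r) powr \<theta>"
          using expansion_conj_increment[OF exp s(1) \<theta>0 U(2), of B K] UB P1 by blast
        obtain D' where D': "\<And>r t. s \<le> r \<Longrightarrow> r \<le> t \<Longrightarrow> t \<le> T \<Longrightarrow>
             norm (congr (V t) (p' t) - congr (V r) (p' r) + congr (V r) (w' r t)) \<le> D' * (t - r) powr \<theta>"
          using expansion_conj_increment[OF exp' s(1) \<theta>0 V(2), of B K] VB P1' by blast
        have DD: "norm (congr (U t) (p t) - congr (U r) (p r) + congr (U r) (w r t)) \<le> max D D' * (t - r) powr \<theta> \<and>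
             norm (congr (V t) (p' t) - congr (V r) (p' r) + congr (V r) (w' r t)) \<le> max D D' * (t - r) powr \<theta>"
          if "s \<le> r \<and> r \<le> t \<and> t \<le> T" for r t
          using D[of r t] D'[of r t] that mult_right_mono[of D "max D D'" "(t - r) powr \<theta>"]
            mult_right_mono[of D' "max D D'" "(t - r) powr \<theta>"] by auto
        have 1: "norm (U t) \<le> B \<and> norm (V t) \<le> B \<and> norm (U t - V t) \<le> C1 * \<epsilon> \<and>
            norm (U t - \<mu> s t) \<le> B * (t - s) powr \<theta> \<and> norm (V t - \<nu> s t) \<le> B * (t - s) powr \<theta> \<and>
            norm ((U t - \<mu> s t) - (V t - \<nu> s t)) \<le> C1 * \<epsilon> * (t - s) powr \<theta>" if t: "s \<le> t \<and> t \<le> T" for t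
        proof -
          have "norm (U t - \<mu> s t ** U s) \<le> B * (t - s) powr \<theta>" "norm (V t - \<nu> s t ** V s) \<le> B * (t - s) powr \<theta>"
            "norm (U t) \<le> B" "norm (V t) \<le> B" using UB[of t] VB[of t] t by auto
          moreover have "norm (U t - V t) \<le> C1 * \<epsilon>"
            "norm ((U t - \<mu> s t ** U s) - (V t - \<nu> s t ** V s)) \<le> C1 * \<epsilon> * (t - s) powr \<theta>" using UV t by auto
          ultimately show ?thesis unfolding U(1) V(1) matrix_mul_rid by auto
        qed
        show ?thesis using U(1) V(1) 1 DD by blast
      qed
      have congr_le: "norm (congr U X - congr V Y) \<le> B\<^sup>2 * x + 2 * B * C1 * \<epsilon> * y"
        if "norm U \<le> B" "norm V \<le> B" "norm (U - V) \<le> C1 * \<epsilon>" "norm (X - Y) \<le> x" "norm Y \<le> y"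
        for U V X Y :: "real^'d^'d" and x y
      proof -
        have y0: "0 \<le> y" using that(5) norm_ge_zero order_trans by blast
        have "norm (congr U X - congr V Y) \<le> B\<^sup>2 * x + (C1 * \<epsilon> * y * B + B * y * (C1 * \<epsilon>))"
          unfolding congr_diff_congr
        proof (intro order.trans[OF norm_triangle_ineq] add_mono)
          show "norm (congr U (X - Y)) \<le> B\<^sup>2 * x"
            using that by (intro order.trans[OF norm_congr_le[of _ B]] mult_left_mono) auto
          show "norm (transpose (U - V) ** Y ** U) \<le> C1 * \<epsilon> * y * B"
            using that B0 C1 \<epsilon> y0 by (intro order.trans[OF norm_matrix_mult3_le] mult_mono mult_nonneg_nonneg) auto
          show "norm (transpose V ** Y ** (U - V)) \<le> B * y * (C1 * \<epsilon>)"
            using that B0 C1 \<epsilon> y0 by (intro order.trans[OF norm_matrix_mult3_le] mult_mono mult_nonneg_nonneg) auto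
        qed
        then show ?thesis by (simp add: algebra_simps)
      qed
      have source: "norm (congr U (w r t) - congr V (w' r t)) \<le> (C2 * \<epsilon> + C2 * norm (\<Delta> t)) * (t - r)"
        if "norm U \<le> B" "norm V \<le> B" "norm (U - V) \<le> C1 * \<epsilon>" "0 \<le> r" "r \<le> t" "t \<le> T" for U V r t
      proof -
        have "norm (congr U (w r t) - congr V (w' r t)) \<le>
          B\<^sup>2 * ((L * norm (\<Delta> t) + F * \<epsilon>) * (t - r)) + 2 * B * C1 * \<epsilon> * (F * (t - r))"
          by (rule congr_le[OF that(1-3) ww[OF that(4-6)] w(2)[OF that(4-6)]])
        also have "\<dots> = (B\<^sup>2 * L * norm (\<Delta> t) + (B\<^sup>2 * F + 2 * B * C1 * F) * \<epsilon>) * (t - r)" by (simp add: algebra_simps)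
        also have "\<dots> \<le> (C2 * norm (\<Delta> t) + C2 * \<epsilon>) * (t - r)"
          using that F0 B0 C1 \<epsilon> unfolding C2_def
          by (intro mult_right_mono add_mono) (auto simp: algebra_simps)
        finally show ?thesis by (simp add: add.commute)
      qed
      have \<Delta>: "norm (\<Delta> s) \<le> C4 * \<epsilon>" if s: "0 \<le> s" "s \<le> T" for s
      proof -
        have "norm (\<Delta> s) \<le> (C3 * \<epsilon> + C2 * \<epsilon> * T) * Transcendental.exp (C2 * T)"
        proof (rule mild_gronwall[of T \<theta> \<gamma> "C2 * \<epsilon>" C2 "C3 * \<epsilon>" "\<lambda>t. norm (\<Delta> t)" "H + H'" s])
          fix s t assume st: "0 \<le> s" "s \<le> t" "t \<le> T"
          have "\<bar>norm (\<Delta> t) - norm (\<Delta> s)\<bar> \<le> norm (\<Delta> t - \<Delta> s)" by (rule norm_triangle_ineq3)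
          also have "\<Delta> t - \<Delta> s = (p t - p s) - (p' t - p' s)" by (simp add: \<Delta>_def)
          also have "norm \<dots> \<le> H * (t - s) powr \<gamma> + H' * (t - s) powr \<gamma>"
            by (rule order.trans[OF norm_triangle_ineq4 add_mono[OF H[OF st] H'[OF st]]])
          finally show "\<bar>norm (\<Delta> t) - norm (\<Delta> s)\<bar> \<le> (H + H') * (t - s) powr \<gamma>" by (simp add: distrib_right)
        next
          fix s assume s: "0 \<le> s" "s \<le> T"
          obtain U V C where U: "U s = mat 1" "V s = mat 1"
            and UV: "\<And>t. s \<le> t \<Longrightarrow> t \<le> T \<Longrightarrow> norm (U t) \<le> B" "\<And>t. s \<le> t \<Longrightarrow> t \<le> T \<Longrightarrow> norm (V t) \<le> B"
              "\<And>t. s \<le> t \<Longrightarrow> t \<le> T \<Longrightarrow> norm (U t - V t) \<le> C1 * \<epsilon>"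
            and inc: "\<And>r t. s \<le> r \<Longrightarrow> r \<le> t \<Longrightarrow> t \<le> T \<Longrightarrow> norm (congr (U t) (p t) - congr (U r) (p r) + congr (U r) (w r t)) \<le> C * (t - r) powr \<theta>"
              "\<And>r t. s \<le> r \<Longrightarrow> r \<le> t \<Longrightarrow> t \<le> T \<Longrightarrow> norm (congr (V t) (p' t) - congr (V r) (p' r) + congr (V r) (w' r t)) \<le> C * (t - r) powr \<theta>"
            using flows[OF s] by blast
          \<comment> \<open>Both flows are the identity at s, so g at s is the distance of p and p'
            there, whereas g at T involves only the terminal data and the distance of the
            flows.\<close>
          define g where "g t = norm (congr (U t) (p t) - congr (V t) (p' t))" for t
          have "g r - g t \<le> (C2 * \<epsilon> + C2 * norm (\<Delta> t)) * (t - r) + 2 * C * (t - r) powr \<theta>"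
            if rt: "s \<le> r" "r \<le> t" "t \<le> T" for r t
          proof -
            define E where "E = congr (U t) (p t) - congr (U r) (p r) + congr (U r) (w r t)"
            define E' where "E' = congr (V t) (p' t) - congr (V r) (p' r) + congr (V r) (w' r t)"
            have eq: "congr (U r) (p r) - congr (V r) (p' r) = (congr (U t) (p t) - congr (V t) (p' t))
              + (congr (U r) (w r t) - congr (V r) (w' r t)) - (E - E')" by (simp add: E_def E'_def)
            have "norm (E - E') \<le> C * (t - r) powr \<theta> + C * (t - r) powr \<theta>"
              unfolding E_def E'_def by (rule order.trans[OF norm_triangle_ineq4 add_mono[OF inc(1)[OF rt] inc(2)[OF rt]]])
            moreover have "g r \<le> g t + norm (congr (U r) (w r t) - congr (V r) (w' r t)) + norm (E - E')"
              unfolding g_def eq by (intro order.trans[OF norm_triangle_ineq4] add_mono norm_triangle_ineq order_refl)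
            ultimately show ?thesis
              using source[of "U r" "V r" r t] UV[of r] rt s by simp
          qed
          moreover have "norm (\<Delta> s) \<le> g s" unfolding g_def U congr_def \<Delta>_def by (simp add: mm_simps)
          moreover have "g T \<le> C3 * \<epsilon>"
          proof -
            have "g T \<le> B\<^sup>2 * (K * \<epsilon>) + 2 * B * C1 * \<epsilon> * K"
              unfolding g_def using UV[of T] s pT qq P1'[of T] T by (intro congr_le) auto
            then show ?thesis by (simp add: C3_def algebra_simps)
          qed
          ultimately show "\<exists>g C. norm (\<Delta> s) \<le> g s \<and> g T \<le> C3 * \<epsilon> \<and> (\<forall>r t. s \<le> r \<and> r \<le> t \<and> t \<le> T \<longrightarrow>
              g r - g t \<le> (C2 * \<epsilon> + C2 * norm (\<Delta> t)) * (t - r) + C * (t - r) powr \<theta>)" by blast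
        qed (use exps C20 T s \<epsilon> in auto)
        then show ?thesis by (simp add: C4_def algebra_simps)
      qed
      fix s t assume st: "0 \<le> s" "s \<le> t" "t \<le> T"
      define h where "h = t - s"
      have h: "0 \<le> h" "h \<le> T" using st by (auto simp: h_def)
      have s: "s \<le> T" using st by simp
      obtain U V C where U: "U s = mat 1" "V s = mat 1"
        and UV: "\<And>t. s \<le> t \<Longrightarrow> t \<le> T \<Longrightarrow> norm (U t) \<le> B" "\<And>t. s \<le> t \<Longrightarrow> t \<le> T \<Longrightarrow> norm (V t) \<le> B"
          "\<And>t. s \<le> t \<Longrightarrow> t \<le> T \<Longrightarrow> norm (U t - V t) \<le> C1 * \<epsilon>"
        and J: "\<And>t. s \<le> t \<Longrightarrow> t \<le> T \<Longrightarrow> norm (U t - \<mu> s t) \<le> B * (t - s) powr \<theta>"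
          "\<And>t. s \<le> t \<Longrightarrow> t \<le> T \<Longrightarrow> norm (V t - \<nu> s t) \<le> B * (t - s) powr \<theta>"
          "\<And>t. s \<le> t \<Longrightarrow> t \<le> T \<Longrightarrow> norm ((U t - \<mu> s t) - (V t - \<nu> s t)) \<le> C1 * \<epsilon> * (t - s) powr \<theta>"
        and inc: "\<And>r t. s \<le> r \<Longrightarrow> r \<le> t \<Longrightarrow> t \<le> T \<Longrightarrow> norm (congr (U t) (p t) - congr (U r) (p r) + congr (U r) (w r t)) \<le> C * (t - r) powr \<theta>"
          "\<And>r t. s \<le> r \<Longrightarrow> r \<le> t \<Longrightarrow> t \<le> T \<Longrightarrow> norm (congr (V t) (p' t) - congr (V r) (p' r) + congr (V r) (w' r t)) \<le> C * (t - r) powr \<theta>"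
        using flows[OF st(1) s] by blast
      \<comment> \<open>The sources of one equation are summed along its flow from s; the errors of
        order \<theta> disappear, leaving a bound linear in t - s.\<close>
      have single: "norm (congr (U' t) (x t) - x s) \<le> B\<^sup>2 * F * t - B\<^sup>2 * F * s"
        if U': "U' s = mat 1" "\<And>t. s \<le> t \<Longrightarrow> t \<le> T \<Longrightarrow> norm (U' t) \<le> B"
          "\<And>r t. s \<le> r \<Longrightarrow> r \<le> t \<Longrightarrow> t \<le> T \<Longrightarrow> norm (congr (U' t) (x t) - congr (U' r) (x r) + congr (U' r) (v r t)) \<le> C * (t - r) powr \<theta>"
          and v: "\<And>r t. 0 \<le> r \<Longrightarrow> r \<le> t \<Longrightarrow> t \<le> T \<Longrightarrow> norm (v r t) \<le> F * (t - r)"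
        for U' x and v :: "real \<Rightarrow> real \<Rightarrow> real^'d^'d"
      proof -
        have "norm (congr (U' t) (x t) - congr (U' s) (x s)) \<le> B\<^sup>2 * F * t - B\<^sup>2 * F * s"
        proof (rule increment_le_of_almost[OF st(2) exps(3), of "\<lambda>t. congr (U' t) (x t)" "\<lambda>t. B\<^sup>2 * F * t" C])
          fix r z assume rz: "s \<le> r" "r \<le> z" "z \<le> t"
          have "norm (congr (U' r) (v r z)) \<le> B\<^sup>2 * (F * (z - r))"
            using U'(2)[of r] v[of r z] rz st by (intro order.trans[OF norm_congr_le[of _ B]] mult_left_mono) auto
          moreover have "norm (congr (U' z) (x z) - congr (U' r) (x r)) \<le>
            norm (congr (U' z) (x z) - congr (U' r) (x r) + congr (U' r) (v r z)) + norm (congr (U' r) (v r z))"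
            using norm_triangle_ineq4[of "congr (U' z) (x z) - congr (U' r) (x r) + congr (U' r) (v r z)" "congr (U' r) (v r z)"] by simp
          ultimately show "norm (congr (U' z) (x z) - congr (U' r) (x r)) \<le> B\<^sup>2 * F * z - B\<^sup>2 * F * r + C * (z - r) powr \<theta>"
            using U'(3)[of r z] rz st by (simp add: algebra_simps)
        qed
        then show ?thesis unfolding U'(1) congr_def by (simp add: mm_simps)
      qed
      have s1: "norm (p s - congr (U t) (p t)) \<le> B\<^sup>2 * F * h"
        using single[OF U(1) UV(1) inc(1) w(1)] by (simp add: norm_minus_commute h_def algebra_simps)
      have s2: "norm (p' s - congr (V t) (p' t)) \<le> B\<^sup>2 * F * h"
        using single[OF U(2) UV(2) inc(2) w(2)] by (simp add: norm_minus_commute h_def algebra_simps)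
      \<comment> \<open>The same summation for the difference of the two conjugated solutions, with
        rate C5 \<epsilon>.\<close>
      have "norm ((congr (U t) (p t) - congr (V t) (p' t)) - (congr (U s) (p s) - congr (V s) (p' s))) \<le> C5 * \<epsilon> * t - C5 * \<epsilon> * s"
      proof (rule increment_le_of_almost[OF st(2) exps(3), of "\<lambda>t. congr (U t) (p t) - congr (V t) (p' t)" "\<lambda>t. C5 * \<epsilon> * t" "2 * C"])
        fix r z assume rz: "s \<le> r" "r \<le> z" "z \<le> t"
        have rz': "s \<le> r" "r \<le> z" "z \<le> T" using rz st by auto
        define E where "E = congr (U z) (p z) - congr (U r) (p r) + congr (U r) (w r z)"
        define E' where "E' = congr (V z) (p' z) - congr (V r) (p' r) + congr (V r) (w' r z)"
        have eq: "congr (U z) (p z) - congr (V z) (p' z) - (congr (U r) (p r) - congr (V r) (p' r)) = (E - E')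
            - (congr (U r) (w r z) - congr (V r) (w' r z))" by (simp add: E_def E'_def)
        have "norm (E - E') \<le> C * (z - r) powr \<theta> + C * (z - r) powr \<theta>"
          unfolding E_def E'_def by (rule order.trans[OF norm_triangle_ineq4 add_mono[OF inc(1)[OF rz'] inc(2)[OF rz']]])
        moreover have "norm (congr (U r) (w r z) - congr (V r) (w' r z)) \<le> (C2 * \<epsilon> + C2 * norm (\<Delta> z)) * (z - r)"
          using source[of "U r" "V r" r z] UV[of r] rz st by simp
        moreover have "(C2 * \<epsilon> + C2 * norm (\<Delta> z)) * (z - r) \<le> (C2 * \<epsilon> + C2 * (C4 * \<epsilon>)) * (z - r)"
          using \<Delta>[of z] rz st C20 by (intro mult_right_mono add_left_mono mult_left_mono) auto
        ultimately show "norm (congr (U z) (p z) - congr (V z) (p' z) - (congr (U r) (p r) - congr (V r) (p' r)))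
            \<le> C5 * \<epsilon> * z - C5 * \<epsilon> * r + 2 * C * (z - r) powr \<theta>"
          unfolding eq C5_def
          by (intro order.trans[OF norm_triangle_ineq4]) (simp add: algebra_simps)
      qed
      then have s3: "norm ((p s - congr (U t) (p t)) - (p' s - congr (V t) (p' t))) \<le> C5 * \<epsilon> * h"
        unfolding U by (simp add: congr_def mm_simps norm_minus_commute h_def algebra_simps)
      have c1: "cl 1 h (p s - congr (U t) (p t)) (p' s - congr (V t) (p' t))"
        using s1 s2 s3 mult_right_mono[OF N(6) h(1)] mult_right_mono[OF N(5), of "\<epsilon> * h"] h \<epsilon>
        unfolding cl_def by (simp add: mult.assoc)
      have cJ: "cl 1 (h powr \<theta>) (U t - \<mu> s t) (V t - \<nu> s t)"
        using J[OF st(2,3)] mult_right_mono[OF N(2), of "h powr \<theta>"] mult_right_mono[OF N(3), of "\<epsilon> * h powr \<theta>"] \<epsilon>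
        unfolding cl_def h_def by (simp add: mult.assoc)
      have cp: "cl 1 1 (p t) (p' t)"
        using P1[of t] P1'[of t] \<Delta>[of t] st N mult_right_mono[OF N(4) \<epsilon>] unfolding cl_def \<Delta>_def by auto
      have cm: "cl 1 1 (\<mu> s t) (\<nu> s t)"
      proof -
        have "norm (\<mu> s t) \<le> N" "norm (\<nu> s t) \<le> N"
          using A.norm_germ_le[OF st] A'.norm_germ_le[OF st] N by (auto simp: power2_eq_square)
        moreover have "norm (\<mu> s t - \<nu> s t) \<le> N * \<epsilon>"
        proof -
          have "norm (\<mu> s t - \<nu> s t) \<le> K * \<epsilon> * h powr \<gamma>" using cf st unfolding close_flows_def h_def by auto
          also have "\<dots> \<le> K * \<epsilon> * K" using A.powr_bounds(1)[OF h] K \<epsilon> by (intro mult_left_mono) auto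
          also have "\<dots> = K * K * \<epsilon>" by simp
          also have "\<dots> \<le> N * \<epsilon>" using N \<epsilon> by (intro mult_right_mono) auto
          finally show ?thesis .
        qed
        ultimately show ?thesis unfolding cl_def by simp
      qed
      have sc: "h powr \<theta> \<le> N * h" using powr_le_scale[of h T N 1 \<theta>] h N exps by auto
      have sc1: "h powr \<theta> * 1 * 1 \<le> N * h" "1 * 1 * h powr \<theta> \<le> N * h" using sc by auto
      have sc0: "h \<le> N * 1" using h N by simp
      \<comment> \<open>The exact flow at t is now replaced by the germ. The error U t - \<mu> s t
        has order \<theta> and is \<epsilon>-close to its counterpart for \<nu>, so the exchange
        stays within order t - s.\<close>
      have e: "congr M' x - congr M x = transpose (M' - M) ** x ** M + (transpose M ** x ** (M' - M) + transpose (M' - M) ** x ** (M' - M))"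
        for M M' x :: "real^'d^'d" by (simp add: congr_def mm_simps algebra_simps)
      have c2: "cl 12 h (congr (U t) (p t) - congr (\<mu> s t) (p t)) (congr (V t) (p' t) - congr (\<nu> s t) (p' t))"
        unfolding e[of "U t"] e[of "V t"]
      proof (rule cl_up[OF cl_add[OF _ cl_add]])
        show "cl 6 h (transpose (U t - \<mu> s t) ** p t ** \<mu> s t) (transpose (V t - \<nu> s t) ** p' t ** \<nu> s t)"
          by (rule cl_fit[OF cl_mult[OF cl_mult[OF cl_transpose[OF cJ] cp] cm] sc1(1)]) simp
        show "cl 6 h (transpose (\<mu> s t) ** p t ** (U t - \<mu> s t)) (transpose (\<nu> s t) ** p' t ** (V t - \<nu> s t))"
          by (rule cl_fit[OF cl_mult[OF cl_mult[OF cl_transpose[OF cm] cp] cJ] sc1(2)]) simp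
        show "cl 8 h (transpose (U t - \<mu> s t) ** p t ** (U t - \<mu> s t)) (transpose (V t - \<nu> s t) ** p' t ** (V t - \<nu> s t))"
          by (rule cl_fit[OF cl_mult[OF cl_mult[OF cl_transpose[OF cl_scale[OF cl_scale[OF cJ sc] sc0]] cp] cJ]]) (use sc in auto)
      qed simp
      have "cl 15 h ((p s - congr (U t) (p t)) + (congr (U t) (p t) - congr (\<mu> s t) (p t)))
          ((p' s - congr (V t) (p' t)) + (congr (V t) (p' t) - congr (\<nu> s t) (p' t)))"
        by (rule cl_up[OF cl_add[OF c1 c2]]) simp
      then have c3: "cl 15 h (p s - congr (\<mu> s t) (p t)) (p' s - congr (\<nu> s t) (p' t))" by simp
      have "norm (p t - p' t) \<le> N ^ 15 * \<epsilon>"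
      proof -
        have "cl 15 1 (p t) (p' t)" by (rule cl_up[OF cp]) simp
        then show ?thesis unfolding cl_def by simp
      qed
      with c3 show "norm (p t - p' t) \<le> N ^ 15 * \<epsilon> \<and> norm (p s - congr (\<mu> s t) (p t)) \<le> N ^ 15 * (t - s) \<and>
        norm (p' s - congr (\<nu> s t) (p' t)) \<le> N ^ 15 * (t - s) \<and>
        norm ((p s - congr (\<mu> s t) (p t)) - (p' s - congr (\<nu> s t) (p' t))) \<le> N ^ 15 * \<epsilon> * (t - s)"
        unfolding cl_def h_def by simp
    qed
  qed (use K1 T exps in auto)
qed (use K T exps in auto)

section \<open>Hoelder seminorms\<close>

lemma holder_leD:
  assumes "holder T \<alpha> F \<le> ennreal C" "0 \<le> C" "0 \<le> s" "s < t" "t \<le> T"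
  shows "norm (F s t) \<le> C * (t - s) powr \<alpha>"
proof -
  have "ennreal (norm (F s t) / (t - s) powr \<alpha>) \<le> holder T \<alpha> F"
    unfolding holder_def using assms by (intro SUP_upper2[of "(s, t)"]) auto
  then have "norm (F s t) / (t - s) powr \<alpha> \<le> C"
    using assms by (metis ennreal_le_iff order_trans)
  then show ?thesis using assms by (simp add: divide_le_eq)
qed

lemma holder_leI:
  assumes "\<And>s t. 0 \<le> s \<Longrightarrow> s < t \<Longrightarrow> t \<le> T \<Longrightarrow> norm (F s t) \<le> C * (t - s) powr \<alpha>"
  shows "holder T \<alpha> F \<le> ennreal C"
  unfolding holder_def using assms
  by (intro SUP_least) (auto intro!: ennreal_leI simp: divide_le_eq)

lemma holder_finiteD:
  assumes "holder T \<alpha> F < \<infinity>"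
  obtains C where "0 \<le> C" "\<And>s t. 0 \<le> s \<Longrightarrow> s < t \<Longrightarrow> t \<le> T \<Longrightarrow> norm (F s t) \<le> C * (t - s) powr \<alpha>"
proof -
  have "holder T \<alpha> F = ennreal (enn2real (holder T \<alpha> F))" using assms by simp
  then show ?thesis using that[of "enn2real (holder T \<alpha> F)"] holder_leD[of T \<alpha> F "enn2real (holder T \<alpha> F)"] by simp
qed

lemma holder_finiteI:
  assumes "\<And>s t. 0 \<le> s \<Longrightarrow> s < t \<Longrightarrow> t \<le> T \<Longrightarrow> norm (F s t) \<le> C * (t - s) powr \<alpha>"
  shows "holder T \<alpha> F < \<infinity>"
  using holder_leI[of T F C \<alpha>, OF assms] by (metis ennreal_less_top infinity_ennreal_def order_le_less_trans)

section \<open>Rough integrals\<close>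

text \<open>It keeps the limit in \<open>has_rough_integral\<close> from being vacuous: two
  candidates are compared on one fine partition, which justifies the definite description in
  \<open>rough_integral\<close>. For t = 0 the partition has n = 0.\<close>

lemma ex_partition_mesh:
  assumes "0 \<le> t" "0 < \<delta>"
  shows "\<exists>n \<pi>. partition_mesh 0 t \<delta> n \<pi>"
proof (cases "t = 0")
  case True
  then show ?thesis by (intro exI[of _ 0] exI[of _ "\<lambda>_. 0"]) (simp add: partition_mesh_def)
next
  case False
  then have t: "0 < t" using assms by simp
  obtain n :: nat where n: "t / \<delta> < real n" using reals_Archimedean2 by blast
  have n0: "0 < real n" using n t assms by (meson divide_pos_pos less_trans)
  have "t / real n < \<delta>" using n n0 assms by (simp add: field_simps)
  then show ?thesis using t n0
    by (intro exI[of _ n] exI[of _ "\<lambda>i. t * real i / real n"])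
      (auto simp: partition_mesh_def divide_strict_right_mono diff_divide_distrib[symmetric] algebra_simps)
qed

text \<open>The germ differs from the increments of I by order \<theta>, and over a partition these
  errors add up to at most C t times the mesh to the power \<theta> - 1. Any path with matching
  increments therefore identifies the integral, whether it stems from sewing or from the equation
  itself.\<close>

lemma rough_integral_eq:
  fixes I :: "real \<Rightarrow> 'v::real_normed_vector"
  assumes \<theta>: "1 < \<theta>"
    and I: "\<And>s t. 0 \<le> s \<Longrightarrow> s \<le> t \<Longrightarrow> t \<le> T \<Longrightarrow>
      norm (I t - I s - (lin_app (Z s) (incr \<eta> s t) + bilin_app (Z' s) (\<eta>2 s t))) \<le> C * (t - s) powr \<theta>"
    and t: "0 \<le> t" "t \<le> T"
  shows "rough_integral \<eta> \<eta>2 Z Z' t = I t - I 0"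
proof -
  let ?X = "\<lambda>s t. lin_app (Z s) (incr \<eta> s t) + bilin_app (Z' s) (\<eta>2 s t)"
  have has: "has_rough_integral \<eta> \<eta>2 Z Z' t (I t - I 0)"
    unfolding has_rough_integral_def
  proof (intro allI impI)
    fix \<epsilon> :: real assume \<epsilon>: "0 < \<epsilon>"
    obtain h0 where h0: "0 < h0" "\<And>h. 0 \<le> h \<Longrightarrow> h \<le> h0 \<Longrightarrow> (\<bar>C\<bar> * t) * h powr (\<theta> - 1) \<le> \<epsilon> / 2"
      using powr_small_step[of "\<bar>C\<bar> * t" "\<theta> - 1" "\<epsilon> / 2"] \<theta> t \<epsilon> by auto
    show "\<exists>\<delta>>0. \<forall>n \<pi>. partition_mesh 0 t \<delta> n \<pi> \<longrightarrow> norm (rough_sum \<eta> \<eta>2 Z Z' n \<pi> - (I t - I 0)) < \<epsilon>"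
    proof (intro exI[of _ h0] conjI h0 allI impI)
      fix n \<pi> assume "partition_mesh 0 t h0 n \<pi>"
      then have \<pi>: "\<pi> 0 = 0" "\<pi> n = t" "\<And>i. i < n \<Longrightarrow> \<pi> i < \<pi> (Suc i) \<and> \<pi> (Suc i) - \<pi> i < h0"
        unfolding partition_mesh_def by auto
      have mono: "\<pi> i \<le> \<pi> j" if "i \<le> j" "j \<le> n" for i j
        using that
      proof (induction j rule: dec_induct)
        case (step k)
        then show ?case using \<pi>(3)[of k] by simp
      qed simp
      have tel: "I t - I 0 = (\<Sum>i<n. I (\<pi> (Suc i)) - I (\<pi> i))"
        using sum_lessThan_telescope[of "\<lambda>i. I (\<pi> i)" n] \<pi> by simp
      have tel': "t = (\<Sum>i<n. \<pi> (Suc i) - \<pi> i)"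
        using sum_lessThan_telescope[of \<pi> n] \<pi> by simp
      have "norm (rough_sum \<eta> \<eta>2 Z Z' n \<pi> - (I t - I 0))
          = norm (\<Sum>i<n. ?X (\<pi> i) (\<pi> (Suc i)) - (I (\<pi> (Suc i)) - I (\<pi> i)))"
        unfolding rough_sum_def tel by (simp add: sum_subtractf)
      also have "\<dots> \<le> (\<Sum>i<n. \<bar>C\<bar> * h0 powr (\<theta> - 1) * (\<pi> (Suc i) - \<pi> i))"
      proof (intro order.trans[OF norm_sum] sum_mono)
        fix i assume "i \<in> {..<n}"
        then have i: "i < n" by simp
        define h where "h = \<pi> (Suc i) - \<pi> i"
        have h: "0 < h" "h < h0" using \<pi>(3)[OF i] by (auto simp: h_def)
        have "norm (?X (\<pi> i) (\<pi> (Suc i)) - (I (\<pi> (Suc i)) - I (\<pi> i)))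
            = norm (I (\<pi> (Suc i)) - I (\<pi> i) - ?X (\<pi> i) (\<pi> (Suc i)))" by (rule norm_minus_commute)
        also have "\<dots> \<le> C * h powr \<theta>"
          unfolding h_def using mono[of 0 i] mono[of "Suc i" n] mono[of i "Suc i"] i \<pi>(1,2) t by (intro I) auto
        also have "\<dots> \<le> \<bar>C\<bar> * h powr \<theta>" by (intro mult_right_mono) auto
        also have "h powr \<theta> = h powr (\<theta> - 1) * h" using h by (simp add: powr_diff)
        also have "\<bar>C\<bar> * (h powr (\<theta> - 1) * h) \<le> \<bar>C\<bar> * (h0 powr (\<theta> - 1) * h)"
          using h \<theta> by (intro mult_left_mono mult_right_mono powr_mono2) auto
        finally show "norm (?X (\<pi> i) (\<pi> (Suc i)) - (I (\<pi> (Suc i)) - I (\<pi> i))) \<le> \<bar>C\<bar> * h0 powr (\<theta> - 1) * (\<pi> (Suc i) - \<pi> i)"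
          by (simp add: h_def mult.assoc)
      qed
      also have "\<dots> = \<bar>C\<bar> * h0 powr (\<theta> - 1) * t" unfolding sum_distrib_left[symmetric] tel'[symmetric] ..
      also have "\<dots> \<le> \<epsilon> / 2" using h0(2)[of h0] h0(1) by (simp add: mult_ac)
      finally show "norm (rough_sum \<eta> \<eta>2 Z Z' n \<pi> - (I t - I 0)) < \<epsilon>" using \<epsilon> by simp
    qed
  qed
  show ?thesis
    unfolding rough_integral_def
  proof (rule the_equality)
    show "has_rough_integral \<eta> \<eta>2 Z Z' t (I t - I 0)" by (rule has)
    fix J assume J: "has_rough_integral \<eta> \<eta>2 Z Z' t J"
    show "J = I t - I 0"
    proof (rule ccontr)
      assume ne: "J \<noteq> I t - I 0"
      define \<epsilon> where "\<epsilon> = norm (J - (I t - I 0)) / 2"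
      have \<epsilon>: "0 < \<epsilon>" using ne by (simp add: \<epsilon>_def)
      obtain d1 where d1: "0 < d1" "\<And>n \<pi>. partition_mesh 0 t d1 n \<pi> \<Longrightarrow> norm (rough_sum \<eta> \<eta>2 Z Z' n \<pi> - J) < \<epsilon>"
        using J \<epsilon> unfolding has_rough_integral_def by blast
      obtain d2 where d2: "0 < d2" "\<And>n \<pi>. partition_mesh 0 t d2 n \<pi> \<Longrightarrow> norm (rough_sum \<eta> \<eta>2 Z Z' n \<pi> - (I t - I 0)) < \<epsilon>"
        using has \<epsilon> unfolding has_rough_integral_def by blast
      obtain n \<pi> where p: "partition_mesh 0 t (min d1 d2) n \<pi>" using ex_partition_mesh[of t "min d1 d2"] t d1 d2 by auto
      let ?S = "rough_sum \<eta> \<eta>2 Z Z' n \<pi>"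
      have "norm (?S - J) < \<epsilon>" "norm (?S - (I t - I 0)) < \<epsilon>"
        using p by (auto intro!: d1(2) d2(2) simp: partition_mesh_def)
      moreover have "norm (J - (I t - I 0)) \<le> norm (?S - (I t - I 0)) + norm (?S - J)"
      proof -
        have "J - (I t - I 0) = (?S - (I t - I 0)) - (?S - J)" by simp
        then show ?thesis by (metis norm_triangle_ineq4)
      qed
      ultimately show False unfolding \<epsilon>_def by linarith
    qed
  qed
qed

section \<open>Geometric rough paths\<close>

text \<open>Integration by parts: the symmetrized integrand is the derivative of the product of two
  components of the increment.\<close>

lemma smooth_lift_symmetric:
  fixes x :: "real \<Rightarrow> real^'p"
  assumes "smooth_path T x" and T: "0 < T" and st: "0 \<le> s" "s \<le> t" "t \<le> T"
  shows "canonical_lift T x s t $ i $ j + canonical_lift T x s t $ j $ i = incr x s t $ i * incr x s t $ j"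
proof -
  obtain D where D: "D 0 = x" "\<And>k t. t \<in> {0..T} \<Longrightarrow> (D k has_vector_derivative D (Suc k) t) (at t within {0..T})"
    using assms(1) unfolding smooth_path_def by blast
  have sub: "{s..t} \<subseteq> {0..T}" using st by auto
  have dx: "(x has_vector_derivative D 1 r) (at r within {0..T})" if "r \<in> {0..T}" for r
    using D(2)[OF that, of 0] D(1) by simp
  have vd: "vector_derivative x (at r within {0..T}) = D 1 r" if "r \<in> {0..T}" for r
    using dx[OF that] that T by (intro vector_derivative_within_closed_interval) auto
  have cont: "continuous_on {0..T} (D k)" for k
    using D(2) by (meson continuous_on_eq_continuous_within has_vector_derivative_continuous)
  define f where "f r = tensor (incr x s r) (D 1 r)" for r
  have cx: "continuous_on {s..t} x" "continuous_on {s..t} (D 1)"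
    using cont[of 0] cont[of 1] D(1) sub by (auto intro: continuous_on_subset)
  have cf: "continuous_on {s..t} f"
    unfolding f_def tensor_def incr_def
    by (intro continuous_on_vec_lambda continuous_intros continuous_on_component cx)
  have "canonical_lift T x s t = (LINT r:{s..t}|lborel. f r)"
    unfolding canonical_lift_def f_def using vd sub
    by (intro set_lebesgue_integral_cong) auto
  also have "\<dots> = integral {s..t} f"
    using borel_integrable_compact[of "{s..t}" f] cf
    by (intro set_borel_integral_eq_integral) (auto simp: set_integrable_def)
  finally have lift: "(f has_integral canonical_lift T x s t) {s..t}"
    using integrable_continuous_real[OF cf] by (simp add: has_integral_iff)
  have comp: "((\<lambda>r. f r $ i $ j) has_integral canonical_lift T x s t $ i $ j) {s..t}" for i j
    using has_integral_linear[OF lift, of "\<lambda>M. M $ i $ j"]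
    by (simp add: o_def bounded_linear_compose[OF bounded_linear_vec_nth bounded_linear_vec_nth])
  have 1: "((\<lambda>r. f r $ i $ j + f r $ j $ i) has_integral (canonical_lift T x s t $ i $ j + canonical_lift T x s t $ j $ i)) {s..t}"
    by (intro has_integral_add comp)
  have d: "((\<lambda>r. incr x s r $ i) has_real_derivative D 1 r $ i) (at r within {s..t})" if "r \<in> {s..t}" for r i
  proof -
    have "(x has_vector_derivative D 1 r) (at r within {s..t})"
      using dx sub that by (intro has_vector_derivative_within_subset[OF _ sub]) auto
    then have "((\<lambda>r. x r $ i) has_vector_derivative D 1 r $ i) (at r within {s..t})"
      using bounded_linear.has_vector_derivative[OF bounded_linear_vec_nth] by blast
    then show ?thesis unfolding has_real_derivative_iff_has_vector_derivative incr_def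
      by (auto intro!: derivative_eq_intros)
  qed
  have "((\<lambda>r. f r $ i $ j + f r $ j $ i) has_integral (incr x s t $ i * incr x s t $ j - incr x s s $ i * incr x s s $ j)) {s..t}"
  proof (rule fundamental_theorem_of_calculus[OF st(2)])
    fix r assume r: "r \<in> {s..t}"
    show "((\<lambda>r. incr x s r $ i * incr x s r $ j) has_vector_derivative (f r $ i $ j + f r $ j $ i)) (at r within {s..t})"
      unfolding has_real_derivative_iff_has_vector_derivative[symmetric]
      by (rule DERIV_cong[OF DERIV_mult[OF d[OF r] d[OF r]]]) (simp add: f_def tensor_def algebra_simps)
  qed
  from has_integral_unique[OF 1 this] show ?thesis by (simp add: incr_def)
qed

text \<open>The identity for smooth lifts passes to the limit at fixed s and t, because the distance
  controls both levels there up to powers of t - s. The seminorms see only s < t; on the diagonal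
  both sides vanish by Chen's relation.\<close>

lemma geometric_symmetric:
  fixes \<eta> :: "real \<Rightarrow> real^'p"
  assumes geo: "geometric_rough_path T \<gamma> \<eta> \<eta>2" and T: "0 < T" and st: "0 \<le> s" "s < t" "t \<le> T"
  shows "\<eta>2 s t $ i $ j + \<eta>2 s t $ j $ i = incr \<eta> s t $ i * incr \<eta> s t $ j"
proof -
  define c where "c = (t - s) powr (2 * \<gamma>)"
  define d where "d = (t - s) powr \<gamma>"
  define E where "E = \<bar>\<eta>2 s t $ i $ j + \<eta>2 s t $ j $ i - incr \<eta> s t $ i * incr \<eta> s t $ j\<bar>"
  define B where "B = norm (incr \<eta> s t)"
  \<comment> \<open>The two entries of the second level contribute 2 c \<epsilon>. The product of
    increments contributes d \<epsilon> (d + 2 B), since for \<epsilon> \<le> 1 the components of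
    the increment of x are at most d + B.\<close>
  have "E \<le> \<epsilon> * (2 * c + d * (d + 2 * B))" if \<epsilon>: "0 < \<epsilon>" "\<epsilon> \<le> 1" for \<epsilon>
  proof -
    obtain x where x: "smooth_path T x" "rough_dist T \<gamma> x (canonical_lift T x) \<eta> \<eta>2 < ennreal \<epsilon>"
      using geo \<epsilon> unfolding geometric_rough_path_def by blast
    let ?L = "canonical_lift T x s t" and ?a = "incr x s t" and ?b = "incr \<eta> s t"
    have h: "holder T \<gamma> (\<lambda>s t. incr x s t - incr \<eta> s t) \<le> ennreal \<epsilon>"
      "holder T (2 * \<gamma>) (\<lambda>s t. canonical_lift T x s t - \<eta>2 s t) \<le> ennreal \<epsilon>"
      using x(2) unfolding rough_dist_def
      by (auto intro: order.trans[OF _ less_imp_le[OF x(2)[unfolded rough_dist_def]]] simp: add_increasing add_increasing2)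
    have 1: "norm (?a - ?b) \<le> \<epsilon> * d" using holder_leD[OF h(1)] \<epsilon> st unfolding d_def by auto
    have 2: "norm (?L - \<eta>2 s t) \<le> \<epsilon> * c" using holder_leD[OF h(2)] \<epsilon> st unfolding c_def by auto
    have 3: "\<bar>?L $ k $ l - \<eta>2 s t $ k $ l\<bar> \<le> \<epsilon> * c" for k l
      using 2 Finite_Cartesian_Product.norm_nth_le[of "?L - \<eta>2 s t" k]
        Finite_Cartesian_Product.norm_nth_le[of "(?L - \<eta>2 s t) $ k" l] by simp
    have 4: "\<bar>?a $ k - ?b $ k\<bar> \<le> \<epsilon> * d" for k
      using 1 Finite_Cartesian_Product.norm_nth_le[of "?a - ?b" k] by simp
    have b: "\<bar>?b $ k\<bar> \<le> B" for k unfolding B_def using Finite_Cartesian_Product.norm_nth_le[of ?b k] by simp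
    have d0: "0 \<le> d" "0 \<le> B" by (auto simp: d_def B_def)
    have "\<epsilon> * d \<le> d" using \<epsilon> d0 by (simp add: mult_left_le_one_le)
    then have a: "\<bar>?a $ k\<bar> \<le> d + B" for k using 4[of k] b[of k] by linarith
    have "?a $ i * ?a $ j - ?b $ i * ?b $ j = (?a $ i - ?b $ i) * ?a $ j + ?b $ i * (?a $ j - ?b $ j)" by (simp add: algebra_simps)
    then have "\<bar>?a $ i * ?a $ j - ?b $ i * ?b $ j\<bar> \<le> \<bar>?a $ i - ?b $ i\<bar> * \<bar>?a $ j\<bar> + \<bar>?b $ i\<bar> * \<bar>?a $ j - ?b $ j\<bar>"
      by (metis abs_mult abs_triangle_ineq)
    also have "\<dots> \<le> (\<epsilon> * d) * (d + B) + B * (\<epsilon> * d)"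
      using 4 a b d0 \<epsilon> by (intro add_mono mult_mono) auto
    finally have "\<bar>?a $ i * ?a $ j - ?b $ i * ?b $ j\<bar> \<le> \<epsilon> * (d * (d + 2 * B))" by (simp add: algebra_simps)
    moreover have "?L $ i $ j + ?L $ j $ i = ?a $ i * ?a $ j"
      using smooth_lift_symmetric[OF x(1) T] st by simp
    ultimately have "E \<le> 2 * (\<epsilon> * c) + \<epsilon> * (d * (d + 2 * B))" unfolding E_def using 3[of i j] 3[of j i] by linarith
    then show ?thesis by (simp add: algebra_simps)
  qed
  then have le: "E \<le> \<epsilon> * (2 * c + d * (d + 2 * B))" if "0 < \<epsilon>" "\<epsilon> \<le> 1" for \<epsilon> using that by blast
  have "((\<lambda>\<epsilon>. \<epsilon> * (2 * c + d * (d + 2 * B))) \<longlongrightarrow> 0 * (2 * c + d * (d + 2 * B))) (at_right 0)"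
    by (intro tendsto_intros)
  moreover have "eventually (\<lambda>\<epsilon>. E \<le> \<epsilon> * (2 * c + d * (d + 2 * B))) (at_right (0::real))"
    unfolding eventually_at_right_field using le by (intro exI[of _ 1]) auto
  ultimately have "E \<le> 0 * (2 * c + d * (d + 2 * B))" by (intro tendsto_lowerbound) auto
  then show ?thesis unfolding E_def by simp
qed

section \<open>The second-order expansion\<close>

definition xi1 :: "real^'d^'d \<Rightarrow> real^'d^'d \<Rightarrow> real^'d^'d" where
  "xi1 p G1 = p ** G1 + transpose G1 ** p"

text \<open>With \<open>G1\<close> and \<open>G2\<close> the two levels of the germ, xi1 and xi2
  form the local expansion, from the left endpoint, of the rough integral in the equation. The
  subtracted products stem from the Gubinelli derivative of p, which the equation
  prescribes.\<close>

definition xi2 :: "real^'d^'d \<Rightarrow> real^'d^'d \<Rightarrow> real^'d^'d \<Rightarrow> real^'d^'d" where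
  "xi2 p G1 G2 = p ** G2 + transpose G2 ** p
    - (p ** G1 ** G1 + transpose G1 ** p ** G1 + transpose G1 ** transpose G1 ** p)"

text \<open>Moving p forward by minus (xi1 + xi2) and back by the congruence is the identity up to
  third order: terms of order 0, 1 and 2 cancel, and every term on the right contains at least three
  factors of order \<gamma>, with \<open>G2\<close> counted twice.\<close>

lemma congr_xi:
  "congr (mat 1 + (G1 + G2)) (p - (xi1 p G1 + xi2 p G1 G2)) - p =
     (transpose G1 ** p ** G2 + transpose G2 ** p ** (G1 + G2))
     - (transpose G2 ** (xi1 p G1 + xi2 p G1 G2) + transpose G1 ** xi2 p G1 G2)
     - ((xi1 p G1 + xi2 p G1 G2) ** G2 + xi2 p G1 G2 ** G1)
     - transpose (G1 + G2) ** (xi1 p G1 + xi2 p G1 G2) ** (G1 + G2)"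
  unfolding congr_def xi1_def xi2_def by (simp add: mm_simps algebra_simps)

lemma double_sum_symmetric:
  fixes F :: "'p::finite \<Rightarrow> 'p \<Rightarrow> 'v::real_vector"
  assumes "\<And>i j. M i j + M j i = x i * x j"
  shows "(\<Sum>i\<in>UNIV. \<Sum>j\<in>UNIV. M i j *\<^sub>R F i j) + (\<Sum>i\<in>UNIV. \<Sum>j\<in>UNIV. M i j *\<^sub>R F j i)
    = (\<Sum>i\<in>UNIV. \<Sum>j\<in>UNIV. (x i * x j) *\<^sub>R F i j)"
proof -
  have "(\<Sum>i\<in>UNIV. \<Sum>j\<in>UNIV. M i j *\<^sub>R F j i) = (\<Sum>i\<in>UNIV. \<Sum>j\<in>UNIV. M j i *\<^sub>R F i j)"
    by (rule sum.swap)
  then show ?thesis by (simp add: sum.distrib[symmetric] scaleR_add_left[symmetric] assms)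
qed

lemma lin_app_mult_left: "lin_app (\<chi> j. p ** (L $ j)) x = p ** lin_app L x"
  for L :: "(real^'n^'m)^'p" and p :: "real^'m^'k"
  by (simp add: lin_app_def mm.sum_right mm.scaleR_right)

lemma lin_app_mult_right: "lin_app (\<chi> j. (L $ j) ** p) x = lin_app L x ** p"
  for L :: "(real^'n^'m)^'p" and p :: "real^'k^'n"
  by (simp add: lin_app_def mm.sum_left mm.scaleR_left)

lemma lin_app_transpose: "lin_app (\<chi> j. transpose (L $ j)) x = transpose (lin_app L x)"
  for L :: "(real^'n^'m)^'p"
  by (simp add: lin_app_def transpose_sum transpose_algebra)

lemma lin_app_riccati_integrand:
  "lin_app (riccati_integrand D p s) x = xi1 (p s) (lin_app (A1 D s) x)"
proof -
  have "riccati_integrand D p s = (\<chi> j. p s ** (A1 D s $ j)) + (\<chi> j. (\<chi> j. transpose (A1 D s $ j)) $ j ** p s)"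
    by (simp add: riccati_integrand_def vec_eq_iff)
  then show ?thesis
    by (simp only: lin_app_algebra lin_app_mult_left lin_app_mult_right lin_app_transpose xi1_def)
qed

text \<open>Inserting the prescribed p' into the Leibniz rule yields the products
  \<open>A i ** A j\<close>, whereas \<open>second_level\<close> contains \<open>A j ** A i\<close>.
  The hypothesis \<open>sym\<close>, valid for geometric paths, exchanges the order through V = G G
  - W; it also combines the two mixed sums Y and Y' into the congruence of p by G.\<close>

lemma bilin_app_riccati_integrand_deriv:
  fixes D :: "('d::finite, 'p::finite) riccati_data"
  assumes p': "p' s = - riccati_integrand D p s" and sym: "\<And>i j. M $ i $ j + M $ j $ i = x $ i * x $ j"
  shows "bilin_app (riccati_integrand_deriv D p p' s) M =
    xi2 (p s) (lin_app (A1 D s) x) (bilin_app (second_level (A1 D) (A1' D) s) M)"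
proof -
  let ?p = "p s"
  define A where "A j = A1 D s $ j" for j
  define N where "N = bilin_app (A1' D s) M"
  define W where "W = (\<Sum>i\<in>UNIV. \<Sum>j\<in>UNIV. (M $ i $ j) *\<^sub>R (A j ** A i))"
  define V where "V = (\<Sum>i\<in>UNIV. \<Sum>j\<in>UNIV. (M $ i $ j) *\<^sub>R (A i ** A j))"
  define Y where "Y = (\<Sum>i\<in>UNIV. \<Sum>j\<in>UNIV. (M $ i $ j) *\<^sub>R (transpose (A i) ** ?p ** A j))"
  define Y' where "Y' = (\<Sum>i\<in>UNIV. \<Sum>j\<in>UNIV. (M $ i $ j) *\<^sub>R (transpose (A j) ** ?p ** A i))"
  define G where "G = lin_app (A1 D s) x"
  have G2: "bilin_app (second_level (A1 D) (A1' D) s) M = N + W"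
    by (simp add: bilin_app_def second_level_def N_def W_def A_def scaleR_add_right sum.distrib)
  have GG: "G ** G = (\<Sum>i\<in>UNIV. \<Sum>j\<in>UNIV. (x $ i * x $ j) *\<^sub>R (A i ** A j))"
    unfolding G_def lin_app_mult_lin_app A_def ..
  have V: "V = G ** G - W"
    using double_sum_symmetric[where M = "\<lambda>i j. M $ i $ j" and x = "\<lambda>i. x $ i" and F = "\<lambda>i j. A i ** A j", OF sym]
    unfolding GG V_def W_def by (simp add: algebra_simps)
  have "transpose G ** ?p ** G = lin_app (\<chi> j. transpose (A j) ** ?p) x ** G"
    unfolding G_def A_def using lin_app_mult_right[of "\<chi> j. transpose (A1 D s $ j)" ?p x]
    by (simp add: lin_app_transpose)
  also have "\<dots> = (\<Sum>i\<in>UNIV. \<Sum>j\<in>UNIV. (x $ i * x $ j) *\<^sub>R (transpose (A i) ** ?p ** A j))"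
    unfolding G_def lin_app_mult_lin_app A_def by simp
  also have "\<dots> = Y + Y'"
    using double_sum_symmetric[where M = "\<lambda>i j. M $ i $ j" and x = "\<lambda>i. x $ i" and F = "\<lambda>i j. transpose (A i) ** ?p ** A j", OF sym]
    unfolding Y_def Y'_def by simp
  finally have YY: "Y + Y' = transpose G ** ?p ** G" by simp
  have entry: "riccati_integrand_deriv D p p' s $ i $ j =
      (?p ** (A1' D s $ i $ j) + transpose (A1' D s $ i $ j) ** ?p)
      - (?p ** (A i ** A j) + transpose (A i) ** ?p ** A j + transpose (A j) ** ?p ** A i + transpose (A i ** A j) ** ?p)" for i j
    unfolding riccati_integrand_deriv_def p' riccati_integrand_def A_def
    by (simp add: mm_simps algebra_simps)
  have "bilin_app (riccati_integrand_deriv D p p' s) M = (?p ** N + transpose N ** ?p) - (?p ** V + Y + Y' + transpose V ** ?p)"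
    unfolding bilin_app_def entry N_def V_def Y_def Y'_def
    by (simp only: scaleR_diff_right scaleR_add_right sum_subtractf sum.distrib transpose_sum transpose_algebra
        mm.sum_left mm.sum_right mm.scaleR_left mm.scaleR_right)
  also have "\<dots> = xi2 ?p G (N + W)"
    unfolding V xi2_def using YY by (simp add: mm_simps algebra_simps)
  finally show ?thesis unfolding G_def G2 .
qed

section \<open>Drift coefficients\<close>

lemma bounded_measurableD:
  assumes "bounded_measurable T f"
  obtains C where "0 \<le> C" "\<And>t. 0 \<le> t \<Longrightarrow> t \<le> T \<Longrightarrow> norm (f t) \<le> C"
proof -
  obtain C where "\<forall>x\<in>f ` {0..T}. norm x \<le> C"
    using assms unfolding bounded_measurable_def bounded_iff by blast
  then show ?thesis by (intro that[of "\<bar>C\<bar>"]) force+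
qed

lemma bounded_measurableI:
  assumes "f \<in> borel_measurable (restrict_space borel {0..T})" "\<And>t. 0 \<le> t \<Longrightarrow> t \<le> T \<Longrightarrow> norm (f t) \<le> C"
  shows "bounded_measurable T f"
  using assms unfolding bounded_measurable_def bounded_iff by (auto intro!: exI[of _ C])

lemma bounded_measurable_mult:
  assumes f: "bounded_measurable T f" and g: "bounded_measurable T g"
  shows "bounded_measurable T (\<lambda>t. f t ** g t)"
proof -
  obtain C where C: "0 \<le> C" "\<And>t. 0 \<le> t \<Longrightarrow> t \<le> T \<Longrightarrow> norm (f t) \<le> C" using bounded_measurableD[OF f] by blast
  obtain C' where C': "0 \<le> C'" "\<And>t. 0 \<le> t \<Longrightarrow> t \<le> T \<Longrightarrow> norm (g t) \<le> C'" using bounded_measurableD[OF g] by blast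
  show ?thesis
  proof (rule bounded_measurableI[of _ _ "C * C'"])
    show "(\<lambda>t. f t ** g t) \<in> borel_measurable (restrict_space borel {0..T})"
      using f g unfolding bounded_measurable_def
      by (intro borel_measurable_continuous_Pair[where H = "(**)"] mm.continuous_on continuous_intros) auto
    show "norm (f t ** g t) \<le> C * C'" if "0 \<le> t" "t \<le> T" for t
      using C C' that by (intro order.trans[OF norm_matrix_mult_le] mult_mono) auto
  qed
qed

lemma bounded_measurable_transpose:
  assumes f: "bounded_measurable T f"
  shows "bounded_measurable T (\<lambda>t. transpose (f t))"
proof -
  obtain C where C: "0 \<le> C" "\<And>t. 0 \<le> t \<Longrightarrow> t \<le> T \<Longrightarrow> norm (f t) \<le> C" using bounded_measurableD[OF f] by blast
  show ?thesis
  proof (rule bounded_measurableI[of _ _ C])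
    show "(\<lambda>t. transpose (f t)) \<in> borel_measurable (restrict_space borel {0..T})"
      using f unfolding bounded_measurable_def
      by (intro borel_measurable_continuous_on[OF linear_continuous_on[OF bounded_linear_transpose]]) auto
  qed (use C in simp)
qed

lemma bounded_measurable_add:
  assumes f: "bounded_measurable T f" and g: "bounded_measurable T g"
  shows "bounded_measurable T (\<lambda>t. f t + g t)" "bounded_measurable T (\<lambda>t. f t - g t)"
proof -
  obtain C where C: "0 \<le> C" "\<And>t. 0 \<le> t \<Longrightarrow> t \<le> T \<Longrightarrow> norm (f t) \<le> C" using bounded_measurableD[OF f] by blast
  obtain C' where C': "0 \<le> C'" "\<And>t. 0 \<le> t \<Longrightarrow> t \<le> T \<Longrightarrow> norm (g t) \<le> C'" using bounded_measurableD[OF g] by blast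
  have m: "f \<in> borel_measurable (restrict_space borel {0..T})" "g \<in> borel_measurable (restrict_space borel {0..T})"
    using f g unfolding bounded_measurable_def by auto
  show "bounded_measurable T (\<lambda>t. f t + g t)"
    using C C' m by (intro bounded_measurableI[of _ _ "C + C'"] borel_measurable_add) (auto intro!: norm_triangle_mono)
  show "bounded_measurable T (\<lambda>t. f t - g t)"
    using C C' m by (intro bounded_measurableI[of _ _ "C + C'"] borel_measurable_diff)
      (auto intro!: order.trans[OF norm_triangle_ineq4] add_mono)
qed

lemma bounded_measurable_continuous:
  assumes "continuous_on {0..T} f" shows "bounded_measurable T f"
  using assms unfolding bounded_measurable_def
  by (auto intro!: borel_measurable_continuous_on_restrict compact_imp_bounded compact_continuous_image)

lemma bounded_measurable_set_integrable:
  assumes f: "bounded_measurable T f" and st: "0 \<le> s" "t \<le> T"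
  shows "set_integrable lborel {s..t} f"
proof -
  obtain C where C: "0 \<le> C" "\<And>t. 0 \<le> t \<Longrightarrow> t \<le> T \<Longrightarrow> norm (f t) \<le> C" using bounded_measurableD[OF f] by blast
  let ?g = "\<lambda>x. indicator {0..T} x *\<^sub>R f x"
  have "?g \<in> borel_measurable borel"
    using f unfolding bounded_measurable_def by (simp add: borel_measurable_restrict_space_iff)
  then have "integrable lborel (\<lambda>x. indicator {s..t} x *\<^sub>R ?g x)"
    by (intro integrableI_bounded_set_indicator[where B = C])
      (use C in \<open>auto simp: indicator_def emeasure_lborel_Icc_eq\<close>)
  moreover have "(\<lambda>x. indicator {s..t} x *\<^sub>R ?g x) = (\<lambda>x. indicator {s..t} x *\<^sub>R f x)"
    using st by (auto simp: indicator_def)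
  ultimately show ?thesis unfolding set_integrable_def by simp
qed

lemma bounded_measurable_integral:
  assumes f: "bounded_measurable T f" and st: "0 \<le> s" "t \<le> T"
  shows "f integrable_on {s..t}" "(LINT r:{s..t}|lborel. f r) = integral {s..t} f"
  using set_borel_integral_eq_integral[OF bounded_measurable_set_integrable[OF assms]] by auto

lemma integral_add_intervals:
  assumes f: "bounded_measurable T f" and "0 \<le> s" "s \<le> u" "u \<le> t" "t \<le> T"
  shows "integral {s..t} f = integral {s..u} f + integral {u..t} f"
  using Henstock_Kurzweil_Integration.integral_combine[of s u t f] bounded_measurable_integral(1)[OF f, of s t] assms by auto

lemma norm_integral_bounded_measurable_le:
  assumes f: "bounded_measurable T f" and st: "0 \<le> s" "s \<le> t" "t \<le> T"
    and C: "\<And>r. s \<le> r \<Longrightarrow> r \<le> t \<Longrightarrow> norm (f r) \<le> C"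
  shows "norm (integral {s..t} f) \<le> C * (t - s)"
proof -
  have "norm (integral {s..t} f) \<le> integral {s..t} (\<lambda>_. C)"
    using bounded_measurable_integral(1)[OF f] st C by (intro integral_norm_bound_integral) auto
  then show ?thesis using st by (simp add: mult.commute)
qed

lemma nonneg_definite_integral:
  assumes f: "bounded_measurable T f" and st: "0 \<le> s" "s \<le> t" "t \<le> T"
    and psd: "\<And>r. 0 \<le> r \<Longrightarrow> r \<le> T \<Longrightarrow> nonneg_definite (f r)"
  shows "nonneg_definite (integral {s..t} f)"
proof -
  have int: "f integrable_on {s..t}" using bounded_measurable_integral(1)[OF f] st by auto
  have "transpose (integral {s..t} f) = integral {s..t} (transpose \<circ> f)"
    using integral_linear[OF int bounded_linear_transpose] by simp
  also have "\<dots> = integral {s..t} f"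
    using psd st by (intro Henstock_Kurzweil_Integration.integral_cong) (auto simp: nonneg_definite_def)
  finally have 1: "transpose (integral {s..t} f) = integral {s..t} f" .
  have 2: "0 \<le> x \<bullet> (integral {s..t} f *v x)" for x
  proof -
    have bl: "bounded_linear (\<lambda>M. x \<bullet> (M *v x))"
      by (rule bounded_linear_intro[of _ "(norm x)\<^sup>2"])
        (use quadratic_form_le in \<open>auto simp: matrix_vector_mult_add_rdistrib inner_add_right scaleR_matrix_vector_assoc[symmetric]\<close>)
    have "x \<bullet> (integral {s..t} f *v x) = integral {s..t} ((\<lambda>M. x \<bullet> (M *v x)) \<circ> f)"
      using integral_linear[OF int bl] by simp
    also have "0 \<le> \<dots>"
      using psd st integrable_linear[OF int bl]
      by (intro Henstock_Kurzweil_Integration.integral_nonneg) (auto simp: nonneg_definite_def)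
    finally show ?thesis .
  qed
  show ?thesis using 1 2 unfolding nonneg_definite_def by blast
qed

text \<open>Everything follows from the coercivity of R with constant r. It bounds the inverse by 1
  / r as an operator; the Frobenius norm is estimated by the sum of the norms of the columns, whence
  the factor CARD('d).\<close>

lemma coercive_inverse:
  fixes R :: "real^'d^'d"
  assumes r: "0 < r" and pd: "positive_definite (R - r *\<^sub>R mat 1)"
  shows "R ** matrix_inv R = mat 1" "matrix_inv R ** R = mat 1" "nonneg_definite (matrix_inv R)"
    "norm (matrix_inv R) \<le> real CARD('d) / r"
proof -
  have coer: "r * (norm x)\<^sup>2 \<le> x \<bullet> (R *v x)" for x
  proof (cases "x = 0")
    case False
    then have "0 < x \<bullet> ((R - r *\<^sub>R mat 1) *v x)" using pd unfolding positive_definite_def by blast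
    then show ?thesis
      by (simp add: matrix_vector_mult_diff_rdistrib inner_diff_right scaleR_matrix_vector_assoc[symmetric]
          power2_norm_eq_inner)
  qed simp
  have sym: "transpose R = R"
    using pd unfolding positive_definite_def by (simp add: transpose_algebra transpose_mat)
  have "x = 0" if "R *v x = 0" for x
    using coer[of x] that r by (simp add: mult_le_0_iff)
  then obtain L where "L ** R = mat 1" using matrix_left_invertible_ker[of R] by blast
  then have inv: "invertible R" using invertible_left_inverse by blast
  show 1: "R ** matrix_inv R = mat 1" "matrix_inv R ** R = mat 1"
    using someI_ex[OF inv[unfolded invertible_def]] unfolding matrix_inv_def by auto
  have RR: "R *v (matrix_inv R *v x) = x" for x
    by (simp add: matrix_vector_mul_assoc 1)
  have "transpose (matrix_inv R) ** R = mat 1"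
    using arg_cong[OF 1(1), of transpose] by (simp add: matrix_transpose_mul sym transpose_mat)
  then have "transpose (matrix_inv R) = matrix_inv R"
    by (metis 1(1) matrix_mul_assoc matrix_mul_lid matrix_mul_rid)
  moreover have "0 \<le> x \<bullet> (matrix_inv R *v x)" for x
  proof -
    have "0 \<le> r * (norm (matrix_inv R *v x))\<^sup>2" using r by simp
    also have "\<dots> \<le> (matrix_inv R *v x) \<bullet> (R *v (matrix_inv R *v x))" by (rule coer)
    finally show ?thesis unfolding RR by (simp add: inner_commute)
  qed
  ultimately show "nonneg_definite (matrix_inv R)" unfolding nonneg_definite_def by blast
  have le: "norm (matrix_inv R *v x) \<le> norm x / r" for x
  proof -
    let ?y = "matrix_inv R *v x"
    have "r * (norm ?y)\<^sup>2 \<le> ?y \<bullet> x" using coer[of ?y] unfolding RR .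
    also have "\<dots> \<le> norm ?y * norm x" using Cauchy_Schwarz_ineq2[of ?y x] by simp
    finally have "norm ?y * (r * norm ?y) \<le> norm ?y * norm x" by (simp add: power2_eq_square mult_ac)
    then show ?thesis using r by (cases "norm ?y = 0") (auto simp: field_simps mult_le_cancel_left)
  qed
  have col: "transpose (matrix_inv R) $ j = matrix_inv R *v axis j 1" for j
    by (simp add: matrix_vector_mult_basis column_def transpose_def vec_eq_iff)
  have "norm (matrix_inv R) = norm (transpose (matrix_inv R))" by simp
  also have "\<dots> \<le> (\<Sum>j\<in>UNIV. norm (transpose (matrix_inv R) $ j))"
    unfolding norm_vec_def[of "transpose (matrix_inv R)"] by (simp add: L2_set_le_sum)
  also have "\<dots> \<le> (\<Sum>j\<in>(UNIV :: 'd set). 1 / r)"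
  proof (rule sum_mono)
    fix j :: 'd
    show "norm (transpose (matrix_inv R) $ j) \<le> 1 / r"
      unfolding col using le[of "axis j 1"] by (simp add: norm_axis_1)
  qed
  finally show "norm (matrix_inv R) \<le> real CARD('d) / r" by simp
qed

lemma matrix_inv_diff:
  fixes R R' :: "real^'d^'d"
  assumes "matrix_inv R ** R = mat 1" "R' ** matrix_inv R' = mat 1"
  shows "matrix_inv R - matrix_inv R' = matrix_inv R ** (R' - R) ** matrix_inv R'"
proof -
  have "matrix_inv R ** (R' - R) ** matrix_inv R' = matrix_inv R ** (R' ** matrix_inv R') - (matrix_inv R ** R) ** matrix_inv R'"
    by (simp add: mm_simps)
  then show ?thesis by (simp add: assms mm_simps)
qed

text \<open>Inversion is continuous on the set of uniformly coercive matrices, by the resolvent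
  identity \<open>matrix_inv_diff\<close> and the uniform bound on the inverses, so measurability
  passes through the composition.\<close>

lemma bounded_measurable_inverse:
  assumes r: "0 < r" and R: "bounded_measurable T R"
    and pd: "\<And>t. 0 \<le> t \<Longrightarrow> t \<le> T \<Longrightarrow> positive_definite (R t - r *\<^sub>R mat 1 :: real^'d^'d)"
  shows "bounded_measurable T (\<lambda>t. matrix_inv (R t))"
proof (rule bounded_measurableI[of _ _ "real CARD('d) / r"])
  let ?C = "{R :: real^'d^'d. positive_definite (R - r *\<^sub>R mat 1)}"
  let ?c = "real CARD('d) / r"
  have c0: "0 < ?c" using r by simp
  have "continuous_on ?C matrix_inv"
  proof (rule continuous_onI)
    fix X e assume X: "X \<in> ?C" and e: "0 < (e :: real)"
    have "dist (matrix_inv Y) (matrix_inv X) \<le> e" if Y: "Y \<in> ?C" "dist Y X < e / (?c * ?c)" for Y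
    proof -
      have i: "positive_definite (X - r *\<^sub>R mat 1)" "positive_definite (Y - r *\<^sub>R mat 1)" using X Y by auto
      have "norm (matrix_inv Y - matrix_inv X) \<le> norm (matrix_inv Y) * norm (X - Y) * norm (matrix_inv X)"
        unfolding matrix_inv_diff[OF coercive_inverse(2)[OF r i(2)] coercive_inverse(1)[OF r i(1)]]
        by (rule norm_matrix_mult3_le)
      also have "\<dots> \<le> ?c * (e / (?c * ?c)) * ?c"
        using coercive_inverse(4)[OF r i(1)] coercive_inverse(4)[OF r i(2)] Y(2) c0 e r
        by (intro mult_mono mult_nonneg_nonneg divide_nonneg_nonneg) (auto simp: dist_norm norm_minus_commute)
      also have "\<dots> = e" using c0 r by simp
      finally show ?thesis by (simp add: dist_norm)
    qed
    then show "\<exists>d>0. \<forall>Y\<in>?C. dist Y X < d \<longrightarrow> dist (matrix_inv Y) (matrix_inv X) \<le> e"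
      using divide_pos_pos[OF e mult_pos_pos[OF c0 c0]] by blast
  qed
  then have m: "matrix_inv \<in> borel_measurable (restrict_space borel ?C)"
    by (rule borel_measurable_continuous_on_restrict)
  have "R \<in> measurable (restrict_space borel {0..T}) (restrict_space borel ?C)"
    using R pd unfolding bounded_measurable_def
    by (intro measurable_restrict_space2) (auto simp: space_restrict_space)
  from measurable_compose[OF this m]
  show "(\<lambda>t. matrix_inv (R t)) \<in> borel_measurable (restrict_space borel {0..T})" .
  show "norm (matrix_inv (R t)) \<le> ?c" if "0 \<le> t" "t \<le> T" for t
    by (rule coercive_inverse(4)[OF r pd[OF that]])
qed

definition Sfun :: "('d::finite, 'p::finite) riccati_data \<Rightarrow> real \<Rightarrow> real^'d^'d" where
  "Sfun D t = Bfun D t ** matrix_inv (Rfun D t) ** transpose (Bfun D t)"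

definition drift_prim :: "(real \<Rightarrow> real^'d^'d) \<Rightarrow> real \<Rightarrow> real \<Rightarrow> real^'d^'d" where
  "drift_prim f s t = integral {s..t} f"

definition frozen_drift :: "('d::finite, 'p::finite) riccati_data \<Rightarrow> real \<Rightarrow> real^'d^'d \<Rightarrow> real^'d^'d" where
  "frozen_drift D r y = y ** Afun D r + transpose (Afun D r) ** y - y ** Sfun D r ** y + Qfun D r"

lemma riccati_drift_eq: "riccati_drift D p r = frozen_drift D r (p r)"
  by (simp add: riccati_drift_def frozen_drift_def Sfun_def matrix_mul_assoc)

locale drift_coeffs =
  fixes T r :: real and D :: "('d::finite, 'p::finite) riccati_data"
  assumes r: "0 < r" and T: "0 < T"
    and meas: "bounded_measurable T (Afun D)" "bounded_measurable T (Bfun D)"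
      "bounded_measurable T (Qfun D)" "bounded_measurable T (Rfun D)"
    and pd: "\<And>t. 0 \<le> t \<Longrightarrow> t \<le> T \<Longrightarrow> positive_definite (Rfun D t - r *\<^sub>R mat 1)"
    and Qpsd: "\<And>t. 0 \<le> t \<Longrightarrow> t \<le> T \<Longrightarrow> nonneg_definite (Qfun D t)"
begin

lemma Sfun_measurable: "bounded_measurable T (Sfun D)"
  unfolding Sfun_def
  by (intro bounded_measurable_mult bounded_measurable_transpose bounded_measurable_inverse[OF r] meas pd)

lemma Sfun_psd:
  assumes "0 \<le> t" "t \<le> T" shows "nonneg_definite (Sfun D t)"
proof -
  have M: "nonneg_definite (matrix_inv (Rfun D t))" by (rule coercive_inverse(3)[OF r pd[OF assms]])
  have eq: "Sfun D t = transpose (transpose (Bfun D t)) ** matrix_inv (Rfun D t) ** transpose (Bfun D t)"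
    by (simp add: Sfun_def)
  show ?thesis
    using M unfolding nonneg_definite_def
    unfolding eq quadratic_congruence by (simp add: matrix_transpose_mul matrix_mul_assoc)
qed

abbreviation "\<phi> \<equiv> drift_germ (drift_prim (Afun D)) (drift_prim (Sfun D)) (drift_prim (Qfun D))"

lemma integral_frozen_drift:
  assumes st: "0 \<le> s" "s \<le> t" "t \<le> T"
  shows "((\<lambda>r. frozen_drift D r y) has_integral \<phi> s t y) {s..t}"
proof -
  have i: "(f has_integral drift_prim f s t) {s..t}" if "bounded_measurable T f" for f :: "real \<Rightarrow> real^'d^'d"
    unfolding drift_prim_def using bounded_measurable_integral(1)[OF that] st by (simp add: has_integral_iff)
  have 1: "((\<lambda>r. y ** f r) has_integral y ** drift_prim f s t) {s..t}" if "bounded_measurable T f" for f :: "real \<Rightarrow> real^'d^'d"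
    using has_integral_linear[OF i[OF that] mm.bounded_linear_right[of y]] by (simp add: o_def)
  have 2: "((\<lambda>r. transpose (f r) ** y) has_integral transpose (drift_prim f s t) ** y) {s..t}" if "bounded_measurable T f" for f :: "real \<Rightarrow> real^'d^'d"
    using has_integral_linear[OF i[OF that] bounded_linear_compose[OF mm.bounded_linear_left[of y] bounded_linear_transpose]]
    by (simp add: o_def)
  have 3: "((\<lambda>r. y ** f r ** y) has_integral y ** drift_prim f s t ** y) {s..t}" if "bounded_measurable T f" for f :: "real \<Rightarrow> real^'d^'d"
    using has_integral_linear[OF i[OF that] bounded_linear_compose[OF mm.bounded_linear_left[of y] mm.bounded_linear_right[of y]]]
    by (simp add: o_def)
  show ?thesis unfolding frozen_drift_def drift_germ_def
    by (intro has_integral_add has_integral_diff 1 2 3 i meas Sfun_measurable)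
qed

lemma riccati_drift_measurable:
  assumes "continuous_on {0..T} p"
  shows "bounded_measurable T (riccati_drift D p)"
  unfolding riccati_drift_eq[abs_def] frozen_drift_def
  by (intro bounded_measurable_add bounded_measurable_mult bounded_measurable_transpose
      bounded_measurable_continuous[OF assms] meas Sfun_measurable)

text \<open>Freezing p at the right endpoint changes the drift by a Lipschitz constant on the ball
  times a \<gamma>-Hoelder increment of p, and integration gives order 1 + \<gamma>. This links the
  Lebesgue integral of the equation to \<open>drift_germ\<close>.\<close>

lemma riccati_drift_approx:
  assumes \<gamma>: "0 < \<gamma>" and p: "\<And>s t. 0 \<le> s \<Longrightarrow> s \<le> t \<Longrightarrow> t \<le> T \<Longrightarrow> norm (p t - p s) \<le> H * (t - s) powr \<gamma>"
    and P: "\<And>t. 0 \<le> t \<Longrightarrow> t \<le> T \<Longrightarrow> norm (p t) \<le> P"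
  obtains C where "0 \<le> C" "\<And>s t. 0 \<le> s \<Longrightarrow> s \<le> t \<Longrightarrow> t \<le> T \<Longrightarrow>
      norm (integral {s..t} (riccati_drift D p) - \<phi> s t (p t)) \<le> C * ((t - s) powr \<gamma> * (t - s))"
    "\<And>s t. 0 \<le> s \<Longrightarrow> s \<le> t \<Longrightarrow> t \<le> T \<Longrightarrow> norm (integral {s..t} (riccati_drift D p)) \<le> C * (t - s)"
proof -
  obtain a where a: "0 \<le> a" "\<And>t. 0 \<le> t \<Longrightarrow> t \<le> T \<Longrightarrow> norm (Afun D t) \<le> a" using bounded_measurableD[OF meas(1)] by blast
  obtain b where b: "0 \<le> b" "\<And>t. 0 \<le> t \<Longrightarrow> t \<le> T \<Longrightarrow> norm (Sfun D t) \<le> b" using bounded_measurableD[OF Sfun_measurable] by blast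
  have cont: "continuous_on {0..T} p" using continuous_on_of_holder[OF \<gamma>, of 0 T p H] p by simp
  note bm = riccati_drift_measurable[OF cont]
  obtain C where C: "0 \<le> C" "\<And>t. 0 \<le> t \<Longrightarrow> t \<le> T \<Longrightarrow> norm (riccati_drift D p t) \<le> C" using bounded_measurableD[OF bm] by blast
  have P0: "0 \<le> P" using P[of 0] T norm_ge_zero[of "p 0"] by linarith
  define c where "c = (2 * a + 2 * b * P) * \<bar>H\<bar>"
  have c0: "0 \<le> c" using a b P0 by (simp add: c_def)
  have frozen: "norm (frozen_drift D r x - frozen_drift D r y) \<le> (2 * a + 2 * b * P) * norm (x - y)"
    if "0 \<le> r" "r \<le> T" "norm x \<le> P" "norm y \<le> P" for r x y
  proof -
    have eq: "frozen_drift D r x - frozen_drift D r y = (x - y) ** Afun D r + transpose (Afun D r) ** (x - y)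
        - ((x - y) ** Sfun D r ** x + y ** Sfun D r ** (x - y))"
      unfolding frozen_drift_def by (simp add: mm_simps algebra_simps)
    let ?d = "norm (x - y)"
    have "norm (frozen_drift D r x - frozen_drift D r y) \<le> ?d * a + a * ?d + (?d * b * P + P * b * ?d)"
      unfolding eq
    proof (intro order.trans[OF norm_triangle_ineq] order.trans[OF norm_triangle_ineq4] add_mono)
      show "norm ((x - y) ** Afun D r) \<le> ?d * a"
        using a that by (intro order.trans[OF norm_matrix_mult_le] mult_mono) auto
      show "norm (transpose (Afun D r) ** (x - y)) \<le> a * ?d"
        using a that by (intro order.trans[OF norm_matrix_mult_le] mult_mono) auto
      show "norm ((x - y) ** Sfun D r ** x) \<le> ?d * b * P"
        using b that by (intro order.trans[OF norm_matrix_mult3_le] mult_mono) auto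
      show "norm (y ** Sfun D r ** (x - y)) \<le> P * b * ?d"
        using b that P0 by (intro order.trans[OF norm_matrix_mult3_le] mult_mono) auto
    qed
    then show ?thesis by (simp add: algebra_simps)
  qed
  show thesis
  proof (rule that[of "c + C"])
    show "0 \<le> c + C" using c0 C by simp
    fix s t assume st: "0 \<le> s" "s \<le> t" "t \<le> T"
    have i1: "(riccati_drift D p has_integral integral {s..t} (riccati_drift D p)) {s..t}"
      using bounded_measurable_integral(1)[OF bm] st by (simp add: has_integral_iff)
    have hi: "((\<lambda>r. riccati_drift D p r - frozen_drift D r (p t)) has_integral
        (integral {s..t} (riccati_drift D p) - \<phi> s t (p t))) {s..t}"
      by (intro has_integral_diff i1 integral_frozen_drift st)
    have "norm (integral {s..t} (riccati_drift D p) - \<phi> s t (p t)) \<le> c * (t - s) powr \<gamma> * measure lborel {s..t}"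
    proof (rule has_integral_bound_real[OF _ _ hi])
      show "0 \<le> c * (t - s) powr \<gamma>" using c0 by simp
      show "finite {}" by simp
      fix r assume "r \<in> {s..t} - {}"
      then have r: "s \<le> r" "r \<le> t" by auto
      have "norm (riccati_drift D p r - frozen_drift D r (p t)) \<le> (2 * a + 2 * b * P) * norm (p r - p t)"
        unfolding riccati_drift_eq using r st P by (intro frozen) auto
      also have "\<dots> \<le> (2 * a + 2 * b * P) * (\<bar>H\<bar> * (t - s) powr \<gamma>)"
      proof (rule mult_left_mono)
        have "norm (p r - p t) \<le> H * (t - r) powr \<gamma>" using p[of r t] r st by (simp add: norm_minus_commute)
        also have "\<dots> \<le> \<bar>H\<bar> * (t - s) powr \<gamma>" using r \<gamma> by (intro mult_mono powr_mono2) auto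
        finally show "norm (p r - p t) \<le> \<bar>H\<bar> * (t - s) powr \<gamma>" .
      qed (use a b P0 in auto)
      finally show "norm (riccati_drift D p r - frozen_drift D r (p t)) \<le> c * (t - s) powr \<gamma>" by (simp add: c_def)
    qed
    also have "\<dots> = c * ((t - s) powr \<gamma> * (t - s))" using st by simp
    also have "\<dots> \<le> (c + C) * ((t - s) powr \<gamma> * (t - s))" using C(1) st by (intro mult_right_mono) auto
    finally show "norm (integral {s..t} (riccati_drift D p) - \<phi> s t (p t)) \<le> (c + C) * ((t - s) powr \<gamma> * (t - s))" .
    have "norm (integral {s..t} (riccati_drift D p)) \<le> C * (t - s)"
      using C st by (intro norm_integral_bounded_measurable_le[OF bm]) auto
    also have "\<dots> \<le> (c + C) * (t - s)" using c0 st by (intro mult_right_mono) auto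
    finally show "norm (integral {s..t} (riccati_drift D p)) \<le> (c + C) * (t - s)" .
  qed
qed

end

section \<open>Solutions and expansions\<close>

lemma congr_add: "congr U (x + y) = congr U x + congr U y"
  by (simp add: congr_def mm_simps)

lemma cl_base_mono:
  assumes K: "2 \<le> K" "K \<le> N" "0 \<le> e" and cl: "two_data.cl K e n r x y"
  shows "two_data.cl N e n r x y"
proof -
  interpret K: two_data K e by unfold_locales (use K in auto)
  interpret N: two_data N e by unfold_locales (use K in auto)
  have "K ^ n * r \<le> N ^ n * r" "K ^ n * e * r \<le> N ^ n * e * r"
    using K K.cl_r[OF cl] by (intro mult_right_mono power_mono; simp)+
  then show ?thesis using cl unfolding K.cl_def N.cl_def by linarith
qed

text \<open>Chen's relation and bilinearity. The right-hand side is the usual sewing defect of a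
  controlled integrand: its remainder against the path, and the increment of its derivative against
  the second level.\<close>

lemma rough_germ_additive_defect:
  assumes "\<eta>2 s t - \<eta>2 s u - \<eta>2 u t = tensor (incr \<eta> s u) (incr \<eta> u t)"
  shows "(lin_app (Z s) (incr \<eta> s u) + bilin_app (Z' s) (\<eta>2 s u))
      + (lin_app (Z u) (incr \<eta> u t) + bilin_app (Z' u) (\<eta>2 u t))
      - (lin_app (Z s) (incr \<eta> s t) + bilin_app (Z' s) (\<eta>2 s t))
    = lin_app (remainder \<eta> Z Z' s u) (incr \<eta> u t) + bilin_app (incr Z' s u) (\<eta>2 u t)"
proof -
  have 1: "incr \<eta> s t = incr \<eta> s u + incr \<eta> u t" by (simp add: incr_def)
  have 2: "\<eta>2 s t = \<eta>2 s u + \<eta>2 u t + tensor (incr \<eta> s u) (incr \<eta> u t)"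
    using assms by (simp add: algebra_simps)
  show ?thesis
    unfolding 1 2 remainder_def incr_def[of Z] incr_def[of Z']
    by (simp add: lin_app_algebra bilin_app_algebra bilin_app_tensor)
qed

lemma lin_app_nth: "lin_app L x $ j = (\<Sum>i\<in>UNIV. (x $ i) *\<^sub>R (L $ i $ j))"
  by (simp add: lin_app_def)

text \<open>The Leibniz rule for controlled paths: the remainder of a product is the product of the
  increments plus each factor times the remainder of the other, here for both orders of
  multiplication.\<close>

lemma remainder_riccati_integrand:
  fixes D :: "('d::finite, 'p::finite) riccati_data"
  defines "A \<equiv> A1 D" and "R \<equiv> remainder (eta D) (A1 D) (A1' D)"
  shows "remainder (eta D) (riccati_integrand D p) (riccati_integrand_deriv D p p') s u $ j =
    (incr p s u ** incr A s u $ j + (remainder (eta D) p p' s u ** A s $ j + p s ** R s u $ j))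
    + (transpose (incr A s u $ j) ** incr p s u + (transpose (A s $ j) ** remainder (eta D) p p' s u
      + transpose (R s u $ j) ** p s))"
proof -
  define a where "a = incr (eta D) s u"
  have "lin_app (riccati_integrand_deriv D p p' s) a $ j =
    lin_app (p' s) a ** A s $ j + p s ** lin_app (A1' D s) a $ j
    + transpose (lin_app (A1' D s) a $ j) ** p s + transpose (A s $ j) ** lin_app (p' s) a"
    unfolding lin_app_nth riccati_integrand_deriv_def A_def lin_app_def[of "p' s"]
    by (simp add: mm.sum_left mm.sum_right mm.scaleR_left mm.scaleR_right transpose_sum transpose_algebra
        scaleR_add_right sum.distrib)
  then show ?thesis
    unfolding R_def remainder_def a_def[symmetric]
    unfolding A_def incr_def riccati_integrand_def
    by (simp add: mm_simps algebra_simps)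
qed

lemma incr_riccati_integrand_deriv:
  fixes D :: "('d::finite, 'p::finite) riccati_data"
  shows "incr (riccati_integrand_deriv D p p') s u $ i $ j =
    ((incr p' s u $ i ** A1 D u $ j + p' s $ i ** incr (A1 D) s u $ j)
    + (incr p s u ** A1' D u $ i $ j + p s ** incr (A1' D) s u $ i $ j))
    + ((transpose (incr (A1' D) s u $ i $ j) ** p u + transpose (A1' D s $ i $ j) ** incr p s u)
    + (transpose (incr (A1 D) s u $ j) ** p' u $ i + transpose (A1 D s $ j) ** incr p' s u $ i))"
  by (simp add: incr_def riccati_integrand_deriv_def mm_simps algebra_simps)

text \<open>Approximation by smooth paths enters through \<open>sym\<close> alone. The integrated
  coefficients carry the constant \<open>K ^ 30\<close> already obtained for the germ, so that one
  number serves \<open>riccati_germ\<close>.\<close>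

locale riccati_setting = drift_coeffs T r D
  for T r and D :: "('d::finite, 'p::finite) riccati_data" +
  fixes \<gamma> \<beta> \<beta>' K :: real
  assumes exps: "1 / 3 < \<gamma>" "\<gamma> < 1 / 2" "0 < \<beta>'" "\<beta>' \<le> \<beta>" "\<beta> \<le> \<gamma>" "\<gamma> + \<beta> + \<beta>' > 1"
    and K: "2 \<le> K" "1 + T \<le> K" "real CARD('p) \<le> K" "norm (mat 1 :: real^'d^'d) \<le> K"
    and close: "close_rough_data K T \<gamma> \<beta> \<beta>' 0 (eta D) (eta2 D) (A1 D) (A1' D) (eta D) (eta2 D) (A1 D) (A1' D)"
    and sym: "\<And>s t i j. 0 \<le> s \<Longrightarrow> s \<le> t \<Longrightarrow> t \<le> T \<Longrightarrow>
      eta2 D s t $ i $ j + eta2 D s t $ j $ i = incr (eta D) s t $ i * incr (eta D) s t $ j"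
    and drift_le: "\<And>s t. 0 \<le> s \<Longrightarrow> s \<le> t \<Longrightarrow> t \<le> T \<Longrightarrow>
      norm (drift_prim (Afun D) s t) \<le> K ^ 30 * (t - s) \<and> norm (drift_prim (Sfun D) s t) \<le> K ^ 30 * (t - s) \<and>
      norm (drift_prim (Qfun D) s t) \<le> K ^ 30 * (t - s)"
    and Qbar: "nonneg_definite (Qbar D)" "norm (Qbar D) \<le> K ^ 30"
begin

abbreviation "\<theta> \<equiv> \<gamma> + \<beta> + \<beta>'"
abbreviation "G1 \<equiv> germ1 (eta D) (A1 D)"
abbreviation "G2 \<equiv> germ2 (eta2 D) (A1 D) (A1' D)"
abbreviation "\<mu> \<equiv> germ (eta D) (eta2 D) (A1 D) (A1' D)"
abbreviation "\<Xi> p s t \<equiv> xi1 p (G1 s t) + xi2 p (G1 s t) (G2 s t)"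

sublocale R: two_rough_data K 0 T \<gamma> \<beta> \<beta>' "eta D" "eta D" "eta2 D" "eta2 D" "A1 D" "A1 D" "A1' D" "A1' D"
  by unfold_locales (use K T exps close in auto)

sublocale G: riccati_germ "K ^ 30" T \<gamma> \<theta> \<mu> "drift_prim (Afun D)" "drift_prim (Sfun D)" "drift_prim (Qfun D)" "Qbar D"
proof
  have K30: "K \<le> K ^ 30" using K self_le_power[of K 30] by simp
  show "2 \<le> K ^ 30" "1 + T \<le> K ^ 30" "norm (mat 1 :: real^'d^'d) \<le> K ^ 30" using K K30 by linarith+
  show "norm (\<mu> s t - mat 1) \<le> K ^ 30 * (t - s) powr \<gamma>" if "0 \<le> s" "s \<le> t" "t \<le> T" for s t
    using R.close_flows_germ that unfolding close_flows_def by blast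
  show "norm (\<mu> u t ** \<mu> s u - \<mu> s t) \<le> K ^ 30 * (t - s) powr \<theta>" if "0 \<le> s" "s \<le> u" "u \<le> t" "t \<le> T" for s u t
    using R.close_flows_germ that unfolding close_flows_def by blast
  show "drift_prim (Afun D) s t = drift_prim (Afun D) s u + drift_prim (Afun D) u t \<and>
     drift_prim (Sfun D) s t = drift_prim (Sfun D) s u + drift_prim (Sfun D) u t \<and>
     drift_prim (Qfun D) s t = drift_prim (Qfun D) s u + drift_prim (Qfun D) u t"
    if "0 \<le> s" "s \<le> u" "u \<le> t" "t \<le> T" for s u t
    unfolding drift_prim_def
    using integral_add_intervals[OF meas(1) that] integral_add_intervals[OF Sfun_measurable that]
      integral_add_intervals[OF meas(3) that] by blast
  show "nonneg_definite (drift_prim (Sfun D) s t) \<and> nonneg_definite (drift_prim (Qfun D) s t)"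
    if "0 \<le> s" "s \<le> t" "t \<le> T" for s t
    unfolding drift_prim_def using that
    by (intro conjI nonneg_definite_integral[OF Sfun_measurable] nonneg_definite_integral[OF meas(3)] Sfun_psd Qpsd)
qed (use T exps drift_le Qbar in auto)

lemma chen:
  "0 \<le> s \<Longrightarrow> s \<le> u \<Longrightarrow> u \<le> t \<Longrightarrow> t \<le> T \<Longrightarrow>
    eta2 D s t - eta2 D s u - eta2 D u t = tensor (incr (eta D) s u) (incr (eta D) u t)"
  using close unfolding close_rough_data_def by blast

lemma rough_germ_eq_xi:
  assumes st: "0 \<le> s" "s \<le> t" "t \<le> T" and p': "p' s = - riccati_integrand D p s"
  shows "lin_app (riccati_integrand D p s) (incr (eta D) s t) + bilin_app (riccati_integrand_deriv D p p' s) (eta2 D s t)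
    = \<Xi> (p s) s t"
  unfolding lin_app_riccati_integrand bilin_app_riccati_integrand_deriv[where D = D and p' = p' and s = s and p = p, OF p' sym[OF st]]
  by (simp add: germ1_def germ2_def)

text \<open>The third bound is \<open>congr_xi\<close> estimated term by term: each product has an
  exponent of at least 3 \<gamma> \<ge> \<theta>. One C serves all p in the ball of radius
  P.\<close>

lemma xi_bounds:
  obtains C where "0 \<le> C" "\<And>s t p. 0 \<le> s \<Longrightarrow> s \<le> t \<Longrightarrow> t \<le> T \<Longrightarrow> norm p \<le> P \<Longrightarrow>
    norm (\<Xi> p s t) \<le> C * (t - s) powr \<gamma> \<and> norm (xi2 p (G1 s t) (G2 s t)) \<le> C * (t - s) powr (2 * \<gamma>) \<and>
    norm (congr (\<mu> s t) (p - \<Xi> p s t) - p) \<le> C * (t - s) powr \<theta>"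
proof -
  define N where "N = K ^ 30 + \<bar>P\<bar>"
  have K30: "K \<le> K ^ 30" "K ^ 10 \<le> K ^ 30" "K ^ 4 \<le> K ^ 30" using K self_le_power[of K 30] by (auto intro!: power_increasing)
  have N: "2 \<le> N" "1 + T \<le> N" "\<bar>P\<bar> \<le> N" "K ^ 4 \<le> N ^ 1" "K ^ 10 \<le> N ^ 1"
    unfolding N_def power_one_right using K K30 by linarith+
  interpret two_data N 0 by unfold_locales (use N in auto)
  show thesis
  proof (rule that[of "N ^ 30"])
    show "0 \<le> N ^ 30" using N by simp
    fix s t and p :: "real^'d^'d" assume st: "0 \<le> s" "s \<le> t" "t \<le> T" and p: "norm p \<le> P"
    define h where "h = t - s"
    have h: "0 \<le> h" "h \<le> T" using st by (auto simp: h_def)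
    define g where "g = G1 s t"
    define k where "k = G2 s t"
    have cg: "cl 1 (h powr \<gamma>) g g"
    proof (rule cl_selfI)
      have "norm g \<le> K ^ 4 * h powr \<gamma>" unfolding g_def by (rule R.cl_selfD[OF R.cl_germ1]) (use st in \<open>auto simp: h_def\<close>)
      also have "\<dots> \<le> N ^ 1 * h powr \<gamma>" using N by (intro mult_right_mono) auto
      finally show "norm g \<le> N ^ 1 * h powr \<gamma>" .
    qed simp
    have ck: "cl 1 (h powr (2 * \<gamma>)) k k"
    proof (rule cl_selfI)
      have "norm k \<le> K ^ 10 * h powr (2 * \<gamma>)" unfolding k_def by (rule R.cl_selfD[OF R.cl_germ2]) (use st in \<open>auto simp: h_def\<close>)
      also have "\<dots> \<le> N ^ 1 * h powr (2 * \<gamma>)" using N by (intro mult_right_mono) auto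
      finally show "norm k \<le> N ^ 1 * h powr (2 * \<gamma>)" .
    qed simp
    have cp: "cl 1 1 p p" by (rule cl_selfI) (use p N in auto)
    have sc2: "h powr (2 * \<gamma>) \<le> N * h powr \<gamma>" using exps h N by (intro powr_le_scale) auto
    have sc3: "h powr \<alpha> \<le> N * h powr \<theta>" if "\<theta> \<le> \<alpha>" "\<alpha> \<le> \<theta> + 1" for \<alpha>
      using h N that by (intro powr_le_scale)
    have e2: "h powr \<gamma> * h powr \<gamma> = h powr (2 * \<gamma>)" by (simp add: powr_add[symmetric])
    have c1: "cl 4 (h powr \<gamma>) (xi1 p g) (xi1 p g)"
      unfolding xi1_def
      by (rule cl_eq[OF cl_add[OF cl_eq[OF cl_mult[OF cp cg], of "h powr \<gamma>" 3] cl_eq[OF cl_mult[OF cl_transpose[OF cg] cp], of "h powr \<gamma>" 3]]]) auto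
    have c2: "cl 8 (h powr (2 * \<gamma>)) (xi2 p g k) (xi2 p g k)"
    proof -
      have a: "cl 3 (h powr (2 * \<gamma>)) (p ** k) (p ** k)" by (rule cl_eq[OF cl_mult[OF cp ck]]) auto
      have b: "cl 3 (h powr (2 * \<gamma>)) (transpose k ** p) (transpose k ** p)" by (rule cl_eq[OF cl_mult[OF cl_transpose[OF ck] cp]]) auto
      have c: "cl 5 (h powr (2 * \<gamma>)) (p ** g ** g) (p ** g ** g)"
        by (rule cl_eq[OF cl_mult[OF cl_mult[OF cp cg] cg]]) (auto simp: e2)
      have d: "cl 5 (h powr (2 * \<gamma>)) (transpose g ** p ** g) (transpose g ** p ** g)"
        by (rule cl_eq[OF cl_mult[OF cl_mult[OF cl_transpose[OF cg] cp] cg]]) (auto simp: e2)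
      have e: "cl 5 (h powr (2 * \<gamma>)) (transpose g ** transpose g ** p) (transpose g ** transpose g ** p)"
        by (rule cl_eq[OF cl_mult[OF cl_mult[OF cl_transpose[OF cg] cl_transpose[OF cg]] cp]]) (auto simp: e2)
      show ?thesis unfolding xi2_def
        by (rule cl_up[OF cl_diff[OF cl_add[OF a b] cl_add[OF cl_add[OF c d] e]]]) simp
    qed
    have c12: "cl 10 (h powr \<gamma>) (xi1 p g + xi2 p g k) (xi1 p g + xi2 p g k)"
      by (rule cl_up[OF cl_add[OF c1 cl_scale[OF c2 sc2]]]) simp
    have cgk: "cl 3 (h powr \<gamma>) (g + k) (g + k)"
      by (rule cl_up[OF cl_add[OF cg cl_scale[OF ck sc2]]]) simp
    let ?x = "xi1 p g + xi2 p g k"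
    have d1: "cl 9 (h powr \<theta>) (transpose g ** p ** k) (transpose g ** p ** k)"
      by (rule cl_fit[OF cl_mult[OF cl_mult[OF cl_transpose[OF cg] cp] ck]]) (use exps in \<open>auto simp: powr_add[symmetric] intro!: sc3\<close>)
    have d2: "cl 9 (h powr \<theta>) (transpose k ** p ** (g + k)) (transpose k ** p ** (g + k))"
      by (rule cl_fit[OF cl_mult[OF cl_mult[OF cl_transpose[OF ck] cp] cgk]]) (use exps in \<open>auto simp: powr_add[symmetric] intro!: sc3\<close>)
    have d3: "cl 13 (h powr \<theta>) (transpose k ** ?x) (transpose k ** ?x)"
      by (rule cl_fit[OF cl_mult[OF cl_transpose[OF ck] c12]]) (use exps in \<open>auto simp: powr_add[symmetric] intro!: sc3\<close>)
    have d4: "cl 13 (h powr \<theta>) (transpose g ** xi2 p g k) (transpose g ** xi2 p g k)"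
      by (rule cl_fit[OF cl_mult[OF cl_transpose[OF cg] c2]]) (use exps in \<open>auto simp: powr_add[symmetric] intro!: sc3\<close>)
    have d5: "cl 13 (h powr \<theta>) (?x ** k) (?x ** k)"
      by (rule cl_fit[OF cl_mult[OF c12 ck]]) (use exps in \<open>auto simp: powr_add[symmetric] intro!: sc3\<close>)
    have d6: "cl 13 (h powr \<theta>) (xi2 p g k ** g) (xi2 p g k ** g)"
      by (rule cl_fit[OF cl_mult[OF c2 cg]]) (use exps in \<open>auto simp: powr_add[symmetric] intro!: sc3\<close>)
    have d7: "cl 20 (h powr \<theta>) (transpose (g + k) ** ?x ** (g + k)) (transpose (g + k) ** ?x ** (g + k))"
      by (rule cl_fit[OF cl_mult[OF cl_mult[OF cl_transpose[OF cgk] c12] cgk]]) (use exps in \<open>auto simp: powr_add[symmetric] intro!: sc3\<close>)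
    have "cl 30 (h powr \<theta>) (congr (mat 1 + (g + k)) (p - ?x) - p) (congr (mat 1 + (g + k)) (p - ?x) - p)"
      unfolding congr_xi
      by (rule cl_up[OF cl_diff[OF cl_diff[OF cl_diff[OF cl_add[OF d1 d2] cl_add[OF d3 d4]] cl_add[OF d5 d6]] d7]]) simp
    moreover have "cl 30 (h powr \<gamma>) ?x ?x" "cl 30 (h powr (2 * \<gamma>)) (xi2 p g k) (xi2 p g k)"
      by (rule cl_up[OF c12] cl_up[OF c2]; simp)+
    ultimately show "norm (\<Xi> p s t) \<le> N ^ 30 * (t - s) powr \<gamma> \<and> norm (xi2 p (G1 s t) (G2 s t)) \<le> N ^ 30 * (t - s) powr (2 * \<gamma>) \<and>
      norm (congr (\<mu> s t) (p - \<Xi> p s t) - p) \<le> N ^ 30 * (t - s) powr \<theta>"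
      unfolding germ_def g_def k_def h_def by (auto dest: cl_selfD)
  qed
qed

text \<open>The left-endpoint form, as it comes out of the rough integral, with the contribution of
  the drift kept as w. \<open>expansion\<close> is the right-endpoint form, suited to solving
  backward from T.\<close>

definition davie :: "(real \<Rightarrow> real \<Rightarrow> real^'d^'d) \<Rightarrow> (real \<Rightarrow> real^'d^'d) \<Rightarrow> bool" where
  "davie w p \<longleftrightarrow> (\<exists>C. \<forall>s t. 0 \<le> s \<and> s \<le> t \<and> t \<le> T \<longrightarrow> norm (p t - p s + \<Xi> (p s) s t + w s t) \<le> C * (t - s) powr \<theta>)"

text \<open>The error of the right-endpoint form is minus the congruence of the error of the
  left-endpoint form, plus three terms. \<open>davie_error_bound\<close> shows these to be small for
  every bounded p once w is close to the drift germ.\<close>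

lemma davie_identity:
  "p s - (congr (\<mu> s t) (p t) + f) =
     - (congr (\<mu> s t) (p s - \<Xi> (p s) s t) - p s) + (congr (\<mu> s t) w - w) + (w - f)
     - congr (\<mu> s t) (p t - p s + \<Xi> (p s) s t + w)"
  by (simp add: congr_add congr_diff algebra_simps)

lemma davie_error_bound:
  assumes P: "\<And>t. 0 \<le> t \<Longrightarrow> t \<le> T \<Longrightarrow> norm (p t) \<le> P" and W: "0 \<le> W"
    and w: "\<And>s t. 0 \<le> s \<Longrightarrow> s \<le> t \<Longrightarrow> t \<le> T \<Longrightarrow> norm (w s t - \<phi> s t (p t)) \<le> W * ((t - s) powr \<gamma> * (t - s))"
      "\<And>s t. 0 \<le> s \<Longrightarrow> s \<le> t \<Longrightarrow> t \<le> T \<Longrightarrow> norm (w s t) \<le> W * (t - s)"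
  obtains C where "\<And>s t. 0 \<le> s \<Longrightarrow> s \<le> t \<Longrightarrow> t \<le> T \<Longrightarrow>
    norm (- (congr (\<mu> s t) (p s - \<Xi> (p s) s t) - p s) + (congr (\<mu> s t) (w s t) - w s t) + (w s t - \<phi> s t (p t)))
      \<le> C * (t - s) powr \<theta>"
proof -
  obtain C where C: "0 \<le> C" "\<And>s t p. 0 \<le> s \<Longrightarrow> s \<le> t \<Longrightarrow> t \<le> T \<Longrightarrow> norm p \<le> P \<Longrightarrow>
    norm (\<Xi> p s t) \<le> C * (t - s) powr \<gamma> \<and> norm (xi2 p (G1 s t) (G2 s t)) \<le> C * (t - s) powr (2 * \<gamma>) \<and>
    norm (congr (\<mu> s t) (p - \<Xi> p s t) - p) \<le> C * (t - s) powr \<theta>"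
    using xi_bounds[of P] by blast
  define L where "L = K ^ 30"
  define c where "c = (2 + L\<^sup>2) * L"
  have L0: "0 \<le> L" using G.K unfolding L_def by simp
  have c0: "0 \<le> c" unfolding c_def using L0 by simp
  show thesis
  proof (rule that)
    fix s t assume st: "0 \<le> s" "s \<le> t" "t \<le> T"
    define h where "h = t - s"
    have h: "0 \<le> h" "h \<le> T" using st by (auto simp: h_def)
    have hh: "h powr \<gamma> * h \<le> L * h powr \<theta>" using G.powr_bounds(4)[OF h] unfolding L_def .
    have 1: "norm (- (congr (\<mu> s t) (p s - \<Xi> (p s) s t) - p s)) \<le> C * h powr \<theta>"
      unfolding norm_minus_cancel using C(2)[OF st P] st by (auto simp: h_def)
    have "norm (congr (\<mu> s t) (w s t) - w s t) \<le> c * h powr \<gamma> * (W * h)"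
      using G.norm_congr_germ_diff[OF st, of "w s t"] mult_left_mono[OF w(2)[OF st], of "c * h powr \<gamma>"] c0
      unfolding c_def L_def h_def by simp
    also have "\<dots> = c * W * (h powr \<gamma> * h)" by simp
    also have "\<dots> \<le> c * W * (L * h powr \<theta>)" using hh c0 W by (intro mult_left_mono) auto
    finally have 2: "norm (congr (\<mu> s t) (w s t) - w s t) \<le> c * W * (L * h powr \<theta>)" .
    have 3: "norm (w s t - \<phi> s t (p t)) \<le> W * (L * h powr \<theta>)"
      using w(1)[OF st] mult_left_mono[OF hh W] unfolding h_def by linarith
    have "norm (- (congr (\<mu> s t) (p s - \<Xi> (p s) s t) - p s) + (congr (\<mu> s t) (w s t) - w s t) + (w s t - \<phi> s t (p t)))
      \<le> C * h powr \<theta> + c * W * (L * h powr \<theta>) + W * (L * h powr \<theta>)"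
      by (intro norm_triangle_mono 1 2 3)
    then show "norm (- (congr (\<mu> s t) (p s - \<Xi> (p s) s t) - p s) + (congr (\<mu> s t) (w s t) - w s t) + (w s t - \<phi> s t (p t)))
      \<le> (C + c * W * L + W * L) * (t - s) powr \<theta>" by (simp add: h_def algebra_simps)
  qed
qed

lemma davie_imp_expansion:
  assumes P: "\<And>t. 0 \<le> t \<Longrightarrow> t \<le> T \<Longrightarrow> norm (p t) \<le> P" and W: "0 \<le> W"
    and w: "\<And>s t. 0 \<le> s \<Longrightarrow> s \<le> t \<Longrightarrow> t \<le> T \<Longrightarrow> norm (w s t - \<phi> s t (p t)) \<le> W * ((t - s) powr \<gamma> * (t - s))"
      "\<And>s t. 0 \<le> s \<Longrightarrow> s \<le> t \<Longrightarrow> t \<le> T \<Longrightarrow> norm (w s t) \<le> W * (t - s)"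
    and d: "davie w p"
  shows "expansion T \<theta> \<mu> (\<lambda>s t. \<phi> s t (p t)) p"
proof -
  obtain C where C: "\<And>s t. 0 \<le> s \<Longrightarrow> s \<le> t \<Longrightarrow> t \<le> T \<Longrightarrow>
    norm (- (congr (\<mu> s t) (p s - \<Xi> (p s) s t) - p s) + (congr (\<mu> s t) (w s t) - w s t) + (w s t - \<phi> s t (p t)))
      \<le> C * (t - s) powr \<theta>"
    using davie_error_bound[OF P W w] by blast
  obtain B where B: "\<And>s t. 0 \<le> s \<Longrightarrow> s \<le> t \<Longrightarrow> t \<le> T \<Longrightarrow> norm (p t - p s + \<Xi> (p s) s t + w s t) \<le> B * (t - s) powr \<theta>"
    using d unfolding davie_def by blast
  define M where "M = K ^ 30 + (K ^ 30)\<^sup>2"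
  have "norm (p s - (congr (\<mu> s t) (p t) + \<phi> s t (p t))) \<le> (C + M\<^sup>2 * B) * (t - s) powr \<theta>"
    if st: "0 \<le> s" "s \<le> t" "t \<le> T" for s t
  proof -
    have "norm (congr (\<mu> s t) (p t - p s + \<Xi> (p s) s t + w s t)) \<le> M\<^sup>2 * (B * (t - s) powr \<theta>)"
      by (rule order.trans[OF norm_congr_le mult_left_mono[OF B[OF st]]]) (use G.norm_germ_le[OF st] in \<open>auto simp: M_def\<close>)
    then show ?thesis unfolding davie_identity[of p s t "\<phi> s t (p t)" "w s t"] distrib_right
      using order.trans[OF norm_triangle_ineq4 add_mono[OF C[OF st]]] by (simp add: mult.assoc)
  qed
  then show ?thesis unfolding expansion_def by blast
qed

text \<open>Here the congruence has to be undone. On intervals of length at most h0 it moves E by at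
  most half of its norm, so E is bounded by twice its congruence; on longer intervals E is bounded
  by Bd, and this is divided by \<open>h0 powr \<theta>\<close>.\<close>

lemma expansion_imp_davie:
  assumes P: "\<And>t. 0 \<le> t \<Longrightarrow> t \<le> T \<Longrightarrow> norm (p t) \<le> P" and W: "0 \<le> W"
    and w: "\<And>s t. 0 \<le> s \<Longrightarrow> s \<le> t \<Longrightarrow> t \<le> T \<Longrightarrow> norm (w s t - \<phi> s t (p t)) \<le> W * ((t - s) powr \<gamma> * (t - s))"
      "\<And>s t. 0 \<le> s \<Longrightarrow> s \<le> t \<Longrightarrow> t \<le> T \<Longrightarrow> norm (w s t) \<le> W * (t - s)"
    and e: "expansion T \<theta> \<mu> (\<lambda>s t. \<phi> s t (p t)) p"
  shows "davie w p"
proof -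
  obtain C where C: "\<And>s t. 0 \<le> s \<Longrightarrow> s \<le> t \<Longrightarrow> t \<le> T \<Longrightarrow>
    norm (- (congr (\<mu> s t) (p s - \<Xi> (p s) s t) - p s) + (congr (\<mu> s t) (w s t) - w s t) + (w s t - \<phi> s t (p t)))
      \<le> C * (t - s) powr \<theta>"
    using davie_error_bound[OF P W w] by blast
  obtain B where B: "\<And>s t. 0 \<le> s \<Longrightarrow> s \<le> t \<Longrightarrow> t \<le> T \<Longrightarrow> norm (p s - (congr (\<mu> s t) (p t) + \<phi> s t (p t))) \<le> B * (t - s) powr \<theta>"
    using e unfolding expansion_def by blast
  obtain X where X: "0 \<le> X" "\<And>s t p. 0 \<le> s \<Longrightarrow> s \<le> t \<Longrightarrow> t \<le> T \<Longrightarrow> norm p \<le> P \<Longrightarrow>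
    norm (\<Xi> p s t) \<le> X * (t - s) powr \<gamma> \<and> norm (xi2 p (G1 s t) (G2 s t)) \<le> X * (t - s) powr (2 * \<gamma>) \<and>
    norm (congr (\<mu> s t) (p - \<Xi> p s t) - p) \<le> X * (t - s) powr \<theta>"
    using xi_bounds[of P] by blast
  define L where "L = K ^ 30"
  have L0: "0 \<le> L" using G.K unfolding L_def by simp
  obtain h0 where h0: "0 < h0" "\<And>h. 0 \<le> h \<Longrightarrow> h \<le> h0 \<Longrightarrow> ((2 + L\<^sup>2) * L) * h powr \<gamma> \<le> 1 / 2"
    using powr_small_step[of "(2 + L\<^sup>2) * L" \<gamma> "1 / 2"] L0 exps by auto
  define Bd where "Bd = 2 * P + X * L + W * T"
  have P0: "0 \<le> P" using P[of 0] T norm_ge_zero[of "p 0"] by linarith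
  have Bd0: "0 \<le> Bd" using P0 X(1) L0 W T by (simp add: Bd_def)
  have "norm (p t - p s + \<Xi> (p s) s t + w s t) \<le> (\<bar>2 * (C + B)\<bar> + Bd / h0 powr \<theta>) * (t - s) powr \<theta>"
    if st: "0 \<le> s" "s \<le> t" "t \<le> T" for s t
  proof -
    define h where "h = t - s"
    have h: "0 \<le> h" "h \<le> T" using st by (auto simp: h_def)
    define E where "E = p t - p s + \<Xi> (p s) s t + w s t"
    show ?thesis
    proof (cases "h \<le> h0")
      case True
      have eq: "congr (\<mu> s t) E = (- (congr (\<mu> s t) (p s - \<Xi> (p s) s t) - p s) + (congr (\<mu> s t) (w s t) - w s t) + (w s t - \<phi> s t (p t)))
          - (p s - (congr (\<mu> s t) (p t) + \<phi> s t (p t)))"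
        unfolding davie_identity[of p s t "\<phi> s t (p t)" "w s t"] E_def by simp
      have "norm (congr (\<mu> s t) E) \<le> C * h powr \<theta> + B * h powr \<theta>"
        unfolding eq h_def by (rule order.trans[OF norm_triangle_ineq4 add_mono[OF C[OF st] B[OF st]]])
      moreover have "norm (congr (\<mu> s t) E - E) \<le> (1 / 2) * norm E"
        using G.norm_congr_germ_diff[OF st, of E] mult_right_mono[OF h0(2)[OF h(1) True], of "norm E"]
        unfolding L_def h_def by simp
      moreover have "norm E \<le> norm (congr (\<mu> s t) E) + norm (congr (\<mu> s t) E - E)"
        using norm_triangle_ineq4[of "congr (\<mu> s t) E" "congr (\<mu> s t) E - E"] by simp
      ultimately have "norm E \<le> 2 * (C + B) * h powr \<theta>" by (simp add: algebra_simps)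
      also have "\<dots> \<le> (\<bar>2 * (C + B)\<bar> + Bd / h0 powr \<theta>) * h powr \<theta>"
        using Bd0 by (intro mult_right_mono) (auto intro: order.trans[OF abs_ge_self] simp: add_increasing2)
      finally show ?thesis by (simp add: E_def h_def)
    next
      case False
      have "norm E \<le> norm (p t) + norm (p s) + norm (\<Xi> (p s) s t) + norm (w s t)"
        unfolding E_def by (intro norm_triangle_mono norm_triangle_ineq4 order_refl)
      also have "\<dots> \<le> P + P + X * L + W * T"
      proof (intro add_mono P)
        have "norm (\<Xi> (p s) s t) \<le> X * h powr \<gamma>" using X(2)[OF st P] st by (auto simp: h_def)
        also have "\<dots> \<le> X * L" using G.powr_bounds(1)[OF h] X(1) unfolding L_def by (intro mult_left_mono)
        finally show "norm (\<Xi> (p s) s t) \<le> X * L" .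
        show "norm (w s t) \<le> W * T" using w(2)[OF st] mult_left_mono[of "t - s" T W] W st by linarith
      qed (use st in auto)
      also have "\<dots> = Bd / h0 powr \<theta> * h0 powr \<theta>" using h0 by (simp add: Bd_def)
      also have "\<dots> \<le> (\<bar>2 * (C + B)\<bar> + Bd / h0 powr \<theta>) * h powr \<theta>"
        using Bd0 h0 False exps by (intro mult_mono powr_mono2) auto
      finally show ?thesis by (simp add: E_def h_def)
    qed
  qed
  then show ?thesis unfolding davie_def by blast
qed

text \<open>The sewing condition for the rough integral: the remainder of the integrand has order
  \<beta> + \<beta>' and meets an increment of order \<gamma>; its derivative varies with order
  \<beta>' and meets the second level of order 2 \<gamma>.\<close>

lemma riccati_integrand_rough_defect:
  assumes p: "\<And>s t. 0 \<le> s \<Longrightarrow> s \<le> t \<Longrightarrow> t \<le> T \<Longrightarrow> norm (p t) \<le> P \<and> norm (p' t) \<le> P \<and>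
      norm (incr p s t) \<le> P * (t - s) powr \<gamma> \<and> norm (incr p' s t) \<le> P * (t - s) powr \<beta> \<and>
      norm (remainder (eta D) p p' s t) \<le> P * (t - s) powr (\<gamma> + \<beta>)"
  obtains C where "0 \<le> C" "\<And>s u t. 0 \<le> s \<Longrightarrow> s \<le> u \<Longrightarrow> u \<le> t \<Longrightarrow> t \<le> T \<Longrightarrow>
    norm (lin_app (remainder (eta D) (riccati_integrand D p) (riccati_integrand_deriv D p p') s u) (incr (eta D) u t)
      + bilin_app (incr (riccati_integrand_deriv D p p') s u) (eta2 D u t)) \<le> C * (t - s) powr \<theta>"
proof -
  define N where "N = K + \<bar>P\<bar>"
  have N: "2 \<le> N" "1 + T \<le> N" "\<bar>P\<bar> \<le> N" "P \<le> N" "K \<le> N" "real CARD('p) \<le> N" unfolding N_def using K by auto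
  interpret two_data N 0 by unfold_locales (use N in auto)
  show thesis
  proof (rule that[of "N ^ 40"])
    show "0 \<le> N ^ 40" using N by simp
    fix s u t assume sut: "0 \<le> s" "s \<le> u" "u \<le> t" "t \<le> T"
    define h where "h = t - s"
    have h: "0 \<le> h" "h \<le> T" using sut by (auto simp: h_def)
    have su: "0 \<le> s" "s \<le> u" "u \<le> T" "u - s \<le> h" and ut: "0 \<le> u" "u \<le> t" "t \<le> T" "t - u \<le> h"
      and uu: "0 \<le> u" "u \<le> u" "u \<le> T" "u - u \<le> h" and ss: "0 \<le> s" "s \<le> s" "s \<le> T"
      using sut by (auto simp: h_def)
    note bsu = cl_base_mono[OF K(1) N(5) order_refl R.base(3)[OF su]] cl_base_mono[OF K(1) N(5) order_refl R.base(4)[OF su]]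
      cl_base_mono[OF K(1) N(5) order_refl R.base(5)[OF su]] cl_base_mono[OF K(1) N(5) order_refl R.base(6)[OF su]]
      cl_base_mono[OF K(1) N(5) order_refl R.base(7)[OF su]]
    note but = cl_base_mono[OF K(1) N(5) order_refl R.base(1)[OF ut]] cl_base_mono[OF K(1) N(5) order_refl R.base(2)[OF ut]]
    note buu = cl_base_mono[OF K(1) N(5) order_refl R.base(3)[OF uu]] cl_base_mono[OF K(1) N(5) order_refl R.base(4)[OF uu]]
    have m: "P * (u - s) powr \<alpha> \<le> N ^ 1 * h powr \<alpha>" if "0 \<le> \<alpha>" for \<alpha>
      using that N su by (simp, intro mult_mono powr_mono2) auto
    have cp: "cl 1 1 (p s) (p s)" "cl 1 1 (p u) (p u)" "cl 1 1 (p' s) (p' s)" "cl 1 1 (p' u) (p' u)"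
      using p[OF ss] p[OF su(1-3)] N by (auto intro!: cl_selfI simp del: One_nat_def)
    have cdp: "cl 1 (h powr \<gamma>) (incr p s u) (incr p s u)" "cl 1 (h powr \<beta>) (incr p' s u) (incr p' s u)"
      "cl 1 (h powr (\<gamma> + \<beta>)) (remainder (eta D) p p' s u) (remainder (eta D) p p' s u)"
      using p[OF su(1-3)] m exps by (auto intro!: cl_selfI order.trans[OF _ m] simp del: One_nat_def)
    have sc: "h powr \<alpha> \<le> N * h powr \<alpha>'" if "\<alpha>' \<le> \<alpha>" "\<alpha> \<le> \<alpha>' + 1" for \<alpha> \<alpha>'
      using h N that by (intro powr_le_scale)
    let ?Z = "riccati_integrand D p" and ?Z' = "riccati_integrand_deriv D p p'"
    let ?r = "remainder (eta D) (A1 D) (A1' D) s u"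
    let ?R = "remainder (eta D) ?Z ?Z' s u"
    have cR: "cl 8 (h powr (\<beta> + \<beta>')) ?R ?R"
    proof -
      have a: "cl 4 (h powr (\<beta> + \<beta>')) (incr p s u ** incr (A1 D) s u $ j) (incr p s u ** incr (A1 D) s u $ j)" for j
        by (rule cl_fit[OF cl_mult[OF cdp(1) cl_nth[OF bsu(3)]]]) (use exps in \<open>auto simp: powr_add[symmetric] intro!: sc\<close>)
      have b: "cl 4 (h powr (\<beta> + \<beta>')) (remainder (eta D) p p' s u ** A1 D s $ j) (remainder (eta D) p p' s u ** A1 D s $ j)" for j
        by (rule cl_fit[OF cl_mult[OF cdp(3) cl_nth[OF bsu(1)]]]) (use exps in \<open>auto intro!: sc\<close>)
      have c: "cl 4 (h powr (\<beta> + \<beta>')) (p s ** ?r $ j) (p s ** ?r $ j)" for j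
        by (rule cl_eq[OF cl_mult[OF cp(1) cl_nth[OF bsu(5)]]]) auto
      have a': "cl 4 (h powr (\<beta> + \<beta>')) (transpose (incr (A1 D) s u $ j) ** incr p s u) (transpose (incr (A1 D) s u $ j) ** incr p s u)" for j
        by (rule cl_fit[OF cl_mult[OF cl_transpose[OF cl_nth[OF bsu(3)]] cdp(1)]]) (use exps in \<open>auto simp: powr_add[symmetric] intro!: sc\<close>)
      have b': "cl 4 (h powr (\<beta> + \<beta>')) (transpose (A1 D s $ j) ** remainder (eta D) p p' s u) (transpose (A1 D s $ j) ** remainder (eta D) p p' s u)" for j
        by (rule cl_fit[OF cl_mult[OF cl_transpose[OF cl_nth[OF bsu(1)]] cdp(3)]]) (use exps in \<open>auto intro!: sc\<close>)
      have c': "cl 4 (h powr (\<beta> + \<beta>')) (transpose (?r $ j) ** p s) (transpose (?r $ j) ** p s)" for j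
        by (rule cl_eq[OF cl_mult[OF cl_transpose[OF cl_nth[OF bsu(5)]] cp(1)]]) auto
      have "cl 7 (h powr (\<beta> + \<beta>')) (?R $ j) (?R $ j)" for j
        unfolding remainder_riccati_integrand
        by (rule cl_up[OF cl_add[OF cl_add[OF a cl_add[OF b c]] cl_add[OF a' cl_add[OF b' c']]]]) simp
      then show ?thesis by (intro cl_up[OF cl_vec[OF _ N(6)]]) auto
    qed
    let ?I = "incr ?Z' s u"
    have cI: "cl 9 (h powr \<beta>') ?I ?I"
    proof -
      have a1: "cl 4 (h powr \<beta>') (incr p' s u $ i ** A1 D u $ j) (incr p' s u $ i ** A1 D u $ j)" for i j
        by (rule cl_fit[OF cl_mult[OF cl_nth[OF cdp(2)] cl_nth[OF buu(1)]]]) (use exps in \<open>auto intro!: sc\<close>)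
      have a2: "cl 4 (h powr \<beta>') (p' s $ i ** incr (A1 D) s u $ j) (p' s $ i ** incr (A1 D) s u $ j)" for i j
        by (rule cl_fit[OF cl_mult[OF cl_nth[OF cp(3)] cl_nth[OF bsu(3)]]]) (use exps in \<open>auto intro!: sc\<close>)
      have a3: "cl 4 (h powr \<beta>') (incr p s u ** A1' D u $ i $ j) (incr p s u ** A1' D u $ i $ j)" for i j
        by (rule cl_fit[OF cl_mult[OF cdp(1) cl_nth[OF cl_nth[OF buu(2)]]]]) (use exps in \<open>auto intro!: sc\<close>)
      have a4: "cl 4 (h powr \<beta>') (p s ** incr (A1' D) s u $ i $ j) (p s ** incr (A1' D) s u $ i $ j)" for i j
        by (rule cl_eq[OF cl_mult[OF cp(1) cl_nth[OF cl_nth[OF bsu(4)]]]]) auto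
      have b1: "cl 4 (h powr \<beta>') (transpose (incr (A1' D) s u $ i $ j) ** p u) (transpose (incr (A1' D) s u $ i $ j) ** p u)" for i j
        by (rule cl_eq[OF cl_mult[OF cl_transpose[OF cl_nth[OF cl_nth[OF bsu(4)]]] cp(2)]]) auto
      have b2: "cl 4 (h powr \<beta>') (transpose (A1' D s $ i $ j) ** incr p s u) (transpose (A1' D s $ i $ j) ** incr p s u)" for i j
        by (rule cl_fit[OF cl_mult[OF cl_transpose[OF cl_nth[OF cl_nth[OF bsu(2)]]] cdp(1)]]) (use exps in \<open>auto intro!: sc\<close>)
      have b3: "cl 4 (h powr \<beta>') (transpose (incr (A1 D) s u $ j) ** p' u $ i) (transpose (incr (A1 D) s u $ j) ** p' u $ i)" for i j
        by (rule cl_fit[OF cl_mult[OF cl_transpose[OF cl_nth[OF bsu(3)]] cl_nth[OF cp(4)]]]) (use exps in \<open>auto intro!: sc\<close>)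
      have b4: "cl 4 (h powr \<beta>') (transpose (A1 D s $ j) ** incr p' s u $ i) (transpose (A1 D s $ j) ** incr p' s u $ i)" for i j
        by (rule cl_fit[OF cl_mult[OF cl_transpose[OF cl_nth[OF bsu(1)]] cl_nth[OF cdp(2)]]]) (use exps in \<open>auto intro!: sc\<close>)
      have "cl 7 (h powr \<beta>') (?I $ i $ j) (?I $ i $ j)" for i j
        unfolding incr_riccati_integrand_deriv
        by (rule cl_up[OF cl_add[OF cl_add[OF cl_add[OF a1 a2] cl_add[OF a3 a4]] cl_add[OF cl_add[OF b1 b2] cl_add[OF b3 b4]]]]) simp
      then show ?thesis by (intro cl_up[OF cl_vec[OF cl_vec[OF _ N(6)] N(6)]]) auto
    qed
    have 1: "cl 39 (h powr \<theta>) (lin_app ?R (incr (eta D) u t)) (lin_app ?R (incr (eta D) u t))"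
      by (rule cl_eq[OF cl_lin_app[OF cR but(1) N(6)]]) (auto simp: powr_add[symmetric] algebra_simps)
    have 2: "cl 39 (h powr \<theta>) (bilin_app ?I (eta2 D u t)) (bilin_app ?I (eta2 D u t))"
      by (rule cl_fit[OF cl_bilin_app[OF cI but(2) N(6)]]) (use exps in \<open>auto simp: powr_add[symmetric] intro!: sc\<close>)
    have "cl 40 (h powr \<theta>) (lin_app ?R (incr (eta D) u t) + bilin_app ?I (eta2 D u t))
      (lin_app ?R (incr (eta D) u t) + bilin_app ?I (eta2 D u t))"
      by (rule cl_up[OF cl_add[OF 1 2]]) simp
    then show "norm (lin_app ?R (incr (eta D) u t) + bilin_app ?I (eta2 D u t)) \<le> N ^ 40 * (t - s) powr \<theta>"
      unfolding h_def by (rule cl_selfD)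
  qed
qed

end

lemma (in two_data) cl_incr_riccati_integrand:
  fixes D E :: "('d::finite, 'p::finite) riccati_data"
  assumes p: "cl n 1 (p s) (q s)" "cl n 1 (p t) (q t)" "cl n \<rho> (incr p s t) (incr q s t)"
    and A: "cl n 1 (A1 D s) (A1 E s)" "cl n 1 (A1 D t) (A1 E t)" "cl n \<rho> (incr (A1 D) s t) (incr (A1 E) s t)"
    and card: "real CARD('p) \<le> K"
  shows "cl (2 * n + 4) \<rho> (incr (\<lambda>t. - riccati_integrand D p t) s t) (incr (\<lambda>t. - riccati_integrand E q t) s t)"
proof -
  have eq: "incr (\<lambda>t. - riccati_integrand D p t) s t $ j = - ((incr p s t ** A1 D t $ j + p s ** incr (A1 D) s t $ j)
      + (transpose (incr (A1 D) s t $ j) ** p t + transpose (A1 D s $ j) ** incr p s t))"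
    for D :: "('d, 'p) riccati_data" and p j
    by (simp add: incr_def riccati_integrand_def mm_simps algebra_simps)
  have 1: "cl (2 * n + 1) \<rho> (incr p s t ** A1 D t $ j) (incr q s t ** A1 E t $ j)" for j
    by (rule cl_eq[OF cl_mult[OF p(3) cl_nth[OF A(2)]]]) auto
  have 2: "cl (2 * n + 1) \<rho> (p s ** incr (A1 D) s t $ j) (q s ** incr (A1 E) s t $ j)" for j
    by (rule cl_eq[OF cl_mult[OF p(1) cl_nth[OF A(3)]]]) auto
  have 3: "cl (2 * n + 1) \<rho> (transpose (incr (A1 D) s t $ j) ** p t) (transpose (incr (A1 E) s t $ j) ** q t)" for j
    by (rule cl_eq[OF cl_mult[OF cl_transpose[OF cl_nth[OF A(3)]] p(2)]]) auto
  have 4: "cl (2 * n + 1) \<rho> (transpose (A1 D s $ j) ** incr p s t) (transpose (A1 E s $ j) ** incr q s t)" for j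
    by (rule cl_eq[OF cl_mult[OF cl_transpose[OF cl_nth[OF A(1)]] p(3)]]) auto
  have "cl (2 * n + 3) \<rho> (incr (\<lambda>t. - riccati_integrand D p t) s t $ j) (incr (\<lambda>t. - riccati_integrand E q t) s t $ j)" for j
    unfolding eq by (rule cl_up[OF cl_minus[OF cl_add[OF cl_add[OF 1 2] cl_add[OF 3 4]]]]) simp
  then show ?thesis by (intro cl_up[OF cl_vec[OF _ card]]) auto
qed

section \<open>Solutions in the sense of rough integrals and solutions in the sense of
  expansions\<close>

context riccati_setting begin

text \<open>The rough integral of the definition is identified with the sewn path I. Subtracting the
  equation at two times then gives the left-endpoint expansion with w the integral of the true
  drift, and this is converted. All constants, P included, depend on the given solution.\<close>

lemma solution_imp_expansion:
  assumes sol: "riccati_solution T \<gamma> \<beta> D p p'"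
  obtains P where "p T = Qbar D" "expansion T \<theta> \<mu> (\<lambda>s t. \<phi> s t (p t)) p"
    "\<And>t. 0 \<le> t \<Longrightarrow> t \<le> T \<Longrightarrow> norm (p t) \<le> P"
proof -
  let ?Z = "riccati_integrand D p" and ?Z' = "riccati_integrand_deriv D p p'"
  have p': "p' t = - ?Z t" if "0 \<le> t" "t \<le> T" for t
    using sol that unfolding riccati_solution_def by simp
  obtain H1 where H1: "0 \<le> H1" "\<And>s t. 0 \<le> s \<Longrightarrow> s < t \<Longrightarrow> t \<le> T \<Longrightarrow> norm (incr p s t) \<le> H1 * (t - s) powr \<gamma>"
    using sol holder_finiteD unfolding riccati_solution_def controlled_def by blast
  obtain H2 where H2: "0 \<le> H2" "\<And>s t. 0 \<le> s \<Longrightarrow> s < t \<Longrightarrow> t \<le> T \<Longrightarrow> norm (incr p' s t) \<le> H2 * (t - s) powr \<beta>"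
    using sol holder_finiteD unfolding riccati_solution_def controlled_def by blast
  obtain H3 where H3: "0 \<le> H3" "\<And>s t. 0 \<le> s \<Longrightarrow> s < t \<Longrightarrow> t \<le> T \<Longrightarrow> norm (remainder (eta D) p p' s t) \<le> H3 * (t - s) powr (\<gamma> + \<beta>)"
    using sol holder_finiteD unfolding riccati_solution_def controlled_def by blast
  have I1: "norm (incr p s t) \<le> H1 * (t - s) powr \<gamma>" "norm (incr p' s t) \<le> H2 * (t - s) powr \<beta>"
    "norm (remainder (eta D) p p' s t) \<le> H3 * (t - s) powr (\<gamma> + \<beta>)" if "0 \<le> s" "s \<le> t" "t \<le> T" for s t
  proof -
    have "norm (incr p s t) \<le> H1 * (t - s) powr \<gamma> \<and> norm (incr p' s t) \<le> H2 * (t - s) powr \<beta> \<and>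
      norm (remainder (eta D) p p' s t) \<le> H3 * (t - s) powr (\<gamma> + \<beta>)"
    proof (cases "s = t")
      case True
      then show ?thesis by (simp add: remainder_def incr_def lin_app_def)
    qed (use H1 H2 H3 that in auto)
    then show "norm (incr p s t) \<le> H1 * (t - s) powr \<gamma>" "norm (incr p' s t) \<le> H2 * (t - s) powr \<beta>"
      "norm (remainder (eta D) p p' s t) \<le> H3 * (t - s) powr (\<gamma> + \<beta>)" by auto
  qed
  have pw: "(t - 0) powr \<alpha> \<le> K" if "0 \<le> t" "t \<le> T" "0 \<le> \<alpha>" "\<alpha> \<le> 1" for t \<alpha>
    using powr_le_const[of t T K \<alpha>] that K by simp
  define P where "P = norm (p 0) + norm (p' 0) + H1 * K + H2 * K + H1 + H2 + H3"
  have HK: "0 \<le> H1 * K" "0 \<le> H2 * K" using H1 H2 K by auto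
  have P: "norm (p t) \<le> P" "norm (p' t) \<le> P" if t: "0 \<le> t" "t \<le> T" for t
  proof -
    have "norm (p t) \<le> norm (p 0) + norm (incr p 0 t)" "norm (p' t) \<le> norm (p' 0) + norm (incr p' 0 t)"
      unfolding incr_def by (metis add.commute diff_add_cancel norm_triangle_ineq)+
    moreover have "norm (incr p 0 t) \<le> H1 * K" "norm (incr p' 0 t) \<le> H2 * K"
      using I1(1,2)[of 0 t] t exps mult_left_mono[OF pw[OF t, of \<gamma>] H1(1)] mult_left_mono[OF pw[OF t, of \<beta>] H2(1)] by auto
    ultimately show "norm (p t) \<le> P" "norm (p' t) \<le> P" unfolding P_def using H1(1) H2(1) H3(1) HK norm_ge_zero[of "p 0"] norm_ge_zero[of "p' 0"]
      by linarith+
  qed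
  have HP: "H1 \<le> P" "H2 \<le> P" "H3 \<le> P"
    unfolding P_def using H1(1) H2(1) H3(1) HK norm_ge_zero[of "p 0"] norm_ge_zero[of "p' 0"] by linarith+
  have Hx: "H * (t - s) powr \<alpha> \<le> P * (t - s) powr \<alpha>" if "H \<le> P" for H s t \<alpha> using that by (intro mult_right_mono) auto
  have hyp: "norm (p t) \<le> P \<and> norm (p' t) \<le> P \<and>
      norm (incr p s t) \<le> P * (t - s) powr \<gamma> \<and> norm (incr p' s t) \<le> P * (t - s) powr \<beta> \<and>
      norm (remainder (eta D) p p' s t) \<le> P * (t - s) powr (\<gamma> + \<beta>)" if "0 \<le> s" "s \<le> t" "t \<le> T" for s t
    using P[of t] that order.trans[OF I1(1)[OF that] Hx[OF HP(1)]] order.trans[OF I1(2)[OF that] Hx[OF HP(2)]]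
      order.trans[OF I1(3)[OF that] Hx[OF HP(3)]] by auto
  have hol: "norm (p t - p s) \<le> P * (t - s) powr \<gamma>" if "0 \<le> s" "s \<le> t" "t \<le> T" for s t
    using hyp[OF that] by (simp add: incr_def)
  have \<gamma>0: "0 < \<gamma>" using exps by simp
  have cont: "continuous_on {0..T} p" by (rule continuous_on_of_holder[OF \<gamma>0 hol])
  note bm = riccati_drift_measurable[OF cont]
  obtain W where W: "0 \<le> W" "\<And>s t. 0 \<le> s \<Longrightarrow> s \<le> t \<Longrightarrow> t \<le> T \<Longrightarrow>
      norm (integral {s..t} (riccati_drift D p) - \<phi> s t (p t)) \<le> W * ((t - s) powr \<gamma> * (t - s))"
    "\<And>s t. 0 \<le> s \<Longrightarrow> s \<le> t \<Longrightarrow> t \<le> T \<Longrightarrow> norm (integral {s..t} (riccati_drift D p)) \<le> W * (t - s)"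
    using riccati_drift_approx[OF \<gamma>0 hol P(1)] by blast
  obtain C where C: "0 \<le> C" "\<And>s u t. 0 \<le> s \<Longrightarrow> s \<le> u \<Longrightarrow> u \<le> t \<Longrightarrow> t \<le> T \<Longrightarrow>
    norm (lin_app (remainder (eta D) ?Z ?Z' s u) (incr (eta D) u t)
      + bilin_app (incr ?Z' s u) (eta2 D u t)) \<le> C * (t - s) powr \<theta>"
    using riccati_integrand_rough_defect[OF hyp] by blast
  obtain X where X: "0 \<le> X" "\<And>s t p. 0 \<le> s \<Longrightarrow> s \<le> t \<Longrightarrow> t \<le> T \<Longrightarrow> norm p \<le> P \<Longrightarrow>
    norm (\<Xi> p s t) \<le> X * (t - s) powr \<gamma> \<and> norm (xi2 p (G1 s t) (G2 s t)) \<le> X * (t - s) powr (2 * \<gamma>) \<and>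
    norm (congr (\<mu> s t) (p - \<Xi> p s t) - p) \<le> X * (t - s) powr \<theta>"
    using xi_bounds[of P] by blast
  define g where "g s t = lin_app (?Z s) (incr (eta D) s t) + bilin_app (?Z' s) (eta2 D s t)" for s t
  have g: "g s t = \<Xi> (p s) s t" if "0 \<le> s" "s \<le> t" "t \<le> T" for s t
    unfolding g_def using that by (intro rough_germ_eq_xi p') auto
  \<comment> \<open>Translations by the germ g: the sewing theorem for almost flows contains
    additive sewing, the Lipschitz condition being trivial because differences of points are
    preserved.\<close>
  have "almost_flow (\<lambda>s t x. x + g s t) 0 T (C + X) \<gamma> \<theta>"
  proof
    fix s t and x y :: "real^'d^'d" assume st: "0 \<le> s" "s \<le> t" "t \<le> T"
    show "norm (x + g s t - (y + g s t) - (x - y)) \<le> (C + X) * (t - s) powr \<gamma> * norm (x - y)"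
      using C(1) X(1) by simp
    have "norm (g s t) \<le> X * (t - s) powr \<gamma>" unfolding g[OF st] using X(2)[OF st P(1)] st by auto
    also have "\<dots> \<le> (C + X) * (1 + norm x) * (t - s) powr \<gamma>"
      using mult_mono[of X "C + X" 1 "1 + norm x"] C(1) X(1) by (intro mult_right_mono) auto
    finally show "norm (x + g s t - x) \<le> (C + X) * (1 + norm x) * (t - s) powr \<gamma>" by simp
  next
    fix s u t and x :: "real^'d^'d" assume sut: "0 \<le> s" "s \<le> u" "u \<le> t" "t \<le> T"
    have eq: "x + g s u + g u t - (x + g s t) =
      lin_app (remainder (eta D) ?Z ?Z' s u) (incr (eta D) u t) + bilin_app (incr ?Z' s u) (eta2 D u t)"
      using rough_germ_additive_defect[OF chen[OF sut], of ?Z ?Z'] unfolding g_def by (simp add: algebra_simps)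
    have "norm (x + g s u + g u t - (x + g s t)) \<le> C * (t - s) powr \<theta>" unfolding eq by (rule C(2)[OF sut])
    also have "\<dots> \<le> (C + X) * (1 + norm x) * (t - s) powr \<theta>"
      using mult_mono[of C "C + X" 1 "1 + norm x"] C(1) X(1) by (intro mult_right_mono) auto
    finally show "norm (x + g s u + g u t - (x + g s t)) \<le> (C + X) * (1 + norm x) * (t - s) powr \<theta>" .
  qed (use C(1) X(1) exps in auto)
  from almost_flow.sewing[OF this, of 0] T obtain I B where
    IB: "\<And>s t. 0 \<le> s \<Longrightarrow> s \<le> t \<Longrightarrow> t \<le> T \<Longrightarrow> norm (I t - (I s + g s t)) \<le> B * (t - s) powr \<theta>"
    by (auto simp: less_imp_le)
  have ri: "rough_integral (eta D) (eta2 D) ?Z ?Z' t = I t - I 0" if "0 \<le> t" "t \<le> T" for t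
    by (rule rough_integral_eq[OF exps(6) _ that]) (use IB in \<open>auto simp: g_def diff_diff_eq\<close>)
  have peq: "p t = Qbar D + (I T - I t) + integral {t..T} (riccati_drift D p)" if t: "0 \<le> t" "t \<le> T" for t
  proof -
    have "p t = Qbar D + (rough_integral (eta D) (eta2 D) ?Z ?Z' T - rough_integral (eta D) (eta2 D) ?Z ?Z' t)
      + (LINT s:{t..T}|lborel. riccati_drift D p s)"
      using sol t unfolding riccati_solution_def by simp
    then show ?thesis using ri[of T] ri[OF t] T bounded_measurable_integral(2)[OF bm, of t T] t by simp
  qed
  have "davie (\<lambda>s t. integral {s..t} (riccati_drift D p)) p"
    unfolding davie_def
  proof (intro exI[of _ B] allI impI, elim conjE)
    fix s t assume st: "0 \<le> s" "s \<le> t" "t \<le> T"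
    have eq: "p t - p s + \<Xi> (p s) s t + integral {s..t} (riccati_drift D p) = - (I t - (I s + g s t))"
      using peq[of s] peq[of t] st integral_add_intervals[OF bm, of s t T] g[OF st] by (simp add: algebra_simps)
    show "norm (p t - p s + \<Xi> (p s) s t + integral {s..t} (riccati_drift D p)) \<le> B * (t - s) powr \<theta>"
      unfolding eq norm_minus_cancel by (rule IB[OF st])
  qed
  from davie_imp_expansion[OF P(1) W this] have "expansion T \<theta> \<mu> (\<lambda>s t. \<phi> s t (p t)) p" .
  moreover have "p T = Qbar D" using peq[of T] T by simp
  ultimately show thesis using P(1) that by blast
qed

text \<open>The path J, minus p minus the integral of the drift from 0, already has increments
  matching the germ, so \<open>rough_integral_eq\<close> evaluates the rough integral and the
  equation becomes an identity. It remains to check that p is controlled by its prescribed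
  derivative.\<close>

lemma expansion_imp_solution:
  assumes pT: "p T = Qbar D" and exp: "expansion T \<theta> \<mu> (\<lambda>s t. \<phi> s t (p t)) p"
    and P: "\<And>t. 0 \<le> t \<Longrightarrow> t \<le> T \<Longrightarrow> norm (p t) \<le> P"
  shows "riccati_solution T \<gamma> \<beta> D p (\<lambda>t. - riccati_integrand D p t)"
proof -
  let ?p' = "\<lambda>t. - riccati_integrand D p t"
  let ?Z = "riccati_integrand D p" and ?Z' = "riccati_integrand_deriv D p ?p'"
  have \<gamma>0: "0 < \<gamma>" using exps by simp
  have \<phi>_le: "norm (\<phi> s t (p t)) \<le> K ^ 30 * (2 * P + P\<^sup>2 + 1) * (t - s)" if "0 \<le> s" "s \<le> t" "t \<le> T" for s t
    using G.norm_drift_germ_le[OF that P] that by auto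
  obtain H where H: "\<And>s t. 0 \<le> s \<Longrightarrow> s \<le> t \<Longrightarrow> t \<le> T \<Longrightarrow> norm (p t - p s) \<le> H * (t - s) powr \<gamma>"
    using G.expansion_holder[OF exp \<phi>_le P] by blast
  have cont: "continuous_on {0..T} p" by (rule continuous_on_of_holder[OF \<gamma>0 H])
  note bm = riccati_drift_measurable[OF cont]
  let ?w = "\<lambda>s t. integral {s..t} (riccati_drift D p)"
  obtain W where W: "0 \<le> W" "\<And>s t. 0 \<le> s \<Longrightarrow> s \<le> t \<Longrightarrow> t \<le> T \<Longrightarrow>
      norm (integral {s..t} (riccati_drift D p) - \<phi> s t (p t)) \<le> W * ((t - s) powr \<gamma> * (t - s))"
    "\<And>s t. 0 \<le> s \<Longrightarrow> s \<le> t \<Longrightarrow> t \<le> T \<Longrightarrow> norm (integral {s..t} (riccati_drift D p)) \<le> W * (t - s)"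
    using riccati_drift_approx[OF \<gamma>0 H P] by blast
  obtain B where B: "\<And>s t. 0 \<le> s \<Longrightarrow> s \<le> t \<Longrightarrow> t \<le> T \<Longrightarrow> norm (p t - p s + \<Xi> (p s) s t + ?w s t) \<le> B * (t - s) powr \<theta>"
    using expansion_imp_davie[OF P W exp] unfolding davie_def by blast
  obtain X where X: "0 \<le> X" "\<And>s t p. 0 \<le> s \<Longrightarrow> s \<le> t \<Longrightarrow> t \<le> T \<Longrightarrow> norm p \<le> P \<Longrightarrow>
    norm (\<Xi> p s t) \<le> X * (t - s) powr \<gamma> \<and> norm (xi2 p (G1 s t) (G2 s t)) \<le> X * (t - s) powr (2 * \<gamma>) \<and>
    norm (congr (\<mu> s t) (p - \<Xi> p s t) - p) \<le> X * (t - s) powr \<theta>"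
    using xi_bounds[of P] by blast
  have germ: "lin_app (?Z s) (incr (eta D) s t) + bilin_app (?Z' s) (eta2 D s t) = \<Xi> (p s) s t"
    if "0 \<le> s" "s \<le> t" "t \<le> T" for s t
    using that by (intro rough_germ_eq_xi) auto
  have "holder T \<gamma> (incr p) < \<infinity>"
    by (rule holder_finiteI[of _ _ H]) (use H in \<open>auto simp: incr_def\<close>)
  moreover have "holder T \<beta> (incr ?p') < \<infinity>"
  proof -
    define N where "N = K + \<bar>P\<bar> + K * \<bar>H\<bar>"
    have KH: "\<bar>H\<bar> \<le> K * \<bar>H\<bar>" using K by (simp add: mult_le_cancel_right1)
    have N: "2 \<le> N" "P \<le> N" "K \<le> N" "real CARD('p) \<le> N" "K * \<bar>H\<bar> \<le> N" unfolding N_def using K KH by auto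
    interpret two_data N 0 by unfold_locales (use N in auto)
    show ?thesis
    proof (rule holder_finiteI)
      fix s t assume "0 \<le> s" "s < t" "t \<le> T"
      then have st: "0 \<le> s" "s \<le> t" "t \<le> T" by auto
      then have tt: "0 \<le> t" "t \<le> t" "t \<le> T" by auto
      have cp: "cl 1 1 (p s) (p s)" "cl 1 1 (p t) (p t)"
        using P[of s] P[of t] st N by (auto intro!: cl_selfI simp del: One_nat_def)
      have cd: "cl 1 ((t - s) powr \<beta>) (incr p s t) (incr p s t)"
      proof (rule cl_selfI)
        have "norm (incr p s t) \<le> H * (t - s) powr \<gamma>" using H[OF st] by (simp add: incr_def)
        also have "\<dots> \<le> \<bar>H\<bar> * (K * (t - s) powr \<beta>)"
          using powr_le_scale[of "t - s" T K \<beta> \<gamma>] exps K st by (intro mult_mono) auto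
        also have "\<dots> \<le> N ^ 1 * (t - s) powr \<beta>" using N(5) mult_right_mono[OF N(5), of "(t - s) powr \<beta>"] by (simp add: mult_ac)
        finally show "norm (incr p s t) \<le> N ^ 1 * (t - s) powr \<beta>" .
      qed simp
      have "cl (2 * 1 + 4) ((t - s) powr \<beta>) (incr ?p' s t) (incr ?p' s t)"
        by (rule cl_incr_riccati_integrand[OF cp cd cl_base_mono[OF K(1) N(3) order_refl R.base(3)[OF st order_refl]]
            cl_base_mono[OF K(1) N(3) order_refl R.base(3)[OF tt order_refl]]
            cl_base_mono[OF K(1) N(3) order_refl R.base(5)[OF st order_refl]] N(4)])
      then show "norm (incr ?p' s t) \<le> N ^ (2 * 1 + 4) * (t - s) powr \<beta>" by (rule cl_selfD)
    qed
  qed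
  moreover have "holder T (\<gamma> + \<beta>) (remainder (eta D) p ?p') < \<infinity>"
  proof (rule holder_finiteI)
    fix s t assume "0 \<le> s" "s < t" "t \<le> T"
    then have st: "0 \<le> s" "s \<le> t" "t \<le> T" by auto
    define h where "h = t - s"
    have h: "0 \<le> h" "h \<le> T" using st by (auto simp: h_def)
    have sc: "h powr \<alpha> \<le> K * h powr (\<gamma> + \<beta>)" if "\<gamma> + \<beta> \<le> \<alpha>" "\<alpha> \<le> \<gamma> + \<beta> + 1" for \<alpha>
      using h K that by (intro powr_le_scale) auto
    \<comment> \<open>The first-order part of \<Xi> is minus the Gubinelli derivative applied to the
      increment of the path. What remains has the orders \<theta>, 2 \<gamma> and 1, all at least
      \<gamma> + \<beta>.\<close>
    have eq: "remainder (eta D) p ?p' s t = (p t - p s + \<Xi> (p s) s t + ?w s t) - (xi2 (p s) (G1 s t) (G2 s t) + ?w s t)"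
      unfolding remainder_def lin_app_algebra lin_app_riccati_integrand by (simp add: incr_def germ1_def)
    have "norm (remainder (eta D) p ?p' s t) \<le> \<bar>B\<bar> * (K * h powr (\<gamma> + \<beta>)) + (X * (K * h powr (\<gamma> + \<beta>)) + W * (K * h powr (\<gamma> + \<beta>)))"
      unfolding eq
    proof (rule order.trans[OF norm_triangle_ineq4 add_mono[OF _ order.trans[OF norm_triangle_ineq add_mono]]])
      have "norm (p t - p s + \<Xi> (p s) s t + ?w s t) \<le> B * h powr \<theta>" using B[OF st] by (simp add: h_def)
      also have "\<dots> \<le> \<bar>B\<bar> * (K * h powr (\<gamma> + \<beta>))" using exps by (intro mult_mono sc) auto
      finally show "norm (p t - p s + \<Xi> (p s) s t + ?w s t) \<le> \<bar>B\<bar> * (K * h powr (\<gamma> + \<beta>))" .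
      have "norm (xi2 (p s) (G1 s t) (G2 s t)) \<le> X * h powr (2 * \<gamma>)" using X(2)[OF st P] st by (auto simp: h_def)
      also have "\<dots> \<le> X * (K * h powr (\<gamma> + \<beta>))" using exps X(1) by (intro mult_left_mono sc) auto
      finally show "norm (xi2 (p s) (G1 s t) (G2 s t)) \<le> X * (K * h powr (\<gamma> + \<beta>))" .
      have "norm (?w s t) \<le> W * h powr 1" using W(3)[OF st] h by (simp add: h_def)
      also have "\<dots> \<le> W * (K * h powr (\<gamma> + \<beta>))" using exps W(1) by (intro mult_left_mono sc) auto
      finally show "norm (?w s t) \<le> W * (K * h powr (\<gamma> + \<beta>))" .
    qed
    then show "norm (remainder (eta D) p ?p' s t) \<le> (\<bar>B\<bar> * K + (X * K + W * K)) * (t - s) powr (\<gamma> + \<beta>)"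
      by (simp add: h_def algebra_simps)
  qed
  moreover have "p t = Qbar D + (rough_integral (eta D) (eta2 D) ?Z ?Z' T - rough_integral (eta D) (eta2 D) ?Z ?Z' t)
      + (LINT s:{t..T}|lborel. riccati_drift D p s)" if t: "0 \<le> t" "t \<le> T" for t
  proof -
    define J where "J t = - p t - ?w 0 t" for t
    have ri: "rough_integral (eta D) (eta2 D) ?Z ?Z' t = J t - J 0" if "0 \<le> t" "t \<le> T" for t
    proof (rule rough_integral_eq[OF exps(6) _ that])
      fix s t assume st: "0 \<le> s" "s \<le> t" "t \<le> T"
      have eq: "J t - J s - (lin_app (?Z s) (incr (eta D) s t) + bilin_app (?Z' s) (eta2 D s t)) = - (p t - p s + \<Xi> (p s) s t + ?w s t)"
        unfolding J_def germ[OF st] using integral_add_intervals[OF bm, of 0 s t] st by (simp add: algebra_simps)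
      show "norm (J t - J s - (lin_app (?Z s) (incr (eta D) s t) + bilin_app (?Z' s) (eta2 D s t))) \<le> B * (t - s) powr \<theta>"
        unfolding eq norm_minus_cancel by (rule B[OF st])
    qed
    have "?w 0 T = ?w 0 t + ?w t T" using integral_add_intervals[OF bm, of 0 t T] t by simp
    moreover have "rough_integral (eta D) (eta2 D) ?Z ?Z' T - rough_integral (eta D) (eta2 D) ?Z ?Z' t = J T - J t"
      using ri[of T] ri[OF t] T by simp
    ultimately show ?thesis
      using bounded_measurable_integral(2)[OF bm, of t T] t pT by (simp add: J_def)
  qed
  ultimately show ?thesis unfolding riccati_solution_def controlled_def by auto
qed

text \<open>Each solution is bounded by a constant of its own, and the drift is Lipschitz on a ball
  containing both; this is what \<open>expansion_unique\<close> asks for. The derivatives agree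
  because the equation prescribes them.\<close>

lemma solution_unique:
  assumes "riccati_solution T \<gamma> \<beta> D p p'" "riccati_solution T \<gamma> \<beta> D q q'" and t: "0 \<le> t" "t \<le> T"
  shows "q t = p t \<and> q' t = p' t"
proof -
  have eq: "p t = q t" if t: "0 \<le> t" "t \<le> T" for t
  proof (rule solution_imp_expansion[OF assms(1)], rule solution_imp_expansion[OF assms(2)])
    fix P Q assume p: "p T = Qbar D" "expansion T \<theta> \<mu> (\<lambda>s t. \<phi> s t (p t)) p" "\<And>t. 0 \<le> t \<Longrightarrow> t \<le> T \<Longrightarrow> norm (p t) \<le> P"
      and q: "q T = Qbar D" "expansion T \<theta> \<mu> (\<lambda>s t. \<phi> s t (q t)) q" "\<And>t. 0 \<le> t \<Longrightarrow> t \<le> T \<Longrightarrow> norm (q t) \<le> Q"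
    let ?M = "max P Q"
    have le: "norm (p t) \<le> ?M" "norm (q t) \<le> ?M" if "0 \<le> t" "t \<le> T" for t using p(3)[OF that] q(3)[OF that] by auto
    have M0: "0 \<le> ?M" using le(1)[OF t] norm_ge_zero order_trans by blast
    show "p t = q t"
    proof (rule G.expansion_unique[OF p(2) q(2) le, where L = "K ^ 30 * (2 + 2 * ?M)"])
      show "0 \<le> K ^ 30 * (2 + 2 * ?M)" using M0 K by simp
      fix s t assume st: "0 \<le> s" "s \<le> t" "t \<le> T"
      then show "norm (\<phi> s t (p t) - \<phi> s t (q t)) \<le> K ^ 30 * (2 + 2 * ?M) * norm (p t - q t) * (t - s)"
        using G.norm_drift_germ_diff_le[OF st le] by (simp add: mult_ac)
    qed (use p q t in auto)
  qed
  moreover have "p' t = - riccati_integrand D p t" "q' t = - riccati_integrand D q t"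
    using assms unfolding riccati_solution_def by auto
  ultimately show ?thesis using eq[OF t] by (simp add: riccati_integrand_def)
qed

end

section \<open>Bounds from the distance of the data\<close>

lemma ennreal_add_leD: "a + b \<le> c \<Longrightarrow> a \<le> c \<and> b \<le> (c :: ennreal)"
  by (meson le_iff_add order_trans add_increasing zero_le order_refl)

lemma sup_norm_leD:
  assumes "sup_norm T f \<le> ennreal C" "0 \<le> C" "0 \<le> t" "t \<le> T" shows "norm (f t) \<le> C"
proof -
  have "ennreal (norm (f t)) \<le> sup_norm T f" unfolding sup_norm_def using assms by (intro SUP_upper) auto
  then show ?thesis using assms by (meson ennreal_le_iff order_trans)
qed

lemma incr_diff: "incr (\<lambda>t. f t - g t) s t = incr f s t - incr g s t"
  by (simp add: incr_def)

text \<open>A pointwise form of \<open>data_dist\<close>. The factor 2 + T comes from reaching time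
  t from the value at 0, which costs e + e (1 + T).\<close>

definition data_close ::
  "real \<Rightarrow> real \<Rightarrow> real \<Rightarrow> real \<Rightarrow> real \<Rightarrow> ('d::finite, 'p::finite) riccati_data \<Rightarrow> ('d, 'p) riccati_data \<Rightarrow> bool" where
  "data_close T \<gamma> \<beta> \<beta>' e D E \<longleftrightarrow> norm (Qbar D - Qbar E) \<le> e \<and>
    (\<forall>t. 0 \<le> t \<and> t \<le> T \<longrightarrow> norm (Afun D t - Afun E t) \<le> e \<and> norm (Bfun D t - Bfun E t) \<le> e \<and>
      norm (Qfun D t - Qfun E t) \<le> e \<and> norm (Rfun D t - Rfun E t) \<le> e \<and>
      norm (A1 D t - A1 E t) \<le> e * (2 + T) \<and> norm (A1' D t - A1' E t) \<le> e * (2 + T)) \<and>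
    (\<forall>s t. 0 \<le> s \<and> s \<le> t \<and> t \<le> T \<longrightarrow>
      norm (incr (eta D) s t - incr (eta E) s t) \<le> e * (t - s) powr \<gamma> \<and>
      norm (eta2 D s t - eta2 E s t) \<le> e * (t - s) powr (2 * \<gamma>) \<and>
      norm (incr (A1 D) s t - incr (A1 E) s t) \<le> e * (t - s) powr \<beta> \<and>
      norm (incr (A1' D) s t - incr (A1' E) s t) \<le> e * (t - s) powr \<beta>' \<and>
      norm (remainder (eta D) (A1 D) (A1' D) s t - remainder (eta E) (A1 E) (A1' E) s t) \<le> e * (t - s) powr (\<beta> + \<beta>'))"

text \<open>\<open>diag\<close> is a separate hypothesis because the seminorms ignore s = t; for
  rough paths it follows from Chen's relation.\<close>

lemma data_dist_le_imp_data_close: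
  fixes D E :: "('d::finite, 'p::finite) riccati_data"
  assumes dist: "data_dist T \<gamma> \<beta> \<beta>' D E \<le> ennreal e" and e: "0 \<le> e" and T: "0 < T"
    and exps: "0 < \<beta>'" "\<beta>' \<le> \<beta>" "\<beta> \<le> 1"
    and diag: "\<And>s. 0 \<le> s \<Longrightarrow> s \<le> T \<Longrightarrow> eta2 D s s = eta2 E s s"
  shows "data_close T \<gamma> \<beta> \<beta>' e D E"
proof -
  note * = dist[unfolded data_dist_def rough_dist_def controlled_dist_def]
  have q: "norm (Qbar D - Qbar E) \<le> e" "norm (A1 D 0 - A1 E 0) \<le> e" "norm (A1' D 0 - A1' E 0) \<le> e"
    and sup: "sup_norm T (\<lambda>t. Afun D t - Afun E t) \<le> ennreal e" "sup_norm T (\<lambda>t. Bfun D t - Bfun E t) \<le> ennreal e"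
      "sup_norm T (\<lambda>t. Qfun D t - Qfun E t) \<le> ennreal e" "sup_norm T (\<lambda>t. Rfun D t - Rfun E t) \<le> ennreal e"
    and hol: "holder T \<gamma> (\<lambda>s t. incr (eta D) s t - incr (eta E) s t) \<le> ennreal e"
      "holder T (2 * \<gamma>) (\<lambda>s t. eta2 D s t - eta2 E s t) \<le> ennreal e"
      "holder T \<beta> (incr (\<lambda>t. A1 D t - A1 E t)) \<le> ennreal e" "holder T \<beta>' (incr (\<lambda>t. A1' D t - A1' E t)) \<le> ennreal e"
      "holder T (\<beta> + \<beta>') (\<lambda>s t. remainder (eta D) (A1 D) (A1' D) s t - remainder (eta E) (A1 E) (A1' E) s t) \<le> ennreal e"
    using * e by (auto dest!: ennreal_add_leD)
  have inc: "norm (incr (eta D) s t - incr (eta E) s t) \<le> e * (t - s) powr \<gamma> \<and>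
      norm (eta2 D s t - eta2 E s t) \<le> e * (t - s) powr (2 * \<gamma>) \<and>
      norm (incr (A1 D) s t - incr (A1 E) s t) \<le> e * (t - s) powr \<beta> \<and>
      norm (incr (A1' D) s t - incr (A1' E) s t) \<le> e * (t - s) powr \<beta>' \<and>
      norm (remainder (eta D) (A1 D) (A1' D) s t - remainder (eta E) (A1 E) (A1' E) s t) \<le> e * (t - s) powr (\<beta> + \<beta>')"
    if st: "0 \<le> s" "s \<le> t" "t \<le> T" for s t
  proof (cases "s = t")
    case True
    then show ?thesis using diag[of s] st by (simp add: incr_def remainder_def lin_app_def)
  next
    case False
    then have st: "0 \<le> s" "s < t" "t \<le> T" using st by auto
    show ?thesis
      using holder_leD[OF hol(1) e st] holder_leD[OF hol(2) e st] holder_leD[OF hol(3) e st]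
        holder_leD[OF hol(4) e st] holder_leD[OF hol(5) e st]
      by (simp add: incr_diff)
  qed
  have val: "norm (f t - g t) \<le> e * (2 + T)"
    if "norm (f 0 - g 0) \<le> e" "norm (incr f 0 t - incr g 0 t) \<le> e * (t - 0) powr \<alpha>" "0 \<le> t" "t \<le> T" "0 < \<alpha>" "\<alpha> \<le> 1"
    for f g :: "real \<Rightarrow> 'v::real_normed_vector" and t \<alpha>
  proof -
    have "norm (f t - g t) \<le> norm (f 0 - g 0) + norm (incr f 0 t - incr g 0 t)"
      using norm_triangle_ineq[of "f 0 - g 0" "incr f 0 t - incr g 0 t"] by (simp add: incr_def)
    also have "\<dots> \<le> e + e * (1 + T)"
      using that(1) order_trans[OF that(2) mult_left_mono[OF powr_le_const[of "t - 0" T "1 + T" \<alpha>] e]] that by auto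
    finally show ?thesis by (simp add: algebra_simps)
  qed
  have b: "\<beta>' \<le> 1" "0 < \<beta>" using exps by auto
  have "norm (A1 D t - A1 E t) \<le> e * (2 + T)" "norm (A1' D t - A1' E t) \<le> e * (2 + T)" if t: "0 \<le> t" "t \<le> T" for t
    using val[of "A1 D" "A1 E", OF q(2) _ t b(2) exps(3)] val[of "A1' D" "A1' E", OF q(3) _ t exps(1) b(1)]
      inc[of 0 t] t by auto
  then show ?thesis
    unfolding data_close_def
    using q(1) sup_norm_leD[OF sup(1) e] sup_norm_leD[OF sup(2) e] sup_norm_leD[OF sup(3) e] sup_norm_leD[OF sup(4) e] inc
    by blast
qed

lemma rough_path_diag:
  assumes "rough_path T \<gamma> \<eta> \<eta>2" "0 \<le> s" "s \<le> T" shows "\<eta>2 s s = 0"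
proof -
  have "\<eta>2 s s - \<eta>2 s s - \<eta>2 s s = tensor (incr \<eta> s s) (incr \<eta> s s)"
    using assms unfolding rough_path_def by blast
  then show ?thesis by (simp add: tensor_def incr_def vec_eq_iff)
qed

lemma data_close_zeroD:
  fixes D :: "('d::finite, 'p::finite) riccati_data"
  assumes "data_close T \<gamma> \<beta> \<beta>' e D zero_data"
  shows "norm (Qbar D) \<le> e"
    "\<And>t. 0 \<le> t \<Longrightarrow> t \<le> T \<Longrightarrow> norm (Afun D t) \<le> e \<and> norm (Bfun D t) \<le> e \<and> norm (Qfun D t) \<le> e \<and> norm (Rfun D t) \<le> e \<and>
      norm (A1 D t) \<le> e * (2 + T) \<and> norm (A1' D t) \<le> e * (2 + T)"
    "\<And>s t. 0 \<le> s \<Longrightarrow> s \<le> t \<Longrightarrow> t \<le> T \<Longrightarrow> norm (incr (eta D) s t) \<le> e * (t - s) powr \<gamma> \<and>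
      norm (eta2 D s t) \<le> e * (t - s) powr (2 * \<gamma>) \<and>
      norm (incr (A1 D) s t) \<le> e * (t - s) powr \<beta> \<and> norm (incr (A1' D) s t) \<le> e * (t - s) powr \<beta>' \<and>
      norm (remainder (eta D) (A1 D) (A1' D) s t) \<le> e * (t - s) powr (\<beta> + \<beta>')"
  using assms unfolding data_close_def zero_data_def remainder_def by (simp_all add: incr_def lin_app_def)

text \<open>It supplies a size M for a single datum, so that existence can be derived inside the
  setting made for two data.\<close>

lemma admissible_finite_data_dist:
  assumes "admissible_data T \<gamma> \<beta> \<beta>' r (D :: ('d::finite, 'p::finite) riccati_data)"
  shows "data_dist T \<gamma> \<beta> \<beta>' D zero_data < \<infinity>"
proof -
  have sup: "sup_norm T f < top" if f: "bounded_measurable T f" for f :: "real \<Rightarrow> real^'d^'d"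
  proof -
    obtain C where "0 \<le> C" "\<And>t. 0 \<le> t \<Longrightarrow> t \<le> T \<Longrightarrow> norm (f t) \<le> C" using bounded_measurableD[OF f] by blast
    then have "sup_norm T f \<le> ennreal C" unfolding sup_norm_def by (intro SUP_least ennreal_leI) auto
    then show ?thesis by (metis ennreal_less_top order_le_less_trans)
  qed
  have z: "incr (\<lambda>_. 0) s t = 0" "remainder (\<lambda>_. 0) (\<lambda>_. 0) (\<lambda>_. 0) s t = 0" for s t
    by (simp_all add: incr_def remainder_def lin_app_def)
  show ?thesis
    using assms
    unfolding data_dist_def zero_data_def admissible_data_def geometric_rough_path_def rough_path_def rough_dist_def
      controlled_dist_def controlled_def
    by (auto simp: z ennreal_add_less_top sup)
qed

lemma (in two_data) cl_fst: "cl n r x y \<Longrightarrow> two_data.cl K 0 n r x x"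
  unfolding cl_def two_data.cl_def[OF two_data.intro[OF K2 order_refl]] by simp

text \<open>K dominates all sizes that occur: the horizon, the number of noise components, the
  identity matrix, the values of \<open>A1\<close> and \<open>A1'\<close> at any time and the
  inverse of R. It can be chosen from T, r, M and the dimensions, independently of the distance
  e.\<close>

locale lipschitz_setting =
  fixes T \<gamma> \<beta> \<beta>' r M K e :: real and D E :: "('d::finite, 'p::finite) riccati_data"
  assumes pos: "0 < T" "0 < r" "0 \<le> M" "0 \<le> e"
    and exps: "1 / 3 < \<gamma>" "\<gamma> < 1 / 2" "0 < \<beta>'" "\<beta>' \<le> \<beta>" "\<beta> \<le> \<gamma>" "\<gamma> + \<beta> + \<beta>' > 1"
    and K: "2 + T \<le> K" "real CARD('p) \<le> K" "norm (mat 1 :: real^'d^'d) \<le> K" "M * (2 + T) \<le> K" "real CARD('d) / r \<le> K"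
    and adm: "admissible_data T \<gamma> \<beta> \<beta>' r D" "admissible_data T \<gamma> \<beta> \<beta>' r E"
    and bd: "data_close T \<gamma> \<beta> \<beta>' M D zero_data" "data_close T \<gamma> \<beta> \<beta>' M E zero_data" "data_close T \<gamma> \<beta> \<beta>' e D E"
begin

lemma K2: "2 \<le> K" "1 + T \<le> K" and MK: "M \<le> K"
proof -
  have "M * 1 \<le> M * (2 + T)" using pos by (intro mult_left_mono) auto
  then show "2 \<le> K" "1 + T \<le> K" "M \<le> K" using K pos by auto
qed

sublocale two_data K e by unfold_locales (use K2 pos in auto)

lemma clI: "norm x \<le> c * h \<Longrightarrow> norm y \<le> c * h \<Longrightarrow> norm (x - y) \<le> b * h \<Longrightarrow> c \<le> K \<Longrightarrow> b \<le> K * e \<Longrightarrow> 0 \<le> h \<Longrightarrow> cl 1 h x y"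
  unfolding cl_def power_one_right by (meson mult_right_mono order_trans)

lemma eK: "e \<le> K * e" "e * (2 + T) \<le> K * e"
  using mult_right_mono[of 1 K e] mult_right_mono[OF K(1) pos(4)] K2 pos by (auto simp: mult.commute)

lemma cl_values:
  assumes t: "0 \<le> t" "t \<le> T"
  shows "cl 1 1 (Afun D t) (Afun E t)" "cl 1 1 (Bfun D t) (Bfun E t)" "cl 1 1 (Qfun D t) (Qfun E t)"
    "cl 1 1 (A1 D t) (A1 E t)" "cl 1 1 (A1' D t) (A1' E t)"
proof -
  note b = data_close_zeroD(2)[OF bd(1) t] data_close_zeroD(2)[OF bd(2) t]
  have d: "norm (Afun D t - Afun E t) \<le> e \<and> norm (Bfun D t - Bfun E t) \<le> e \<and> norm (Qfun D t - Qfun E t) \<le> e \<and>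
      norm (A1 D t - A1 E t) \<le> e * (2 + T) \<and> norm (A1' D t - A1' E t) \<le> e * (2 + T)"
    using bd(3) t unfolding data_close_def by blast
  show "cl 1 1 (Afun D t) (Afun E t)" "cl 1 1 (Bfun D t) (Bfun E t)" "cl 1 1 (Qfun D t) (Qfun E t)"
    by (rule clI[of _ M _ _ e, OF _ _ _ MK eK(1)]; use b d in simp)+
  show "cl 1 1 (A1 D t) (A1 E t)" "cl 1 1 (A1' D t) (A1' E t)"
    by (rule clI[of _ "M * (2 + T)" _ _ "e * (2 + T)", OF _ _ _ K(4) eK(2)]; use b d in simp)+
qed

lemma chen:
  assumes "0 \<le> s" "s \<le> u" "u \<le> t" "t \<le> T"
  shows "eta2 D s t - eta2 D s u - eta2 D u t = tensor (incr (eta D) s u) (incr (eta D) u t)"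
    "eta2 E s t - eta2 E s u - eta2 E u t = tensor (incr (eta E) s u) (incr (eta E) u t)"
  using adm assms unfolding admissible_data_def geometric_rough_path_def rough_path_def by blast+

lemma close_data: "close_rough_data K T \<gamma> \<beta> \<beta>' e (eta D) (eta2 D) (A1 D) (A1' D) (eta E) (eta2 E) (A1 E) (A1' E)"
  unfolding close_rough_data_def
proof (intro conjI[OF _ allI[OF allI[OF allI[OF impI]]]] allI impI, elim conjE)
  fix s t assume st: "0 \<le> s" "s \<le> t" "t \<le> T"
  have s: "s \<le> T" using st by simp
  note b = data_close_zeroD(3)[OF bd(1) st] data_close_zeroD(3)[OF bd(2) st]
  show "cl 1 ((t - s) powr \<gamma>) (incr (eta D) s t) (incr (eta E) s t) \<and>
      cl 1 ((t - s) powr (2 * \<gamma>)) (eta2 D s t) (eta2 E s t) \<and>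
      cl 1 1 (A1 D s) (A1 E s) \<and> cl 1 1 (A1' D s) (A1' E s) \<and>
      cl 1 ((t - s) powr \<beta>) (incr (A1 D) s t) (incr (A1 E) s t) \<and>
      cl 1 ((t - s) powr \<beta>') (incr (A1' D) s t) (incr (A1' E) s t) \<and>
      cl 1 ((t - s) powr (\<beta> + \<beta>')) (remainder (eta D) (A1 D) (A1' D) s t) (remainder (eta E) (A1 E) (A1' E) s t)"
    by (intro conjI cl_values st(1) s; rule clI[of _ M _ _ e, OF _ _ _ MK eK(1)])
      (use b st bd(3)[unfolded data_close_def] in auto)
qed (use chen in auto)

sublocale RR: two_rough_data K e T \<gamma> \<beta> \<beta>' "eta D" "eta E" "eta2 D" "eta2 E" "A1 D" "A1 E" "A1' D" "A1' E"
  by unfold_locales (use pos exps K K2 close_data in auto)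

lemma coeffs: "drift_coeffs T r D" "drift_coeffs T r E"
  using adm pos unfolding admissible_data_def drift_coeffs_def by auto

text \<open>The resolvent identity again; the common lower bound r enters through CARD('d) / r \<le>
  K.\<close>

lemma cl_inverse:
  assumes t: "0 \<le> t" "t \<le> T"
  shows "cl 2 1 (matrix_inv (Rfun D t)) (matrix_inv (Rfun E t))"
proof -
  have pd: "positive_definite (Rfun D t - r *\<^sub>R mat 1)" "positive_definite (Rfun E t - r *\<^sub>R mat 1)"
    using adm t unfolding admissible_data_def by auto
  note i = coercive_inverse[OF pos(2) pd(1)] coercive_inverse[OF pos(2) pd(2)]
  have n: "norm (matrix_inv (Rfun D t)) \<le> K" "norm (matrix_inv (Rfun E t)) \<le> K"
    using order_trans[OF _ K(5)] i by auto
  have d: "norm (Rfun E t - Rfun D t) \<le> e"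
    using bd(3) t unfolding data_close_def by (auto simp: norm_minus_commute)
  have "norm (matrix_inv (Rfun D t) - matrix_inv (Rfun E t)) \<le>
      norm (matrix_inv (Rfun D t)) * norm (Rfun E t - Rfun D t) * norm (matrix_inv (Rfun E t))"
    unfolding matrix_inv_diff[OF i(2) i(5)] by (rule norm_matrix_mult3_le)
  also have "\<dots> \<le> K * e * K" using n d pos K2 by (intro mult_mono mult_nonneg_nonneg) auto
  finally have "norm (matrix_inv (Rfun D t) - matrix_inv (Rfun E t)) \<le> K\<^sup>2 * e" by (simp add: power2_eq_square mult_ac)
  moreover have "K \<le> K\<^sup>2" using self_le_power[of K 2] K2 by simp
  ultimately show ?thesis using n unfolding cl_def by simp
qed

lemma cl_Sfun: "0 \<le> t \<Longrightarrow> t \<le> T \<Longrightarrow> cl 6 1 (Sfun D t) (Sfun E t)"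
  unfolding Sfun_def by (rule cl_eq[OF cl_mult[OF cl_mult[OF cl_values(2) cl_inverse] cl_transpose[OF cl_values(2)]]]) auto

lemma cl_drift_prim:
  assumes bm: "bounded_measurable T f" "bounded_measurable T g" and c: "\<And>t. 0 \<le> t \<Longrightarrow> t \<le> T \<Longrightarrow> cl n 1 (f t) (g t)"
    and n: "n \<le> 30" and st: "0 \<le> s" "s \<le> t" "t \<le> T"
  shows "cl 30 (t - s) (drift_prim f s t) (drift_prim g s t)"
proof -
  have eq: "drift_prim f s t - drift_prim g s t = integral {s..t} (\<lambda>r. f r - g r)"
    unfolding drift_prim_def
    using bounded_measurable_integral(1)[OF bm(1)] bounded_measurable_integral(1)[OF bm(2)] st
    by (subst Henstock_Kurzweil_Integration.integral_diff) auto
  show ?thesis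
    using c[THEN cl_up[OF _ n]] st unfolding cl_def eq
    by (auto simp: drift_prim_def intro!: norm_integral_bounded_measurable_le bm bounded_measurable_add)
qed

lemma cl_drift:
  assumes st: "0 \<le> s" "s \<le> t" "t \<le> T"
  shows "cl 30 (t - s) (drift_prim (Afun D) s t) (drift_prim (Afun E) s t)"
    "cl 30 (t - s) (drift_prim (Sfun D) s t) (drift_prim (Sfun E) s t)"
    "cl 30 (t - s) (drift_prim (Qfun D) s t) (drift_prim (Qfun E) s t)"
proof -
  note m = drift_coeffs.meas[OF coeffs(1)] drift_coeffs.meas[OF coeffs(2)]
  show "cl 30 (t - s) (drift_prim (Afun D) s t) (drift_prim (Afun E) s t)"
    by (rule cl_drift_prim[OF m(1,5) cl_values(1) _ st]) auto
  show "cl 30 (t - s) (drift_prim (Sfun D) s t) (drift_prim (Sfun E) s t)"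
    by (rule cl_drift_prim[OF drift_coeffs.Sfun_measurable[OF coeffs(1)] drift_coeffs.Sfun_measurable[OF coeffs(2)] cl_Sfun _ st]) auto
  show "cl 30 (t - s) (drift_prim (Qfun D) s t) (drift_prim (Qfun E) s t)"
    by (rule cl_drift_prim[OF m(3,7) cl_values(3) _ st]) auto
qed

lemma Qbar_bound: "norm (Qbar D) \<le> K ^ 30" "norm (Qbar D - Qbar E) \<le> K * e"
  using data_close_zeroD(1)[OF bd(1)] bd(3) MK self_le_power[of K 30] K2 eK(1) unfolding data_close_def by auto

lemma setting: "riccati_setting T r D \<gamma> \<beta> \<beta>' K"
proof -
  interpret d: drift_coeffs T r D by (rule coeffs(1))
  show ?thesis
  proof unfold_locales
    show "close_rough_data K T \<gamma> \<beta> \<beta>' 0 (eta D) (eta2 D) (A1 D) (A1' D) (eta D) (eta2 D) (A1 D) (A1' D)"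
      unfolding close_rough_data_def using chen(1) by (auto intro!: cl_fst[OF RR.base(1)] cl_fst[OF RR.base(2)] cl_fst[OF RR.base(3)]
          cl_fst[OF RR.base(4)] cl_fst[OF RR.base(5)] cl_fst[OF RR.base(6)] cl_fst[OF RR.base(7)] simp del: One_nat_def)
    show "eta2 D s t $ i $ j + eta2 D s t $ j $ i = incr (eta D) s t $ i * incr (eta D) s t $ j"
      if "0 \<le> s" "s \<le> t" "t \<le> T" for s t i j
    proof (cases "s = t")
      case True
      moreover have "rough_path T \<gamma> (eta D) (eta2 D)" using adm unfolding admissible_data_def geometric_rough_path_def by blast
      ultimately show ?thesis using rough_path_diag[of T \<gamma> "eta D" "eta2 D" s] that by (simp add: incr_def)
    next
      case False
      then show ?thesis using that pos adm unfolding admissible_data_def by (intro geometric_symmetric[of T \<gamma>]) auto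
    qed
    show "norm (drift_prim (Afun D) s t) \<le> K ^ 30 * (t - s) \<and> norm (drift_prim (Sfun D) s t) \<le> K ^ 30 * (t - s) \<and>
      norm (drift_prim (Qfun D) s t) \<le> K ^ 30 * (t - s)" if "0 \<le> s" "s \<le> t" "t \<le> T" for s t
      using cl_drift[OF that] unfolding cl_def by blast
    show "nonneg_definite (Qbar D)" using adm unfolding admissible_data_def by blast
  qed (use exps K K2 Qbar_bound in auto)
qed

text \<open>\<open>setting\<close> speaks of D only; exchanging the roles gives it for E.\<close>

lemma swap: "lipschitz_setting T \<gamma> \<beta> \<beta>' r M K e E D"
  by unfold_locales (use pos exps K adm bd in \<open>auto simp: data_close_def norm_minus_commute\<close>)

end

section \<open>Lipschitz dependence on the data\<close>

lemma congr_germ_expand: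
  "congr (mat 1 + g) x = x + ((transpose g ** x + x ** g) + transpose g ** x ** g)"
  by (simp add: congr_def mm_simps algebra_simps)

text \<open>With y = \<open>p s\<close>, x = \<open>p t\<close> and X =
  \<open>p s - congr (\<mu> s t) (p t)\<close> the left side is the Gubinelli remainder of p. On the
  right X has order t - s and the other terms have order at least 2 \<gamma>, each with a Lipschitz
  bound; the expansion errors of the individual solutions do not appear.\<close>

lemma remainder_expand:
  assumes "y = X + congr (mat 1 + (g + k)) x"
  shows "(x - y) + xi1 y g =
    - X - (((transpose k ** x + x ** k) + transpose (g + k) ** x ** (g + k)) + ((x - y) ** g + transpose g ** (x - y)))"
  unfolding assms congr_def xi1_def by (simp add: mm_simps algebra_simps)

section \<open>The distance of two solutions as controlled paths\<close>

context lipschitz_setting begin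

text \<open>All five summands of \<open>controlled_dist\<close> are computed from the values of the
  solutions, the germs, and the differences \<open>p s - congr (RR.\<mu> s t) (p t)\<close>.
  \<open>N ^ 100\<close> is a common bound for the powers collected on the way. The derivative p'
  inherits only the regularity \<beta> of \<open>A1\<close>.\<close>

lemma controlled_dist_le:
  assumes N: "K \<le> N"
    and p': "\<And>t. 0 \<le> t \<Longrightarrow> t \<le> T \<Longrightarrow> p' t = - riccati_integrand D p t"
    and q': "\<And>t. 0 \<le> t \<Longrightarrow> t \<le> T \<Longrightarrow> q' t = - riccati_integrand E q t"
    and pq: "\<And>t. 0 \<le> t \<Longrightarrow> t \<le> T \<Longrightarrow> norm (p t) \<le> N \<and> norm (q t) \<le> N \<and> norm (p t - q t) \<le> N * e"
    and X: "\<And>s t. 0 \<le> s \<Longrightarrow> s \<le> t \<Longrightarrow> t \<le> T \<Longrightarrow>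
      norm (p s - congr (RR.\<mu> s t) (p t)) \<le> N * (t - s) \<and> norm (q s - congr (RR.\<nu> s t) (q t)) \<le> N * (t - s) \<and>
      norm ((p s - congr (RR.\<mu> s t) (p t)) - (q s - congr (RR.\<nu> s t) (q t))) \<le> N * e * (t - s)"
  shows "controlled_dist T \<gamma> \<beta> (eta D) (eta E) p p' q q' \<le> ennreal (5 * N ^ 100 * e)"
proof -
  have N': "2 \<le> N" "1 + T \<le> N" "real CARD('p) \<le> N" using N K K2 by auto
  interpret W: two_data N e by unfold_locales (use N' pos in auto)
  note lift = cl_base_mono[OF K2(1) N pos(4)]
  have cp: "W.cl n 1 (p t) (q t)" if "0 \<le> t" "t \<le> T" "1 \<le> n" for t n
    by (rule W.cl_up[OF _ that(3)]) (use pq that in \<open>simp add: W.cl_def\<close>)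
  have cA: "W.cl n 1 (A1 D t) (A1 E t)" if "0 \<le> t" "t \<le> T" "1 \<le> n" for t n
    by (rule W.cl_up[OF lift[OF cl_values(4)]]) (use that in auto)
  have *: "W.cl 30 ((t - s) powr \<gamma>) (incr p s t) (incr q s t) \<and>
      W.cl 40 ((t - s) powr (\<gamma> + \<beta>)) (remainder (eta D) p p' s t) (remainder (eta E) q q' s t) \<and>
      W.cl 66 ((t - s) powr \<beta>) (incr p' s t) (incr q' s t)"
    if st: "0 \<le> s" "s \<le> t" "t \<le> T" for s t
  proof -
    define h where "h = t - s"
    have h: "0 \<le> h" "h \<le> T" "t - s \<le> h" using st by (auto simp: h_def)
    have s: "0 \<le> s" "s \<le> T" and t: "0 \<le> t" "t \<le> T" using st by auto
    have sc: "h powr \<alpha> \<le> N * h powr \<alpha>'" if "\<alpha>' \<le> \<alpha>" "\<alpha> \<le> \<alpha>' + 1" for \<alpha> \<alpha>'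
      using h N' that by (intro powr_le_scale)
    define g g' k k' where "g = germ1 (eta D) (A1 D) s t" and "g' = germ1 (eta E) (A1 E) s t"
      and "k = germ2 (eta2 D) (A1 D) (A1' D) s t" and "k' = germ2 (eta2 E) (A1 E) (A1' E) s t"
    define Y Y' where "Y = p s - congr (RR.\<mu> s t) (p t)" and "Y' = q s - congr (RR.\<nu> s t) (q t)"
    have cg: "W.cl 4 (h powr \<gamma>) g g'" unfolding g_def g'_def by (rule lift[OF RR.cl_germ1[OF st h(3)]])
    have ck: "W.cl 10 (h powr (2 * \<gamma>)) k k'" unfolding k_def k'_def by (rule lift[OF RR.cl_germ2[OF st h(3)]])
    have cgk: "W.cl 12 (h powr \<gamma>) (g + k) (g' + k')"
      unfolding g_def g'_def k_def k'_def by (rule lift[OF RR.cl_germ12[OF st h(3,2)]])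
    have cx: "W.cl 1 1 (p t) (q t)" using cp[OF t] by simp
    have "W.cl 1 (h powr 1) Y Y'"
      using X[OF st] h unfolding W.cl_def Y_def Y'_def h_def by simp
    then have cY: "W.cl 2 (h powr \<alpha>) Y Y'" if "0 \<le> \<alpha>" "\<alpha> \<le> 1" for \<alpha>
      by (rule W.cl_fit) (use sc[of \<alpha> 1] that in auto)
    have e2: "h powr \<gamma> * h powr \<gamma> = h powr (2 * \<gamma>)" by (simp add: powr_add[symmetric])
    have Tg: "W.cl 14 (h powr \<gamma>) (transpose (g + k) ** p t) (transpose (g' + k') ** q t)"
      by (rule W.cl_eq[OF W.cl_mult[OF W.cl_transpose[OF cgk] cx]]) auto
    have gT: "W.cl 14 (h powr \<gamma>) (p t ** (g + k)) (q t ** (g' + k'))"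
      by (rule W.cl_eq[OF W.cl_mult[OF cx cgk]]) auto
    have gTg: "W.cl 27 (h powr (2 * \<gamma>)) (transpose (g + k) ** p t ** (g + k)) (transpose (g' + k') ** q t ** (g' + k'))"
      by (rule W.cl_eq[OF W.cl_mult[OF Tg cgk] e2]) auto
    have ep: "p s = Y + congr (mat 1 + (g + k)) (p t)" "q s = Y' + congr (mat 1 + (g' + k')) (q t)"
      by (simp_all add: Y_def Y'_def g_def k_def g'_def k'_def germ_def add.assoc)
    have ip: "incr p s t = - (Y + ((transpose (g + k) ** p t + p t ** (g + k)) + transpose (g + k) ** p t ** (g + k)))"
      "incr q s t = - (Y' + ((transpose (g' + k') ** q t + q t ** (g' + k')) + transpose (g' + k') ** q t ** (g' + k')))"
      unfolding incr_def ep congr_germ_expand by simp_all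
    have g2: "W.cl 28 (h powr \<gamma>) (transpose (g + k) ** p t ** (g + k)) (transpose (g' + k') ** q t ** (g' + k'))"
      by (rule W.cl_fit[OF gTg sc]) (use exps in auto)
    have "W.cl 2 (h powr \<gamma>) Y Y'" using exps by (intro cY) auto
    then have ci: "W.cl 30 (h powr \<gamma>) (incr p s t) (incr q s t)"
      unfolding ip by (intro W.cl_minus W.cl_eq[OF W.cl_add[OF _ W.cl_add[OF W.cl_add[OF Tg gT] g2]]]) auto
    have cib: "W.cl 31 (h powr \<beta>) (incr p s t) (incr q s t)"
      by (rule W.cl_fit[OF ci sc]) (use exps in auto)
    have "W.cl 1 (h powr \<beta>) (incr (A1 D) s t) (incr (A1 E) s t)" by (rule lift[OF RR.base(5)[OF st h(3)]])
    then have cAi: "W.cl 31 (h powr \<beta>) (incr (A1 D) s t) (incr (A1 E) s t)" by (rule W.cl_up) simp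
    have "W.cl (2 * 31 + 4) (h powr \<beta>) (incr (\<lambda>t. - riccati_integrand D p t) s t) (incr (\<lambda>t. - riccati_integrand E q t) s t)"
      by (rule W.cl_incr_riccati_integrand[OF cp[OF s] cp[OF t] cib cA[OF s] cA[OF t] cAi N'(3)]) auto
    then have "W.cl 66 (h powr \<beta>) (incr p' s t) (incr q' s t)"
      using p'[OF s] p'[OF t] q'[OF s] q'[OF t] by (simp add: incr_def)
    moreover have "W.cl 40 (h powr (\<gamma> + \<beta>)) (remainder (eta D) p p' s t) (remainder (eta E) q q' s t)"
    proof -
      have er: "remainder (eta D) p p' s t = - Y - (((transpose k ** p t + p t ** k)
          + transpose (g + k) ** p t ** (g + k)) + (incr p s t ** g + transpose g ** incr p s t))"
        "remainder (eta E) q q' s t = - Y' - (((transpose k' ** q t + q t ** k')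
          + transpose (g' + k') ** q t ** (g' + k')) + (incr q s t ** g' + transpose g' ** incr q s t))"
        using remainder_expand[OF ep(1)] remainder_expand[OF ep(2)]
        unfolding remainder_def p'[OF s] q'[OF s] lin_app_algebra lin_app_riccati_integrand g_def g'_def germ1_def
        by (simp_all add: incr_def)
      have s2: "h powr (2 * \<gamma>) \<le> N * h powr (\<gamma> + \<beta>)" by (rule sc) (use exps in auto)
      have a: "W.cl 13 (h powr (\<gamma> + \<beta>)) (transpose k ** p t) (transpose k' ** q t)"
        by (rule W.cl_fit[OF W.cl_mult[OF W.cl_transpose[OF ck] cx]]) (use s2 in auto)
      have b: "W.cl 13 (h powr (\<gamma> + \<beta>)) (p t ** k) (q t ** k')"
        by (rule W.cl_fit[OF W.cl_mult[OF cx ck]]) (use s2 in auto)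
      have c: "W.cl 28 (h powr (\<gamma> + \<beta>)) (transpose (g + k) ** p t ** (g + k)) (transpose (g' + k') ** q t ** (g' + k'))"
        by (rule W.cl_fit[OF gTg s2]) auto
      have d: "W.cl 36 (h powr (\<gamma> + \<beta>)) (incr p s t ** g) (incr q s t ** g')"
        by (rule W.cl_fit[OF W.cl_mult[OF ci cg]]) (use s2 e2 in auto)
      have f: "W.cl 36 (h powr (\<gamma> + \<beta>)) (transpose g ** incr p s t) (transpose g' ** incr q s t)"
        by (rule W.cl_fit[OF W.cl_mult[OF W.cl_transpose[OF cg] ci]]) (use s2 e2 in auto)
      have "W.cl 2 (h powr (\<gamma> + \<beta>)) Y Y'" using exps by (intro cY) auto
      then show ?thesis
        unfolding er by (intro W.cl_eq[OF W.cl_diff[OF W.cl_minus W.cl_add[OF W.cl_add[OF W.cl_add[OF a b] c] W.cl_add[OF d f]]]]) auto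
    qed
    ultimately show ?thesis using ci unfolding h_def by blast
  qed
  have diff: "norm (x - y) \<le> N ^ 100 * e * c" if "W.cl n c x y" "n \<le> 100" for n c and x y :: "'v::real_normed_vector"
    using W.cl_up[OF that] unfolding W.cl_def by blast
  have h1: "holder T \<gamma> (incr (\<lambda>t. p t - q t)) \<le> ennreal (N ^ 100 * e)"
    by (rule holder_leI, unfold incr_diff, rule diff[OF conjunct1[OF *]]) auto
  have h2: "holder T \<beta> (incr (\<lambda>t. p' t - q' t)) \<le> ennreal (N ^ 100 * e)"
    by (rule holder_leI, unfold incr_diff, rule diff[OF conjunct2[OF conjunct2[OF *]]]) auto
  have h3: "holder T (\<gamma> + \<beta>) (\<lambda>s t. remainder (eta D) p p' s t - remainder (eta E) q q' s t) \<le> ennreal (N ^ 100 * e)"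
    by (rule holder_leI, rule diff[OF conjunct1[OF conjunct2[OF *]]]) auto
  have z: "0 \<le> (0 :: real)" "0 \<le> T" using pos by auto
  have n1: "norm (p 0 - q 0) \<le> N ^ 100 * e" using diff[OF cp[OF z order_refl]] by simp
  have "W.cl 5 1 (riccati_integrand D p 0) (riccati_integrand E q 0)"
  proof (rule W.cl_eq[OF W.cl_vec[where n = 4, OF _ N'(3)] refl])
    have P: "W.cl 1 1 (p 0) (q 0)" and A: "W.cl 1 1 (A1 D 0) (A1 E 0)" using cp[OF z] cA[OF z] by auto
    have "W.cl 3 1 (p 0 ** A1 D 0 $ j) (q 0 ** A1 E 0 $ j)" "W.cl 3 1 (transpose (A1 D 0 $ j) ** p 0) (transpose (A1 E 0 $ j) ** q 0)" for j
      by (rule W.cl_eq[OF W.cl_mult[OF P W.cl_nth[OF A]]] W.cl_eq[OF W.cl_mult[OF W.cl_transpose[OF W.cl_nth[OF A]] P]]; simp)+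
    from W.cl_add[OF this] show "W.cl 4 1 (riccati_integrand D p 0 $ j) (riccati_integrand E q 0 $ j)" for j
      by (simp add: riccati_integrand_def)
  qed simp
  from diff[OF W.cl_minus[OF this]] have n2: "norm (p' 0 - q' 0) \<le> N ^ 100 * e" using p'[OF z] q'[OF z] by simp
  have N0: "0 \<le> N ^ 100 * e" using N' pos by simp
  have "controlled_dist T \<gamma> \<beta> (eta D) (eta E) p p' q q' \<le>
      ennreal (N ^ 100 * e) + ennreal (N ^ 100 * e) + ennreal (N ^ 100 * e) + ennreal (N ^ 100 * e) + ennreal (N ^ 100 * e)"
    unfolding controlled_dist_def by (intro add_mono h1 h2 h3 ennreal_leI n1 n2)
  also have "\<dots> = ennreal (N ^ 100 * e + N ^ 100 * e + N ^ 100 * e + N ^ 100 * e + N ^ 100 * e)"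
    by (simp only: ennreal_plus add_nonneg_nonneg N0)
  also have "N ^ 100 * e + N ^ 100 * e + N ^ 100 * e + N ^ 100 * e + N ^ 100 * e = 5 * N ^ 100 * e" by simp
  finally show ?thesis .
qed

end

lemma riccati_germ_mono:
  fixes \<mu> :: "real \<Rightarrow> real \<Rightarrow> real^'d::finite^'d"
  assumes "riccati_germ K T \<gamma> \<theta> \<mu> a S Q q" "K \<le> K'" shows "riccati_germ K' T \<gamma> \<theta> \<mu> a S Q q"
proof -
  interpret riccati_germ K T \<gamma> \<theta> \<mu> a S Q q by fact
  have le: "K * h \<le> K' * h" if "0 \<le> h" for h using assms(2) that by (rule mult_right_mono)
  show ?thesis
  proof
    show "norm (\<mu> s t - mat 1) \<le> K' * (t - s) powr \<gamma>" if "0 \<le> s" "s \<le> t" "t \<le> T" for s t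
      by (rule order_trans[OF near[OF that] le]) simp
    show "norm (\<mu> u t ** \<mu> s u - \<mu> s t) \<le> K' * (t - s) powr \<theta>" if "0 \<le> s" "s \<le> u" "u \<le> t" "t \<le> T" for s u t
      by (rule order_trans[OF flow[OF that] le]) simp
    show "norm (a s t) \<le> K' * (t - s) \<and> norm (S s t) \<le> K' * (t - s) \<and> norm (Q s t) \<le> K' * (t - s)"
      if "0 \<le> s" "s \<le> t" "t \<le> T" for s t
      using drift_le[OF that] le[of "t - s"] that by auto
    show "2 \<le> K'" "1 + T \<le> K'" "norm (mat 1 :: real^'d^'d) \<le> K'" "norm q \<le> K'"
      using K q(2) assms(2) by linarith+
  qed (assumption | rule exps additive psd q(1))+
qed

text \<open>The bound is known for the solution constructed by truncation and passes to an arbitrary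
  one by uniqueness. Thus the Lipschitz estimate covers all solutions with one constant.\<close>

lemma (in riccati_setting) solution_norm_le:
  assumes sol: "riccati_solution T \<gamma> \<beta> D p p'"
    and P: "\<exists>p. p T = Qbar D \<and> expansion T \<theta> \<mu> (\<lambda>s t. \<phi> s t (p t)) p \<and> (\<forall>t. 0 \<le> t \<and> t \<le> T \<longrightarrow> norm (p t) \<le> P)"
    and t: "0 \<le> t" "t \<le> T"
  shows "norm (p t) \<le> P"
proof -
  obtain q where q: "q T = Qbar D" "expansion T \<theta> \<mu> (\<lambda>s t. \<phi> s t (q t)) q" "\<And>t. 0 \<le> t \<Longrightarrow> t \<le> T \<Longrightarrow> norm (q t) \<le> P"
    using P by blast
  show ?thesis using solution_unique[OF expansion_imp_solution[OF q] sol t] q(3)[OF t] by simp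
qed

lemma ex_bound:
  fixes T M r :: real
  assumes "0 < T" "0 < r" "0 \<le> M"
  obtains K where "2 + T \<le> K" "real CARD('p::finite) \<le> K" "norm (mat 1 :: real^'d::finite^'d) \<le> K" "M * (2 + T) \<le> K"
    "real CARD('d) / r \<le> K"
proof (rule that)
  define a b c where "a = norm (mat 1 :: real^'d^'d)" and "b = M * (2 + T)" and "c = real CARD('d) / r"
  define K where "K = 2 + T + real CARD('p) + a + b + c"
  have nn: "0 \<le> a" "0 \<le> b" "0 \<le> c" using assms by (auto simp: a_def b_def c_def)
  show "2 + T \<le> K" "real CARD('p::finite) \<le> K" "norm (mat 1 :: real^'d::finite^'d) \<le> K" "M * (2 + T) \<le> K"
    "real CARD('d) / r \<le> K"
    unfolding a_def[symmetric] b_def[symmetric] c_def[symmetric] K_def using nn assms by auto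
qed

lemma lipschitz_settingI:
  fixes D E :: "('d::finite, 'p::finite) riccati_data"
  assumes "0 < T" "0 < r" "0 \<le> M" "0 \<le> e"
    and exps: "1 / 3 < \<gamma>" "\<gamma> < 1 / 2" "0 < \<beta>'" "\<beta>' \<le> \<beta>" "\<beta> \<le> \<gamma>" "\<gamma> + \<beta> + \<beta>' > 1"
    and K: "2 + T \<le> K" "real CARD('p) \<le> K" "norm (mat 1 :: real^'d^'d) \<le> K" "M * (2 + T) \<le> K" "real CARD('d) / r \<le> K"
    and adm: "admissible_data T \<gamma> \<beta> \<beta>' r D" "admissible_data T \<gamma> \<beta> \<beta>' r E"
    and dist: "data_dist T \<gamma> \<beta> \<beta>' D zero_data \<le> ennreal M" "data_dist T \<gamma> \<beta> \<beta>' E zero_data \<le> ennreal M"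
      "data_dist T \<gamma> \<beta> \<beta>' D E \<le> ennreal e"
  shows "lipschitz_setting T \<gamma> \<beta> \<beta>' r M K e D E"
proof -
  have diag: "eta2 D s s = 0" "eta2 E s s = 0" if "0 \<le> s" "s \<le> T" for s
    using adm that rough_path_diag unfolding admissible_data_def geometric_rough_path_def by blast+
  have z: "eta2 (zero_data :: ('d, 'p) riccati_data) s s = 0" for s by (simp add: zero_data_def)
  show ?thesis
    by unfold_locales (use assms(1-4) exps K adm diag z in
        \<open>auto intro!: data_dist_le_imp_data_close[OF dist(1)] data_dist_le_imp_data_close[OF dist(2)] data_dist_le_imp_data_close[OF dist(3)]\<close>)
qed

text \<open>The order of choices matters: K from T, r, M and the dimensions, then P0 from K, then L,
  then the stability constant C from L, all before D and E are fixed. The distance is represented by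
  a real e because the estimates are made in the reals.\<close>

lemma riccati_solution_lipschitz:
  fixes T \<gamma> \<beta> \<beta>' r M :: real
  assumes T: "0 < T" and r: "0 < r" and M: "0 \<le> M"
    and exps: "1 / 3 < \<gamma>" "\<gamma> < 1 / 2" "0 < \<beta>'" "\<beta>' \<le> \<beta>" "\<beta> \<le> \<gamma>" "\<gamma> + \<beta> + \<beta>' > 1"
  obtains C where "0 < C" "\<And>(D :: ('d::finite, 'p::finite) riccati_data) E e p p' q q'.
    admissible_data T \<gamma> \<beta> \<beta>' r D \<Longrightarrow> admissible_data T \<gamma> \<beta> \<beta>' r E \<Longrightarrow>
    data_dist T \<gamma> \<beta> \<beta>' D zero_data \<le> ennreal M \<Longrightarrow> data_dist T \<gamma> \<beta> \<beta>' E zero_data \<le> ennreal M \<Longrightarrow>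
    0 \<le> e \<Longrightarrow> data_dist T \<gamma> \<beta> \<beta>' D E \<le> ennreal e \<Longrightarrow>
    riccati_solution T \<gamma> \<beta> D p p' \<Longrightarrow> riccati_solution T \<gamma> \<beta> E q q' \<Longrightarrow>
    controlled_dist T \<gamma> \<beta> (eta D) (eta E) p p' q q' \<le> ennreal (C * e)"
proof (rule ex_bound[OF T r M, where 'd = 'd and 'p = 'p])
  fix K assume K: "2 + T \<le> K" "real CARD('p) \<le> K" "norm (mat 1 :: real^'d^'d) \<le> K" "M * (2 + T) \<le> K" "real CARD('d) / r \<le> K"
  have K2: "2 \<le> K" using K(1) T by simp
  have K30: "K \<le> K ^ 30" using self_le_power[of K 30] K2 by simp
  let ?\<theta> = "\<gamma> + \<beta> + \<beta>'"
  obtain P0 where P0: "1 \<le> P0" "\<And>(\<mu> :: real \<Rightarrow> real \<Rightarrow> real^'d^'d) a S Q q. riccati_germ (K ^ 30) T \<gamma> ?\<theta> \<mu> a S Q q \<Longrightarrow>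
    \<exists>p. p T = q \<and> expansion T ?\<theta> \<mu> (\<lambda>s t. drift_germ a S Q s t (p t)) p \<and>
      (\<forall>t. 0 \<le> t \<and> t \<le> T \<longrightarrow> norm (p t) \<le> P0)"
    using riccati_germ_existence[of "K ^ 30" T \<gamma> ?\<theta>, where 'd = 'd] by blast
  define L where "L = K ^ 30 + P0"
  have L: "K ^ 30 \<le> L" "P0 \<le> L" "K \<le> L" "2 \<le> L" "1 + T \<le> L" using P0(1) K30 K2 K T by (auto simp: L_def)
  have ex: "0 < \<gamma>" "\<gamma> < 1" "1 < ?\<theta>" "?\<theta> \<le> 1 + \<gamma>" using exps by auto
  show thesis
  proof (rule riccati_germ_stability[OF L(4) T L(5) ex, where 'd = 'd])
    fix C assume C: "0 \<le> C" "\<And>\<epsilon> (\<mu> :: real \<Rightarrow> real \<Rightarrow> real^'d^'d) a S Q q \<nu> a' S' Q' q' p p' s t.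
      0 \<le> \<epsilon> \<Longrightarrow> riccati_germ L T \<gamma> ?\<theta> \<mu> a S Q q \<Longrightarrow> riccati_germ L T \<gamma> ?\<theta> \<nu> a' S' Q' q' \<Longrightarrow>
      close_flows L \<gamma> ?\<theta> \<epsilon> 0 T \<mu> \<nu> \<Longrightarrow>
      (\<And>s t. 0 \<le> s \<Longrightarrow> s \<le> t \<Longrightarrow> t \<le> T \<Longrightarrow> norm (a s t - a' s t) \<le> L * \<epsilon> * (t - s) \<and>
        norm (S s t - S' s t) \<le> L * \<epsilon> * (t - s) \<and> norm (Q s t - Q' s t) \<le> L * \<epsilon> * (t - s)) \<Longrightarrow>
      norm (q - q') \<le> L * \<epsilon> \<Longrightarrow>
      expansion T ?\<theta> \<mu> (\<lambda>s t. drift_germ a S Q s t (p t)) p \<Longrightarrow>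
      expansion T ?\<theta> \<nu> (\<lambda>s t. drift_germ a' S' Q' s t (p' t)) p' \<Longrightarrow> p T = q \<Longrightarrow> p' T = q' \<Longrightarrow>
      (\<And>t. 0 \<le> t \<Longrightarrow> t \<le> T \<Longrightarrow> norm (p t) \<le> L \<and> norm (p' t) \<le> L) \<Longrightarrow>
      0 \<le> s \<Longrightarrow> s \<le> t \<Longrightarrow> t \<le> T \<Longrightarrow>
      norm (p t - p' t) \<le> C * \<epsilon> \<and> norm (p s - congr (\<mu> s t) (p t)) \<le> C * (t - s) \<and>
      norm (p' s - congr (\<nu> s t) (p' t)) \<le> C * (t - s) \<and>
      norm ((p s - congr (\<mu> s t) (p t)) - (p' s - congr (\<nu> s t) (p' t))) \<le> C * \<epsilon> * (t - s)"
    define N where "N = L + C"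
    have N: "C \<le> N" "L \<le> N" "K \<le> N" "0 < N" using C(1) L by (auto simp: N_def)
    show thesis
    proof (rule that[of "5 * N ^ 100"])
      show "0 < 5 * N ^ 100" using N by simp
      fix D E :: "('d, 'p) riccati_data" and e p p' q q'
      assume adm: "admissible_data T \<gamma> \<beta> \<beta>' r D" "admissible_data T \<gamma> \<beta> \<beta>' r E"
        and dist: "data_dist T \<gamma> \<beta> \<beta>' D zero_data \<le> ennreal M" "data_dist T \<gamma> \<beta> \<beta>' E zero_data \<le> ennreal M"
        and e: "0 \<le> e" "data_dist T \<gamma> \<beta> \<beta>' D E \<le> ennreal e"
        and sol: "riccati_solution T \<gamma> \<beta> D p p'" "riccati_solution T \<gamma> \<beta> E q q'"
      interpret Z: lipschitz_setting T \<gamma> \<beta> \<beta>' r M K e D E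
        by (rule lipschitz_settingI[OF T r M e(1) exps K adm dist e(2)])
      interpret Z': lipschitz_setting T \<gamma> \<beta> \<beta>' r M K e E D by (rule Z.swap)
      interpret SD: riccati_setting T r D \<gamma> \<beta> \<beta>' K by (rule Z.setting)
      interpret SE: riccati_setting T r E \<gamma> \<beta> \<beta>' K by (rule Z'.setting)
      have bp: "norm (p t) \<le> L" "norm (q t) \<le> L" if t: "0 \<le> t" "t \<le> T" for t
        using SD.solution_norm_le[OF sol(1) P0(2)[OF SD.G.riccati_germ_axioms] t]
          SE.solution_norm_le[OF sol(2) P0(2)[OF SE.G.riccati_germ_axioms] t] L(2) by auto
      have Le: "K ^ 30 * e * h \<le> L * e * h" if "0 \<le> h" for h using L(1) e(1) that by (intro mult_right_mono)
      have qe: "norm (Qbar D - Qbar E) \<le> L * e" using Z.Qbar_bound(2) mult_right_mono[OF L(3) e(1)] by simp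
      have dr: "norm (drift_prim (Afun D) s t - drift_prim (Afun E) s t) \<le> L * e * (t - s) \<and>
          norm (drift_prim (Sfun D) s t - drift_prim (Sfun E) s t) \<le> L * e * (t - s) \<and>
          norm (drift_prim (Qfun D) s t - drift_prim (Qfun E) s t) \<le> L * e * (t - s)"
        if st: "0 \<le> s" "s \<le> t" "t \<le> T" for s t
        using Z.cl_drift[OF st] Le[of "t - s"] st unfolding Z.cl_def by auto
      obtain P where P: "p T = Qbar D" "expansion T ?\<theta> SD.\<mu> (\<lambda>s t. SD.\<phi> s t (p t)) p"
        by (rule SD.solution_imp_expansion[OF sol(1)])
      obtain P' where P': "q T = Qbar E" "expansion T ?\<theta> SE.\<mu> (\<lambda>s t. SE.\<phi> s t (q t)) q"
        by (rule SE.solution_imp_expansion[OF sol(2)])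
      have st: "norm (p t - q t) \<le> C * e \<and> norm (p s - congr (SD.\<mu> s t) (p t)) \<le> C * (t - s) \<and>
          norm (q s - congr (SE.\<mu> s t) (q t)) \<le> C * (t - s) \<and>
          norm ((p s - congr (SD.\<mu> s t) (p t)) - (q s - congr (SE.\<mu> s t) (q t))) \<le> C * e * (t - s)"
        if st: "0 \<le> s" "s \<le> t" "t \<le> T" for s t
        by (rule C(2)[OF e(1) riccati_germ_mono[OF SD.G.riccati_germ_axioms L(1)]
              riccati_germ_mono[OF SE.G.riccati_germ_axioms L(1)]
              close_flows_mono[OF Z.RR.close_flows_germ L(1) e(1)] dr qe P(2) P'(2) P(1) P'(1) conjI[OF bp] st])
      have Ne: "C * x \<le> N * x" if "0 \<le> x" for x using N(1) that by (rule mult_right_mono)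
      show "controlled_dist T \<gamma> \<beta> (eta D) (eta E) p p' q q' \<le> ennreal (5 * N ^ 100 * e)"
      proof (rule Z.controlled_dist_le[OF N(3)])
        show "norm (p t) \<le> N \<and> norm (q t) \<le> N \<and> norm (p t - q t) \<le> N * e" if t: "0 \<le> t" "t \<le> T" for t
          using bp[OF t] st[OF t(1) order_refl t(2)] Ne[OF e(1)] N(2) by auto
        show "norm (p s - congr (SD.\<mu> s t) (p t)) \<le> N * (t - s) \<and> norm (q s - congr (SE.\<mu> s t) (q t)) \<le> N * (t - s) \<and>
          norm ((p s - congr (SD.\<mu> s t) (p t)) - (q s - congr (SE.\<mu> s t) (q t))) \<le> N * e * (t - s)"
          if "0 \<le> s" "s \<le> t" "t \<le> T" for s t
          using st[OF that] Ne[of "t - s"] Ne[of "e * (t - s)"] e(1) that by (auto simp: mult.assoc)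
      qed (use sol in \<open>auto simp: riccati_solution_def\<close>)
    qed
  qed
qed

lemma holder_zero: "holder T \<alpha> (\<lambda>s t. 0) = 0"
  using holder_leI[of T "\<lambda>s t. 0" 0 \<alpha>] by simp

lemma incr_zero: "incr (\<lambda>_. 0) = (\<lambda>s t. 0)"
  by (simp add: incr_def fun_eq_iff)

lemma data_dist_self: "data_dist T \<gamma> \<beta> \<beta>' D D = 0"
proof -
  have "sup_norm T (\<lambda>_. 0 :: real^'d^'d) = 0" by (simp add: sup_norm_def flip: bot_ennreal)
  then show ?thesis by (simp add: data_dist_def rough_dist_def controlled_dist_def incr_zero holder_zero)
qed

text \<open>The setting for two data is reused with both equal to D and e = 0; M is the actual size
  of D, finite by admissibility.\<close>

lemma riccati_solution_exists_unique:
  fixes D :: "('d::finite, 'p::finite) riccati_data"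
  assumes T: "0 < T" and r: "0 < r"
    and exps: "1 / 3 < \<gamma>" "\<gamma> < 1 / 2" "0 < \<beta>'" "\<beta>' \<le> \<beta>" "\<beta> \<le> \<gamma>" "\<gamma> + \<beta> + \<beta>' > 1"
    and adm: "admissible_data T \<gamma> \<beta> \<beta>' r D"
  shows "\<exists>p p'. riccati_solution T \<gamma> \<beta> D p p' \<and>
    (\<forall>q q'. riccati_solution T \<gamma> \<beta> D q q' \<longrightarrow> (\<forall>t\<in>{0..T}. q t = p t \<and> q' t = p' t))"
proof -
  define M where "M = enn2real (data_dist T \<gamma> \<beta> \<beta>' D zero_data)"
  have M: "0 \<le> M" "data_dist T \<gamma> \<beta> \<beta>' D zero_data \<le> ennreal M"
    using admissible_finite_data_dist[OF adm] by (auto simp: M_def)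
  obtain K where K: "2 + T \<le> K" "real CARD('p) \<le> K" "norm (mat 1 :: real^'d^'d) \<le> K" "M * (2 + T) \<le> K" "real CARD('d) / r \<le> K"
    by (rule ex_bound[OF T r M(1), where 'd = 'd and 'p = 'p])
  have "data_dist T \<gamma> \<beta> \<beta>' D D \<le> ennreal 0" by (simp add: data_dist_self)
  then interpret lipschitz_setting T \<gamma> \<beta> \<beta>' r M K 0 D D
    by (intro lipschitz_settingI T r M exps K adm order_refl)
  interpret S: riccati_setting T r D \<gamma> \<beta> \<beta>' K by (rule setting)
  obtain P0 where "\<exists>p. p T = Qbar D \<and> expansion T S.\<theta> S.\<mu> (\<lambda>s t. S.\<phi> s t (p t)) p \<and> (\<forall>t. 0 \<le> t \<and> t \<le> T \<longrightarrow> norm (p t) \<le> P0)"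
  proof (rule riccati_germ_existence[of "K ^ 30" T \<gamma> S.\<theta>, where 'd = 'd])
    fix P assume P: "\<And>(\<mu> :: real \<Rightarrow> real \<Rightarrow> real^'d^'d) a S Q q. riccati_germ (K ^ 30) T \<gamma> S.\<theta> \<mu> a S Q q \<Longrightarrow>
      \<exists>p. p T = q \<and> expansion T S.\<theta> \<mu> (\<lambda>s t. drift_germ a S Q s t (p t)) p \<and> (\<forall>t. 0 \<le> t \<and> t \<le> T \<longrightarrow> norm (p t) \<le> P)"
    show thesis by (rule that[OF P[OF S.G.riccati_germ_axioms]])
  qed
  then obtain p where p: "p T = Qbar D" "expansion T S.\<theta> S.\<mu> (\<lambda>s t. S.\<phi> s t (p t)) p"
      "\<And>t. 0 \<le> t \<Longrightarrow> t \<le> T \<Longrightarrow> norm (p t) \<le> P0"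
    by blast
  have sol: "riccati_solution T \<gamma> \<beta> D p (\<lambda>t. - riccati_integrand D p t)" by (rule S.expansion_imp_solution[OF p])
  have "q t = p t \<and> q' t = - riccati_integrand D p t" if "riccati_solution T \<gamma> \<beta> D q q'" "t \<in> {0..T}" for q q' t
    using S.solution_unique[OF sol that(1)] that(2) by simp
  then show ?thesis using sol by blast
qed

theorem theoremA2:
  fixes T \<gamma> \<beta> \<beta>' :: real
  assumes "T > 0"
    and "1/3 < \<gamma>" and "\<gamma> < 1/2"
    and "0 < \<beta>'" and "\<beta>' \<le> \<beta>" and "\<beta> \<le> \<gamma>" and "\<gamma> + \<beta> + \<beta>' > 1"
  shows "(\<forall>D :: ('d::finite, 'p::finite) riccati_data.
           (\<exists>r>0. admissible_data T \<gamma> \<beta> \<beta>' r D) \<longrightarrow>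
           (\<exists>p p'. riccati_solution T \<gamma> \<beta> D p p' \<and>
              (\<forall>q q'. riccati_solution T \<gamma> \<beta> D q q' \<longrightarrow>
                 (\<forall>t\<in>{0..T}. q t = p t \<and> q' t = p' t))))
       \<and> (\<forall>r>0. \<forall>M. \<exists>C. \<forall>D E :: ('d, 'p) riccati_data. \<forall>p p' q q'.
           admissible_data T \<gamma> \<beta> \<beta>' r D \<and> admissible_data T \<gamma> \<beta> \<beta>' r E \<and>
           data_dist T \<gamma> \<beta> \<beta>' D zero_data \<le> ennreal M \<and>
           data_dist T \<gamma> \<beta> \<beta>' E zero_data \<le> ennreal M \<and>
           riccati_solution T \<gamma> \<beta> D p p' \<and> riccati_solution T \<gamma> \<beta> E q q' \<longrightarrow>
           controlled_dist T \<gamma> \<beta> (eta D) (eta E) p p' q q'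
             \<le> ennreal C * data_dist T \<gamma> \<beta> \<beta>' D E)"
proof (intro conjI allI impI)
  fix D :: "('d, 'p) riccati_data" assume "\<exists>r>0. admissible_data T \<gamma> \<beta> \<beta>' r D"
  then show "\<exists>p p'. riccati_solution T \<gamma> \<beta> D p p' \<and>
      (\<forall>q q'. riccati_solution T \<gamma> \<beta> D q q' \<longrightarrow> (\<forall>t\<in>{0..T}. q t = p t \<and> q' t = p' t))"
    using riccati_solution_exists_unique assms by blast
next
  fix r M :: real assume r: "0 < r"
  \<comment> \<open>A negative M becomes 0 in \<open>ennreal\<close>, so it may be replaced by max M
    0, as the auxiliary result asks for M \<ge> 0.\<close>
  have M: "ennreal M = ennreal (max M 0)" by (simp add: max_def ennreal_neg)
  show "\<exists>C. \<forall>D E :: ('d, 'p) riccati_data. \<forall>p p' q q'.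
           admissible_data T \<gamma> \<beta> \<beta>' r D \<and> admissible_data T \<gamma> \<beta> \<beta>' r E \<and>
           data_dist T \<gamma> \<beta> \<beta>' D zero_data \<le> ennreal M \<and>
           data_dist T \<gamma> \<beta> \<beta>' E zero_data \<le> ennreal M \<and>
           riccati_solution T \<gamma> \<beta> D p p' \<and> riccati_solution T \<gamma> \<beta> E q q' \<longrightarrow>
           controlled_dist T \<gamma> \<beta> (eta D) (eta E) p p' q q'
             \<le> ennreal C * data_dist T \<gamma> \<beta> \<beta>' D E"
    unfolding M
  proof (rule riccati_solution_lipschitz[OF assms(1) r max.cobounded2[of 0 M] assms(2-7), where 'd = 'd and 'p = 'p],
      intro exI allI impI, elim conjE)
    fix C and D E :: "('d, 'p) riccati_data" and p p' q q'
    assume C: "0 < C" "\<And>(D :: ('d::finite, 'p::finite) riccati_data) E e p p' q q'.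
        admissible_data T \<gamma> \<beta> \<beta>' r D \<Longrightarrow> admissible_data T \<gamma> \<beta> \<beta>' r E \<Longrightarrow>
        data_dist T \<gamma> \<beta> \<beta>' D zero_data \<le> ennreal (max M 0) \<Longrightarrow> data_dist T \<gamma> \<beta> \<beta>' E zero_data \<le> ennreal (max M 0) \<Longrightarrow>
        0 \<le> e \<Longrightarrow> data_dist T \<gamma> \<beta> \<beta>' D E \<le> ennreal e \<Longrightarrow>
        riccati_solution T \<gamma> \<beta> D p p' \<Longrightarrow> riccati_solution T \<gamma> \<beta> E q q' \<Longrightarrow>
        controlled_dist T \<gamma> \<beta> (eta D) (eta E) p p' q q' \<le> ennreal (C * e)"
      and adm: "admissible_data T \<gamma> \<beta> \<beta>' r D" "admissible_data T \<gamma> \<beta> \<beta>' r E"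
        "data_dist T \<gamma> \<beta> \<beta>' D zero_data \<le> ennreal (max M 0)" "data_dist T \<gamma> \<beta> \<beta>' E zero_data \<le> ennreal (max M 0)"
      and sol: "riccati_solution T \<gamma> \<beta> D p p'" "riccati_solution T \<gamma> \<beta> E q q'"
    show "controlled_dist T \<gamma> \<beta> (eta D) (eta E) p p' q q' \<le> ennreal C * data_dist T \<gamma> \<beta> \<beta>' D E"
    proof (cases "data_dist T \<gamma> \<beta> \<beta>' D E" rule: ennreal_cases)
      case (real e)
      then show ?thesis using C(2)[OF adm real(1) _ sol] C(1) by (simp add: ennreal_mult)
    next
      \<comment> \<open>For infinite distance the right-hand side is infinite because C > 0; with C
        = 0 the product would be 0.\<close>
      case top
      then show ?thesis using C(1) by (simp add: ennreal_mult_top)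
    qed
  qed
qed

end
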